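(* Let $(I,\Omega)$ be a finite quiver and $i\in I$ a loop-free vertex such that all arrows of $H$ ending at $i$ lie in $\Omega$ ($H_i\subset\Omega$). Let $V$ be an $I$-graded vector space with $s_i(\dim V)\in\mathbb{Z}_{\ge0}^I$, let $q\in(\mathbb{C}^\times)^I$, and let $\theta\in\mathbb{Q}^I$ with $\theta\cdot\dim V=0$. Put $q'=u_i(q)$, $\theta'=r_i(\theta)$, and let $V'$ be an $I$-graded vector space with $\dim V'=s_i(\dim V)$ and $V'_j=V_j$ for all $j\ne i$. Suppose $\theta_i\le0$, and $q_i\ne1$ if $\theta_i=0$. Then the projections $r\colon P\to Z$ and $r'\colon P\to Z'$ induce isomorphisms $$\mathcal{M}^{\mathrm s}_{q,\theta}(V)\ \simeq\ P/G\ \simeq\ \mathcal{M}^{\mathrm s}_{q',\theta'}(V').$$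
   Context: Quiver notation: $H=\Omega\sqcup\overline\Omega$ (arrows and their reverses $\overline h$), $\epsilon=1$ on $\Omega$, $-1$ on $\overline\Omega$, $\mathrm{out}(h),\mathrm{in}(h)$ source and target, $H_i=\{h\in H:\mathrm{in}(h)=i\}$, $\overline{H}_i=\{\overline h:h\in H_i\}$. A vertex $i$ is loop-free if no $h\in H$ has $\mathrm{in}(h)=\mathrm{out}(h)=i$. $(\alpha,\beta)=2\sum_j\alpha_j\beta_j-\sum_{h\in H}\alpha_{\mathrm{out}(h)}\beta_{\mathrm{in}(h)}$, $\mathbf{e}_i$ is the $i$-th coordinate vector. Reflections: $s_i(\alpha)=\alpha-(\alpha,\mathbf{e}_i)\mathbf{e}_i$; $r_i(\theta)_j=\theta_j-(\mathbf{e}_i,\mathbf{e}_j)\theta_i$; $u_i(q)_j=q_jq_i^{-(\mathbf{e}_i,\mathbf{e}_j)}$. $\mathbf{M}(V)=\bigoplus_{h\in H}\mathrm{Hom}(V_{\mathrm{out}(h)},V_{\mathrm{in}(h)})$ with natural action of $G_V=\prod_jGL(V_j)$. $x\in\mathbf{M}(V)$ is $\theta$-stable if $\theta\cdot\dim S<0$ for each $x$-invariant graded subspace $S\ne0,V$ (with $\theta\cdot\dim V=0$); $\mathbf{M}^{\mathrm s}_\theta(V)$ is the set of $\theta$-stable points. A total order $<$ on $H$ is fixed; on $\mathbf{M}^\circ(V)=\{x:\det(1+x_hx_{\overline h})\ne0\ \forall h\in H\}$ define $\Phi_V=(\Phi_j)_{j\in I}$, $\Phi_j(x)=\prod^<_{h\in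 H_j}(1+x_hx_{\overline h})^{\epsilon(h)}$. $\mathcal{M}^{\mathrm s}_{q,\theta}(V)=(\mathbf{M}^{\mathrm s}_\theta(V)\cap\Phi_V^{-1}(q))/G_V$ (geometric quotient). Set $\mathbf{M}=\mathbf{M}(V)$, $\mathbf{M}'=\mathbf{M}(V')$, $Z=\mathbf{M}^{\mathrm s}_\theta(V)\cap\Phi_V^{-1}(q)$, $Z'=\mathbf{M}^{\mathrm s}_{\theta'}(V')\cap\Phi_{V'}^{-1}(q')$. Let $\widehat V_i=\bigoplus_{h\in H_i}V_{\mathrm{out}(h)}$ $(=\widehat{V'}_i)$, with inclusions $\iota_h$ and projections $\pi_h$. For $x\in\mathbf{M}$, $\sigma=\sigma(x)=\sum_{h\in H_i}\iota_hx_{\overline h}\colon V_i\to\widehat V_i$ and $\tau=\tau(x)=\sum_{h\in H_i}\Phi_hx_h\pi_h\colon\widehat V_i\to V_i$, where $\Phi_h=\prod^<_{h'\in H_i,\,h'<h}(1+x_{h'}x_{\overline{h'}})$; $\sigma'=\sigma(x')$, $\tau'=\tau(x')$ for $x'\in\mathbf{M}'$. $P\subset\mathbf{M}\times\mathbf{M}'$ is the subvariety of pairs $(x,x')$ such that: (R1) $x_h=x'_h$ for $h\notin H_i\cup\overline{H}_i$; (R2) $0\to V'_i\xrightarrow{\sigma'}\widehat V_i\xrightarrow{\tau}V_i\to0$ is exact; (R3) $\sigma\tau=q_i\sigma'\tau'+q_i-1$; (R4) $\det(1+x_hx_{\overline h})\ne0$ for all $h\in H$; (R4') $\det(1+x'_hx'_{\overline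 h})\neq0$ for all $h\in H$; (R5) $\Phi_V(x)=q$; (R5') $\Phi_{V'}(x')=q'$; (R6) $x$ is $\theta$-stable; (R6') $x'$ is $\theta'$-stable. $r,r'$ are the projections to the first and second factor. $G=GL(V_i)\times GL(V'_i)\times\prod_{j\ne i}GL(V_j)$ acts on $P$; $r$, $r'$ are equivariant via $G\to G_V$, $G\to G_{V'}$, and $P/G$ is the geometric quotient (which exists). *)

theory Defs
  imports
    "Graph_Theory.Digraph"
    "Jordan_Normal_Form.VS_Connect"
    "HOL-Algebra.Group_Action"
    "HOL-Algebra.Product_Groups"
    "HOL-Analysis.Abstract_Topology"
begin

section \<open>Complex varieties and geometric quotients as spaces with functions\<close>

text \<open>
  A space with functions: a topological space with, for every open set, the functions
  that are regular on it. In \<open>fs_reg S U f\<close> only the values of \<open>f\<close> on \<open>U\<close> matter.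
\<close>

record 'p fspace =
  fs_top :: "'p topology"
  fs_reg :: "'p set \<Rightarrow> ('p \<Rightarrow> complex) \<Rightarrow> bool"

abbreviation fs_carrier :: "'p fspace \<Rightarrow> 'p set" where
  "fs_carrier S \<equiv> topspace (fs_top S)"

definition fs_iso :: "'p fspace \<Rightarrow> 'r fspace \<Rightarrow> ('p \<Rightarrow> 'r) \<Rightarrow> bool" where
  "fs_iso S T f \<longleftrightarrow>
     homeomorphic_map (fs_top S) (fs_top T) f \<and>
     (\<forall>U g. openin (fs_top T) U \<longrightarrow>
        (fs_reg T U g \<longleftrightarrow> fs_reg S {x \<in> fs_carrier S. f x \<in> U} (g \<circ> f)))"

text \<open>The algebra of polynomial functions generated by a set \<open>C\<close> of coordinate functions.\<close>

inductive_set poly_funs :: "('p \<Rightarrow> complex) set \<Rightarrow> ('p \<Rightarrow> complex) set"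
  for C :: "('p \<Rightarrow> complex) set" where
  const: "(\<lambda>_. c) \<in> poly_funs C"
| coord: "f \<in> C \<Longrightarrow> f \<in> poly_funs C"
| add: "f \<in> poly_funs C \<Longrightarrow> g \<in> poly_funs C \<Longrightarrow> (\<lambda>p. f p + g p) \<in> poly_funs C"
| mult: "f \<in> poly_funs C \<Longrightarrow> g \<in> poly_funs C \<Longrightarrow> (\<lambda>p. f p * g p) \<in> poly_funs C"

definition zariski_topology :: "('p \<Rightarrow> complex) set \<Rightarrow> 'p set \<Rightarrow> 'p topology" where
  "zariski_topology C X =
     subtopology (topology_generated_by {{p. f p \<noteq> 0} | f. f \<in> poly_funs C}) X"

text \<open>
  The reduced subvariety with point set \<open>X\<close> of the affine space with coordinates \<open>C\<close>;
  a function is regular when it is locally a quotient of polynomial functions.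
\<close>

definition subvariety :: "('p \<Rightarrow> complex) set \<Rightarrow> 'p set \<Rightarrow> 'p fspace" where
  "subvariety C X =
     \<lparr> fs_top = zariski_topology C X,
       fs_reg = (\<lambda>U f. \<forall>p\<in>U. \<exists>W a b. openin (zariski_topology C X) W \<and> p \<in> W \<and> W \<subseteq> U \<and>
                   a \<in> poly_funs C \<and> b \<in> poly_funs C \<and>
                   (\<forall>y\<in>W. b y \<noteq> 0 \<and> f y = a y / b y)) \<rparr>"

lemma subvariety_reg_cong:
  assumes "\<And>x. x \<in> U \<Longrightarrow> f x = g x"
  shows "fs_reg (subvariety C X) U f \<longleftrightarrow> fs_reg (subvariety C X) U g"
proof -
  have "(\<forall>y\<in>W. b y \<noteq> 0 \<and> f y = a y / b y) \<longleftrightarrow> (\<forall>y\<in>W. b y \<noteq> 0 \<and> g y = a y / b y)"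
    if "W \<subseteq> U" for W a b
    using assms that by (intro ball_cong) auto
  then show ?thesis
    unfolding subvariety_def fspace.simps by (intro ball_cong ex_cong1 refl) blast
qed

definition geometric_quotient ::
  "('g, 'm) monoid_scheme \<Rightarrow> ('g \<Rightarrow> 'p \<Rightarrow> 'p) \<Rightarrow> 'p fspace \<Rightarrow> 'r fspace \<Rightarrow> ('p \<Rightarrow> 'r) \<Rightarrow> bool" where
  "geometric_quotient G \<phi> S Y \<pi> \<longleftrightarrow>
     quotient_map (fs_top S) (fs_top Y) \<pi> \<and>
     (\<forall>x\<in>fs_carrier S. \<forall>y\<in>fs_carrier S. \<pi> x = \<pi> y \<longleftrightarrow> y \<in> orbit G \<phi> x) \<and>
     (\<forall>U f. openin (fs_top Y) U \<longrightarrow>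
        (fs_reg Y U f \<longleftrightarrow> fs_reg S {x \<in> fs_carrier S. \<pi> x \<in> U} (f \<circ> \<pi>)))"

text \<open>
  The orbit space with the quotient topology and the invariant regular functions. By the
  lemmas below it is a geometric quotient, and any two geometric quotients of a subvariety
  are isomorphic compatibly with the projections.
\<close>

definition orbit_space ::
  "('g, 'm) monoid_scheme \<Rightarrow> ('g \<Rightarrow> 'p \<Rightarrow> 'p) \<Rightarrow> 'p fspace \<Rightarrow> 'p set fspace" where
  "orbit_space G \<phi> S =
     \<lparr> fs_top = topology (\<lambda>U. U \<subseteq> orbits G (fs_carrier S) \<phi> \<and>
                  openin (fs_top S) {x \<in> fs_carrier S. orbit G \<phi> x \<in> U}),
       fs_reg = (\<lambda>U f. fs_reg S {x \<in> fs_carrier S. orbit G \<phi> x \<in> U} (f \<circ> orbit G \<phi>)) \<rparr>"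

lemma openin_orbit_space:
  "openin (fs_top (orbit_space G \<phi> S)) U \<longleftrightarrow>
     U \<subseteq> orbits G (fs_carrier S) \<phi> \<and> openin (fs_top S) {x \<in> fs_carrier S. orbit G \<phi> x \<in> U}"
proof -
  have "istopology (\<lambda>U. U \<subseteq> orbits G (fs_carrier S) \<phi> \<and>
          openin (fs_top S) {x \<in> fs_carrier S. orbit G \<phi> x \<in> U})"
    unfolding istopology_def
  proof (intro conjI allI impI)
    fix A B assume
      A: "A \<subseteq> orbits G (fs_carrier S) \<phi> \<and> openin (fs_top S) {x \<in> fs_carrier S. orbit G \<phi> x \<in> A}" and
      B: "B \<subseteq> orbits G (fs_carrier S) \<phi> \<and> openin (fs_top S) {x \<in> fs_carrier S. orbit G \<phi> x \<in> B}"
    then show "A \<inter> B \<subseteq> orbits G (fs_carrier S) \<phi>" by blast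
    have "{x \<in> fs_carrier S. orbit G \<phi> x \<in> A \<inter> B} =
          {x \<in> fs_carrier S. orbit G \<phi> x \<in> A} \<inter> {x \<in> fs_carrier S. orbit G \<phi> x \<in> B}" by blast
    then show "openin (fs_top S) {x \<in> fs_carrier S. orbit G \<phi> x \<in> A \<inter> B}"
      using A B by (simp add: openin_Int)
  next
    fix \<K> assume K: "\<forall>K\<in>\<K>. K \<subseteq> orbits G (fs_carrier S) \<phi> \<and>
      openin (fs_top S) {x \<in> fs_carrier S. orbit G \<phi> x \<in> K}"
    then show "\<Union>\<K> \<subseteq> orbits G (fs_carrier S) \<phi>" by blast
    have "{x \<in> fs_carrier S. orbit G \<phi> x \<in> \<Union>\<K>} =
          \<Union>((\<lambda>K. {x \<in> fs_carrier S. orbit G \<phi> x \<in> K}) ` \<K>)" by blast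
    then show "openin (fs_top S) {x \<in> fs_carrier S. orbit G \<phi> x \<in> \<Union>\<K>}"
      using K by (auto intro!: openin_Union)
  qed
  then show ?thesis
    by (simp add: orbit_space_def)
qed

lemma topspace_orbit_space: "fs_carrier (orbit_space G \<phi> S) = orbits G (fs_carrier S) \<phi>"
proof
  show "fs_carrier (orbit_space G \<phi> S) \<subseteq> orbits G (fs_carrier S) \<phi>"
    using openin_topspace openin_orbit_space by metis
  have "{x \<in> fs_carrier S. orbit G \<phi> x \<in> orbits G (fs_carrier S) \<phi>} = fs_carrier S"
    unfolding orbits_def by blast
  then show "orbits G (fs_carrier S) \<phi> \<subseteq> fs_carrier (orbit_space G \<phi> S)"
    by (intro openin_subset) (simp add: openin_orbit_space)
qed

lemma geometric_quotient_orbit_space: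
  fixes G (structure)
  assumes "group G"
    and "\<And>g x. g \<in> carrier G \<Longrightarrow> x \<in> fs_carrier S \<Longrightarrow> \<phi> g x \<in> fs_carrier S"
    and one: "\<And>x. x \<in> fs_carrier S \<Longrightarrow> \<phi> \<one> x = x"
    and mult: "\<And>g h x. g \<in> carrier G \<Longrightarrow> h \<in> carrier G \<Longrightarrow> x \<in> fs_carrier S \<Longrightarrow>
                 \<phi> (g \<otimes> h) x = \<phi> g (\<phi> h x)"
  shows "geometric_quotient G \<phi> S (orbit_space G \<phi> S) (orbit G \<phi>)"
proof -
  interpret group G by fact
  have orb: "orbit G \<phi> x = orbit G \<phi> y \<longleftrightarrow> y \<in> orbit G \<phi> x"
    if "x \<in> fs_carrier S" "y \<in> fs_carrier S" for x y
  proof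
    assume "orbit G \<phi> x = orbit G \<phi> y"
    moreover have "y \<in> orbit G \<phi> y"
      unfolding orbit_def using one[OF that(2)] one_closed by (metis (mono_tags, lifting) mem_Collect_eq)
    ultimately show "y \<in> orbit G \<phi> x" by simp
  next
    assume "y \<in> orbit G \<phi> x"
    then obtain g where g: "g \<in> carrier G" "y = \<phi> g x"
      unfolding orbit_def by blast
    have 1: "\<phi> h y = \<phi> (h \<otimes> g) x" if "h \<in> carrier G" for h
      using that g mult \<open>x \<in> fs_carrier S\<close> by simp
    have 2: "\<phi> h x = \<phi> (h \<otimes> inv g) y" if "h \<in> carrier G" for h
      using that g 1[of "h \<otimes> inv g"] by (simp add: m_assoc)
    show "orbit G \<phi> x = orbit G \<phi> y"
    proof
      show "orbit G \<phi> x \<subseteq> orbit G \<phi> y"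
        unfolding orbit_def using 2 g(1) m_closed inv_closed by blast
      show "orbit G \<phi> y \<subseteq> orbit G \<phi> x"
        unfolding orbit_def using 1 g(1) m_closed by blast
    qed
  qed
  have "orbit G \<phi> ` fs_carrier S = orbits G (fs_carrier S) \<phi>"
    unfolding orbits_def by blast
  then have "quotient_map (fs_top S) (fs_top (orbit_space G \<phi> S)) (orbit G \<phi>)"
    unfolding quotient_map_def topspace_orbit_space by (simp add: openin_orbit_space)
  then show ?thesis
    unfolding geometric_quotient_def using orb by (simp add: orbit_space_def)
qed

lemma geometric_quotient_unique:
  assumes Y: "geometric_quotient G \<phi> S Y \<pi>" and Y': "geometric_quotient G \<phi> S Y' \<pi>'"
    and local: "\<And>U f g. openin (fs_top S) U \<Longrightarrow> (\<And>x. x \<in> U \<Longrightarrow> f x = g x) \<Longrightarrow>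
                 fs_reg S U f \<longleftrightarrow> fs_reg S U g"
  shows "\<exists>f. fs_iso Y Y' f \<and> (\<forall>x\<in>fs_carrier S. f (\<pi> x) = \<pi>' x)"
proof -
  have q: "quotient_map (fs_top S) (fs_top Y) \<pi>" and q': "quotient_map (fs_top S) (fs_top Y') \<pi>'"
    using Y Y' unfolding geometric_quotient_def by blast+
  have fib: "\<pi> x = \<pi> y \<longleftrightarrow> \<pi>' x = \<pi>' y" if "x \<in> fs_carrier S" "y \<in> fs_carrier S" for x y
    using Y Y' that unfolding geometric_quotient_def by blast
  define f where "f = (\<lambda>z. \<pi>' (SOME x. x \<in> fs_carrier S \<and> \<pi> x = z))"
  have f: "f (\<pi> x) = \<pi>' x" if "x \<in> fs_carrier S" for x
  proof -
    have "(SOME y. y \<in> fs_carrier S \<and> \<pi> y = \<pi> x) \<in> fs_carrier S \<and>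
          \<pi> (SOME y. y \<in> fs_carrier S \<and> \<pi> y = \<pi> x) = \<pi> x"
      by (rule someI[of "\<lambda>y. y \<in> fs_carrier S \<and> \<pi> y = \<pi> x" x]) (simp add: that)
    then show ?thesis unfolding f_def using fib that by blast
  qed
  have carr: "\<pi> ` fs_carrier S = fs_carrier Y" "\<pi>' ` fs_carrier S = fs_carrier Y'"
    using q q' unfolding quotient_map_def by blast+
  have im: "f ` fs_carrier Y = fs_carrier Y'"
    unfolding carr[symmetric] image_image using f by (auto simp: image_def)
  have inj: "inj_on f (fs_carrier Y)"
    unfolding carr[symmetric] inj_on_def using f fib by force
  have pre: "{x \<in> fs_carrier S. \<pi> x \<in> {y \<in> fs_carrier Y. f y \<in> U}} =
             {x \<in> fs_carrier S. \<pi>' x \<in> U}" for U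
    using f carr by auto
  have op: "openin (fs_top Y) {y \<in> fs_carrier Y. f y \<in> U} \<longleftrightarrow> openin (fs_top Y') U"
    if "U \<subseteq> fs_carrier Y'" for U
  proof -
    have "openin (fs_top Y) {y \<in> fs_carrier Y. f y \<in> U} \<longleftrightarrow>
          openin (fs_top S) {x \<in> fs_carrier S. \<pi> x \<in> {y \<in> fs_carrier Y. f y \<in> U}}"
      by (rule q[unfolded quotient_map_def, THEN conjunct2, rule_format, symmetric]) blast
    also have "\<dots> \<longleftrightarrow> openin (fs_top Y') U"
      unfolding pre using q' that unfolding quotient_map_def by blast
    finally show ?thesis .
  qed
  have reg: "fs_reg Y' U g \<longleftrightarrow> fs_reg Y {y \<in> fs_carrier Y. f y \<in> U} (g \<circ> f)"
    if U: "openin (fs_top Y') U" for U g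
  proof -
    let ?W = "{x \<in> fs_carrier S. \<pi>' x \<in> U}"
    have UY: "U \<subseteq> fs_carrier Y'" using U openin_subset by blast
    have "fs_reg Y {y \<in> fs_carrier Y. f y \<in> U} (g \<circ> f) \<longleftrightarrow> fs_reg S ?W (g \<circ> f \<circ> \<pi>)"
      using Y[unfolded geometric_quotient_def, THEN conjunct2, THEN conjunct2, rule_format,
          of "{y \<in> fs_carrier Y. f y \<in> U}" "g \<circ> f"] op[OF UY] U
      by (simp only: pre simp_thms)
    also have "\<dots> \<longleftrightarrow> fs_reg S ?W (g \<circ> \<pi>')"
    proof (rule local)
      show "openin (fs_top S) ?W" using q' U UY unfolding quotient_map_def by blast
      show "\<And>x. x \<in> ?W \<Longrightarrow> (g \<circ> f \<circ> \<pi>) x = (g \<circ> \<pi>') x" using f by simp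
    qed
    also have "\<dots> \<longleftrightarrow> fs_reg Y' U g"
      using Y' U unfolding geometric_quotient_def by blast
    finally show ?thesis by simp
  qed
  have "fs_iso Y Y' f"
    unfolding fs_iso_def homeomorphic_map_def quotient_map_def
    by (intro conjI allI impI im op inj reg)
  then show ?thesis using f by blast
qed

section \<open>Quivers, reflections and representations\<close>

text \<open>
  A quiver \<open>(I, \<Omega>)\<close> is a finite digraph (loops and multiple arcs allowed). The doubled
  arrow set is the disjoint union \<open>H = \<Omega> <+> \<Omega>\<close>: \<open>Inl a\<close> is the arrow \<open>a\<close> itself and
  \<open>Inr a\<close> is its reverse.
\<close>

definition darrows :: "('v, 'a) pre_digraph \<Rightarrow> ('a + 'a) set" where
  "darrows Q = arcs Q <+> arcs Q"

fun out_v :: "('v, 'a) pre_digraph \<Rightarrow> 'a + 'a \<Rightarrow> 'v" where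
  "out_v Q (Inl a) = tail Q a"
| "out_v Q (Inr a) = head Q a"

fun in_v :: "('v, 'a) pre_digraph \<Rightarrow> 'a + 'a \<Rightarrow> 'v" where
  "in_v Q (Inl a) = head Q a"
| "in_v Q (Inr a) = tail Q a"

fun opp :: "'a + 'a \<Rightarrow> 'a + 'a" where
  "opp (Inl a) = Inr a"
| "opp (Inr a) = Inl a"

fun eps :: "'a + 'a \<Rightarrow> int" where
  "eps (Inl a) = 1"
| "eps (Inr a) = - 1"

definition in_arrows :: "('v, 'a) pre_digraph \<Rightarrow> 'v \<Rightarrow> ('a + 'a) set" where
  "in_arrows Q j = {h \<in> darrows Q. in_v Q h = j}"

definition loop_free :: "('v, 'a) pre_digraph \<Rightarrow> 'v \<Rightarrow> bool" where
  "loop_free Q i \<longleftrightarrow> \<not> (\<exists>h\<in>darrows Q. in_v Q h = i \<and> out_v Q h = i)"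

definition pairing :: "('v, 'a) pre_digraph \<Rightarrow> ('v \<Rightarrow> int) \<Rightarrow> ('v \<Rightarrow> int) \<Rightarrow> int" where
  "pairing Q \<alpha> \<beta> =
     2 * (\<Sum>j\<in>verts Q. \<alpha> j * \<beta> j) - (\<Sum>h\<in>darrows Q. \<alpha> (out_v Q h) * \<beta> (in_v Q h))"

definition coord_vec :: "'v \<Rightarrow> 'v \<Rightarrow> int" where
  "coord_vec i j = (if j = i then 1 else 0)"

definition refl_dim :: "('v, 'a) pre_digraph \<Rightarrow> 'v \<Rightarrow> ('v \<Rightarrow> int) \<Rightarrow> 'v \<Rightarrow> int" where
  "refl_dim Q i \<alpha> j = \<alpha> j - pairing Q \<alpha> (coord_vec i) * coord_vec i j"

definition refl_theta :: "('v, 'a) pre_digraph \<Rightarrow> 'v \<Rightarrow> ('v \<Rightarrow> rat) \<Rightarrow> 'v \<Rightarrow> rat" where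
  "refl_theta Q i \<theta> j = \<theta> j - of_int (pairing Q (coord_vec i) (coord_vec j)) * \<theta> i"

definition refl_q :: "('v, 'a) pre_digraph \<Rightarrow> 'v \<Rightarrow> ('v \<Rightarrow> complex) \<Rightarrow> 'v \<Rightarrow> complex" where
  "refl_q Q i q j = q j * q i powi (- pairing Q (coord_vec i) (coord_vec j))"

text \<open>
  A graded vector space is given by its dimension vector \<open>v\<close>, with \<open>V\<^sub>j = \<complex>\<^bsup>v j\<^esup>\<close>, so that
  linear maps between the components are matrices.
\<close>

definition reps :: "('v, 'a) pre_digraph \<Rightarrow> ('v \<Rightarrow> nat) \<Rightarrow> ('a + 'a \<Rightarrow> complex mat) set" where
  "reps Q v = (\<Pi>\<^sub>E h\<in>darrows Q. carrier_mat (v (in_v Q h)) (v (out_v Q h)))"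

definition rep_coords ::
  "('v, 'a) pre_digraph \<Rightarrow> ('v \<Rightarrow> nat) \<Rightarrow> (('a + 'a \<Rightarrow> complex mat) \<Rightarrow> complex) set" where
  "rep_coords Q v =
     {(\<lambda>x. x h $$ (k, l)) | h k l. h \<in> darrows Q \<and> k < v (in_v Q h) \<and> l < v (out_v Q h)}"

definition GL :: "nat \<Rightarrow> complex mat monoid" where
  "GL n = units_of (ring_mat TYPE(complex) n ())"

definition GL_prod :: "('v, 'a) pre_digraph \<Rightarrow> ('v \<Rightarrow> nat) \<Rightarrow> ('v \<Rightarrow> complex mat) monoid" where
  "GL_prod Q v = product_group (verts Q) (\<lambda>j. GL (v j))"

definition rep_act ::
  "('v, 'a) pre_digraph \<Rightarrow> ('v \<Rightarrow> nat) \<Rightarrow> ('v \<Rightarrow> complex mat) \<Rightarrow>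
     ('a + 'a \<Rightarrow> complex mat) \<Rightarrow> 'a + 'a \<Rightarrow> complex mat" where
  "rep_act Q v g x =
     (\<lambda>h\<in>darrows Q. g (in_v Q h) * x h * inv\<^bsub>GL (v (out_v Q h))\<^esub> g (out_v Q h))"

section \<open>Stability and the multiplicative moment map\<close>

definition lin_subspace :: "nat \<Rightarrow> complex vec set \<Rightarrow> bool" where
  "lin_subspace n W \<longleftrightarrow> VectorSpace.subspace class_ring W (module_vec TYPE(complex) n)"

definition subspace_dim :: "nat \<Rightarrow> complex vec set \<Rightarrow> nat" where
  "subspace_dim n W = vectorspace.dim class_ring (module_vec TYPE(complex) n \<lparr>carrier := W\<rparr>)"

definition invariant_subspace ::
  "('v, 'a) pre_digraph \<Rightarrow> ('v \<Rightarrow> nat) \<Rightarrow> ('a + 'a \<Rightarrow> complex mat) \<Rightarrow> ('v \<Rightarrow> complex vec set) \<Rightarrow> bool" where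
  "invariant_subspace Q v x S \<longleftrightarrow>
     (\<forall>j\<in>verts Q. lin_subspace (v j) (S j)) \<and>
     (\<forall>h\<in>darrows Q. \<forall>u\<in>S (out_v Q h). x h *\<^sub>v u \<in> S (in_v Q h))"

definition stable ::
  "('v, 'a) pre_digraph \<Rightarrow> ('v \<Rightarrow> nat) \<Rightarrow> ('v \<Rightarrow> rat) \<Rightarrow> ('a + 'a \<Rightarrow> complex mat) \<Rightarrow> bool" where
  "stable Q v \<theta> x \<longleftrightarrow>
     (\<Sum>j\<in>verts Q. \<theta> j * of_nat (v j)) = 0 \<and>
     (\<forall>S. invariant_subspace Q v x S \<and>
          \<not> (\<forall>j\<in>verts Q. S j = {0\<^sub>v (v j)}) \<and> \<not> (\<forall>j\<in>verts Q. S j = carrier_vec (v j)) \<longrightarrow>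
          (\<Sum>j\<in>verts Q. \<theta> j * of_nat (subspace_dim (v j) (S j))) < 0)"

text \<open>
  The relation \<open>ord\<close> is the chosen strict total order on \<open>H\<close>, with \<open>(h', h) \<in> ord\<close> meaning
  \<open>h' < h\<close>. Ordered products have their factors increasing from left to right.
\<close>

definition ordered_list :: "'h rel \<Rightarrow> 'h set \<Rightarrow> 'h list" where
  "ordered_list ord A = (THE hs. set hs = A \<and> sorted_wrt (\<lambda>h h'. (h, h') \<in> ord) hs)"

definition ordered_prod :: "'h rel \<Rightarrow> nat \<Rightarrow> ('h \<Rightarrow> complex mat) \<Rightarrow> 'h set \<Rightarrow> complex mat" where
  "ordered_prod ord n F A = foldr (*) (map F (ordered_list ord A)) (1\<^sub>m n)"

definition one_plus ::
  "('v, 'a) pre_digraph \<Rightarrow> ('v \<Rightarrow> nat) \<Rightarrow> ('a + 'a \<Rightarrow> complex mat) \<Rightarrow> 'a + 'a \<Rightarrow> complex mat" where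
  "one_plus Q v x h = 1\<^sub>m (v (in_v Q h)) + x h * x (opp h)"

definition reps0 :: "('v, 'a) pre_digraph \<Rightarrow> ('v \<Rightarrow> nat) \<Rightarrow> ('a + 'a \<Rightarrow> complex mat) set" where
  "reps0 Q v = {x \<in> reps Q v. \<forall>h\<in>darrows Q. det (one_plus Q v x h) \<noteq> 0}"

definition moment_map ::
  "('v, 'a) pre_digraph \<Rightarrow> ('a + 'a) rel \<Rightarrow> ('v \<Rightarrow> nat) \<Rightarrow>
     ('a + 'a \<Rightarrow> complex mat) \<Rightarrow> 'v \<Rightarrow> complex mat" where
  "moment_map Q ord v x j =
     ordered_prod ord (v j) (\<lambda>h. one_plus Q v x h [^]\<^bsub>GL (v j)\<^esub> eps h) (in_arrows Q j)"

definition moment_fibre ::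
  "('v, 'a) pre_digraph \<Rightarrow> ('a + 'a) rel \<Rightarrow> ('v \<Rightarrow> nat) \<Rightarrow> ('v \<Rightarrow> complex) \<Rightarrow>
     ('a + 'a \<Rightarrow> complex mat) set" where
  "moment_fibre Q ord v q =
     {x \<in> reps0 Q v. \<forall>j\<in>verts Q. moment_map Q ord v x j = q j \<cdot>\<^sub>m 1\<^sub>m (v j)}"

text \<open>
  \<open>stable_fibre\<close> is \<open>M\<^bsup>s\<^esup>\<^sub>\<theta>(V) \<inter> \<Phi>\<^sub>V\<^bsup>-1\<^esup>(q)\<close> and \<open>moduli\<close> is its geometric quotient by \<open>G\<^sub>V\<close>.
\<close>

definition stable_fibre ::
  "('v, 'a) pre_digraph \<Rightarrow> ('a + 'a) rel \<Rightarrow> ('v \<Rightarrow> nat) \<Rightarrow> ('v \<Rightarrow> complex) \<Rightarrow> ('v \<Rightarrow> rat) \<Rightarrow>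
     ('a + 'a \<Rightarrow> complex mat) set" where
  "stable_fibre Q ord v q \<theta> = {x \<in> moment_fibre Q ord v q. stable Q v \<theta> x}"

definition moduli ::
  "('v, 'a) pre_digraph \<Rightarrow> ('a + 'a) rel \<Rightarrow> ('v \<Rightarrow> nat) \<Rightarrow> ('v \<Rightarrow> complex) \<Rightarrow> ('v \<Rightarrow> rat) \<Rightarrow>
     ('a + 'a \<Rightarrow> complex mat) set fspace" where
  "moduli Q ord v q \<theta> =
     orbit_space (GL_prod Q v) (rep_act Q v)
       (subvariety (rep_coords Q v) (stable_fibre Q ord v q \<theta>))"

section \<open>The correspondence variety\<close>

text \<open>Elements of \<open>\<Oplus>\<^bsub>h \<in> H\<^sub>i\<^esub> V\<^bsub>out(h)\<^esub>\<close> are families indexed by \<open>H\<^sub>i\<close>.\<close>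

definition Vhat ::
  "('v, 'a) pre_digraph \<Rightarrow> 'v \<Rightarrow> ('v \<Rightarrow> nat) \<Rightarrow> ('a + 'a \<Rightarrow> complex vec) set" where
  "Vhat Q i v = (\<Pi>\<^sub>E h\<in>in_arrows Q i. carrier_vec (v (out_v Q h)))"

definition sigma ::
  "('v, 'a) pre_digraph \<Rightarrow> 'v \<Rightarrow> ('a + 'a \<Rightarrow> complex mat) \<Rightarrow> complex vec \<Rightarrow> 'a + 'a \<Rightarrow> complex vec" where
  "sigma Q i x u = (\<lambda>h\<in>in_arrows Q i. x (opp h) *\<^sub>v u)"

definition partial_prod ::
  "('v, 'a) pre_digraph \<Rightarrow> ('a + 'a) rel \<Rightarrow> 'v \<Rightarrow> ('v \<Rightarrow> nat) \<Rightarrow>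
     ('a + 'a \<Rightarrow> complex mat) \<Rightarrow> 'a + 'a \<Rightarrow> complex mat" where
  "partial_prod Q ord i v x h =
     ordered_prod ord (v i) (one_plus Q v x) {h' \<in> in_arrows Q i. (h', h) \<in> ord}"

definition tau ::
  "('v, 'a) pre_digraph \<Rightarrow> ('a + 'a) rel \<Rightarrow> 'v \<Rightarrow> ('v \<Rightarrow> nat) \<Rightarrow>
     ('a + 'a \<Rightarrow> complex mat) \<Rightarrow> ('a + 'a \<Rightarrow> complex vec) \<Rightarrow> complex vec" where
  "tau Q ord i v x w =
     finsum_vec TYPE(complex) (v i) (\<lambda>h. (partial_prod Q ord i v x h * x h) *\<^sub>v w h) (in_arrows Q i)"

definition corr ::
  "('v, 'a) pre_digraph \<Rightarrow> ('a + 'a) rel \<Rightarrow> 'v \<Rightarrow> ('v \<Rightarrow> nat) \<Rightarrow> ('v \<Rightarrow> nat) \<Rightarrow>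
     ('v \<Rightarrow> complex) \<Rightarrow> ('v \<Rightarrow> rat) \<Rightarrow> ('v \<Rightarrow> complex) \<Rightarrow> ('v \<Rightarrow> rat) \<Rightarrow>
     (('a + 'a \<Rightarrow> complex mat) \<times> ('a + 'a \<Rightarrow> complex mat)) set" where
  "corr Q ord i v v' q \<theta> q' \<theta>' = {(x, x'). x \<in> reps Q v \<and> x' \<in> reps Q v' \<and>
     (\<forall>h\<in>darrows Q - (in_arrows Q i \<union> opp ` in_arrows Q i). x h = x' h) \<and>
     \<comment> \<open>exactness of \<open>0 \<rightarrow> V'\<^sub>i \<rightarrow> Vhat \<rightarrow> V\<^sub>i \<rightarrow> 0\<close> with maps \<open>\<sigma>'\<close>, \<open>\<tau>\<close>\<close>
     inj_on (sigma Q i x') (carrier_vec (v' i)) \<and>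
     sigma Q i x' ` carrier_vec (v' i) = {w \<in> Vhat Q i v. tau Q ord i v x w = 0\<^sub>v (v i)} \<and>
     tau Q ord i v x ` Vhat Q i v = carrier_vec (v i) \<and>
     \<comment> \<open>\<open>\<sigma>\<tau> = q\<^sub>i \<sigma>'\<tau>' + q\<^sub>i - 1\<close>, componentwise\<close>
     (\<forall>w\<in>Vhat Q i v. \<forall>h\<in>in_arrows Q i.
        sigma Q i x (tau Q ord i v x w) h =
          q i \<cdot>\<^sub>v sigma Q i x' (tau Q ord i v' x' w) h + (q i - 1) \<cdot>\<^sub>v w h) \<and>
     (\<forall>h\<in>darrows Q. det (one_plus Q v x h) \<noteq> 0) \<and>
     (\<forall>h\<in>darrows Q. det (one_plus Q v' x' h) \<noteq> 0) \<and>
     (\<forall>j\<in>verts Q. moment_map Q ord v x j = q j \<cdot>\<^sub>m 1\<^sub>m (v j)) \<and>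
     (\<forall>j\<in>verts Q. moment_map Q ord v' x' j = q' j \<cdot>\<^sub>m 1\<^sub>m (v' j)) \<and>
     stable Q v \<theta> x \<and> stable Q v' \<theta>' x'}"

definition corr_coords ::
  "('v, 'a) pre_digraph \<Rightarrow> ('v \<Rightarrow> nat) \<Rightarrow> ('v \<Rightarrow> nat) \<Rightarrow>
     (('a + 'a \<Rightarrow> complex mat) \<times> ('a + 'a \<Rightarrow> complex mat) \<Rightarrow> complex) set" where
  "corr_coords Q v v' = {c \<circ> fst | c. c \<in> rep_coords Q v} \<union> {c \<circ> snd | c. c \<in> rep_coords Q v'}"

definition corr_group ::
  "('v, 'a) pre_digraph \<Rightarrow> 'v \<Rightarrow> ('v \<Rightarrow> nat) \<Rightarrow> ('v \<Rightarrow> nat) \<Rightarrow>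
     (complex mat \<times> complex mat \<times> ('v \<Rightarrow> complex mat)) monoid" where
  "corr_group Q i v v' =
     GL (v i) \<times>\<times> (GL (v' i) \<times>\<times> product_group (verts Q - {i}) (\<lambda>j. GL (v j)))"

text \<open>The maps \<open>G \<rightarrow> G\<^sub>V\<close> and \<open>G \<rightarrow> G\<^bsub>V'\<^esub>\<close> are \<open>(a, b, g) \<mapsto> g(i := a)\<close> and \<open>(a, b, g) \<mapsto> g(i := b)\<close>.\<close>

definition corr_act ::
  "('v, 'a) pre_digraph \<Rightarrow> 'v \<Rightarrow> ('v \<Rightarrow> nat) \<Rightarrow> ('v \<Rightarrow> nat) \<Rightarrow>
     complex mat \<times> complex mat \<times> ('v \<Rightarrow> complex mat) \<Rightarrow>
     ('a + 'a \<Rightarrow> complex mat) \<times> ('a + 'a \<Rightarrow> complex mat) \<Rightarrow>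
     ('a + 'a \<Rightarrow> complex mat) \<times> ('a + 'a \<Rightarrow> complex mat)" where
  "corr_act Q i v v' = (\<lambda>(a, b, g) (x, x'). (rep_act Q v (g(i := a)) x, rep_act Q v' (g(i := b)) x'))"

definition corr_quotient ::
  "('v, 'a) pre_digraph \<Rightarrow> ('a + 'a) rel \<Rightarrow> 'v \<Rightarrow> ('v \<Rightarrow> nat) \<Rightarrow> ('v \<Rightarrow> nat) \<Rightarrow>
     ('v \<Rightarrow> complex) \<Rightarrow> ('v \<Rightarrow> rat) \<Rightarrow> ('v \<Rightarrow> complex) \<Rightarrow> ('v \<Rightarrow> rat) \<Rightarrow>
     (('a + 'a \<Rightarrow> complex mat) \<times> ('a + 'a \<Rightarrow> complex mat)) set fspace" where
  "corr_quotient Q ord i v v' q \<theta> q' \<theta>' =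
     orbit_space (corr_group Q i v v') (corr_act Q i v v')
       (subvariety (corr_coords Q v v') (corr Q ord i v v' q \<theta> q' \<theta>'))"

end

theory Submission
  imports Defs
begin

text \<open>
  Write \<open>X\<close> for the row of the \<open>x\<^sub>h\<close> with \<open>h \<in> H\<^sub>i\<close> and \<open>U\<close> for the strictly block upper triangular part
  of \<open>\<sigma>X\<close>. Telescoping the ordered products gives \<open>\<Phi>\<^sub>i = 1 + \<tau>\<sigma>\<close> and \<open>X = \<tau>(1 - U)\<close>, whence the block
  factorization \<open>1 + \<sigma>\<tau> = (1 + \<sigma>X - U)(1 - U)\<^sup>-\<^sup>1\<close>, whose diagonal blocks are the \<open>1 + x\<^bsub>h'\<^esub>x\<^sub>h\<close> with \<open>h'\<close> the
  reverse of \<open>h\<close>. Hence \<open>1 + \<sigma>\<tau> = q\<^sub>i(1 + \<sigma>'\<tau>')\<close> can be read off factor by factor: it gives the moment map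
  equations of \<open>x'\<close> from those of \<open>x\<close> and conversely, and \<open>x'\<close> is determined by \<open>x\<close> together with an
  injection \<open>\<sigma>'\<close> onto \<open>ker \<tau>\<close>. Stability is transferred by comparing an invariant subspace \<open>S\<close> of one
  representation with the one that agrees with \<open>S\<close> away from \<open>i\<close> and is \<open>\<tau>(hat S)\<close> or \<open>\<sigma>'\<^sup>-\<^sup>1(hat S)\<close> at \<open>i\<close>.
  So the fibres of \<open>r\<close> and \<open>r'\<close> are single orbits of \<open>GL(V'\<^sub>i)\<close> and \<open>GL(V\<^sub>i)\<close>. Splittings of \<open>\<tau>\<close> and of \<open>\<sigma>'\<close>
  can be chosen regularly on open sets, so both projections have local sections, and therefore the
  induced bijections of orbit spaces are isomorphisms.
\<close>

section \<open>Regular functions and local sections\<close>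

text \<open>The obstacle is that (R3) relates only the products \<sigma>\<tau> and \<sigma>'\<tau>',
  whereas determinants, moment map values and the group action speak of single arrows, and the
  passage from the row X to \<tau> is not linear: the partial products contain X themselves. The
  factor 1 - U makes this passage manageable. It depends on X only through \<sigma>X, it cancels on
  the right, and it is common to both sides: above the diagonal blocks,
  \<open>\<sigma>'X' = s\<^sup>-\<^sup>1(1 + \<sigma>X - U) - (1 - U)\<close> reads U' = U. The
  constant \<open>s\<close> is \<open>q i\<close>. Since \<open>\<theta>' i = - \<theta> i\<close>,
  the two directions are not instances of one statement; the construction of \<open>x\<close> from
  \<open>x'\<close> and the return of stability are dual arguments. The sign of
  \<open>\<theta> i\<close> enters twice: it turns a defect of exactness into an inequality of
  weights, and for \<open>q i = 1\<close> it makes \<tau> onto and \<sigma>' injective on stable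
  points. For \<open>q i \<noteq> 1\<close> this holds because \<tau>\<sigma> and \<tau>'\<sigma>'
  are nonzero scalars. Exactness is carried by explicit splittings, so that it can be used as matrix
  identities and varied regularly with the point.\<close>

lemma generate_topology_on_poly:
  assumes "generate_topology_on {{p. f p \<noteq> 0} | f. f \<in> poly_funs C} T" and "p \<in> T"
  shows "\<exists>f\<in>poly_funs C. f p \<noteq> 0 \<and> {y. f y \<noteq> 0} \<subseteq> T"
  using assms
proof (induction T arbitrary: p)
  case Empty
  then show ?case by simp
next
  case (Int a b)
  then obtain f g where "f \<in> poly_funs C" "f p \<noteq> 0" "{y. f y \<noteq> 0} \<subseteq> a"
    "g \<in> poly_funs C" "g p \<noteq> 0" "{y. g y \<noteq> 0} \<subseteq> b" by blast
  \<comment> \<open>Two principal open sets meet in the nonvanishing locus of the product, so the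
    generating family is already a base.\<close>
  then show ?case by (intro bexI[OF _ poly_funs.mult[of f C g]]) auto
next
  case (UN K)
  then show ?case by blast
next
  case (Basis s)
  then show ?case by blast
qed

text \<open>The working form of openness: a point of an open set is certified by one polynomial,
  because principal open sets form a base.\<close>

lemma openin_zariski:
  "openin (zariski_topology C X) W \<longleftrightarrow>
     W \<subseteq> X \<and> (\<forall>p\<in>W. \<exists>f\<in>poly_funs C. f p \<noteq> 0 \<and> (\<forall>y\<in>X. f y \<noteq> 0 \<longrightarrow> y \<in> W))"
    (is "_ \<longleftrightarrow> ?R")
proof
  assume "openin (zariski_topology C X) W"
  then obtain T where T: "openin (topology_generated_by {{p. f p \<noteq> 0} | f. f \<in> poly_funs C}) T" "W = T \<inter> X"
    unfolding zariski_topology_def openin_subtopology by blast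
  have "\<exists>f\<in>poly_funs C. f p \<noteq> 0 \<and> (\<forall>y\<in>X. f y \<noteq> 0 \<longrightarrow> y \<in> W)" if "p \<in> W" for p
    using generate_topology_on_poly[OF T(1)[unfolded openin_topology_generated_by_iff], of p] that T(2)
    by blast
  then show ?R using T by blast
next
  assume R: ?R
  have "openin (zariski_topology C X) ({y. f y \<noteq> 0} \<inter> X)" if "f \<in> poly_funs C" for f
    unfolding zariski_topology_def openin_subtopology
    using that by (intro exI[of _ "{y. f y \<noteq> 0}"] conjI refl topology_generated_by_Basis) blast
  then have "openin (zariski_topology C X) (\<Union>{{y. f y \<noteq> 0} \<inter> X | f. f \<in> poly_funs C \<and> {y. f y \<noteq> 0} \<inter> X \<subseteq> W})"
    by (intro openin_Union) blast
  moreover have "\<Union>{{y. f y \<noteq> 0} \<inter> X | f. f \<in> poly_funs C \<and> {y. f y \<noteq> 0} \<inter> X \<subseteq> W} = W"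
  proof
    show "W \<subseteq> \<Union>{{y. f y \<noteq> 0} \<inter> X | f. f \<in> poly_funs C \<and> {y. f y \<noteq> 0} \<inter> X \<subseteq> W}"
    proof
      fix p assume "p \<in> W"
      then obtain f where "f \<in> poly_funs C" "f p \<noteq> 0" "\<forall>y\<in>X. f y \<noteq> 0 \<longrightarrow> y \<in> W" using R by blast
      then show "p \<in> \<Union>{{y. f y \<noteq> 0} \<inter> X | f. f \<in> poly_funs C \<and> {y. f y \<noteq> 0} \<inter> X \<subseteq> W}"
        using \<open>p \<in> W\<close> R by (intro UnionI[of "{y. f y \<noteq> 0} \<inter> X"]) blast+
    qed
  qed blast
  ultimately show "openin (zariski_topology C X) W" by simp
qed

lemma topspace_zariski [simp]: "topspace (zariski_topology C X) = X"
proof -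
  have "openin (zariski_topology C X) X"
    unfolding openin_zariski by (auto intro!: bexI[OF _ poly_funs.const[of 1]])
  then show ?thesis
    by (meson openin_subset openin_topspace openin_zariski subset_antisym)
qed

lemma fs_carrier_subvariety [simp]: "fs_carrier (subvariety C X) = X"
  by (simp add: subvariety_def)

lemma fs_top_subvariety: "fs_top (subvariety C X) = zariski_topology C X"
  by (simp add: subvariety_def)

text \<open>A single quotient on all of \<open>N\<close>; the denominator may depend on \<open>f\<close>.\<close>

definition reg_on :: "('p \<Rightarrow> complex) set \<Rightarrow> 'p set \<Rightarrow> ('p \<Rightarrow> complex) \<Rightarrow> bool" where
  "reg_on C N f \<longleftrightarrow>
     (\<exists>a\<in>poly_funs C. \<exists>b\<in>poly_funs C. \<forall>p\<in>N. b p \<noteq> 0 \<and> f p = a p / b p)"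

lemma reg_onI: "a \<in> poly_funs C \<Longrightarrow> b \<in> poly_funs C \<Longrightarrow>
    (\<And>p. p \<in> N \<Longrightarrow> b p \<noteq> 0 \<and> f p = a p / b p) \<Longrightarrow> reg_on C N f"
  unfolding reg_on_def by blast

lemma reg_on_cong: "reg_on C N f \<Longrightarrow> (\<And>p. p \<in> N \<Longrightarrow> g p = f p) \<Longrightarrow> reg_on C N g"
  unfolding reg_on_def by force

lemma reg_on_mono: "reg_on C N f \<Longrightarrow> M \<subseteq> N \<Longrightarrow> reg_on C M f"
  unfolding reg_on_def by blast

lemma reg_on_const: "reg_on C N (\<lambda>_. c)"
  by (rule reg_onI[OF poly_funs.const[of c] poly_funs.const[of 1]]) auto

lemma reg_on_coord: "f \<in> C \<Longrightarrow> reg_on C N f"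
  by (rule reg_onI[OF poly_funs.coord poly_funs.const[of 1]]) auto

lemma reg_on_mult:
  assumes "reg_on C N f" "reg_on C N g"
  shows "reg_on C N (\<lambda>p. f p * g p)"
proof -
  obtain a b where ab: "a \<in> poly_funs C" "b \<in> poly_funs C" "\<forall>p\<in>N. b p \<noteq> 0 \<and> f p = a p / b p"
    using assms(1) unfolding reg_on_def by blast
  obtain a' b' where ab': "a' \<in> poly_funs C" "b' \<in> poly_funs C" "\<forall>p\<in>N. b' p \<noteq> 0 \<and> g p = a' p / b' p"
    using assms(2) unfolding reg_on_def by blast
  show ?thesis
    by (rule reg_onI[OF poly_funs.mult[OF ab(1) ab'(1)] poly_funs.mult[OF ab(2) ab'(2)]])
      (use ab(3) ab'(3) in auto)
qed

lemma reg_on_add: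
  assumes "reg_on C N f" "reg_on C N g"
  shows "reg_on C N (\<lambda>p. f p + g p)"
proof -
  obtain a b where ab: "a \<in> poly_funs C" "b \<in> poly_funs C" "\<forall>p\<in>N. b p \<noteq> 0 \<and> f p = a p / b p"
    using assms(1) unfolding reg_on_def by blast
  obtain a' b' where ab': "a' \<in> poly_funs C" "b' \<in> poly_funs C" "\<forall>p\<in>N. b' p \<noteq> 0 \<and> g p = a' p / b' p"
    using assms(2) unfolding reg_on_def by blast
  show ?thesis
    by (rule reg_onI[OF poly_funs.add[OF poly_funs.mult[OF ab(1) ab'(2)] poly_funs.mult[OF ab'(1) ab(2)]]
          poly_funs.mult[OF ab(2) ab'(2)]])
      (use ab(3) ab'(3) in \<open>auto simp: add_frac_eq\<close>)
qed

lemma reg_on_inverse: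
  assumes "reg_on C N f" "\<And>p. p \<in> N \<Longrightarrow> f p \<noteq> 0"
  shows "reg_on C N (\<lambda>p. inverse (f p))"
proof -
  obtain a b where ab: "a \<in> poly_funs C" "b \<in> poly_funs C" "\<forall>p\<in>N. b p \<noteq> 0 \<and> f p = a p / b p"
    using assms(1) unfolding reg_on_def by blast
  show ?thesis
    by (rule reg_onI[OF ab(2) ab(1)]) (use ab(3) assms(2) in \<open>force simp: inverse_eq_divide\<close>)
qed

lemma reg_on_sum:
  assumes "\<And>j. j \<in> J \<Longrightarrow> reg_on C N (f j)"
  shows "reg_on C N (\<lambda>p. \<Sum>j\<in>J. f j p)"
  using assms by (induction J rule: infinite_finite_induct) (auto intro: reg_on_const reg_on_add)

lemma reg_on_prod:
  assumes "\<And>j. j \<in> J \<Longrightarrow> reg_on C N (f j)"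
  shows "reg_on C N (\<lambda>p. \<Prod>j\<in>J. f j p)"
  using assms by (induction J rule: infinite_finite_induct) (auto intro: reg_on_const reg_on_mult)

lemma reg_on_poly_comp:
  assumes "f \<in> poly_funs C" and "\<And>c. c \<in> C \<Longrightarrow> reg_on D N (\<lambda>p. c (s p))"
  shows "reg_on D N (\<lambda>p. f (s p))"
  using assms by (induction f) (auto intro: reg_on_const reg_on_add reg_on_mult)

lemma openin_reg_on_nonzero:
  assumes "reg_on C N f" "openin (zariski_topology C X) N"
  shows "openin (zariski_topology C X) {p \<in> N. f p \<noteq> 0}"
  unfolding openin_zariski
proof (intro conjI ballI)
  show "{p \<in> N. f p \<noteq> 0} \<subseteq> X" using assms(2) unfolding openin_zariski by blast
  fix p assume p: "p \<in> {p \<in> N. f p \<noteq> 0}"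
  obtain a b where ab: "a \<in> poly_funs C" "b \<in> poly_funs C" "\<forall>p\<in>N. b p \<noteq> 0 \<and> f p = a p / b p"
    using assms(1) unfolding reg_on_def by blast
  obtain g where g: "g \<in> poly_funs C" "g p \<noteq> 0" "\<forall>y\<in>X. g y \<noteq> 0 \<longrightarrow> y \<in> N"
    using assms(2) p unfolding openin_zariski by blast
  \<comment> \<open>The polynomial \<open>g\<close> keeps a point in \<open>N\<close> and the
    numerator \<open>a\<close> keeps the value of \<open>f\<close> nonzero; their product does
    both.\<close>
  show "\<exists>h\<in>poly_funs C. h p \<noteq> 0 \<and> (\<forall>y\<in>X. h y \<noteq> 0 \<longrightarrow> y \<in> {p \<in> N. f p \<noteq> 0})"
    by (rule bexI[OF _ poly_funs.mult[OF g(1) ab(1)]]) (use ab(3) g p in auto)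
qed

text \<open>Continuity of a map with regular coordinates. It is stated for a map on an open subset
  \<open>N\<close>, since it serves both for a projection on its whole domain and for a local
  section.\<close>

lemma openin_regular_preimage:
  assumes W: "openin (zariski_topology C X) W" and N: "openin (zariski_topology D Y) N"
    and s: "\<And>y. y \<in> N \<Longrightarrow> s y \<in> X"
    and reg: "\<And>c. c \<in> C \<Longrightarrow> reg_on D N (\<lambda>y. c (s y))"
  shows "openin (zariski_topology D Y) {y \<in> N. s y \<in> W}"
proof (subst openin_subopen, intro ballI)
  fix y assume "y \<in> {y \<in> N. s y \<in> W}"
  then have y: "y \<in> N" "s y \<in> W" by auto
  obtain f where f: "f \<in> poly_funs C" "f (s y) \<noteq> 0" "\<forall>x\<in>X. f x \<noteq> 0 \<longrightarrow> x \<in> W"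
    using W y(2) unfolding openin_zariski by blast
  show "\<exists>T. openin (zariski_topology D Y) T \<and> y \<in> T \<and> T \<subseteq> {y \<in> N. s y \<in> W}"
    by (rule exI[of _ "{y \<in> N. f (s y) \<noteq> 0}"])
      (use openin_reg_on_nonzero[OF reg_on_poly_comp[OF f(1) reg] N] y f s in auto)
qed

lemma fs_reg_subvariety:
  "fs_reg (subvariety C X) U f \<longleftrightarrow>
     (\<forall>p\<in>U. \<exists>W. openin (zariski_topology C X) W \<and> p \<in> W \<and> W \<subseteq> U \<and> reg_on C W f)"
  unfolding subvariety_def fspace.simps reg_on_def by meson

text \<open>A regular function is a quotient only locally, so a neighbourhood of \<open>s y\<close>
  with a single quotient a / b is fixed first and then pulled back; numerator and denominator pull
  back separately.\<close>

lemma fs_reg_pullback: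
  assumes g: "fs_reg (subvariety C X) U g" and N: "openin (zariski_topology D Y) N"
    and s: "\<And>y. y \<in> N \<Longrightarrow> s y \<in> X"
    and reg: "\<And>c. c \<in> C \<Longrightarrow> reg_on D N (\<lambda>y. c (s y))"
    and y: "y \<in> N" "s y \<in> U"
  shows "\<exists>W. openin (zariski_topology D Y) W \<and> y \<in> W \<and> W \<subseteq> {y \<in> N. s y \<in> U} \<and>
           reg_on D W (\<lambda>y. g (s y))"
proof -
  obtain W where W: "openin (zariski_topology C X) W" "s y \<in> W" "W \<subseteq> U" "reg_on C W g"
    using g y unfolding fs_reg_subvariety by blast
  let ?W = "{y \<in> N. s y \<in> W}"
  obtain a b where ab: "a \<in> poly_funs C" "b \<in> poly_funs C" "\<forall>p\<in>W. b p \<noteq> 0 \<and> g p = a p / b p"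
    using W(4) unfolding reg_on_def by blast
  have reg': "reg_on D ?W (\<lambda>y. c (s y))" if "c \<in> C" for c
    using reg[OF that] by (rule reg_on_mono) blast
  have "reg_on D ?W (\<lambda>y. a (s y))" "reg_on D ?W (\<lambda>y. b (s y))"
    using ab(1,2) reg' by (auto intro: reg_on_poly_comp)
  then have "reg_on D ?W (\<lambda>y. a (s y) * inverse (b (s y)))"
    using ab(3) by (intro reg_on_mult reg_on_inverse) auto
  then have "reg_on D ?W (\<lambda>y. g (s y))"
    by (rule reg_on_cong) (use ab(3) in \<open>auto simp: divide_inverse\<close>)
  moreover have "openin (zariski_topology D Y) ?W"
    by (rule openin_regular_preimage[OF W(1) N]) (fact s reg)+
  ultimately show ?thesis
    using W(2,3) y(1) by (intro exI[of _ ?W] conjI) auto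
qed

text \<open>Criterion behind both isomorphisms. Local sections make \<open>r\<close> onto and make
  openness and regularity descend: on \<open>N\<close>, a set W is the preimage under
  \<open>s\<close> of its preimage under \<open>r\<close>, and a function g equals (g o r) o s. The
  groups enter only through \<open>orb\<close>, which makes the induced map of orbits well defined
  and injective.\<close>

lemma fs_iso_orbit_space_local_sections:
  assumes rX: "\<And>x. x \<in> X \<Longrightarrow> r x \<in> Y"
    and rC: "\<And>d. d \<in> D \<Longrightarrow> d \<circ> r \<in> C"
    and sec: "\<And>y. y \<in> Y \<Longrightarrow> \<exists>N s. openin (zariski_topology D Y) N \<and> y \<in> N \<and>
                (\<forall>z\<in>N. s z \<in> X \<and> r (s z) = z) \<and> (\<forall>c\<in>C. reg_on D N (\<lambda>z. c (s z)))"
    and orb: "\<And>x y. x \<in> X \<Longrightarrow> y \<in> X \<Longrightarrow>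
                orbit G \<phi> x = orbit G \<phi> y \<longleftrightarrow> orbit K \<psi> (r x) = orbit K \<psi> (r y)"
  shows "\<exists>f. fs_iso (orbit_space G \<phi> (subvariety C X)) (orbit_space K \<psi> (subvariety D Y)) f \<and>
           (\<forall>x\<in>X. f (orbit G \<phi> x) = orbit K \<psi> (r x))"
proof -
  \<comment> \<open>The choice of a representative of the orbit does not matter by
    \<open>orb\<close>.\<close>
  define f where "f = (\<lambda>z. orbit K \<psi> (r (SOME x. x \<in> X \<and> orbit G \<phi> x = z)))"
  have f: "f (orbit G \<phi> x) = orbit K \<psi> (r x)" if "x \<in> X" for x
  proof -
    have "(SOME y. y \<in> X \<and> orbit G \<phi> y = orbit G \<phi> x) \<in> X \<and>
          orbit G \<phi> (SOME y. y \<in> X \<and> orbit G \<phi> y = orbit G \<phi> x) = orbit G \<phi> x"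
      by (rule someI[of "\<lambda>y. y \<in> X \<and> orbit G \<phi> y = orbit G \<phi> x" x]) (simp add: that)
    then show ?thesis unfolding f_def using orb that by blast
  qed
  have rreg: "reg_on C X (\<lambda>x. d (r x))" if "d \<in> D" for d
    using reg_on_coord[OF rC[OF that], of X] by (simp add: comp_def)
  have X: "openin (zariski_topology C X) X"
    using openin_topspace[of "zariski_topology C X"] by simp
  have surj: "\<exists>x\<in>X. r x = y" if "y \<in> Y" for y
    using sec[OF that] by blast
  have op: "openin (zariski_topology C X) {x \<in> X. r x \<in> W} \<longleftrightarrow> openin (zariski_topology D Y) W"
    if "W \<subseteq> Y" for W
  proof
    assume L: "openin (zariski_topology C X) {x \<in> X. r x \<in> W}"
    show "openin (zariski_topology D Y) W"
    proof (subst openin_subopen, intro ballI)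
      fix y assume "y \<in> W"
      with that have "y \<in> Y" by blast
      from sec[OF this] obtain N s where Ns: "openin (zariski_topology D Y) N" "y \<in> N"
        "\<forall>z\<in>N. s z \<in> X \<and> r (s z) = z" "\<forall>c\<in>C. reg_on D N (\<lambda>z. c (s z))"
        by (elim exE conjE) (rule that)
      \<comment> \<open>As \<open>r (s z) = z\<close> on \<open>N\<close>, this set is the part of W
        inside \<open>N\<close>.\<close>
      have "openin (zariski_topology D Y) {z \<in> N. s z \<in> {x \<in> X. r x \<in> W}}"
        by (rule openin_regular_preimage[OF L Ns(1)]) (use Ns in auto)
      then show "\<exists>T. openin (zariski_topology D Y) T \<and> y \<in> T \<and> T \<subseteq> W"
        using Ns \<open>y \<in> W\<close> that by (intro exI[of _ "{z \<in> N. s z \<in> {x \<in> X. r x \<in> W}}"]) auto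
    qed
  next
    assume "openin (zariski_topology D Y) W"
    then show "openin (zariski_topology C X) {x \<in> X. r x \<in> W}"
      by (rule openin_regular_preimage[OF _ X]) (use rX rreg in auto)
  qed
  have reg: "fs_reg (subvariety C X) {x \<in> X. r x \<in> W} (\<lambda>x. g (r x)) \<longleftrightarrow> fs_reg (subvariety D Y) W g"
    if "W \<subseteq> Y" for W g
  proof
    assume L: "fs_reg (subvariety C X) {x \<in> X. r x \<in> W} (\<lambda>x. g (r x))"
    show "fs_reg (subvariety D Y) W g"
      unfolding fs_reg_subvariety
    proof
      fix y assume "y \<in> W"
      with that have "y \<in> Y" by blast
      from sec[OF this] obtain N s where Ns: "openin (zariski_topology D Y) N" "y \<in> N"
        "\<forall>z\<in>N. s z \<in> X \<and> r (s z) = z" "\<forall>c\<in>C. reg_on D N (\<lambda>z. c (s z))"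
        by (elim exE conjE) (rule that)
      have "\<exists>V. openin (zariski_topology D Y) V \<and> y \<in> V \<and>
              V \<subseteq> {z \<in> N. s z \<in> {x \<in> X. r x \<in> W}} \<and> reg_on D V (\<lambda>z. g (r (s z)))"
        by (rule fs_reg_pullback[OF L Ns(1)]) (use Ns \<open>y \<in> W\<close> in auto)
      then obtain V where V: "openin (zariski_topology D Y) V" "y \<in> V"
        "V \<subseteq> {z \<in> N. s z \<in> {x \<in> X. r x \<in> W}}" "reg_on D V (\<lambda>z. g (r (s z)))" by blast
      have "reg_on D V g"
        by (rule reg_on_cong[OF V(4)]) (use V(3) Ns(3) in force)
      moreover have "V \<subseteq> W" using V(3) Ns(3) by force
      ultimately show "\<exists>V. openin (zariski_topology D Y) V \<and> y \<in> V \<and> V \<subseteq> W \<and> reg_on D V g"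
        using V by blast
    qed
  next
    assume R: "fs_reg (subvariety D Y) W g"
    show "fs_reg (subvariety C X) {x \<in> X. r x \<in> W} (\<lambda>x. g (r x))"
      unfolding fs_reg_subvariety
    proof
      fix x assume "x \<in> {x \<in> X. r x \<in> W}"
      then show "\<exists>V. openin (zariski_topology C X) V \<and> x \<in> V \<and> V \<subseteq> {x \<in> X. r x \<in> W} \<and>
          reg_on C V (\<lambda>x. g (r x))"
        by (intro fs_reg_pullback[OF R X]) (use rX rreg in auto)
    qed
  qed
  let ?S = "orbit_space G \<phi> (subvariety C X)" and ?T = "orbit_space K \<psi> (subvariety D Y)"
  have carrS: "fs_carrier ?S = orbit G \<phi> ` X" and carrT: "fs_carrier ?T = orbit K \<psi> ` Y"
    unfolding topspace_orbit_space by (auto simp: orbits_def)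
  have im: "f ` fs_carrier ?S = fs_carrier ?T"
    unfolding carrS carrT image_image using f rX surj by (force simp: image_iff)
  have inj: "inj_on f (fs_carrier ?S)"
    unfolding carrS inj_on_def using f orb by force
  \<comment> \<open>Pulled back along the orbit map, the preimage of \<open>U\<close> under
    \<open>f\<close> is the preimage under \<open>r\<close> of the saturated set lying over
    \<open>U\<close>. This reduces statements on the orbit spaces to \<open>op\<close> and
    \<open>reg\<close>.\<close>
  have pre: "{x \<in> X. orbit G \<phi> x \<in> {z \<in> fs_carrier ?S. f z \<in> U}} =
      {x \<in> X. r x \<in> {y \<in> Y. orbit K \<psi> y \<in> U}}" for U
    unfolding carrS using f rX by auto
  have fop: "openin (fs_top ?S) {z \<in> fs_carrier ?S. f z \<in> U} \<longleftrightarrow> openin (fs_top ?T) U"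
    if "U \<subseteq> fs_carrier ?T" for U
  proof -
    have "openin (fs_top ?S) {z \<in> fs_carrier ?S. f z \<in> U} \<longleftrightarrow>
        openin (zariski_topology C X) {x \<in> X. r x \<in> {y \<in> Y. orbit K \<psi> y \<in> U}}"
      unfolding openin_orbit_space fs_top_subvariety topspace_zariski pre[unfolded fs_top_subvariety]
      by (auto simp: topspace_orbit_space fs_top_subvariety)
    also have "\<dots> \<longleftrightarrow> openin (fs_top ?T) U"
      unfolding openin_orbit_space fs_top_subvariety topspace_zariski
      using op[of "{y \<in> Y. orbit K \<psi> y \<in> U}"] that by (auto simp: topspace_orbit_space fs_top_subvariety)
    finally show ?thesis .
  qed
  have freg: "fs_reg ?T U g \<longleftrightarrow> fs_reg ?S {z \<in> fs_carrier ?S. f z \<in> U} (g \<circ> f)" for U g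
  proof -
    have "fs_reg ?S {z \<in> fs_carrier ?S. f z \<in> U} (g \<circ> f) \<longleftrightarrow>
        fs_reg (subvariety C X) {x \<in> X. orbit G \<phi> x \<in> {z \<in> fs_carrier ?S. f z \<in> U}} (g \<circ> f \<circ> orbit G \<phi>)"
      by (subst (1) orbit_space_def) (simp only: fspace.simps fs_carrier_subvariety)
    also have "\<dots> \<longleftrightarrow> fs_reg (subvariety C X) {x \<in> X. r x \<in> {y \<in> Y. orbit K \<psi> y \<in> U}}
        (\<lambda>x. (g \<circ> orbit K \<psi>) (r x))"
      unfolding pre using f by (intro subvariety_reg_cong) auto
    also have "\<dots> \<longleftrightarrow> fs_reg (subvariety D Y) {y \<in> Y. orbit K \<psi> y \<in> U} (g \<circ> orbit K \<psi>)"
      by (rule reg) blast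
    also have "\<dots> \<longleftrightarrow> fs_reg ?T U g"
      by (simp add: orbit_space_def)
    finally show ?thesis by simp
  qed
  have "fs_iso ?S ?T f"
    unfolding fs_iso_def homeomorphic_map_def quotient_map_def
    using im fop inj freg by blast
  then show ?thesis using f by blast
qed

section \<open>Matrices\<close>

text \<open>
  Ring laws with side conditions on dimensions rather than carriers: the simplifier can
  decide these without instantiating the sizes.
\<close>

named_theorems mat_ring

lemma mult_mat_assoc [mat_ring]:
  fixes A B C :: "'k::comm_ring_1 mat"
  assumes "dim_col A = dim_row B" "dim_col B = dim_row C"
  shows "A * B * C = A * (B * C)"
  using assms by (intro assoc_mult_mat[of _ "dim_row A" "dim_col A" _ "dim_col B" _ "dim_col C"]) (auto intro!: carrier_matI)

lemma mult_mat_add_right [mat_ring]: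
  fixes A B C :: "'k::comm_ring_1 mat"
  assumes "dim_col A = dim_row B" "dim_row B = dim_row C" "dim_col B = dim_col C"
  shows "A * (B + C) = A * B + A * C"
  using assms by (intro mult_add_distrib_mat[of _ "dim_row A" "dim_col A" _ "dim_col B"]) (auto intro!: carrier_matI)

lemma mult_mat_add_left [mat_ring]:
  fixes A B C :: "'k::comm_ring_1 mat"
  assumes "dim_col A = dim_row C" "dim_row A = dim_row B" "dim_col A = dim_col B"
  shows "(A + B) * C = A * C + B * C"
  using assms by (intro add_mult_distrib_mat[of _ "dim_row A" "dim_col A" _ _ "dim_col C"]) (auto intro!: carrier_matI)

lemma mult_mat_minus_right [mat_ring]:
  fixes A B C :: "'k::comm_ring_1 mat"
  assumes "dim_col A = dim_row B" "dim_row B = dim_row C" "dim_col B = dim_col C"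
  shows "A * (B - C) = A * B - A * C"
  using assms by (intro mult_minus_distrib_mat[of _ "dim_row A" "dim_col A" _ "dim_col B"]) (auto intro!: carrier_matI)

lemma mult_mat_minus_left [mat_ring]:
  fixes A B C :: "'k::comm_ring_1 mat"
  assumes "dim_col A = dim_row C" "dim_row A = dim_row B" "dim_col A = dim_col B"
  shows "(A - B) * C = A * C - B * C"
  using assms by (intro minus_mult_distrib_mat[of _ "dim_row A" "dim_col A" _ _ "dim_col C"]) (auto intro!: carrier_matI)

lemma mult_mat_smult_right [mat_ring]:
  fixes A B :: "'k::comm_ring_1 mat"
  assumes "dim_col A = dim_row B"
  shows "A * (c \<cdot>\<^sub>m B) = c \<cdot>\<^sub>m (A * B)"
  using assms by (intro mult_smult_distrib[of _ "dim_row A" "dim_col A" _ "dim_col B"]) (auto intro!: carrier_matI)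

lemma mult_mat_smult_left [mat_ring]:
  fixes A B :: "'k::comm_ring_1 mat"
  assumes "dim_col A = dim_row B"
  shows "(c \<cdot>\<^sub>m A) * B = c \<cdot>\<^sub>m (A * B)"
  using assms by (intro mult_smult_assoc_mat[of _ "dim_row A" "dim_col A" _ "dim_col B"]) (auto intro!: carrier_matI)

lemma mult_mat_one_left [mat_ring]:
  fixes A :: "'k::comm_ring_1 mat"
  assumes "dim_row A = n"
  shows "1\<^sub>m n * A = A"
  using assms by (intro left_mult_one_mat[of _ _ "dim_col A"]) (auto intro!: carrier_matI)

lemma mult_mat_one_right [mat_ring]:
  fixes A :: "'k::comm_ring_1 mat"
  assumes "dim_col A = n"
  shows "A * 1\<^sub>m n = A"
  using assms by (intro right_mult_one_mat[of _ "dim_row A"]) (auto intro!: carrier_matI)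

lemma mult_mat_zero_left [mat_ring]:
  fixes A :: "'k::comm_ring_1 mat"
  assumes "dim_row A = n"
  shows "0\<^sub>m m n * A = 0\<^sub>m m (dim_col A)"
  using assms by (intro left_mult_zero_mat[of _ _ "dim_col A"]) (auto intro!: carrier_matI)

lemma mult_mat_zero_right [mat_ring]:
  fixes A :: "'k::comm_ring_1 mat"
  assumes "dim_col A = n"
  shows "A * 0\<^sub>m n m = 0\<^sub>m (dim_row A) m"
  using assms by (intro right_mult_zero_mat[of _ "dim_row A"]) (auto intro!: carrier_matI)

lemma zero_add_mat [mat_ring]:
  "dim_row A = n \<Longrightarrow> dim_col A = m \<Longrightarrow> 0\<^sub>m n m + A = (A :: 'k::comm_ring_1 mat)"
  "dim_row A = n \<Longrightarrow> dim_col A = m \<Longrightarrow> A + 0\<^sub>m n m = (A :: 'k::comm_ring_1 mat)"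
  by (auto intro!: eq_matI)

lemma one_smult_mat [mat_ring]: "1 \<cdot>\<^sub>m A = (A :: 'k::comm_ring_1 mat)"
  by (auto intro!: eq_matI)

lemma smult_smult_mat: "a \<cdot>\<^sub>m (b \<cdot>\<^sub>m A) = (a * b :: complex) \<cdot>\<^sub>m A"
  by (intro eq_matI) auto

lemma mult_mat_entry:
  fixes A B :: "'k::comm_ring_1 mat"
  assumes "A \<in> carrier_mat n m" "B \<in> carrier_mat m l" "r < n" "c < l"
  shows "(A * B) $$ (r, c) = (\<Sum>a = 0..<m. A $$ (r, a) * B $$ (a, c))"
  using assms by (simp add: scalar_prod_def)

lemma mult_mat_mult_vec:
  fixes A B :: "'k::comm_ring_1 mat"
  assumes "dim_col A = dim_row B" "dim_col B = dim_vec v"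
  shows "A * B *\<^sub>v v = A *\<^sub>v (B *\<^sub>v v)"
  using assms by (intro assoc_mult_mat_vec[of _ "dim_row A" "dim_col A" _ "dim_col B"]) (auto intro!: carrier_matI carrier_vecI)

lemma mult_mat_zero_vec:
  fixes A :: "'k::comm_ring_1 mat"
  shows "dim_col A = m \<Longrightarrow> A *\<^sub>v 0\<^sub>v m = 0\<^sub>v (dim_row A)"
  by (intro eq_vecI) auto

lemma zero_mat_mult_vec: "u \<in> carrier_vec m \<Longrightarrow> 0\<^sub>m n m *\<^sub>v u = (0\<^sub>v n :: 'k::comm_ring_1 vec)"
  by (intro eq_vecI) (auto simp: scalar_prod_def)

lemma smult_one_mult_vec: "u \<in> carrier_vec n \<Longrightarrow> (c \<cdot>\<^sub>m 1\<^sub>m n) *\<^sub>v u = c \<cdot>\<^sub>v (u :: complex vec)"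
  by (intro eq_vecI) (auto simp: scalar_prod_def if_distrib[of "\<lambda>t. _ * t * _"] sum.delta cong: if_cong)

lemma mult_mat_unit_vec:
  fixes A :: "'k::comm_ring_1 mat"
  assumes "A \<in> carrier_mat n m" "c < m"
  shows "A *\<^sub>v unit_vec m c = col A c"
  using assms by (intro eq_vecI) auto

lemma mat_eq_iff_mult_vec:
  fixes A B :: "'k::comm_ring_1 mat"
  assumes A: "A \<in> carrier_mat n m" and B: "B \<in> carrier_mat n m"
    and eq: "\<And>u. u \<in> carrier_vec m \<Longrightarrow> A *\<^sub>v u = B *\<^sub>v u"
  shows "A = B"
proof (rule eq_matI)
  fix r c assume "r < dim_row B" "c < dim_col B"
  then have rc: "r < n" "c < m" using B by auto
  have "A *\<^sub>v unit_vec m c = B *\<^sub>v unit_vec m c" by (rule eq) simp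
  then have "col A c = col B c"
    using mult_mat_unit_vec[OF A rc(2)] mult_mat_unit_vec[OF B rc(2)] by simp
  then show "A $$ (r, c) = B $$ (r, c)"
    using A B rc by (metis carrier_matD index_col)
qed (use A B in auto)

section \<open>Injective matrices: extension to invertible ones, complements, dimension
  inequalities\<close>

definition inj_mat :: "complex mat \<Rightarrow> bool" where
  "inj_mat A \<longleftrightarrow> (\<forall>u\<in>carrier_vec (dim_col A). A *\<^sub>v u = 0\<^sub>v (dim_row A) \<longrightarrow> u = 0\<^sub>v (dim_col A))"

lemma inj_matD: "inj_mat A \<Longrightarrow> A \<in> carrier_mat n m \<Longrightarrow> u \<in> carrier_vec m \<Longrightarrow>
    A *\<^sub>v u = 0\<^sub>v n \<Longrightarrow> u = 0\<^sub>v m"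
  unfolding inj_mat_def by auto

lemma inj_mat_left_inverse:
  assumes A: "A \<in> carrier_mat n m" and L: "L \<in> carrier_mat m n" and 1: "L * A = 1\<^sub>m m"
  shows "inj_mat A"
  unfolding inj_mat_def
proof (intro ballI impI)
  fix u assume u: "u \<in> carrier_vec (dim_col A)" "A *\<^sub>v u = 0\<^sub>v (dim_row A)"
  have "u = L * A *\<^sub>v u" using u A unfolding 1 by simp
  also have "\<dots> = 0\<^sub>v m" using A L u by (simp add: mult_mat_mult_vec mult_mat_zero_vec)
  finally show "u = 0\<^sub>v (dim_col A)" using A by simp
qed

lemma inj_mat_right_factor_vec:
  assumes A: "A \<in> carrier_mat n m" "inj_mat A" and u: "u \<in> carrier_vec m" "v \<in> carrier_vec m"
    and eq: "A *\<^sub>v u = A *\<^sub>v v"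
  shows "u = v"
proof -
  have "A *\<^sub>v (u - v) = A *\<^sub>v u - A *\<^sub>v v"
    using A u by (simp add: mult_minus_distrib_mat_vec)
  also have "\<dots> = 0\<^sub>v n" using A u eq by simp
  finally have "u - v = 0\<^sub>v m" using inj_matD[OF A(2) A(1)] u by simp
  then show ?thesis using u
    by (metis carrier_vecD eq_vecI index_minus_vec(1) index_zero_vec(1) eq_iff_diff_eq_0)
qed

text \<open>Padding a matrix that is too wide with zero rows makes it square without changing its
  kernel; being injective it would be invertible, although it has a zero row.\<close>

lemma inj_mat_cols_le_rows:
  assumes A: "A \<in> carrier_mat n m" and inj: "inj_mat A"
  shows "m \<le> n"
proof (rule ccontr)
  assume "\<not> m \<le> n"
  then have nm: "n < m" by simp
  define A' where "A' = mat m m (\<lambda>(r, c). if r < n then A $$ (r, c) else 0)"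
  have A': "A' \<in> carrier_mat m m" by (simp add: A'_def)
  have "det A' \<noteq> 0"
    unfolding det_0_iff_vec_prod_zero[OF A']
  proof clarify
    fix w :: "complex vec" assume w: "w \<in> carrier_vec m" "w \<noteq> 0\<^sub>v m" "A' *\<^sub>v w = 0\<^sub>v m"
    have "A *\<^sub>v w = 0\<^sub>v n"
    proof (rule eq_vecI)
      fix r assume "r < dim_vec (0\<^sub>v n :: complex vec)"
      then have r: "r < n" by simp
      have "(A *\<^sub>v w) $ r = (A' *\<^sub>v w) $ r"
        using r nm A w(1) by (simp add: A'_def scalar_prod_def)
      then show "(A *\<^sub>v w) $ r = 0\<^sub>v n $ r" using w(3) r nm by simp
    qed (use A in simp)
    then show False using inj_matD[OF inj A w(1)] w(2) by blast
  qed
  then have "A' \<in> Units (ring_mat TYPE(complex) m ())"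
    by (rule det_non_zero_imp_unit[OF A'])
  then obtain B where B: "B \<in> carrier_mat m m" "A' * B = 1\<^sub>m m"
    unfolding Units_def ring_mat_simps by blast
  \<comment> \<open>Row \<open>n\<close> is the first padding row, so every product with
    \<open>A'\<close> on the left vanishes there.\<close>
  have "(A' * B) $$ (n, n) = 0"
    using nm B(1) by (simp add: A'_def scalar_prod_def)
  then show False using B(2) nm by simp
qed

definition append_col :: "complex mat \<Rightarrow> complex vec \<Rightarrow> complex mat" where
  "append_col A w = mat (dim_row A) (Suc (dim_col A)) (\<lambda>(r, c). if c < dim_col A then A $$ (r, c) else w $ r)"

lemma append_col_mult_vec:
  assumes "A \<in> carrier_mat n m" "w \<in> carrier_vec n" "u \<in> carrier_vec (Suc m)"
  shows "append_col A w *\<^sub>v u = A *\<^sub>v vec m (\<lambda>r. u $ r) + u $ m \<cdot>\<^sub>v w"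
  using assms by (intro eq_vecI) (auto simp: append_col_def scalar_prod_def)

text \<open>In a kernel vector, a nonzero coefficient of the new column would express
  \<open>w\<close> through the columns of \<open>A\<close>.\<close>

lemma inj_mat_append_col:
  assumes A: "A \<in> carrier_mat n m" and inj: "inj_mat A" and w: "w \<in> carrier_vec n"
    and nin: "\<And>u. u \<in> carrier_vec m \<Longrightarrow> A *\<^sub>v u \<noteq> w"
  shows "inj_mat (append_col A w)"
  unfolding inj_mat_def
proof (intro ballI impI)
  have A': "append_col A w \<in> carrier_mat n (Suc m)" using A by (simp add: append_col_def)
  fix u assume "u \<in> carrier_vec (dim_col (append_col A w))"
    "append_col A w *\<^sub>v u = 0\<^sub>v (dim_row (append_col A w))"
  then have u: "u \<in> carrier_vec (Suc m)" "append_col A w *\<^sub>v u = 0\<^sub>v n" using A' by auto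
  define u' where "u' = vec m (\<lambda>r. u $ r)"
  have u': "u' \<in> carrier_vec m" by (simp add: u'_def)
  have eq: "(A *\<^sub>v u') $ r + u $ m * w $ r = 0" if "r < n" for r
  proof -
    have "(append_col A w *\<^sub>v u) $ r = (A *\<^sub>v u') $ r + u $ m * w $ r"
      unfolding append_col_mult_vec[OF A w u(1)] u'_def using that A w by simp
    then show ?thesis using u(2) that by simp
  qed
  have um: "u $ m = 0"
  proof (rule ccontr)
    assume um: "u $ m \<noteq> 0"
    have "A *\<^sub>v ((- inverse (u $ m)) \<cdot>\<^sub>v u') = w"
    proof (rule eq_vecI)
      fix r assume "r < dim_vec w"
      then have r: "r < n" using w by simp
      have "(A *\<^sub>v ((- inverse (u $ m)) \<cdot>\<^sub>v u')) $ r = - inverse (u $ m) * (A *\<^sub>v u') $ r"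
        using r A u' by (simp add: mult_mat_vec)
      also have "(A *\<^sub>v u') $ r = - (u $ m * w $ r)" using eq[OF r] by (simp add: eq_neg_iff_add_eq_0)
      finally show "(A *\<^sub>v ((- inverse (u $ m)) \<cdot>\<^sub>v u')) $ r = w $ r"
        using um by (simp add: field_simps)
    qed (use w A in simp)
    then show False using nin u' by simp
  qed
  then have "A *\<^sub>v u' = 0\<^sub>v n" using eq A by (intro eq_vecI) auto
  then have "u' = 0\<^sub>v m" using inj_matD[OF inj A u'] by simp
  then have "u $ r = 0" if "r < m" for r
    using that unfolding u'_def by (metis index_vec index_zero_vec(1))
  then show "u = 0\<^sub>v (dim_col (append_col A w))"
    using u um A' by (intro eq_vecI) (auto simp: less_Suc_eq)
qed

text \<open>Columns are added one at a time. While there are fewer columns than rows, some vector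
  lies outside the range: otherwise preimages of the unit vectors form a right inverse, which is
  injective and has more columns than rows.\<close>

lemma inj_mat_extend_square:
  assumes "A \<in> carrier_mat n m" and "inj_mat A"
  shows "\<exists>M\<in>carrier_mat n n. det M \<noteq> 0 \<and> (\<forall>r<n. \<forall>c<m. M $$ (r, c) = A $$ (r, c))"
  using assms
proof (induction "n - m" arbitrary: A m)
  case 0
  then have "m = n" using inj_mat_cols_le_rows[of A n m] by simp
  with 0 have A: "A \<in> carrier_mat n n" by simp
  then have "det A \<noteq> 0"
    unfolding det_0_iff_vec_prod_zero[OF A] using inj_matD[OF 0(3) A] by blast
  then show ?case using A \<open>m = n\<close> by blast
next
  case (Suc k)
  have "\<exists>w\<in>carrier_vec n. \<forall>u\<in>carrier_vec m. A *\<^sub>v u \<noteq> w"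
  proof (rule ccontr)
    assume "\<not> ?thesis"
    then have "\<forall>w\<in>carrier_vec n. \<exists>u\<in>carrier_vec m. A *\<^sub>v u = w" by blast
    then obtain f where f: "\<And>w. w \<in> carrier_vec n \<Longrightarrow> f w \<in> carrier_vec m \<and> A *\<^sub>v f w = w" by metis
    define B where "B = mat m n (\<lambda>(r, c). f (unit_vec n c) $ r)"
    have B: "B \<in> carrier_mat m n" by (simp add: B_def)
    have colB: "col B c = f (unit_vec n c)" if "c < n" for c
      using that f[of "unit_vec n c"] by (intro eq_vecI) (auto simp: B_def)
    have "A * B = 1\<^sub>m n"
    proof (rule eq_matI)
      fix r c assume "r < dim_row (1\<^sub>m n :: complex mat)" "c < dim_col (1\<^sub>m n :: complex mat)"
      then have rc: "r < n" "c < n" by auto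
      have "(A * B) $$ (r, c) = (A *\<^sub>v f (unit_vec n c)) $ r"
        using rc Suc.prems(1) B colB[OF rc(2)] by simp
      then show "(A * B) $$ (r, c) = (1\<^sub>m n :: complex mat) $$ (r, c)"
        using f[of "unit_vec n c"] rc by (simp add: unit_vec_def)
    qed (use Suc.prems(1) B in auto)
    then have "inj_mat B" using inj_mat_left_inverse[OF B Suc.prems(1)] by simp
    then show False using inj_mat_cols_le_rows[OF B] Suc.hyps(2) by simp
  qed
  then obtain w where w: "w \<in> carrier_vec n" "\<And>u. u \<in> carrier_vec m \<Longrightarrow> A *\<^sub>v u \<noteq> w" by blast
  have A': "append_col A w \<in> carrier_mat n (Suc m)"
    using Suc.prems(1) by (simp add: append_col_def)
  have "inj_mat (append_col A w)"
    by (rule inj_mat_append_col[OF Suc.prems w])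
  moreover have "k = n - Suc m" using Suc.hyps(2) by simp
  ultimately obtain M where M: "M \<in> carrier_mat n n" "det M \<noteq> 0"
    "\<forall>r<n. \<forall>c<Suc m. M $$ (r, c) = append_col A w $$ (r, c)"
    using Suc.hyps(1)[of "Suc m" "append_col A w"] A' by blast
  have "\<forall>r<n. \<forall>c<m. M $$ (r, c) = A $$ (r, c)" using M(3) Suc.prems(1) by (simp add: append_col_def)
  then show ?case using M by blast
qed

text \<open>For an invertible square \<open>M\<close> whose first \<open>m\<close> columns are
  \<open>A\<close>, take \<open>R\<close> to be the other columns of \<open>M\<close>, and
  \<open>L\<close> and \<open>T\<close> the first \<open>m\<close> and the last \<open>k\<close>
  rows of its inverse. The five identities are the block forms of the two equations for an
  inverse.\<close>

lemma inj_mat_complement: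
  assumes A: "A \<in> carrier_mat n m" and inj: "inj_mat A" and n: "n = m + k"
  shows "\<exists>R\<in>carrier_mat n k. \<exists>L\<in>carrier_mat m n. \<exists>T\<in>carrier_mat k n.
    L * A = 1\<^sub>m m \<and> T * R = 1\<^sub>m k \<and> T * A = 0\<^sub>m k m \<and> L * R = 0\<^sub>m m k \<and> A * L + R * T = 1\<^sub>m n"
proof -
  obtain M where M: "M \<in> carrier_mat n n" "det M \<noteq> 0" "\<forall>r<n. \<forall>c<m. M $$ (r, c) = A $$ (r, c)"
    using inj_mat_extend_square[OF A inj] by blast
  obtain W where W: "W \<in> carrier_mat n n" "W * M = 1\<^sub>m n" "M * W = 1\<^sub>m n"
    using det_non_zero_imp_unit[OF M(1,2), of "()"] unfolding Units_def ring_mat_simps by blast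
  define R where "R = mat n k (\<lambda>(r, c). M $$ (r, m + c))"
  define L where "L = mat m n (\<lambda>(r, c). W $$ (r, c))"
  define T where "T = mat k n (\<lambda>(r, c). W $$ (m + r, c))"
  have WM: "(\<Sum>l = 0..<n. W $$ (r, l) * M $$ (l, c)) = (if r = c then 1 else 0)" if "r < n" "c < n" for r c
  proof -
    have "(\<Sum>l = 0..<n. W $$ (r, l) * M $$ (l, c)) = (W * M) $$ (r, c)"
      using that W(1) M(1) by (simp add: scalar_prod_def)
    then show ?thesis using W(2) that by simp
  qed
  have MW: "(\<Sum>l = 0..<n. M $$ (r, l) * W $$ (l, c)) = (if r = c then 1 else 0)" if "r < n" "c < n" for r c
  proof -
    have "(\<Sum>l = 0..<n. M $$ (r, l) * W $$ (l, c)) = (M * W) $$ (r, c)"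
      using that W(1) M(1) by (simp add: scalar_prod_def)
    then show ?thesis using W(3) that by simp
  qed
  have Ac: "A $$ (r, c) = M $$ (r, c)" if "r < n" "c < m" for r c using M(3) that by simp
  have split: "(\<Sum>l = 0..<n. f l) = (\<Sum>l = 0..<m. f l) + (\<Sum>l = 0..<k. f (m + l))" for f :: "nat \<Rightarrow> complex"
  proof -
    have "(\<Sum>l = 0..<n. f l) = (\<Sum>l = 0..<m. f l) + (\<Sum>l = m..<n. f l)"
      by (rule sum.atLeastLessThan_concat[symmetric]) (use n in auto)
    also have "(\<Sum>l = m..<n. f l) = (\<Sum>l = 0..<k. f (m + l))"
      using sum.shift_bounds_nat_ivl[of f 0 m k] n by (simp add: add.commute)
    finally show ?thesis .
  qed
  have lt: "c < n" if "c < m" for c using that n by simp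
  have lt': "m + c < n" if "c < k" for c using that n by simp
  have "L * A = 1\<^sub>m m"
    by (rule eq_matI) (use A in \<open>auto simp: L_def scalar_prod_def Ac WM lt\<close>)
  moreover have "T * R = 1\<^sub>m k"
    by (rule eq_matI) (auto simp: T_def R_def scalar_prod_def WM lt')
  moreover have "T * A = 0\<^sub>m k m"
    by (rule eq_matI) (use A lt' in \<open>auto simp: T_def scalar_prod_def Ac WM lt\<close>)
  moreover have "L * R = 0\<^sub>m m k"
    by (rule eq_matI) (auto simp: L_def R_def scalar_prod_def WM lt lt')
  moreover have "A * L + R * T = 1\<^sub>m n"
  proof (rule eq_matI)
    fix r c assume "r < dim_row (1\<^sub>m n :: complex mat)" "c < dim_col (1\<^sub>m n :: complex mat)"
    then have rc: "r < n" "c < n" by auto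
    have "(A * L + R * T) $$ (r, c) =
        (\<Sum>l = 0..<m. M $$ (r, l) * W $$ (l, c)) + (\<Sum>l = 0..<k. M $$ (r, m + l) * W $$ (m + l, c))"
      using rc A by (simp add: L_def R_def T_def scalar_prod_def Ac)
    also have "\<dots> = (if r = c then 1 else 0)"
      using MW[OF rc] split[of "\<lambda>l. M $$ (r, l) * W $$ (l, c)"] by simp
    finally show "(A * L + R * T) $$ (r, c) = (1\<^sub>m n :: complex mat) $$ (r, c)" using rc by simp
  qed (use A in \<open>auto simp: R_def T_def\<close>)
  ultimately show ?thesis
    by (intro bexI[of _ R] bexI[of _ L] bexI[of _ T]) (auto simp: R_def L_def T_def)
qed

lemma inj_mat_transpose:
  assumes A: "A \<in> carrier_mat n m" and B: "B \<in> carrier_mat m n" and 1: "A * B = 1\<^sub>m n"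
  shows "inj_mat (transpose_mat A)"
proof (rule inj_mat_left_inverse)
  show "transpose_mat B * transpose_mat A = 1\<^sub>m n"
    using transpose_mult[OF A B] 1 by simp
qed (use A B in auto)

text \<open>The transpose of \<open>inj_mat_complement\<close>: a right inverse of \<open>T\<close>
  is a left inverse of its transpose.\<close>

lemma right_invertible_complement:
  fixes T \<rho> :: "complex mat"
  assumes T: "T \<in> carrier_mat m n" and \<rho>: "\<rho> \<in> carrier_mat n m" "T * \<rho> = 1\<^sub>m m" and n: "n = m + k"
  shows "\<exists>R\<in>carrier_mat n m. \<exists>L\<in>carrier_mat k n. \<exists>S\<in>carrier_mat n k.
    T * R = 1\<^sub>m m \<and> L * S = 1\<^sub>m k \<and> T * S = 0\<^sub>m m k \<and> L * R = 0\<^sub>m k m \<and> S * L + R * T = 1\<^sub>m n"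
proof -
  have T': "transpose_mat T \<in> carrier_mat n m" using T by simp
  from inj_mat_complement[OF T' inj_mat_transpose[OF T \<rho>] n]
  obtain R L S where R: "R \<in> carrier_mat n k" and L: "L \<in> carrier_mat m n" and S: "S \<in> carrier_mat k n"
    and eq: "L * transpose_mat T = 1\<^sub>m m" "S * R = 1\<^sub>m k" "S * transpose_mat T = 0\<^sub>m k m"
    "L * R = 0\<^sub>m m k" "transpose_mat T * L + R * S = 1\<^sub>m n"
    by blast
  have "T * transpose_mat L = 1\<^sub>m m"
    using transpose_mult[OF L T'] eq(1) by simp
  moreover have "transpose_mat R * transpose_mat S = 1\<^sub>m k"
    using transpose_mult[OF S R] eq(2) by simp
  moreover have "T * transpose_mat S = 0\<^sub>m m k"
    using transpose_mult[OF S T'] eq(3) by (simp add: zero_transpose_mat)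
  moreover have "transpose_mat R * transpose_mat L = 0\<^sub>m k m"
    using transpose_mult[OF L R] eq(4) by (simp add: zero_transpose_mat)
  moreover have "transpose_mat S * transpose_mat R + transpose_mat L * T = 1\<^sub>m n"
  proof -
    have "transpose_mat (transpose_mat T * L + R * S) =
        transpose_mat L * transpose_mat (transpose_mat T) + transpose_mat S * transpose_mat R"
      using transpose_mult[OF T' L] transpose_mult[OF R S] T' L R S
      by (simp add: transpose_add[of _ n n])
    then show ?thesis
      using eq(5) T L R S by (simp add: comm_add_mat[of "transpose_mat S * transpose_mat R" n n])
  qed
  ultimately show ?thesis
    using R L S by (intro bexI[of _ "transpose_mat L"] bexI[of _ "transpose_mat R"] bexI[of _ "transpose_mat S"]) auto
qed

text \<open>The columns of \<open>A\<close> are its values on unit vectors and are lifted through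
  \<open>B\<close> one by one. This is how an inclusion of ranges becomes a matrix identity.\<close>

lemma range_subset_factor:
  fixes A B :: "complex mat"
  assumes A: "A \<in> carrier_mat n a" and B: "B \<in> carrier_mat n b"
    and sub: "\<And>u. u \<in> carrier_vec a \<Longrightarrow> A *\<^sub>v u \<in> (\<lambda>u. B *\<^sub>v u) ` carrier_vec b"
  shows "\<exists>Y\<in>carrier_mat b a. A = B * Y"
proof -
  have "\<forall>c<a. \<exists>y\<in>carrier_vec b. col A c = B *\<^sub>v y"
    using sub[of "unit_vec a _"] mult_mat_unit_vec[OF A] by (metis imageE unit_vec_carrier)
  then obtain y where y: "\<And>c. c < a \<Longrightarrow> y c \<in> carrier_vec b \<and> col A c = B *\<^sub>v y c" by metis
  define Y where "Y = mat b a (\<lambda>(r, c). y c $ r)"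
  have Y: "Y \<in> carrier_mat b a" by (simp add: Y_def)
  have colY: "col Y c = y c" if "c < a" for c
    using y[OF that] that by (intro eq_vecI) (auto simp: Y_def)
  have "A = B * Y"
  proof (rule eq_matI)
    fix r c assume "r < dim_row (B * Y)" "c < dim_col (B * Y)"
    then have rc: "r < n" "c < a" using B Y by auto
    have "col A c $ r = (B *\<^sub>v col Y c) $ r" using y[OF rc(2)] colY[OF rc(2)] by simp
    then show "A $$ (r, c) = (B * Y) $$ (r, c)" using rc A B Y by simp
  qed (use A B Y in auto)
  then show ?thesis using Y by blast
qed

text \<open>The hypothesis says that the matrix with \<open>Y\<close> and \<open>Z\<close> side by
  side is injective.\<close>

lemma independent_ranges_dim_le:
  fixes Y Z :: "complex mat"
  assumes Y: "Y \<in> carrier_mat k a" and Z: "Z \<in> carrier_mat k b"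
    and inj: "\<And>u w. u \<in> carrier_vec a \<Longrightarrow> w \<in> carrier_vec b \<Longrightarrow> Y *\<^sub>v u + Z *\<^sub>v w = 0\<^sub>v k \<Longrightarrow>
      u = 0\<^sub>v a \<and> w = 0\<^sub>v b"
  shows "a + b \<le> k"
proof -
  define M where "M = mat k (a + b) (\<lambda>(r, c). if c < a then Y $$ (r, c) else Z $$ (r, c - a))"
  have M: "M \<in> carrier_mat k (a + b)" by (simp add: M_def)
  have split: "(\<Sum>l = 0..<a + b. f l) = (\<Sum>l = 0..<a. f l) + (\<Sum>l = 0..<b. f (a + l))" for f :: "nat \<Rightarrow> complex"
  proof -
    have "(\<Sum>l = 0..<a + b. f l) = (\<Sum>l = 0..<a. f l) + (\<Sum>l = a..<a + b. f l)"
      by (rule sum.atLeastLessThan_concat[symmetric]) auto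
    also have "(\<Sum>l = a..<a + b. f l) = (\<Sum>l = 0..<b. f (a + l))"
      using sum.shift_bounds_nat_ivl[of f 0 a b] by (simp add: add.commute)
    finally show ?thesis .
  qed
  have "inj_mat M"
    unfolding inj_mat_def
  proof (intro ballI impI)
    fix u assume "u \<in> carrier_vec (dim_col M)" "M *\<^sub>v u = 0\<^sub>v (dim_row M)"
    then have u: "u \<in> carrier_vec (a + b)" "M *\<^sub>v u = 0\<^sub>v k" using M by auto
    define y z where "y = vec a (\<lambda>l. u $ l)" and "z = vec b (\<lambda>l. u $ (a + l))"
    have "M *\<^sub>v u = Y *\<^sub>v y + Z *\<^sub>v z"
      using u(1) Y Z by (intro eq_vecI) (auto simp: M_def y_def z_def scalar_prod_def split)
    then have "y = 0\<^sub>v a \<and> z = 0\<^sub>v b" using inj[of y z] u(2) by (simp add: y_def z_def)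
    then have y0: "u $ l = 0" if "l < a" for l
      using that unfolding y_def by (metis index_vec index_zero_vec(1))
    have z0: "u $ (a + l) = 0" if "l < b" for l
      using \<open>y = 0\<^sub>v a \<and> z = 0\<^sub>v b\<close> that unfolding z_def by (metis index_vec index_zero_vec(1))
    show "u = 0\<^sub>v (dim_col M)"
    proof (rule eq_vecI)
      fix l assume "l < dim_vec (0\<^sub>v (dim_col M) :: complex vec)"
      then have "l < a + b" using M by simp
      then show "u $ l = 0\<^sub>v (dim_col M) $ l"
        using y0[of l] z0[of "l - a"] M by (cases "l < a") auto
    qed (use u M in simp)
  qed
  then show ?thesis using inj_mat_cols_le_rows[OF M] by simp
qed

text \<open>The hypothesis says that \<open>Y\<close> stacked on \<open>Z\<close> is
  injective.\<close>

lemma joint_injective_dim_le: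
  fixes Y Z :: "complex mat"
  assumes Y: "Y \<in> carrier_mat a k" and Z: "Z \<in> carrier_mat b k"
    and inj: "\<And>u. u \<in> carrier_vec k \<Longrightarrow> Y *\<^sub>v u = 0\<^sub>v a \<Longrightarrow> Z *\<^sub>v u = 0\<^sub>v b \<Longrightarrow> u = 0\<^sub>v k"
  shows "k \<le> a + b"
proof -
  have M: "Y @\<^sub>r Z \<in> carrier_mat (a + b) k" using Y Z by simp
  have "inj_mat (Y @\<^sub>r Z)"
    unfolding inj_mat_def
  proof (intro ballI impI)
    fix u assume "u \<in> carrier_vec (dim_col (Y @\<^sub>r Z))" "(Y @\<^sub>r Z) *\<^sub>v u = 0\<^sub>v (dim_row (Y @\<^sub>r Z))"
    then have u: "u \<in> carrier_vec k" "(Y @\<^sub>r Z) *\<^sub>v u = 0\<^sub>v (a + b)" using M by auto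
    have e: "(Y *\<^sub>v u) @\<^sub>v (Z *\<^sub>v u) = 0\<^sub>v (a + b)" using mat_mult_append[OF Y Z u(1)] u(2) by simp
    have "Y *\<^sub>v u = 0\<^sub>v a"
    proof (rule eq_vecI)
      fix r assume "r < dim_vec (0\<^sub>v a :: complex vec)"
      then show "(Y *\<^sub>v u) $ r = 0\<^sub>v a $ r"
        using arg_cong[OF e, of "\<lambda>w. w $ r"] Y Z by (simp del: index_mult_mat_vec)
    qed (use Y in simp)
    moreover have "Z *\<^sub>v u = 0\<^sub>v b"
    proof (rule eq_vecI)
      fix r assume "r < dim_vec (0\<^sub>v b :: complex vec)"
      then show "(Z *\<^sub>v u) $ r = 0\<^sub>v b $ r"
        using arg_cong[OF e, of "\<lambda>w. w $ (a + r)"] Y Z by (simp del: index_mult_mat_vec)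
    qed (use Z in simp)
    ultimately show "u = 0\<^sub>v (dim_col (Y @\<^sub>r Z))" using inj[OF u(1)] M by simp
  qed
  then show ?thesis using inj_mat_cols_le_rows[OF M] by simp
qed

subsection \<open>Inverses and general linear groups\<close>

text \<open>Cramer's formula is used beside the group inverse because its entries are visibly
  polynomials divided by the determinant, hence regular functions where the determinant does not
  vanish.\<close>

definition mat_inv :: "complex mat \<Rightarrow> complex mat" where
  "mat_inv A = inverse (det A) \<cdot>\<^sub>m adj_mat A"

lemma mat_inv:
  assumes A: "A \<in> carrier_mat n n" and d: "det A \<noteq> 0"
  shows "mat_inv A \<in> carrier_mat n n" "A * mat_inv A = 1\<^sub>m n" "mat_inv A * A = 1\<^sub>m n"
proof -
  note adj = adj_mat[OF A]
  show "mat_inv A \<in> carrier_mat n n" using adj(1) by (simp add: mat_inv_def)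
  have "A * mat_inv A = inverse (det A) \<cdot>\<^sub>m (A * adj_mat A)"
    using A adj(1) by (simp add: mat_inv_def mult_mat_smult_right)
  then show "A * mat_inv A = 1\<^sub>m n"
    using d by (simp add: adj(2)) (auto intro!: eq_matI)
  have "mat_inv A * A = inverse (det A) \<cdot>\<^sub>m (adj_mat A * A)"
    using A adj(1) by (simp add: mat_inv_def mult_mat_smult_left)
  then show "mat_inv A * A = 1\<^sub>m n"
    using d by (simp add: adj(3)) (auto intro!: eq_matI)
qed

lemma det_nonzero_inverse:
  fixes A B :: "complex mat"
  assumes "A \<in> carrier_mat n n" "B \<in> carrier_mat n n" "A * B = 1\<^sub>m n"
  shows "det A \<noteq> 0"
  using det_mult[OF assms(1,2)] assms(3) by auto

lemma GL_carrier: "A \<in> carrier (GL n) \<longleftrightarrow> A \<in> carrier_mat n n \<and> det A \<noteq> 0"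
proof
  assume "A \<in> carrier (GL n)"
  then have U: "A \<in> Units (ring_mat TYPE(complex) n ())" by (simp add: GL_def units_of_def)
  then show "A \<in> carrier_mat n n \<and> det A \<noteq> 0"
    using unit_imp_det_non_zero[OF U] by (auto simp: Units_def ring_mat_simps)
next
  assume "A \<in> carrier_mat n n \<and> det A \<noteq> 0"
  then show "A \<in> carrier (GL n)"
    using det_non_zero_imp_unit[of A n "()"] by (simp add: GL_def units_of_def)
qed

lemma GL_mult [simp]: "mult (GL n) = (*)" and GL_one [simp]: "one (GL n) = 1\<^sub>m n"
  by (simp_all add: GL_def units_of_def ring_mat_simps)

lemma GL_group: "group (GL n)"
proof -
  interpret ring "ring_mat TYPE(complex) n ()" by (rule ring_mat)
  show ?thesis unfolding GL_def by (rule units_group)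
qed

lemma GL_inv:
  assumes A: "A \<in> carrier (GL n)"
  shows "inv\<^bsub>GL n\<^esub> A \<in> carrier_mat n n" "A * inv\<^bsub>GL n\<^esub> A = 1\<^sub>m n" "inv\<^bsub>GL n\<^esub> A * A = 1\<^sub>m n"
    "inv\<^bsub>GL n\<^esub> A \<in> carrier (GL n)"
proof -
  interpret group "GL n" by (rule GL_group)
  show inv: "inv\<^bsub>GL n\<^esub> A \<in> carrier (GL n)" using A by simp
  then show "inv\<^bsub>GL n\<^esub> A \<in> carrier_mat n n" unfolding GL_carrier by blast
  show "A * inv\<^bsub>GL n\<^esub> A = 1\<^sub>m n" "inv\<^bsub>GL n\<^esub> A * A = 1\<^sub>m n"
    using r_inv[OF A] l_inv[OF A] by simp_all
qed

lemma GL_inv_eq: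
  assumes "A \<in> carrier_mat n n" "B \<in> carrier_mat n n" "A * B = 1\<^sub>m n"
  shows "inv\<^bsub>GL n\<^esub> A = B"
proof -
  interpret group "GL n" by (rule GL_group)
  have A: "A \<in> carrier (GL n)"
    using assms det_nonzero_inverse unfolding GL_carrier by blast
  have BA: "B * A = 1\<^sub>m n" by (rule mat_mult_left_right_inverse[OF assms])
  then have B: "B \<in> carrier (GL n)"
    using assms det_nonzero_inverse unfolding GL_carrier by blast
  show ?thesis using inv_equality[of B A] A B BA by simp
qed

lemma GL_pow_one:
  assumes "A \<in> carrier_mat n n"
  shows "A [^]\<^bsub>GL n\<^esub> (1::int) = A"
  using assms by (simp add: int_pow_def2 nat_pow_def)

lemma GL_pow_minus_one:
  assumes A: "A \<in> carrier_mat n n"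
  shows "A [^]\<^bsub>GL n\<^esub> (-1::int) = inv\<^bsub>GL n\<^esub> A"
  using assms by (simp add: int_pow_def2 nat_pow_def)

text \<open>If C is the inverse of 1 + AB, then 1 - BCA is an inverse of 1 + BA. This exchanges the
  condition at an arrow with the one at its reverse.\<close>

lemma det_one_plus_commute:
  fixes A B :: "complex mat"
  assumes A: "A \<in> carrier_mat n m" and B: "B \<in> carrier_mat m n" and d: "det (1\<^sub>m n + A * B) \<noteq> 0"
  shows "det (1\<^sub>m m + B * A) \<noteq> 0"
proof -
  have AB: "1\<^sub>m n + A * B \<in> carrier_mat n n" using A B by simp
  define C where "C = mat_inv (1\<^sub>m n + A * B)"
  note C = mat_inv[OF AB d, folded C_def]
  have "C + A * (B * C) = 1\<^sub>m n"
    using C(2) A B C(1) by (simp add: mat_ring)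
  then have "B * A = B * ((C + A * (B * C)) * A)" using A by (simp add: mult_mat_one_left)
  also have "\<dots> = B * (C * A) + B * (A * (B * (C * A)))"
    using A B C(1) by (simp add: mat_ring)
  finally have eq: "B * A = B * (C * A) + B * (A * (B * (C * A)))" .
  have "(1\<^sub>m m + B * A) * (1\<^sub>m m - B * C * A) = 1\<^sub>m m"
  proof -
    have "(1\<^sub>m m + B * A) * (1\<^sub>m m - B * C * A) =
        1\<^sub>m m - B * (C * A) + (B * A - B * (A * (B * (C * A))))"
      using A B C(1) by (simp add: mat_ring) (auto intro!: eq_matI simp del: index_mult_mat(1))
    also have "\<dots> = 1\<^sub>m m"
      unfolding eq using A B C(1) by (intro eq_matI) (auto simp del: index_mult_mat(1))
    finally show ?thesis .
  qed
  then show ?thesis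
    using A B C(1) by (intro det_nonzero_inverse[of _ m "1\<^sub>m m - B * C * A"]) auto
qed

lemma det_smult_nonzero: "(s::complex) \<noteq> 0 \<Longrightarrow> det (s \<cdot>\<^sub>m A) \<noteq> 0 \<longleftrightarrow> det A \<noteq> 0"
  by simp

lemma GL_inv_smult:
  assumes A: "A \<in> carrier_mat n n" "det A \<noteq> 0" and s: "s \<noteq> 0"
  shows "inv\<^bsub>GL n\<^esub> (s \<cdot>\<^sub>m A) = inverse s \<cdot>\<^sub>m inv\<^bsub>GL n\<^esub> A"
proof (rule GL_inv_eq)
  have G: "A \<in> carrier (GL n)" using A by (simp add: GL_carrier)
  note I = GL_inv[OF G]
  show "s \<cdot>\<^sub>m A \<in> carrier_mat n n" "inverse s \<cdot>\<^sub>m inv\<^bsub>GL n\<^esub> A \<in> carrier_mat n n" using A I by auto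
  have "s \<cdot>\<^sub>m A * (inverse s \<cdot>\<^sub>m inv\<^bsub>GL n\<^esub> A) = s \<cdot>\<^sub>m (inverse s \<cdot>\<^sub>m (A * inv\<^bsub>GL n\<^esub> A))"
    using A(1) I(1) by (simp add: mat_ring smult_smult_mat mult.commute)
  then show "s \<cdot>\<^sub>m A * (inverse s \<cdot>\<^sub>m inv\<^bsub>GL n\<^esub> A) = 1\<^sub>m n"
    using I(2) s by (simp add: smult_smult_mat) (auto intro!: eq_matI)
qed

subsection \<open>Subspaces\<close>

lemma lin_subspace_iff:
  "lin_subspace n W \<longleftrightarrow> W \<subseteq> carrier_vec n \<and> 0\<^sub>v n \<in> W \<and>
     (\<forall>u\<in>W. \<forall>w\<in>W. u + w \<in> W) \<and> (\<forall>c. \<forall>u\<in>W. c \<cdot>\<^sub>v u \<in> W)"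
  unfolding lin_subspace_def VectorSpace.subspace_def LinearCombinations.submodule_def
  using vec_vs[where 'a = complex and n = n] vec_module[where 'a = complex and n = n]
  by (auto simp: module_vec_simps)

lemma lin_subspace_zero: "lin_subspace n {0\<^sub>v n}"
  unfolding lin_subspace_iff by auto

lemma lin_subspace_carrier: "lin_subspace n (carrier_vec n)"
  unfolding lin_subspace_iff by auto

lemma lin_subspace_image:
  assumes A: "A \<in> carrier_mat n m" and W: "lin_subspace m W"
  shows "lin_subspace n ((\<lambda>u. A *\<^sub>v u) ` W)"
  unfolding lin_subspace_iff
proof (intro conjI ballI allI)
  have Wc: "W \<subseteq> carrier_vec m" using W unfolding lin_subspace_iff by blast
  show "(\<lambda>u. A *\<^sub>v u) ` W \<subseteq> carrier_vec n" using A Wc by auto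
  have "0\<^sub>v n = A *\<^sub>v 0\<^sub>v m" using A by (simp add: mult_mat_zero_vec)
  then show "0\<^sub>v n \<in> (\<lambda>u. A *\<^sub>v u) ` W" using W unfolding lin_subspace_iff by blast
next
  fix u w assume "u \<in> (\<lambda>u. A *\<^sub>v u) ` W" "w \<in> (\<lambda>u. A *\<^sub>v u) ` W"
  then obtain f g where fg: "f \<in> W" "g \<in> W" "u = A *\<^sub>v f" "w = A *\<^sub>v g" by blast
  then have "u + w = A *\<^sub>v (f + g)"
    using W by (auto simp: lin_subspace_iff intro!: mult_add_distrib_mat_vec[OF A, symmetric])
  then show "u + w \<in> (\<lambda>u. A *\<^sub>v u) ` W" using fg W unfolding lin_subspace_iff by blast
next
  fix c u assume "u \<in> (\<lambda>u. A *\<^sub>v u) ` W"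
  then obtain f where f: "f \<in> W" "u = A *\<^sub>v f" by blast
  then have "c \<cdot>\<^sub>v u = A *\<^sub>v (c \<cdot>\<^sub>v f)"
    using W by (auto simp: lin_subspace_iff intro!: mult_mat_vec[OF A, symmetric])
  then show "c \<cdot>\<^sub>v u \<in> (\<lambda>u. A *\<^sub>v u) ` W" using f W unfolding lin_subspace_iff by blast
qed

lemma lin_subspace_preimage:
  assumes A: "A \<in> carrier_mat n m" and W: "lin_subspace n W"
  shows "lin_subspace m {u \<in> carrier_vec m. A *\<^sub>v u \<in> W}"
  using A W unfolding lin_subspace_iff
  by (auto simp: mult_mat_zero_vec mult_add_distrib_mat_vec[OF A] mult_mat_vec[OF A])

text \<open>An injective matrix is a linear isomorphism onto its range. With this, dimensions of
  subspaces are compared by counting columns of injective matrices.\<close>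

lemma subspace_dim_range:
  assumes A: "A \<in> carrier_mat n k" and inj: "inj_mat A" and W: "W = (\<lambda>u. A *\<^sub>v u) ` carrier_vec k"
    and sub: "lin_subspace n W"
  shows "subspace_dim n W = k"
proof -
  interpret V: vec_space "TYPE(complex)" n .
  interpret U: vec_space "TYPE(complex)" k .
  let ?W = "module_vec TYPE(complex) n\<lparr>carrier := W\<rparr>"
  have vW: "vectorspace class_ring ?W"
    using V.subspace_is_vs sub unfolding lin_subspace_def by blast
  have "linear_map class_ring U.V ?W (\<lambda>u. A *\<^sub>v u)"
    unfolding linear_map_def mod_hom_def mod_hom_axioms_def module_hom_def
    using vW U.vectorspace_axioms A W
    by (auto simp: vectorspace_def module_vec_simps mult_add_distrib_mat_vec mult_mat_vec)
  then interpret L: linear_map class_ring U.V ?W "\<lambda>u. A *\<^sub>v u" .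
  have "U.dim = L.W.dim"
  proof (rule L.dim_eq)
    show "inj_on (\<lambda>u. A *\<^sub>v u) (carrier U.V)"
      using inj_mat_right_factor_vec[OF A inj] by (auto simp: inj_on_def)
    show "(\<lambda>u. A *\<^sub>v u) ` carrier U.V = carrier ?W" using W by simp
  qed simp
  then show ?thesis unfolding subspace_dim_def using U.dim_is_n by simp
qed

text \<open>Take an injective matrix with range in \<open>W\<close> and as many columns as possible;
  the number is bounded by \<open>n\<close>. A vector of \<open>W\<close> outside the range could be
  appended as a further column.\<close>

lemma subspace_basis_mat:
  assumes sub: "lin_subspace n W"
  shows "\<exists>A\<in>carrier_mat n (subspace_dim n W). inj_mat A \<and> W = (\<lambda>u. A *\<^sub>v u) ` carrier_vec (subspace_dim n W)"
proof -
  let ?P = "\<lambda>k. \<exists>A\<in>carrier_mat n k. inj_mat A \<and> (\<lambda>u. A *\<^sub>v u) ` carrier_vec k \<subseteq> W"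
  have P0: "?P 0"
  proof (intro bexI[of _ "0\<^sub>m n 0"] conjI)
    show "inj_mat (0\<^sub>m n 0)" unfolding inj_mat_def by (auto intro: eq_vecI)
    have "0\<^sub>m n 0 *\<^sub>v u = 0\<^sub>v n" if "u \<in> carrier_vec 0" for u :: "complex vec"
      using that by (intro eq_vecI) (auto simp: scalar_prod_def)
    then show "(\<lambda>u. 0\<^sub>m n 0 *\<^sub>v u) ` carrier_vec 0 \<subseteq> W" using sub unfolding lin_subspace_iff by auto
  qed simp
  have Pn: "k \<le> n" if "?P k" for k using that inj_mat_cols_le_rows by blast
  define k where "k = (GREATEST k. ?P k)"
  have "?P k" unfolding k_def by (rule GreatestI_nat[of ?P, OF P0]) (rule Pn)
  then obtain A where A: "A \<in> carrier_mat n k" "inj_mat A" "(\<lambda>u. A *\<^sub>v u) ` carrier_vec k \<subseteq> W" by blast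
  have "W \<subseteq> (\<lambda>u. A *\<^sub>v u) ` carrier_vec k"
  proof (rule ccontr)
    assume "\<not> ?thesis"
    then obtain w where w: "w \<in> W" "\<And>u. u \<in> carrier_vec k \<Longrightarrow> A *\<^sub>v u \<noteq> w" by blast
    have wn: "w \<in> carrier_vec n" using w(1) sub unfolding lin_subspace_iff by blast
    have A': "append_col A w \<in> carrier_mat n (Suc k)"
      using A(1) by (simp add: append_col_def)
    have "inj_mat (append_col A w)"
      by (rule inj_mat_append_col[OF A(1,2) wn w(2)])
    moreover have "(\<lambda>u. append_col A w *\<^sub>v u) ` carrier_vec (Suc k) \<subseteq> W"
    proof clarify
      fix u :: "complex vec" assume u: "u \<in> carrier_vec (Suc k)"
      have "A *\<^sub>v vec k (\<lambda>r. u $ r) \<in> W" using A(3) by auto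
      then show "append_col A w *\<^sub>v u \<in> W"
        unfolding append_col_mult_vec[OF A(1) wn u] using w(1) sub unfolding lin_subspace_iff by blast
    qed
    ultimately have "?P (Suc k)" using A' by blast
    then have "Suc k \<le> k" unfolding k_def by (rule Greatest_le_nat) (rule Pn)
    then show False by simp
  qed
  then have W: "W = (\<lambda>u. A *\<^sub>v u) ` carrier_vec k" using A(3) by blast
  then show ?thesis using subspace_dim_range[OF A(1,2) W sub] A by auto
qed

lemma subspace_dim_carrier: "subspace_dim n (carrier_vec n) = n"
proof (rule subspace_dim_range[of "1\<^sub>m n"])
  show "inj_mat (1\<^sub>m n)" unfolding inj_mat_def by auto
  show "carrier_vec n = (\<lambda>u. 1\<^sub>m n *\<^sub>v u) ` (carrier_vec n :: complex vec set)"
    by (auto simp: image_iff)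
qed (auto intro: lin_subspace_carrier)

lemma subspace_dim_zero: "subspace_dim n {0\<^sub>v n} = 0"
proof (rule subspace_dim_range[of "0\<^sub>m n 0"])
  show "inj_mat (0\<^sub>m n 0)" unfolding inj_mat_def by (auto intro: eq_vecI)
  show "{0\<^sub>v n} = (\<lambda>u. 0\<^sub>m n 0 *\<^sub>v u) ` (carrier_vec 0 :: complex vec set)"
    by (auto simp: zero_mat_mult_vec intro!: image_eqI[of _ _ "0\<^sub>v 0"])
qed (auto intro: lin_subspace_zero)

lemma subspace_dim_less:
  assumes W: "lin_subspace n W" "W \<noteq> carrier_vec n"
  shows "subspace_dim n W < n"
proof -
  obtain A where A: "A \<in> carrier_mat n (subspace_dim n W)" "inj_mat A"
    "W = (\<lambda>u. A *\<^sub>v u) ` carrier_vec (subspace_dim n W)"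
    using subspace_basis_mat[OF W(1)] by blast
  have "subspace_dim n W \<le> n" by (rule inj_mat_cols_le_rows[OF A(1,2)])
  moreover have "subspace_dim n W \<noteq> n"
  proof
    assume e: "subspace_dim n W = n"
    then have An: "A \<in> carrier_mat n n" using A(1) by simp
    have "det A \<noteq> 0"
      unfolding det_0_iff_vec_prod_zero[OF An] using inj_matD[OF A(2) An] by blast
    then obtain L where L: "A * L = 1\<^sub>m n" "L \<in> carrier_mat n n"
      using mat_inv[OF An] by blast
    have "carrier_vec n \<subseteq> W"
    proof
      fix w :: "complex vec" assume w: "w \<in> carrier_vec n"
      have "A *\<^sub>v (L *\<^sub>v w) = w" using assoc_mult_mat_vec[OF An L(2) w] L(1) w by simp
      then have "w \<in> (\<lambda>u. A *\<^sub>v u) ` carrier_vec n"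
        using mult_mat_vec_carrier[OF L(2) w] by (metis imageI)
      then show "w \<in> W" by (subst A(3)[unfolded e])
    qed
    then show False using W unfolding lin_subspace_iff by blast
  qed
  ultimately show ?thesis by simp
qed

lemma subspace_dim_pos:
  assumes W: "lin_subspace n W" "W \<noteq> {0\<^sub>v n}"
  shows "0 < subspace_dim n W"
proof (rule ccontr)
  assume "\<not> ?thesis"
  then have "subspace_dim n W = 0" by simp
  then obtain A where A: "A \<in> carrier_mat n 0" "W = (\<lambda>u. A *\<^sub>v u) ` carrier_vec 0"
    using subspace_basis_mat[OF W(1)] by auto
  have "A *\<^sub>v u = 0\<^sub>v n" if "u \<in> carrier_vec 0" for u
    using that A(1) by (intro eq_vecI) (auto simp: scalar_prod_def)
  then have "W \<subseteq> {0\<^sub>v n}" by (subst A(2)) blast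
  then show False using W unfolding lin_subspace_iff by blast
qed

subsection \<open>Split short exact sequences\<close>

text \<open>Exactness of \<open>0 \<rightarrow> k \<rightarrow> N \<rightarrow> n \<rightarrow>
  0\<close> together with a retraction \<open>L\<close> and a section \<open>R\<close>. The relation
  \<open>L * R = 0\<close> follows by multiplying the last identity by \<open>L\<close> on the left
  and \<open>R\<close> on the right.\<close>

definition split_exact ::
  "nat \<Rightarrow> nat \<Rightarrow> nat \<Rightarrow> complex mat \<Rightarrow> complex mat \<Rightarrow> complex mat \<Rightarrow> complex mat \<Rightarrow> bool" where
  "split_exact k N n S T L R \<longleftrightarrow>
     S \<in> carrier_mat N k \<and> T \<in> carrier_mat n N \<and> L \<in> carrier_mat k N \<and> R \<in> carrier_mat N n \<and>
     T * S = 0\<^sub>m n k \<and> L * S = 1\<^sub>m k \<and> T * R = 1\<^sub>m n \<and> S * L + R * T = 1\<^sub>m N"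

text \<open>\<open>R\<close> lifts the identity through \<open>T\<close>. Then 1 - RT maps into the
  kernel of \<open>T\<close>, which is the range of \<open>S\<close>, and factoring it through
  \<open>S\<close> gives \<open>L\<close>.\<close>

lemma split_exact_of_images:
  assumes S: "S \<in> carrier_mat N k" and T: "T \<in> carrier_mat n N"
    and inj: "inj_mat S" and surj: "(\<lambda>u. T *\<^sub>v u) ` carrier_vec N = carrier_vec n"
    and ex: "(\<lambda>u. S *\<^sub>v u) ` carrier_vec k = {u \<in> carrier_vec N. T *\<^sub>v u = 0\<^sub>v n}"
  shows "\<exists>L R. split_exact k N n S T L R"
proof -
  have "\<exists>Y\<in>carrier_mat N n. 1\<^sub>m n = T * Y"
    by (rule range_subset_factor[OF one_carrier_mat T]) (use surj in auto)
  then obtain R where R: "R \<in> carrier_mat N n" "T * R = 1\<^sub>m n" by metis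
  have "\<exists>Y\<in>carrier_mat k N. 1\<^sub>m N - R * T = S * Y"
  proof (rule range_subset_factor[OF _ S])
    show "1\<^sub>m N - R * T \<in> carrier_mat N N" using R T by auto
    fix u :: "complex vec" assume u: "u \<in> carrier_vec N"
    have c: "(1\<^sub>m N - R * T) *\<^sub>v u \<in> carrier_vec N" using R T u by (auto intro!: carrier_vecI)
    have "T * (1\<^sub>m N - R * T) = 0\<^sub>m n N"
    proof -
      have "T * (1\<^sub>m N - R * T) = T - T * R * T" using R(1) T by (simp add: mat_ring)
      also have "\<dots> = 0\<^sub>m n N" unfolding R(2) using T by (simp add: mat_ring)
      finally show ?thesis .
    qed
    then have "T *\<^sub>v ((1\<^sub>m N - R * T) *\<^sub>v u) = 0\<^sub>v n"
      using R(1) T u by (simp add: mult_mat_mult_vec[symmetric] zero_mat_mult_vec)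
    then show "(1\<^sub>m N - R * T) *\<^sub>v u \<in> (\<lambda>u. S *\<^sub>v u) ` carrier_vec k"
      unfolding ex using c by blast
  qed
  then obtain L where L: "L \<in> carrier_mat k N" "1\<^sub>m N - R * T = S * L" by blast
  have TS: "T * S = 0\<^sub>m n k"
  proof (rule mat_eq_iff_mult_vec)
    fix u :: "complex vec" assume u: "u \<in> carrier_vec k"
    then have "S *\<^sub>v u \<in> {u \<in> carrier_vec N. T *\<^sub>v u = 0\<^sub>v n}" unfolding ex[symmetric] by blast
    then show "T * S *\<^sub>v u = 0\<^sub>m n k *\<^sub>v u"
      using S T u by (simp add: mult_mat_mult_vec zero_mat_mult_vec)
  qed (use S T in auto)
  \<comment> \<open>From SL = 1 - RT and TS = 0; injectivity of \<open>S\<close> then cancels the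
    outer factor and leaves LS = 1.\<close>
  have "S * (L * S) = S"
  proof -
    have "S * (L * S) = S * L * S" using S L(1) by (simp add: mat_ring)
    also have "\<dots> = S - R * (T * S)" unfolding L(2)[symmetric] using S R(1) T by (simp add: mat_ring)
    also have "\<dots> = S" unfolding TS using S R(1) by (simp add: mult_mat_zero_right) (auto intro!: eq_matI)
    finally show ?thesis .
  qed
  then have LS: "L * S = 1\<^sub>m k"
  proof (intro mat_eq_iff_mult_vec)
    fix u :: "complex vec" assume u: "u \<in> carrier_vec k" and e: "S * (L * S) = S"
    have "S *\<^sub>v (L * S *\<^sub>v u) = S *\<^sub>v u"
      using arg_cong[OF e, of "\<lambda>A. A *\<^sub>v u"] S L(1) u by (simp add: mult_mat_mult_vec)
    then show "L * S *\<^sub>v u = 1\<^sub>m k *\<^sub>v u"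
      using inj_mat_right_factor_vec[OF S inj, of "L * S *\<^sub>v u" u] S L(1) u by (auto intro!: carrier_vecI)
  qed (use S L in auto)
  have "S * L + R * T = 1\<^sub>m N"
    unfolding L(2)[symmetric] using R(1) T by (intro eq_matI) auto
  then show ?thesis unfolding split_exact_def using S T L R TS LS by blast
qed

lemma images_of_split_exact:
  assumes "split_exact k N n S T L R"
  shows "inj_mat S" "(\<lambda>u. T *\<^sub>v u) ` carrier_vec N = carrier_vec n"
    "(\<lambda>u. S *\<^sub>v u) ` carrier_vec k = {u \<in> carrier_vec N. T *\<^sub>v u = 0\<^sub>v n}"
proof -
  have c: "S \<in> carrier_mat N k" "T \<in> carrier_mat n N" "L \<in> carrier_mat k N" "R \<in> carrier_mat N n"
    and e: "T * S = 0\<^sub>m n k" "L * S = 1\<^sub>m k" "T * R = 1\<^sub>m n" "S * L + R * T = 1\<^sub>m N"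
    using assms unfolding split_exact_def by auto
  show "inj_mat S" by (rule inj_mat_left_inverse[OF c(1,3) e(2)])
  show "(\<lambda>u. T *\<^sub>v u) ` carrier_vec N = carrier_vec n"
  proof (intro equalityI subsetI)
    fix u :: "complex vec" assume u: "u \<in> carrier_vec n"
    have "u = T *\<^sub>v (R *\<^sub>v u)" using u c e(3) by (simp add: mult_mat_mult_vec[symmetric])
    then show "u \<in> (\<lambda>u. T *\<^sub>v u) ` carrier_vec N" using c(4) u by (intro image_eqI[of _ _ "R *\<^sub>v u"]) auto
  qed (use c in auto)
  show "(\<lambda>u. S *\<^sub>v u) ` carrier_vec k = {u \<in> carrier_vec N. T *\<^sub>v u = 0\<^sub>v n}"
  proof (intro equalityI subsetI)
    fix u assume "u \<in> (\<lambda>u. S *\<^sub>v u) ` carrier_vec k"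
    then obtain z where z: "z \<in> carrier_vec k" "u = S *\<^sub>v z" by blast
    have "T *\<^sub>v u = T * S *\<^sub>v z" unfolding z(2) using c z(1) by (simp add: mult_mat_mult_vec)
    then show "u \<in> {u \<in> carrier_vec N. T *\<^sub>v u = 0\<^sub>v n}"
      unfolding e(1) using z c by (auto simp: zero_mat_mult_vec)
  next
    fix u assume "u \<in> {u \<in> carrier_vec N. T *\<^sub>v u = 0\<^sub>v n}"
    then have u: "u \<in> carrier_vec N" "T *\<^sub>v u = 0\<^sub>v n" by auto
    have Lu: "L *\<^sub>v u \<in> carrier_vec k" using c u by auto
    have "u = (S * L + R * T) *\<^sub>v u" unfolding e(4) using u(1) by simp
    also have "\<dots> = S *\<^sub>v (L *\<^sub>v u) + R *\<^sub>v (T *\<^sub>v u)"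
      using c u(1) by (subst add_mult_distrib_mat_vec[of _ N N]) (auto simp: mult_mat_mult_vec)
    also have "\<dots> = S *\<^sub>v (L *\<^sub>v u)"
      unfolding u(2) using c mult_mat_vec_carrier[OF c(1) Lu] by (simp add: mult_mat_zero_vec)
    finally show "u \<in> (\<lambda>u. S *\<^sub>v u) ` carrier_vec k" using Lu by blast
  qed
qed

subsection \<open>Matrices of regular functions\<close>

definition reg_mat :: "('p \<Rightarrow> complex) set \<Rightarrow> 'p set \<Rightarrow> nat \<Rightarrow> nat \<Rightarrow> ('p \<Rightarrow> complex mat) \<Rightarrow> bool" where
  "reg_mat C N n m M \<longleftrightarrow>
     (\<forall>p\<in>N. M p \<in> carrier_mat n m) \<and> (\<forall>k<n. \<forall>l<m. reg_on C N (\<lambda>p. M p $$ (k, l)))"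

lemma reg_matI:
  assumes "\<And>p. p \<in> N \<Longrightarrow> M p \<in> carrier_mat n m"
    and "\<And>k l. k < n \<Longrightarrow> l < m \<Longrightarrow> reg_on C N (\<lambda>p. M p $$ (k, l))"
  shows "reg_mat C N n m M"
  using assms unfolding reg_mat_def by blast

lemma reg_mat_carrier: "reg_mat C N n m M \<Longrightarrow> p \<in> N \<Longrightarrow> M p \<in> carrier_mat n m"
  unfolding reg_mat_def by blast

lemma reg_mat_entry: "reg_mat C N n m M \<Longrightarrow> k < n \<Longrightarrow> l < m \<Longrightarrow> reg_on C N (\<lambda>p. M p $$ (k, l))"
  unfolding reg_mat_def by blast

lemma reg_mat_cong: "reg_mat C N n m M \<Longrightarrow> (\<And>p. p \<in> N \<Longrightarrow> M' p = M p) \<Longrightarrow> reg_mat C N n m M'"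
  by (rule reg_matI) (auto simp: reg_mat_carrier intro: reg_on_cong[OF reg_mat_entry])

lemma reg_mat_const: "A \<in> carrier_mat n m \<Longrightarrow> reg_mat C N n m (\<lambda>_. A)"
  by (rule reg_matI) (auto intro: reg_on_const)

lemma reg_mat_mat:
  assumes "\<And>k l. k < n \<Longrightarrow> l < m \<Longrightarrow> reg_on C N (f k l)"
  shows "reg_mat C N n m (\<lambda>p. mat n m (\<lambda>(k, l). f k l p))"
  using assms by (auto intro!: reg_matI)

lemma reg_mat_mult:
  assumes A: "reg_mat C N n m A" and B: "reg_mat C N m l B"
  shows "reg_mat C N n l (\<lambda>p. A p * B p)"
proof (rule reg_matI)
  fix r c assume rc: "r < n" "c < l"
  have "reg_on C N (\<lambda>p. \<Sum>j\<in>{0..<m}. A p $$ (r, j) * B p $$ (j, c))"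
    using rc by (intro reg_on_sum reg_on_mult reg_mat_entry[OF A] reg_mat_entry[OF B]) auto
  then show "reg_on C N (\<lambda>p. (A p * B p) $$ (r, c))"
  proof (rule reg_on_cong)
    show "(A p * B p) $$ (r, c) = (\<Sum>j\<in>{0..<m}. A p $$ (r, j) * B p $$ (j, c))" if "p \<in> N" for p
      using reg_mat_carrier[OF A that] reg_mat_carrier[OF B that] rc by (auto simp: scalar_prod_def)
  qed
qed (rule mult_carrier_mat[OF reg_mat_carrier[OF A] reg_mat_carrier[OF B]])

lemma reg_mat_add:
  assumes A: "reg_mat C N n m A" and B: "reg_mat C N n m B"
  shows "reg_mat C N n m (\<lambda>p. A p + B p)"
proof (rule reg_matI)
  fix r c assume rc: "r < n" "c < m"
  have "reg_on C N (\<lambda>p. A p $$ (r, c) + B p $$ (r, c))"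
    using rc by (intro reg_on_add reg_mat_entry[OF A] reg_mat_entry[OF B])
  then show "reg_on C N (\<lambda>p. (A p + B p) $$ (r, c))"
  proof (rule reg_on_cong)
    show "(A p + B p) $$ (r, c) = A p $$ (r, c) + B p $$ (r, c)" if "p \<in> N" for p
      using reg_mat_carrier[OF A that] reg_mat_carrier[OF B that] rc by auto
  qed
qed (use reg_mat_carrier[OF A] reg_mat_carrier[OF B] in auto)

lemma reg_mat_smult:
  assumes A: "reg_mat C N n m A" and f: "reg_on C N f"
  shows "reg_mat C N n m (\<lambda>p. f p \<cdot>\<^sub>m A p)"
proof (rule reg_matI)
  fix r c assume rc: "r < n" "c < m"
  have "reg_on C N (\<lambda>p. f p * A p $$ (r, c))"
    using rc by (intro reg_on_mult reg_mat_entry[OF A] f)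
  then show "reg_on C N (\<lambda>p. (f p \<cdot>\<^sub>m A p) $$ (r, c))"
  proof (rule reg_on_cong)
    show "(f p \<cdot>\<^sub>m A p) $$ (r, c) = f p * A p $$ (r, c)" if "p \<in> N" for p
      using reg_mat_carrier[OF A that] rc by auto
  qed
qed (use reg_mat_carrier[OF A] in auto)

lemma reg_mat_minus:
  assumes A: "reg_mat C N n m A" and B: "reg_mat C N n m B"
  shows "reg_mat C N n m (\<lambda>p. A p - B p)"
proof (rule reg_mat_cong)
  show "reg_mat C N n m (\<lambda>p. A p + (- 1) \<cdot>\<^sub>m B p)"
    by (intro reg_mat_add A reg_mat_smult[OF B] reg_on_const)
  show "A p - B p = A p + (- 1) \<cdot>\<^sub>m B p" if "p \<in> N" for p
    using reg_mat_carrier[OF A that] reg_mat_carrier[OF B that] by (intro eq_matI) auto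
qed

lemma reg_on_det:
  assumes A: "reg_mat C N n n A"
  shows "reg_on C N (\<lambda>p. det (A p))"
proof (rule reg_on_cong)
  show "reg_on C N (\<lambda>p. \<Sum>\<pi>\<in>{\<pi>. \<pi> permutes {0..<n}}. signof \<pi> * (\<Prod>j = 0..<n. A p $$ (j, \<pi> j)))"
    by (intro reg_on_sum reg_on_mult reg_on_const reg_on_prod reg_mat_entry[OF A])
      (auto dest: permutes_in_image)
  show "det (A p) = (\<Sum>\<pi>\<in>{\<pi>. \<pi> permutes {0..<n}}. signof \<pi> * (\<Prod>j = 0..<n. A p $$ (j, \<pi> j)))"
    if "p \<in> N" for p using det_def'[OF reg_mat_carrier[OF A that]] .
qed

lemma reg_mat_inv:
  assumes A: "reg_mat C N n n A" and d: "\<And>p. p \<in> N \<Longrightarrow> det (A p) \<noteq> 0"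
  shows "reg_mat C N n n (\<lambda>p. mat_inv (A p))"
  unfolding mat_inv_def
proof (intro reg_mat_smult reg_on_inverse reg_on_det[OF A] d)
  show "reg_mat C N n n (\<lambda>p. adj_mat (A p))"
  proof (rule reg_matI)
    fix r c assume rc: "r < n" "c < n"
    have "reg_mat C N (n - 1) (n - 1) (\<lambda>p. mat_delete (A p) c r)"
    proof (rule reg_mat_cong)
      show "reg_mat C N (n - 1) (n - 1) (\<lambda>p. mat (n - 1) (n - 1)
          (\<lambda>(k, l). A p $$ (if k < c then k else Suc k, if l < r then l else Suc l)))"
        by (intro reg_mat_mat reg_mat_entry[OF A]) auto
      show "mat_delete (A p) c r = mat (n - 1) (n - 1)
          (\<lambda>(k, l). A p $$ (if k < c then k else Suc k, if l < r then l else Suc l))" if "p \<in> N" for p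
        using reg_mat_carrier[OF A that] by (simp add: mat_delete_def)
    qed
    then have "reg_on C N (\<lambda>p. (- 1) ^ (c + r) * det (mat_delete (A p) c r))"
      by (intro reg_on_mult reg_on_const reg_on_det)
    then show "reg_on C N (\<lambda>p. adj_mat (A p) $$ (r, c))"
    proof (rule reg_on_cong)
      show "adj_mat (A p) $$ (r, c) = (- 1) ^ (c + r) * det (mat_delete (A p) c r)" if "p \<in> N" for p
        using reg_mat_carrier[OF A that] rc by (auto simp: adj_mat_def cofactor_def)
    qed
  qed (use adj_mat(1) reg_mat_carrier[OF A] in blast)
qed

subsection \<open>Ordered products\<close>

text \<open>Removing the greatest element matches ordered products, in which the greatest index
  contributes the last factor.\<close>

lemma finite_linear_order_max_induct [consumes 3, case_names empty insert]:
  assumes "finite A" and "strict_linear_order_on H ord" and "A \<subseteq> H"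
    and empty: "P {}"
    and insert: "\<And>A m. finite A \<Longrightarrow> insert m A \<subseteq> H \<Longrightarrow> (\<And>a. a \<in> A \<Longrightarrow> (a, m) \<in> ord) \<Longrightarrow> P A \<Longrightarrow> P (insert m A)"
  shows "P A"
  using assms(1,3)
proof (induction A rule: finite_psubset_induct)
  case (psubset A)
  show ?case
  proof (cases "A = {}")
    case False
    have tr: "trans ord" and ir: "irrefl ord" and tot: "total_on H ord"
      using assms(2) unfolding strict_linear_order_on_def by auto
    have "\<exists>m\<in>A. \<forall>a\<in>A. (a, m) \<in> ord \<or> a = m"
      using psubset(1) False psubset(3)
    proof (induction A rule: finite_ne_induct)
      case (insert x F)
      then obtain m where m: "m \<in> F" "\<forall>a\<in>F. (a, m) \<in> ord \<or> a = m" by auto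
      show ?case
      proof (cases "(m, x) \<in> ord")
        case True
        then have "\<forall>a\<in>insert x F. (a, x) \<in> ord \<or> a = x" using m tr by (auto elim: transE)
        then show ?thesis by blast
      next
        case False
        then have "(x, m) \<in> ord \<or> x = m" using tot m insert.prems unfolding total_on_def by auto
        then show ?thesis using m by blast
      qed
    qed auto
    then obtain m where m: "m \<in> A" "\<forall>a\<in>A. (a, m) \<in> ord \<or> a = m" by blast
    have "P (insert m (A - {m}))"
      using m psubset(1,3) by (intro insert psubset(2)) auto
    then show ?thesis using m(1) by (simp add: insert_absorb)
  qed (simp add: empty)
qed

text \<open>Justifies the definite description in \<open>ordered_list\<close>.\<close>

lemma sorted_wrt_set_unique:
  assumes "trans r" "irrefl r" "sorted_wrt (\<lambda>x y. (x, y) \<in> r) xs" "sorted_wrt (\<lambda>x y. (x, y) \<in> r) ys"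
    "set xs = set ys"
  shows "xs = ys"
  using assms(3-5)
proof (induction xs arbitrary: ys)
  case Nil
  then show ?case by simp
next
  case (Cons x xs)
  then obtain y ys' where ys: "ys = y # ys'" by (cases ys) auto
  have irr: "(a, a) \<notin> r" for a using assms(2) unfolding irrefl_def by blast
  have asym: "(b, a) \<notin> r" if "(a, b) \<in> r" for a b using that irr transD[OF assms(1)] by blast
  have "x = y"
  proof (rule ccontr)
    assume "x \<noteq> y"
    then have "x \<in> set ys'" "y \<in> set xs" using Cons.prems ys by auto
    then show False using Cons.prems ys asym by auto
  qed
  moreover have "x \<notin> set xs" "y \<notin> set ys'" using Cons.prems ys irr by auto
  ultimately have "set xs = set ys'" using Cons.prems ys by auto
  then show ?case using Cons ys \<open>x = y\<close> by simp
qed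

context
  fixes H :: "'h set" and ord :: "'h rel"
  assumes ord: "strict_linear_order_on H ord"
begin

lemma ordered_list_eqI:
  assumes "set hs = A" "sorted_wrt (\<lambda>h h'. (h, h') \<in> ord) hs"
  shows "ordered_list ord A = hs"
  unfolding ordered_list_def
  using assms ord sorted_wrt_set_unique[of ord] unfolding strict_linear_order_on_def
  by (intro the_equality) auto

lemma ordered_list_empty: "ordered_list ord {} = []"
  by (rule ordered_list_eqI) auto

lemma ordered_list_props:
  assumes "finite A" "A \<subseteq> H"
  shows "set (ordered_list ord A) = A \<and> sorted_wrt (\<lambda>h h'. (h, h') \<in> ord) (ordered_list ord A)"
  using assms(1) ord assms(2)
proof (induction A rule: finite_linear_order_max_induct)
  case (insert A m)
  have "ordered_list ord (insert m A) = ordered_list ord A @ [m]"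
    by (rule ordered_list_eqI) (use insert in \<open>auto simp: sorted_wrt_append\<close>)
  then show ?case using insert by (auto simp: sorted_wrt_append)
qed (simp add: ordered_list_empty)

lemma ordered_list_insert_max:
  assumes "finite A" "A \<subseteq> H" "\<And>a. a \<in> A \<Longrightarrow> (a, m) \<in> ord"
  shows "ordered_list ord (insert m A) = ordered_list ord A @ [m]"
  by (rule ordered_list_eqI) (use ordered_list_props[OF assms(1,2)] assms(3) in \<open>auto simp: sorted_wrt_append\<close>)

lemma ordered_prod_empty: "ordered_prod ord n F {} = 1\<^sub>m n"
  by (simp add: ordered_prod_def ordered_list_empty)

lemma ordered_prod_insert_max:
  fixes F :: "'h \<Rightarrow> complex mat"
  assumes "finite A" "A \<subseteq> H" "\<And>a. a \<in> A \<Longrightarrow> (a, m) \<in> ord"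
    and F: "\<And>a. a \<in> insert m A \<Longrightarrow> F a \<in> carrier_mat n n"
  shows "ordered_prod ord n F (insert m A) = ordered_prod ord n F A * F m"
proof -
  have fold: "foldr (*) As M = foldr (*) As (1\<^sub>m n) * M \<and> foldr (*) As (1\<^sub>m n) \<in> carrier_mat n n"
    if "set As \<subseteq> carrier_mat n n" "M \<in> carrier_mat n n" for As and M :: "complex mat"
    using that
  proof (induction As)
    case (Cons a As)
    then show ?case by (auto simp: mat_ring)
  qed auto
  have Fm: "F m \<in> carrier_mat n n" using F by simp
  have "ordered_prod ord n F (insert m A) = foldr (*) (map F (ordered_list ord A)) (F m * 1\<^sub>m n)"
    by (simp add: ordered_prod_def ordered_list_insert_max[OF assms(1-3)])
  also have "\<dots> = ordered_prod ord n F A * F m"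
    using fold[of "map F (ordered_list ord A)" "F m"] Fm F ordered_list_props[OF assms(1,2)]
    unfolding ordered_prod_def right_mult_one_mat[OF Fm] by force
  finally show ?thesis .
qed

lemma ordered_prod_carrier:
  fixes F :: "'h \<Rightarrow> complex mat"
  assumes "finite A" "A \<subseteq> H" "\<And>a. a \<in> A \<Longrightarrow> F a \<in> carrier_mat n n"
  shows "ordered_prod ord n F A \<in> carrier_mat n n"
  using assms(1) ord assms(2,3)
proof (induction A rule: finite_linear_order_max_induct)
  case (insert A m)
  have "ordered_prod ord n F (insert m A) = ordered_prod ord n F A * F m"
    using insert by (intro ordered_prod_insert_max) auto
  then show ?case using insert by auto
qed (simp add: ordered_prod_empty)

lemma ordered_prod_cong:
  assumes "\<And>a. a \<in> A \<Longrightarrow> F a = G a" "finite A" "A \<subseteq> H"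
  shows "ordered_prod ord n F A = ordered_prod ord n G A"
  unfolding ordered_prod_def using assms ordered_list_props[OF assms(2,3)]
  by (metis map_cong)

lemma ordered_prod_smult:
  fixes F :: "'h \<Rightarrow> complex mat"
  assumes "finite A" "A \<subseteq> H" "\<And>a. a \<in> A \<Longrightarrow> F a \<in> carrier_mat n n"
  shows "ordered_prod ord n (\<lambda>a. c a \<cdot>\<^sub>m F a) A = (\<Prod>a\<in>A. c a) \<cdot>\<^sub>m ordered_prod ord n F A"
  using assms(1) ord assms(2,3)
proof (induction A rule: finite_linear_order_max_induct)
  case (insert A m)
  have Fm: "F m \<in> carrier_mat n n" and pA: "ordered_prod ord n F A \<in> carrier_mat n n"
    using insert by (auto intro!: ordered_prod_carrier)
  have m: "m \<notin> A" using insert(3) ord unfolding strict_linear_order_on_def irrefl_def by blast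
  have "ordered_prod ord n (\<lambda>a. c a \<cdot>\<^sub>m F a) (insert m A) =
      ordered_prod ord n (\<lambda>a. c a \<cdot>\<^sub>m F a) A * (c m \<cdot>\<^sub>m F m)"
    using insert by (intro ordered_prod_insert_max) auto
  also have "\<dots> = ((\<Prod>a\<in>A. c a) \<cdot>\<^sub>m ordered_prod ord n F A) * (c m \<cdot>\<^sub>m F m)"
    using insert by simp
  also have "\<dots> = (\<Prod>a\<in>insert m A. c a) \<cdot>\<^sub>m (ordered_prod ord n F A * F m)"
    using insert(1) m Fm pA by (simp add: mat_ring smult_smult_mat ac_simps)
  also have "ordered_prod ord n F A * F m = ordered_prod ord n F (insert m A)"
    using insert by (intro ordered_prod_insert_max[symmetric]) auto
  finally show ?case .
qed (auto simp: ordered_prod_empty)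

lemma ordered_prod_det_nonzero:
  fixes F :: "'h \<Rightarrow> complex mat"
  assumes "finite A" "A \<subseteq> H" "\<And>a. a \<in> A \<Longrightarrow> F a \<in> carrier_mat n n \<and> det (F a) \<noteq> 0"
  shows "det (ordered_prod ord n F A) \<noteq> 0"
  using assms(1) ord assms(2,3)
proof (induction A rule: finite_linear_order_max_induct)
  case (insert A m)
  have "ordered_prod ord n F (insert m A) = ordered_prod ord n F A * F m"
    using insert by (intro ordered_prod_insert_max) auto
  then show ?case
    using insert ordered_prod_carrier[of A F n] by (auto simp: det_mult[of _ n])
qed (simp add: ordered_prod_empty)

lemma ordered_prod_invariant:
  fixes F :: "'h \<Rightarrow> complex mat"
  assumes "finite A" "A \<subseteq> H" "\<And>a. a \<in> A \<Longrightarrow> F a \<in> carrier_mat n n"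
    "S \<subseteq> carrier_vec n" "\<And>a u. a \<in> A \<Longrightarrow> u \<in> S \<Longrightarrow> F a *\<^sub>v u \<in> S" "u \<in> S"
  shows "ordered_prod ord n F A *\<^sub>v u \<in> S"
  using assms(1) ord assms(2,3,5,6)
proof (induction A arbitrary: u rule: finite_linear_order_max_induct)
  case (insert A m)
  have "ordered_prod ord n F (insert m A) = ordered_prod ord n F A * F m"
    using insert by (intro ordered_prod_insert_max) auto
  moreover have "dim_col (F m) = dim_vec u" using insert(5,7) assms(4) by (metis carrier_matD(2) carrier_vecD insertI1 subsetD)
  moreover have "ordered_prod ord n F A \<in> carrier_mat n n" "F m \<in> carrier_mat n n"
    using insert by (auto intro!: ordered_prod_carrier)
  ultimately have "ordered_prod ord n F (insert m A) *\<^sub>v u = ordered_prod ord n F A *\<^sub>v (F m *\<^sub>v u)"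
    by (simp add: mult_mat_mult_vec)
  then show ?case using insert by simp
qed (use assms(4) in \<open>auto simp: ordered_prod_empty\<close>)

lemma reg_mat_ordered_prod:
  assumes "finite A" "A \<subseteq> H" "\<And>a. a \<in> A \<Longrightarrow> reg_mat C N n n (F a)"
  shows "reg_mat C N n n (\<lambda>p. ordered_prod ord n (\<lambda>a. F a p) A)"
  using assms(1) ord assms(2,3)
proof (induction A rule: finite_linear_order_max_induct)
  case (insert A m)
  have "reg_mat C N n n (\<lambda>p. ordered_prod ord n (\<lambda>a. F a p) A * F m p)"
    using insert by (intro reg_mat_mult) auto
  then show ?case
    by (rule reg_mat_cong) (use insert in \<open>auto intro!: ordered_prod_insert_max reg_mat_carrier[where N = N]\<close>)
qed (simp add: ordered_prod_empty reg_mat_const)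

text \<open>Iterates P(1 + Y) = P + PY, where P is the product over the predecessors.
  \<open>A\<close> is an initial segment of \<open>K\<close>, so predecessors in \<open>K\<close>
  and in \<open>A\<close> agree; \<open>A = K\<close> gives the moment map and the predecessors of
  an arrow give a partial product. The entrywise form keeps the sum one of numbers.\<close>

lemma ordered_prod_one_plus_telescope:
  fixes Y :: "'h \<Rightarrow> complex mat"
  assumes "finite A" "A \<subseteq> K" "K \<subseteq> H" "\<And>h. h \<in> K \<Longrightarrow> Y h \<in> carrier_mat n n"
    and "\<And>h h'. h \<in> A \<Longrightarrow> h' \<in> K \<Longrightarrow> (h', h) \<in> ord \<Longrightarrow> h' \<in> A"
    and rc: "r < n" "c < n"
  shows "ordered_prod ord n (\<lambda>h. 1\<^sub>m n + Y h) A $$ (r, c) = (1\<^sub>m n :: complex mat) $$ (r, c) +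
    (\<Sum>h\<in>A. (ordered_prod ord n (\<lambda>h. 1\<^sub>m n + Y h) {h' \<in> K. (h', h) \<in> ord} * Y h) $$ (r, c))"
proof -
  have "A \<subseteq> H" using assms(2,3) by blast
  with assms(1) ord show ?thesis using assms(2,5)
  proof (induction A rule: finite_linear_order_max_induct)
    case (insert A m)
    have irr: "(a, a) \<notin> ord" for a using ord unfolding strict_linear_order_on_def irrefl_def by blast
    have asym: "(b, a) \<notin> ord" if "(a, b) \<in> ord" for a b
      using that irr ord unfolding strict_linear_order_on_def by (metis transD)
    have m: "m \<notin> A" using insert(3) irr by blast
    \<comment> \<open>The set \<open>A\<close> being extended is exactly the set of predecessors of
      \<open>m\<close> in \<open>K\<close>, so the new term has the product over \<open>A\<close> as
      its coefficient.\<close>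
    have seg: "{h' \<in> K. (h', m) \<in> ord} = A" using insert(3,5,6) irr by blast
    have YA: "1\<^sub>m n + Y a \<in> carrier_mat n n" if "a \<in> insert m A" for a
      using that assms(4) insert(5) by auto
    have pA: "ordered_prod ord n (\<lambda>h. 1\<^sub>m n + Y h) A \<in> carrier_mat n n"
      using insert YA by (intro ordered_prod_carrier) auto
    have Ym: "Y m \<in> carrier_mat n n" using insert(5) assms(4) by auto
    have IH: "ordered_prod ord n (\<lambda>h. 1\<^sub>m n + Y h) A $$ (r, c) = (1\<^sub>m n :: complex mat) $$ (r, c) +
      (\<Sum>h\<in>A. (ordered_prod ord n (\<lambda>h. 1\<^sub>m n + Y h) {h' \<in> K. (h', h) \<in> ord} * Y h) $$ (r, c))"
    proof (rule insert.IH)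
      show "A \<subseteq> K" using insert(5) by blast
      show "h' \<in> A" if "h \<in> A" "h' \<in> K" "(h', h) \<in> ord" for h h'
        using insert(3)[OF that(1)] insert(6)[of h h'] that asym by blast
    qed
    have "ordered_prod ord n (\<lambda>h. 1\<^sub>m n + Y h) (insert m A) =
        ordered_prod ord n (\<lambda>h. 1\<^sub>m n + Y h) A * (1\<^sub>m n + Y m)"
      using insert YA by (intro ordered_prod_insert_max) auto
    also have "\<dots> = ordered_prod ord n (\<lambda>h. 1\<^sub>m n + Y h) A +
        ordered_prod ord n (\<lambda>h. 1\<^sub>m n + Y h) {h' \<in> K. (h', m) \<in> ord} * Y m"
      unfolding seg using pA Ym by (simp add: mat_ring)
    finally show ?case
      using IH pA Ym rc insert(1) m by (simp add: seg del: index_mult_mat(1) index_one_mat)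
  qed (simp add: ordered_prod_empty)
qed

end

section \<open>Block matrices\<close>

definition blocks_dim :: "'h set \<Rightarrow> ('h \<Rightarrow> nat) \<Rightarrow> nat" where
  "blocks_dim K d = (\<Sum>h\<in>K. d h)"

text \<open>Any bijection will do: diagonal and triangular shape are read off from the block labels
  of two indices, not from the indices themselves.\<close>

definition blocks_enum :: "'h set \<Rightarrow> ('h \<Rightarrow> nat) \<Rightarrow> nat \<Rightarrow> 'h \<times> nat" where
  "blocks_enum K d = (SOME e. bij_betw e {0..<blocks_dim K d} (SIGMA h:K. {0..<d h}))"

definition blk :: "'h set \<Rightarrow> ('h \<Rightarrow> nat) \<Rightarrow> nat \<Rightarrow> 'h" where
  "blk K d r = fst (blocks_enum K d r)"

definition loc :: "'h set \<Rightarrow> ('h \<Rightarrow> nat) \<Rightarrow> nat \<Rightarrow> nat" where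
  "loc K d r = snd (blocks_enum K d r)"

definition idx :: "'h set \<Rightarrow> ('h \<Rightarrow> nat) \<Rightarrow> 'h \<Rightarrow> nat \<Rightarrow> nat" where
  "idx K d h a = inv_into {0..<blocks_dim K d} (blocks_enum K d) (h, a)"

definition blocks_vec :: "'h set \<Rightarrow> ('h \<Rightarrow> nat) \<Rightarrow> ('h \<Rightarrow> complex vec) \<Rightarrow> complex vec" where
  "blocks_vec K d w = vec (blocks_dim K d) (\<lambda>r. w (blk K d r) $ loc K d r)"

definition row_blocks :: "'h set \<Rightarrow> ('h \<Rightarrow> nat) \<Rightarrow> nat \<Rightarrow> ('h \<Rightarrow> complex mat) \<Rightarrow> complex mat" where
  "row_blocks K d m S = mat (blocks_dim K d) m (\<lambda>(r, c). S (blk K d r) $$ (loc K d r, c))"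

definition col_blocks :: "'h set \<Rightarrow> ('h \<Rightarrow> nat) \<Rightarrow> nat \<Rightarrow> ('h \<Rightarrow> complex mat) \<Rightarrow> complex mat" where
  "col_blocks K d m X = mat m (blocks_dim K d) (\<lambda>(r, c). X (blk K d c) $$ (r, loc K d c))"

definition diag_blocks ::
  "'h set \<Rightarrow> ('h \<Rightarrow> nat) \<Rightarrow> ('h \<Rightarrow> nat) \<Rightarrow> ('h \<Rightarrow> complex mat) \<Rightarrow> complex mat" where
  "diag_blocks K d d' B = mat (blocks_dim K d) (blocks_dim K d') (\<lambda>(r, c).
     if blk K d r = blk K d' c then B (blk K d r) $$ (loc K d r, loc K d' c) else 0)"

text \<open>Truncation to the strictly upper block triangular part, with respect to the order of the
  arrows.\<close>

definition upper_blocks :: "'h set \<Rightarrow> ('h \<Rightarrow> nat) \<Rightarrow> 'h rel \<Rightarrow> complex mat \<Rightarrow> complex mat" where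
  "upper_blocks K d ord M = mat (blocks_dim K d) (blocks_dim K d)
     (\<lambda>(r, c). if (blk K d r, blk K d c) \<in> ord then M $$ (r, c) else 0)"

lemma blocks_carrier [simp]:
  "blocks_vec K d w \<in> carrier_vec (blocks_dim K d)"
  "row_blocks K d m S \<in> carrier_mat (blocks_dim K d) m"
  "col_blocks K d m S \<in> carrier_mat m (blocks_dim K d)"
  "diag_blocks K d d' S \<in> carrier_mat (blocks_dim K d) (blocks_dim K d')"
  "upper_blocks K d ord M \<in> carrier_mat (blocks_dim K d) (blocks_dim K d)"
  by (auto simp: blocks_vec_def row_blocks_def col_blocks_def diag_blocks_def upper_blocks_def)

lemmas blocks_dims [simp] =
  blocks_carrier(1)[THEN carrier_vecD] blocks_carrier(2-5)[THEN carrier_matD(1)]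
  blocks_carrier(2-5)[THEN carrier_matD(2)]

context
  fixes K :: "'h set"
  assumes K: "finite K"
begin

lemma blocks_enum: "bij_betw (blocks_enum K d) {0..<blocks_dim K d} (SIGMA h:K. {0..<d h})"
proof -
  have fin: "finite (SIGMA h:K. {0..<d h})" using K by auto
  have "card (SIGMA h:K. {0..<d h}) = blocks_dim K d"
    using K by (simp add: blocks_dim_def)
  then show ?thesis
    using ex_bij_betw_nat_finite[OF fin] someI_ex unfolding blocks_enum_def by metis
qed

lemma blk_loc:
  assumes "r < blocks_dim K d"
  shows "blk K d r \<in> K" "loc K d r < d (blk K d r)" "idx K d (blk K d r) (loc K d r) = r"
proof -
  have "blocks_enum K d r \<in> (SIGMA h:K. {0..<d h})"
    using bij_betwE[OF blocks_enum[of d]] assms by auto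
  then show "blk K d r \<in> K" "loc K d r < d (blk K d r)"
    by (auto simp: blk_def loc_def)
  show "idx K d (blk K d r) (loc K d r) = r"
    using blocks_enum[of d] assms unfolding idx_def blk_def loc_def bij_betw_def
    by (simp add: inv_into_f_f)
qed

lemma idx:
  assumes "h \<in> K" "a < d h"
  shows "idx K d h a < blocks_dim K d" "blk K d (idx K d h a) = h" "loc K d (idx K d h a) = a"
proof -
  have ha: "(h, a) \<in> blocks_enum K d ` {0..<blocks_dim K d}"
    using blocks_enum[of d] assms unfolding bij_betw_def by auto
  show "idx K d h a < blocks_dim K d"
    using inv_into_into[OF ha] unfolding idx_def by simp
  show "blk K d (idx K d h a) = h" "loc K d (idx K d h a) = a"
    using f_inv_into_f[OF ha] unfolding idx_def blk_def loc_def by simp_all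
qed

lemma sum_blocks:
  fixes f :: "'h \<Rightarrow> nat \<Rightarrow> complex"
  shows "(\<Sum>r = 0..<blocks_dim K d. f (blk K d r) (loc K d r)) = (\<Sum>h\<in>K. \<Sum>a = 0..<d h. f h a)"
proof -
  have "(\<Sum>h\<in>K. \<Sum>a = 0..<d h. f h a) = (\<Sum>(h, a)\<in>(SIGMA h:K. {0..<d h}). f h a)"
    using K by (simp add: sum.Sigma)
  also have "\<dots> = (\<Sum>r = 0..<blocks_dim K d. (\<lambda>(h, a). f h a) (blocks_enum K d r))"
    by (rule sum.reindex_bij_betw[OF blocks_enum, symmetric])
  finally show ?thesis by (simp add: blk_def loc_def case_prod_unfold)
qed

lemma sum_blocks_single:
  fixes f :: "'h \<Rightarrow> nat \<Rightarrow> complex"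
  assumes "h \<in> K"
  shows "(\<Sum>r = 0..<blocks_dim K d. if blk K d r = h then f (blk K d r) (loc K d r) else 0) = (\<Sum>a = 0..<d h. f h a)"
proof -
  have "(\<Sum>r = 0..<blocks_dim K d. if blk K d r = h then f (blk K d r) (loc K d r) else 0) =
      (\<Sum>k\<in>K. \<Sum>a = 0..<d k. if k = h then f k a else 0)"
    by (rule sum_blocks)
  also have "\<dots> = (\<Sum>k\<in>K. if k = h then (\<Sum>a = 0..<d k. f k a) else 0)"
    by (intro sum.cong) auto
  finally show ?thesis using K assms by simp
qed

lemma row_col_blocks_entry:
  assumes "\<And>h. h \<in> K \<Longrightarrow> S h \<in> carrier_mat (d h) m" "\<And>h. h \<in> K \<Longrightarrow> X h \<in> carrier_mat m (d h)"
    "r < blocks_dim K d" "c < blocks_dim K d"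
  shows "(row_blocks K d m S * col_blocks K d m X) $$ (r, c) =
    (S (blk K d r) * X (blk K d c)) $$ (loc K d r, loc K d c)"
proof -
  note b = blk_loc[OF assms(3)] blk_loc[OF assms(4)]
  have "S (blk K d r) \<in> carrier_mat (d (blk K d r)) m" "X (blk K d c) \<in> carrier_mat m (d (blk K d c))"
    using assms b by auto
  then show ?thesis
    using assms(3,4) b by (simp add: row_blocks_def col_blocks_def scalar_prod_def)
qed

lemma col_row_blocks_entry:
  assumes "\<And>h. h \<in> K \<Longrightarrow> S h \<in> carrier_mat (d h) m" "\<And>h. h \<in> K \<Longrightarrow> X h \<in> carrier_mat m (d h)"
    "r < m" "c < m"
  shows "(col_blocks K d m X * row_blocks K d m S) $$ (r, c) = (\<Sum>h\<in>K. (X h * S h) $$ (r, c))"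
proof -
  have "(col_blocks K d m X * row_blocks K d m S) $$ (r, c) =
    (\<Sum>l = 0..<blocks_dim K d. X (blk K d l) $$ (r, loc K d l) * S (blk K d l) $$ (loc K d l, c))"
    using assms(3,4) by (simp add: row_blocks_def col_blocks_def scalar_prod_def)
  also have "\<dots> = (\<Sum>h\<in>K. \<Sum>a = 0..<d h. X h $$ (r, a) * S h $$ (a, c))"
    by (rule sum_blocks)
  also have "\<dots> = (\<Sum>h\<in>K. (X h * S h) $$ (r, c))"
  proof (rule sum.cong[OF refl])
    fix h assume "h \<in> K"
    then have "S h \<in> carrier_mat (d h) m" "X h \<in> carrier_mat m (d h)" using assms by auto
    then show "(\<Sum>a = 0..<d h. X h $$ (r, a) * S h $$ (a, c)) = (X h * S h) $$ (r, c)"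
      using assms(3,4) by (simp add: scalar_prod_def)
  qed
  finally show ?thesis .
qed

lemma row_blocks_mult_vec:
  assumes "\<And>h. h \<in> K \<Longrightarrow> S h \<in> carrier_mat (d h) m" "u \<in> carrier_vec m"
  shows "row_blocks K d m S *\<^sub>v u = blocks_vec K d (\<lambda>h. S h *\<^sub>v u)"
proof (rule eq_vecI)
  fix r assume "r < dim_vec (blocks_vec K d (\<lambda>h. S h *\<^sub>v u))"
  then have r: "r < blocks_dim K d" by simp
  note b = blk_loc[OF r]
  have "S (blk K d r) \<in> carrier_mat (d (blk K d r)) m" using assms b by auto
  then show "(row_blocks K d m S *\<^sub>v u) $ r = blocks_vec K d (\<lambda>h. S h *\<^sub>v u) $ r"
    using r b assms(2) by (simp add: row_blocks_def blocks_vec_def scalar_prod_def)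
qed simp

lemma blocks_vec_cong: "(\<And>h. h \<in> K \<Longrightarrow> w h = w' h) \<Longrightarrow> blocks_vec K d w = blocks_vec K d w'"
  by (intro eq_vecI) (auto simp: blocks_vec_def blk_loc)

lemma blocks_vec_eqD:
  assumes "blocks_vec K d w = blocks_vec K d w'" "h \<in> K" "w h \<in> carrier_vec (d h)" "w' h \<in> carrier_vec (d h)"
  shows "w h = w' h"
proof (rule eq_vecI)
  fix a assume "a < dim_vec (w' h)"
  then have a: "a < d h" using assms(4) by simp
  have "blocks_vec K d w $ idx K d h a = blocks_vec K d w' $ idx K d h a" using assms(1) by simp
  then show "w h $ a = w' h $ a"
    using idx[OF assms(2), of a d] a by (simp add: blocks_vec_def)
qed (use assms in simp)

lemma blocks_vec_surj:
  assumes "u \<in> carrier_vec (blocks_dim K d)"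
  shows "u = blocks_vec K d (\<lambda>h\<in>K. vec (d h) (\<lambda>a. u $ idx K d h a))"
  by (rule eq_vecI) (use assms blk_loc[of _ d] in \<open>auto simp: blocks_vec_def\<close>)

lemma col_blocks_mult_vec:
  assumes "\<And>h. h \<in> K \<Longrightarrow> X h \<in> carrier_mat m (d h)" "\<And>h. h \<in> K \<Longrightarrow> w h \<in> carrier_vec (d h)" "r < m"
  shows "(col_blocks K d m X *\<^sub>v blocks_vec K d w) $ r = (\<Sum>h\<in>K. (X h *\<^sub>v w h) $ r)"
proof -
  have "(col_blocks K d m X *\<^sub>v blocks_vec K d w) $ r =
      (\<Sum>l = 0..<blocks_dim K d. X (blk K d l) $$ (r, loc K d l) * w (blk K d l) $ loc K d l)"
    using assms(3) by (simp add: col_blocks_def blocks_vec_def scalar_prod_def)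
  also have "\<dots> = (\<Sum>h\<in>K. \<Sum>a = 0..<d h. X h $$ (r, a) * w h $ a)"
    by (rule sum_blocks)
  also have "\<dots> = (\<Sum>h\<in>K. (X h *\<^sub>v w h) $ r)"
  proof (rule sum.cong[OF refl])
    fix h assume "h \<in> K"
    then have "X h \<in> carrier_mat m (d h)" "w h \<in> carrier_vec (d h)" using assms by auto
    then show "(\<Sum>a = 0..<d h. X h $$ (r, a) * w h $ a) = (X h *\<^sub>v w h) $ r"
      using assms(3) by (simp add: scalar_prod_def)
  qed
  finally show ?thesis .
qed

lemma diag_blocks_mult_vec:
  assumes "\<And>h. h \<in> K \<Longrightarrow> B h \<in> carrier_mat (d h) (d' h)" "\<And>h. h \<in> K \<Longrightarrow> w h \<in> carrier_vec (d' h)"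
  shows "diag_blocks K d d' B *\<^sub>v blocks_vec K d' w = blocks_vec K d (\<lambda>h. B h *\<^sub>v w h)"
proof (rule eq_vecI)
  fix r assume "r < dim_vec (blocks_vec K d (\<lambda>h. B h *\<^sub>v w h))"
  then have r: "r < blocks_dim K d" by simp
  note b = blk_loc[OF r]
  let ?h = "blk K d r"
  have Bw: "B ?h \<in> carrier_mat (d ?h) (d' ?h)" "w ?h \<in> carrier_vec (d' ?h)" using assms b by auto
  have "(diag_blocks K d d' B *\<^sub>v blocks_vec K d' w) $ r =
      (\<Sum>c = 0..<blocks_dim K d'. if blk K d' c = ?h then B ?h $$ (loc K d r, loc K d' c) * w (blk K d' c) $ loc K d' c else 0)"
    using r by (auto simp: diag_blocks_def blocks_vec_def scalar_prod_def intro!: sum.cong)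
  also have "\<dots> = (\<Sum>a = 0..<d' ?h. B ?h $$ (loc K d r, a) * w ?h $ a)"
    by (rule sum_blocks_single[OF b(1)])
  finally show "(diag_blocks K d d' B *\<^sub>v blocks_vec K d' w) $ r = blocks_vec K d (\<lambda>h. B h *\<^sub>v w h) $ r"
    using Bw b r by (simp add: blocks_vec_def scalar_prod_def)
qed simp

lemma diag_row_blocks:
  assumes "\<And>h. h \<in> K \<Longrightarrow> B h \<in> carrier_mat (d h) (d' h)" "\<And>h. h \<in> K \<Longrightarrow> S h \<in> carrier_mat (d' h) m"
  shows "diag_blocks K d d' B * row_blocks K d' m S = row_blocks K d m (\<lambda>h. B h * S h)"
proof (rule eq_matI)
  fix r c assume "r < dim_row (row_blocks K d m (\<lambda>h. B h * S h))" "c < dim_col (row_blocks K d m (\<lambda>h. B h * S h))"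
  then have r: "r < blocks_dim K d" and c: "c < m" by simp_all
  note b = blk_loc[OF r]
  let ?h = "blk K d r"
  have Bw: "B ?h \<in> carrier_mat (d ?h) (d' ?h)" "S ?h \<in> carrier_mat (d' ?h) m" using assms b by auto
  have "(diag_blocks K d d' B * row_blocks K d' m S) $$ (r, c) =
      (\<Sum>l = 0..<blocks_dim K d'. if blk K d' l = ?h then B ?h $$ (loc K d r, loc K d' l) * S (blk K d' l) $$ (loc K d' l, c) else 0)"
    using r c by (auto simp: diag_blocks_def row_blocks_def scalar_prod_def intro!: sum.cong)
  also have "\<dots> = (\<Sum>a = 0..<d' ?h. B ?h $$ (loc K d r, a) * S ?h $$ (a, c))"
    by (rule sum_blocks_single[OF b(1)])
  finally show "(diag_blocks K d d' B * row_blocks K d' m S) $$ (r, c) = row_blocks K d m (\<lambda>h. B h * S h) $$ (r, c)"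
    using Bw b r c by (simp add: row_blocks_def scalar_prod_def)
qed simp_all

lemma col_diag_blocks:
  assumes "\<And>h. h \<in> K \<Longrightarrow> B h \<in> carrier_mat (d h) (d' h)" "\<And>h. h \<in> K \<Longrightarrow> X h \<in> carrier_mat m (d h)"
  shows "col_blocks K d m X * diag_blocks K d d' B = col_blocks K d' m (\<lambda>h. X h * B h)"
proof (rule eq_matI)
  fix r c assume "r < dim_row (col_blocks K d' m (\<lambda>h. X h * B h))" "c < dim_col (col_blocks K d' m (\<lambda>h. X h * B h))"
  then have c: "c < blocks_dim K d'" and r: "r < m" by simp_all
  note b = blk_loc[OF c]
  let ?h = "blk K d' c"
  have Bw: "B ?h \<in> carrier_mat (d ?h) (d' ?h)" "X ?h \<in> carrier_mat m (d ?h)" using assms b by auto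
  have "(col_blocks K d m X * diag_blocks K d d' B) $$ (r, c) =
      (\<Sum>l = 0..<blocks_dim K d. if blk K d l = ?h then X (blk K d l) $$ (r, loc K d l) * B (blk K d l) $$ (loc K d l, loc K d' c) else 0)"
    using r c by (auto simp: diag_blocks_def col_blocks_def scalar_prod_def intro!: sum.cong)
  also have "\<dots> = (\<Sum>a = 0..<d ?h. X ?h $$ (r, a) * B ?h $$ (a, loc K d' c))"
    by (rule sum_blocks_single[OF b(1)])
  finally show "(col_blocks K d m X * diag_blocks K d d' B) $$ (r, c) = col_blocks K d' m (\<lambda>h. X h * B h) $$ (r, c)"
    using Bw b r c by (simp add: col_blocks_def scalar_prod_def)
qed simp_all

lemma diag_diag_blocks:
  assumes "\<And>h. h \<in> K \<Longrightarrow> B h \<in> carrier_mat (d h) (d h)" "\<And>h. h \<in> K \<Longrightarrow> B' h \<in> carrier_mat (d h) (d h)"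
  and "\<And>h. h \<in> K \<Longrightarrow> B h * B' h = 1\<^sub>m (d h)"
  shows "diag_blocks K d d B * diag_blocks K d d B' = 1\<^sub>m (blocks_dim K d)"
proof (rule mat_eq_iff_mult_vec)
  fix u :: "complex vec" assume u: "u \<in> carrier_vec (blocks_dim K d)"
  define w where "w = (\<lambda>h\<in>K. vec (d h) (\<lambda>a. u $ idx K d h a))"
  have w: "u = blocks_vec K d w" "\<And>h. h \<in> K \<Longrightarrow> w h \<in> carrier_vec (d h)"
    using blocks_vec_surj[OF u] unfolding w_def by auto
  have "diag_blocks K d d B * diag_blocks K d d B' *\<^sub>v u = diag_blocks K d d B *\<^sub>v blocks_vec K d (\<lambda>h. B' h *\<^sub>v w h)"
    using u by (simp add: mult_mat_mult_vec w(1) diag_blocks_mult_vec[OF assms(2) w(2)])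
  also have "\<dots> = blocks_vec K d (\<lambda>h. B h *\<^sub>v (B' h *\<^sub>v w h))"
    by (rule diag_blocks_mult_vec[OF assms(1) mult_mat_vec_carrier[OF assms(2) w(2)]])
  also have "\<dots> = blocks_vec K d w"
  proof (rule blocks_vec_cong)
    fix h assume h: "h \<in> K"
    show "B h *\<^sub>v (B' h *\<^sub>v w h) = w h"
      using assoc_mult_mat_vec[OF assms(1)[OF h] assms(2)[OF h] w(2)[OF h]] assms(3)[OF h] w(2)[OF h] by simp
  qed
  finally show "diag_blocks K d d B * diag_blocks K d d B' *\<^sub>v u = 1\<^sub>m (blocks_dim K d) *\<^sub>v u"
    using w(1) u by simp
qed auto

lemma inj_diag_blocks:
  assumes B: "\<And>h. h \<in> K \<Longrightarrow> B h \<in> carrier_mat (d h) (d' h)" "\<And>h. h \<in> K \<Longrightarrow> inj_mat (B h)"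
  shows "inj_mat (diag_blocks K d d' B)"
  unfolding inj_mat_def
proof (intro ballI impI)
  fix u assume "u \<in> carrier_vec (dim_col (diag_blocks K d d' B))"
    "diag_blocks K d d' B *\<^sub>v u = 0\<^sub>v (dim_row (diag_blocks K d d' B))"
  then have u: "u \<in> carrier_vec (blocks_dim K d')" "diag_blocks K d d' B *\<^sub>v u = 0\<^sub>v (blocks_dim K d)"
    by auto
  define w where "w = (\<lambda>h\<in>K. vec (d' h) (\<lambda>a. u $ idx K d' h a))"
  have w: "u = blocks_vec K d' w" "\<And>h. h \<in> K \<Longrightarrow> w h \<in> carrier_vec (d' h)"
    using blocks_vec_surj[OF u(1)] unfolding w_def by auto
  have "blocks_vec K d (\<lambda>h. B h *\<^sub>v w h) = 0\<^sub>v (blocks_dim K d)"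
    using u(2) diag_blocks_mult_vec[OF B(1) w(2)] w(1) by simp
  also have "\<dots> = blocks_vec K d (\<lambda>h. 0\<^sub>v (d h))"
    by (rule eq_vecI) (auto simp: blocks_vec_def blk_loc)
  finally have "B h *\<^sub>v w h = 0\<^sub>v (d h)" if "h \<in> K" for h
    using blocks_vec_eqD[of d "\<lambda>h. B h *\<^sub>v w h" "\<lambda>h. 0\<^sub>v (d h)" h] that B(1)[OF that] w(2)[OF that] by auto
  then have "w h = 0\<^sub>v (d' h)" if "h \<in> K" for h
    using inj_matD[OF B(2)[OF that] B(1)[OF that] w(2)[OF that]] that by blast
  then have "u = blocks_vec K d' (\<lambda>h. 0\<^sub>v (d' h))" unfolding w(1) by (rule blocks_vec_cong)
  also have "\<dots> = 0\<^sub>v (blocks_dim K d')"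
    by (rule eq_vecI) (auto simp: blocks_vec_def blk_loc)
  finally show "u = 0\<^sub>v (dim_col (diag_blocks K d d' B))" by simp
qed

text \<open>A block diagonal factor does not mix labels, so it commutes with truncation. This lets a
  change of basis at the other vertices pass through U.\<close>

lemma upper_diag_blocks_left:
  assumes M: "M \<in> carrier_mat (blocks_dim K d) (blocks_dim K d)"
  shows "upper_blocks K d ord (diag_blocks K d d B * M) = diag_blocks K d d B * upper_blocks K d ord M"
proof (rule eq_matI)
  fix r c assume "r < dim_row (diag_blocks K d d B * upper_blocks K d ord M)" "c < dim_col (diag_blocks K d d B * upper_blocks K d ord M)"
  then have rc: "r < blocks_dim K d" "c < blocks_dim K d" by simp_all
  show "upper_blocks K d ord (diag_blocks K d d B * M) $$ (r, c) = (diag_blocks K d d B * upper_blocks K d ord M) $$ (r, c)"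
    using rc M by (auto simp: upper_blocks_def diag_blocks_def scalar_prod_def intro!: sum.cong sum.neutral)
qed simp_all

lemma upper_diag_blocks_right:
  assumes M: "M \<in> carrier_mat (blocks_dim K d) (blocks_dim K d)"
  shows "upper_blocks K d ord (M * diag_blocks K d d B) = upper_blocks K d ord M * diag_blocks K d d B"
proof (rule eq_matI)
  fix r c assume "r < dim_row (upper_blocks K d ord M * diag_blocks K d d B)" "c < dim_col (upper_blocks K d ord M * diag_blocks K d d B)"
  then have rc: "r < blocks_dim K d" "c < blocks_dim K d" by simp_all
  show "upper_blocks K d ord (M * diag_blocks K d d B) $$ (r, c) = (upper_blocks K d ord M * diag_blocks K d d B) $$ (r, c)"
    using rc M by (auto simp: upper_blocks_def diag_blocks_def scalar_prod_def intro!: sum.cong sum.neutral)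
qed simp_all

text \<open>Nilpotence of a strictly triangular matrix in a form that avoids powers: each column
  block of \<open>Y\<close> is a combination of earlier ones, so all vanish in the order of their
  labels. Hence 1 - U can be cancelled on the right without constructing its inverse.\<close>

lemma upper_blocks_fixpoint_zero:
  assumes ord: "strict_linear_order_on H ord" "K \<subseteq> H"
    and Y: "Y \<in> carrier_mat m (blocks_dim K d)" and eq: "Y = Y * upper_blocks K d ord U"
  shows "Y = 0\<^sub>m m (blocks_dim K d)"
proof -
  \<comment> \<open>The induction runs over initial segments of \<open>K\<close>; the set
    \<open>K\<close> itself is the final case.\<close>
  have col: "\<forall>c<blocks_dim K d. blk K d c \<in> A \<longrightarrow> (\<forall>r<m. Y $$ (r, c) = 0)"
    if "A \<subseteq> K" "\<And>h h'. h \<in> A \<Longrightarrow> h' \<in> K \<Longrightarrow> (h', h) \<in> ord \<Longrightarrow> h' \<in> A" for A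
  proof -
    have "finite A" "A \<subseteq> H" using that(1) K ord(2) finite_subset by blast+
    from \<open>finite A\<close> ord(1) \<open>A \<subseteq> H\<close> that show ?thesis
    proof (induction A rule: finite_linear_order_max_induct)
      case (insert A k)
      have irr: "(a, a) \<notin> ord" for a using ord unfolding strict_linear_order_on_def irrefl_def by blast
      have asym: "(b, a) \<notin> ord" if "(a, b) \<in> ord" for a b
        using that irr ord unfolding strict_linear_order_on_def by (metis transD)
      have IH: "\<forall>c<blocks_dim K d. blk K d c \<in> A \<longrightarrow> (\<forall>r<m. Y $$ (r, c) = 0)"
      proof (rule insert.IH)
        show "A \<subseteq> K" using insert(5) by blast
        show "h' \<in> A" if "h \<in> A" "h' \<in> K" "(h', h) \<in> ord" for h h'
          using insert(3)[OF that(1)] insert(6)[of h h'] that asym by blast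
      qed
      have "Y $$ (r, c) = 0" if c: "c < blocks_dim K d" "blk K d c = k" and r: "r < m" for r c
      proof -
        have "Y $$ (r, c) = (Y * upper_blocks K d ord U) $$ (r, c)" using eq by simp
        also have "\<dots> = (\<Sum>l = 0..<blocks_dim K d. Y $$ (r, l) * upper_blocks K d ord U $$ (l, c))"
          using Y r c(1) by (simp add: scalar_prod_def)
        also have "\<dots> = 0"
        proof (rule sum.neutral, intro ballI)
          fix l assume "l \<in> {0..<blocks_dim K d}"
          then have l: "l < blocks_dim K d" by simp
          show "Y $$ (r, l) * upper_blocks K d ord U $$ (l, c) = 0"
          proof (cases "(blk K d l, k) \<in> ord")
            case True
            then have "blk K d l \<in> insert k A" using insert(6)[of k] blk_loc(1)[OF l] by blast
            then have "blk K d l \<in> A" using True irr by blast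
            then show ?thesis using IH l r by simp
          next
            case False
            then show ?thesis using l c by (simp add: upper_blocks_def)
          qed
        qed
        finally show ?thesis .
      qed
      then show ?case using IH by blast
    qed simp
  qed
  show ?thesis
    by (rule eq_matI) (use col[of K] Y blk_loc(1)[of _ d] in auto)
qed

end

context
  fixes K :: "'h set"
  assumes K: "finite K"
begin

lemma mult_col_blocks:
  assumes a: "a \<in> carrier_mat m' m" and X: "\<And>h. h \<in> K \<Longrightarrow> X h \<in> carrier_mat m (d h)"
  shows "a * col_blocks K d m X = col_blocks K d m' (\<lambda>h. a * X h)"
proof (rule eq_matI)
  fix r c assume "r < dim_row (col_blocks K d m' (\<lambda>h. a * X h))" "c < dim_col (col_blocks K d m' (\<lambda>h. a * X h))"
  then have rc: "r < m'" "c < blocks_dim K d" by simp_all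
  note b = blk_loc[OF K rc(2)]
  have "X (blk K d c) \<in> carrier_mat m (d (blk K d c))" using X b by blast
  then show "(a * col_blocks K d m X) $$ (r, c) = col_blocks K d m' (\<lambda>h. a * X h) $$ (r, c)"
    using rc a b by (simp add: col_blocks_def scalar_prod_def)
qed (use a in simp_all)

lemma mult_row_blocks:
  assumes a: "a \<in> carrier_mat m m'" and S: "\<And>h. h \<in> K \<Longrightarrow> S h \<in> carrier_mat (d h) m"
  shows "row_blocks K d m S * a = row_blocks K d m' (\<lambda>h. S h * a)"
proof (rule eq_matI)
  fix r c assume "r < dim_row (row_blocks K d m' (\<lambda>h. S h * a))" "c < dim_col (row_blocks K d m' (\<lambda>h. S h * a))"
  then have rc: "r < blocks_dim K d" "c < m'" by simp_all
  note b = blk_loc[OF K rc(1)]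
  have "S (blk K d r) \<in> carrier_mat (d (blk K d r)) m" using S b by blast
  then show "(row_blocks K d m S * a) $$ (r, c) = row_blocks K d m' (\<lambda>h. S h * a) $$ (r, c)"
    using rc a b by (simp add: row_blocks_def scalar_prod_def)
qed (use a in simp_all)

lemma col_blocks_eq_iff:
  assumes X: "\<And>h. h \<in> K \<Longrightarrow> X h \<in> carrier_mat m (d h)" and Y: "\<And>h. h \<in> K \<Longrightarrow> Y h \<in> carrier_mat m (d h)"
  shows "col_blocks K d m X = col_blocks K d m Y \<longleftrightarrow> (\<forall>h\<in>K. X h = Y h)"
proof (intro iffI ballI)
  fix h assume eq: "col_blocks K d m X = col_blocks K d m Y" and h: "h \<in> K"
  show "X h = Y h"
  proof (rule eq_matI)
    fix r c assume "r < dim_row (Y h)" "c < dim_col (Y h)"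
    then have rc: "r < m" "c < d h" using Y[OF h] by auto
    have "col_blocks K d m X $$ (r, idx K d h c) = col_blocks K d m Y $$ (r, idx K d h c)" using eq by simp
    then show "X h $$ (r, c) = Y h $$ (r, c)"
      using rc idx[OF K h, of c d] by (simp add: col_blocks_def)
  qed (use X[OF h] Y[OF h] in auto)
next
  assume "\<forall>h\<in>K. X h = Y h"
  then show "col_blocks K d m X = col_blocks K d m Y"
    by (intro eq_matI) (auto simp: col_blocks_def blk_loc[OF K])
qed

lemma row_blocks_eq_iff:
  assumes X: "\<And>h. h \<in> K \<Longrightarrow> X h \<in> carrier_mat (d h) m" and Y: "\<And>h. h \<in> K \<Longrightarrow> Y h \<in> carrier_mat (d h) m"
  shows "row_blocks K d m X = row_blocks K d m Y \<longleftrightarrow> (\<forall>h\<in>K. X h = Y h)"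
proof (intro iffI ballI)
  fix h assume eq: "row_blocks K d m X = row_blocks K d m Y" and h: "h \<in> K"
  show "X h = Y h"
  proof (rule eq_matI)
    fix r c assume "r < dim_row (Y h)" "c < dim_col (Y h)"
    then have rc: "r < d h" "c < m" using Y[OF h] by auto
    have "row_blocks K d m X $$ (idx K d h r, c) = row_blocks K d m Y $$ (idx K d h r, c)" using eq by simp
    then show "X h $$ (r, c) = Y h $$ (r, c)"
      using rc idx[OF K h, of r d] by (simp add: row_blocks_def)
  qed (use X[OF h] Y[OF h] in auto)
next
  assume "\<forall>h\<in>K. X h = Y h"
  then show "row_blocks K d m X = row_blocks K d m Y"
    by (intro eq_matI) (auto simp: row_blocks_def blk_loc[OF K])
qed

end

lemma lin_subspace_col_blocks:
  assumes W: "lin_subspace m W" and K: "finite K"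
    and X: "\<And>h. h \<in> K \<Longrightarrow> X h \<in> carrier_mat m (d h)" "\<And>h. h \<in> K \<Longrightarrow> f h \<in> carrier_vec (d h)"
    and mem: "\<And>h. h \<in> K \<Longrightarrow> X h *\<^sub>v f h \<in> W"
  shows "col_blocks K d m X *\<^sub>v blocks_vec K d f \<in> W"
proof -
  have Wc: "X h *\<^sub>v f h \<in> carrier_vec m" if "h \<in> K" for h
    using mem[OF that] W unfolding lin_subspace_iff by blast
  have part: "vec m (\<lambda>r. \<Sum>h\<in>A. (X h *\<^sub>v f h) $ r) \<in> W" if "A \<subseteq> K" for A
    using finite_subset[OF that K] that
  proof (induction A)
    case empty
    have "vec m (\<lambda>r. \<Sum>h\<in>{}. (X h *\<^sub>v f h) $ r) = 0\<^sub>v m" by (intro eq_vecI) auto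
    then show ?case using W unfolding lin_subspace_iff by simp
  next
    case (insert h A)
    have "vec m (\<lambda>r. \<Sum>h\<in>insert h A. (X h *\<^sub>v f h) $ r) = X h *\<^sub>v f h + vec m (\<lambda>r. \<Sum>h\<in>A. (X h *\<^sub>v f h) $ r)"
      using insert Wc[of h] by (intro eq_vecI) (auto simp del: index_mult_mat_vec)
    then show ?case using insert mem[of h] W unfolding lin_subspace_iff by auto
  qed
  have "col_blocks K d m X *\<^sub>v blocks_vec K d f = vec m (\<lambda>r. \<Sum>h\<in>K. (X h *\<^sub>v f h) $ r)"
    using col_blocks_mult_vec[OF K X] by (intro eq_vecI) auto
  then show ?thesis using part[of K] by simp
qed

section \<open>The maps at a vertex\<close>

lemma opp_opp [simp]: "opp (opp h) = h" by (cases h) auto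
lemma in_v_opp [simp]: "in_v Q (opp h) = out_v Q h" by (cases h) auto
lemma out_v_opp [simp]: "out_v Q (opp h) = in_v Q h" by (cases h) auto
lemma opp_darrows [simp]: "opp h \<in> darrows Q \<longleftrightarrow> h \<in> darrows Q"
  by (cases h) (auto simp: darrows_def)
lemma eps_opp: "eps (opp h) = - eps h" by (cases h) auto

text \<open>By \<open>in_arrows_Inl\<close> all exponents at the vertex \<open>i\<close> are 1, so
  its moment map is a product without inverses; the arrows leaving \<open>i\<close> are reverses and
  carry the exponent -1 at their targets.\<close>

locale quiver_vertex =
  fixes Q :: "('v, 'a) pre_digraph" and ord :: "('a + 'a) rel" and i :: 'v and v :: "'v \<Rightarrow> nat"
  assumes fin_Q: "fin_digraph Q"
    and ord: "strict_linear_order_on (darrows Q) ord"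
    and i: "i \<in> verts Q" and loop_free: "loop_free Q i"
    and in_arrows_Inl: "in_arrows Q i \<subseteq> Inl ` arcs Q"
begin

abbreviation Hi where "Hi \<equiv> in_arrows Q i"
abbreviation d where "d \<equiv> (\<lambda>h. v (out_v Q h))"
abbreviation N where "N \<equiv> blocks_dim Hi d"
abbreviation up where "up \<equiv> upper_blocks Hi d ord"

lemma finite_darrows: "finite (darrows Q)"
  using fin_Q unfolding darrows_def fin_digraph_def fin_digraph_axioms_def by auto

lemma Hi_darrows: "Hi \<subseteq> darrows Q" by (auto simp: in_arrows_def)

lemma finite_Hi: "finite Hi" using finite_subset[OF Hi_darrows finite_darrows] .

lemma in_v_Hi: "h \<in> Hi \<Longrightarrow> in_v Q h = i" by (auto simp: in_arrows_def)

lemma out_v_Hi: "h \<in> Hi \<Longrightarrow> out_v Q h \<noteq> i"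
  using loop_free by (auto simp: in_arrows_def loop_free_def)

lemma in_v_verts: "h \<in> darrows Q \<Longrightarrow> in_v Q h \<in> verts Q"
proof -
  interpret fin_digraph Q by (rule fin_Q)
  show "h \<in> darrows Q \<Longrightarrow> in_v Q h \<in> verts Q" by (cases h) (auto simp: darrows_def)
qed

lemma out_v_verts: "h \<in> darrows Q \<Longrightarrow> out_v Q h \<in> verts Q"
  using in_v_verts[of "opp h"] by simp

lemma out_v_Hi_verts: "h \<in> Hi \<Longrightarrow> out_v Q h \<in> verts Q - {i}"
  using out_v_Hi out_v_verts Hi_darrows by blast

lemma eps_Hi: "h \<in> Hi \<Longrightarrow> eps h = 1"
  using in_arrows_Inl by auto

lemma opp_notin_Hi: "h \<in> Hi \<Longrightarrow> opp h \<notin> Hi"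
  using in_v_Hi[of "opp h"] out_v_Hi[of h] by auto

lemma darrows_cases [consumes 1, case_names in_i out_i other]:
  assumes "h \<in> darrows Q"
  obtains "h \<in> Hi" | k where "k \<in> Hi" "h = opp k" | "h \<in> darrows Q - (Hi \<union> opp ` Hi)"
  using assms by blast

lemma other_not_i: "h \<in> darrows Q - (Hi \<union> opp ` Hi) \<Longrightarrow> in_v Q h \<noteq> i \<and> out_v Q h \<noteq> i"
proof -
  assume h: "h \<in> darrows Q - (Hi \<union> opp ` Hi)"
  then have "in_v Q h \<noteq> i" by (auto simp: in_arrows_def)
  moreover have "out_v Q h \<noteq> i"
  proof
    assume "out_v Q h = i"
    then have "opp h \<in> Hi" using h by (auto simp: in_arrows_def)
    then have "opp (opp h) \<in> opp ` Hi" by blast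
    then show False using h by simp
  qed
  ultimately show ?thesis by blast
qed

text \<open>Used for \<open>w = v\<close> and \<open>w = v'\<close>, so that statements about \<open>w\<close> cover both sides of the correspondence.\<close>

definition adm :: "('v \<Rightarrow> nat) \<Rightarrow> bool" where
  "adm w \<longleftrightarrow> (\<forall>j\<in>verts Q - {i}. w j = v j)"

lemma adm_d: "adm w \<Longrightarrow> h \<in> Hi \<Longrightarrow> w (out_v Q h) = d h"
  using out_v_Hi_verts unfolding adm_def by blast

text \<open>The block sizes are always taken from \<open>v\<close>, also when the dimension vector
  \<open>w\<close> is the reflected one, so that the maps of both sides meet in the same space of
  dimension \<open>N\<close>.\<close>

definition sigma_mat :: "('v \<Rightarrow> nat) \<Rightarrow> ('a + 'a \<Rightarrow> complex mat) \<Rightarrow> complex mat" where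
  "sigma_mat w x = row_blocks Hi d (w i) (\<lambda>h. x (opp h))"

definition in_mat :: "('v \<Rightarrow> nat) \<Rightarrow> ('a + 'a \<Rightarrow> complex mat) \<Rightarrow> complex mat" where
  "in_mat w x = col_blocks Hi d (w i) x"

definition tau_mat :: "('v \<Rightarrow> nat) \<Rightarrow> ('a + 'a \<Rightarrow> complex mat) \<Rightarrow> complex mat" where
  "tau_mat w x = col_blocks Hi d (w i) (\<lambda>h. partial_prod Q ord i w x h * x h)"

lemma vertex_mats_carrier [simp]:
  "sigma_mat w x \<in> carrier_mat N (w i)" "in_mat w x \<in> carrier_mat (w i) N" "tau_mat w x \<in> carrier_mat (w i) N"
  by (simp_all add: sigma_mat_def in_mat_def tau_mat_def)

lemmas vertex_mats_dims [simp] =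
  vertex_mats_carrier[THEN carrier_matD(1)] vertex_mats_carrier[THEN carrier_matD(2)]

context
  fixes w x
  assumes w: "adm w" and x: "x \<in> reps Q w"
begin

lemma x_carrier: "h \<in> darrows Q \<Longrightarrow> x h \<in> carrier_mat (w (in_v Q h)) (w (out_v Q h))"
  using x by (auto simp: reps_def)

lemma x_in_carrier: "h \<in> Hi \<Longrightarrow> x h \<in> carrier_mat (w i) (d h)"
  using x_carrier[of h] adm_d[OF w] Hi_darrows in_v_Hi by auto

lemma x_out_carrier: "h \<in> Hi \<Longrightarrow> x (opp h) \<in> carrier_mat (d h) (w i)"
  using x_carrier[of "opp h"] adm_d[OF w] Hi_darrows in_v_Hi by auto

lemma one_plus_Hi: "h \<in> Hi \<Longrightarrow> one_plus Q w x h = 1\<^sub>m (w i) + x h * x (opp h)"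
  by (simp add: one_plus_def in_v_Hi)

lemma one_plus_carrier: "h \<in> darrows Q \<Longrightarrow> one_plus Q w x h \<in> carrier_mat (w (in_v Q h)) (w (in_v Q h))"
  using x_carrier[of h] x_carrier[of "opp h"] by (simp add: one_plus_def)

lemma one_plus_Hi_carrier: "h \<in> Hi \<Longrightarrow> one_plus Q w x h \<in> carrier_mat (w i) (w i)"
  using one_plus_carrier[of h] Hi_darrows in_v_Hi by auto

lemma partial_prod_carrier: "partial_prod Q ord i w x h \<in> carrier_mat (w i) (w i)"
  unfolding partial_prod_def
  using finite_Hi Hi_darrows one_plus_Hi_carrier by (intro ordered_prod_carrier[OF ord]) auto

text \<open>Telescoping over the predecessors of \<open>h\<close>, which form an initial segment by
  transitivity.\<close>

lemma partial_prod_entry: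
  assumes h: "h \<in> Hi" and rc: "r < w i" "c < w i"
  shows "partial_prod Q ord i w x h $$ (r, c) = (1\<^sub>m (w i) :: complex mat) $$ (r, c) +
    (\<Sum>k | k \<in> Hi \<and> (k, h) \<in> ord. (partial_prod Q ord i w x k * (x k * x (opp k))) $$ (r, c))"
proof -
  have pp: "partial_prod Q ord i w x k =
      ordered_prod ord (w i) (\<lambda>h. 1\<^sub>m (w i) + x h * x (opp h)) {h' \<in> Hi. (h', k) \<in> ord}" for k
    unfolding partial_prod_def
    using finite_Hi Hi_darrows one_plus_Hi by (intro ordered_prod_cong[OF ord]) auto
  show ?thesis
    unfolding pp using finite_Hi Hi_darrows h rc ord mult_carrier_mat[OF x_in_carrier x_out_carrier]
    by (intro ordered_prod_one_plus_telescope[OF ord])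
      (auto simp: strict_linear_order_on_def elim: transE)
qed

lemma moment_map_i_entry:
  assumes rc: "r < w i" "c < w i"
  shows "moment_map Q ord w x i $$ (r, c) = (1\<^sub>m (w i) :: complex mat) $$ (r, c) +
    (\<Sum>k\<in>Hi. (partial_prod Q ord i w x k * (x k * x (opp k))) $$ (r, c))"
proof -
  have pp: "partial_prod Q ord i w x k =
      ordered_prod ord (w i) (\<lambda>h. 1\<^sub>m (w i) + x h * x (opp h)) {h' \<in> Hi. (h', k) \<in> ord}" for k
    unfolding partial_prod_def
    using finite_Hi Hi_darrows one_plus_Hi by (intro ordered_prod_cong[OF ord]) auto
  have "moment_map Q ord w x i = ordered_prod ord (w i) (\<lambda>h. 1\<^sub>m (w i) + x h * x (opp h)) Hi"
    unfolding moment_map_def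
    using finite_Hi Hi_darrows one_plus_Hi one_plus_Hi_carrier
    by (intro ordered_prod_cong[OF ord]) (auto simp: eps_Hi GL_pow_one)
  then show ?thesis
    unfolding pp using finite_Hi Hi_darrows rc mult_carrier_mat[OF x_in_carrier x_out_carrier]
    by (simp only:) (intro ordered_prod_one_plus_telescope[OF ord], auto)
qed

lemma tau_block_carrier: "h \<in> Hi \<Longrightarrow> partial_prod Q ord i w x h * x h \<in> carrier_mat (w i) (d h)"
  by (rule mult_carrier_mat[OF partial_prod_carrier x_in_carrier])

lemma tau_sigma_term:
  "h \<in> Hi \<Longrightarrow> partial_prod Q ord i w x h * x h * x (opp h) = partial_prod Q ord i w x h * (x h * x (opp h))"
  by (rule assoc_mult_mat[OF partial_prod_carrier x_in_carrier x_out_carrier])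

lemma moment_map_i: "moment_map Q ord w x i = 1\<^sub>m (w i) + tau_mat w x * sigma_mat w x"
proof (rule eq_matI)
  have "moment_map Q ord w x i \<in> carrier_mat (w i) (w i)"
    unfolding moment_map_def using finite_Hi Hi_darrows one_plus_Hi_carrier
    by (intro ordered_prod_carrier[OF ord]) (auto simp: eps_Hi GL_pow_one)
  then show "dim_row (moment_map Q ord w x i) = dim_row (1\<^sub>m (w i) + tau_mat w x * sigma_mat w x)"
    "dim_col (moment_map Q ord w x i) = dim_col (1\<^sub>m (w i) + tau_mat w x * sigma_mat w x)" by auto
  fix r c assume "r < dim_row (1\<^sub>m (w i) + tau_mat w x * sigma_mat w x)"
    "c < dim_col (1\<^sub>m (w i) + tau_mat w x * sigma_mat w x)"
  then have rc: "r < w i" "c < w i" by simp_all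
  have "(tau_mat w x * sigma_mat w x) $$ (r, c) =
      (\<Sum>h\<in>Hi. (partial_prod Q ord i w x h * x h * x (opp h)) $$ (r, c))"
    unfolding tau_mat_def sigma_mat_def
    using col_row_blocks_entry[OF finite_Hi x_out_carrier tau_block_carrier rc] by simp
  then show "moment_map Q ord w x i $$ (r, c) = (1\<^sub>m (w i) + tau_mat w x * sigma_mat w x) $$ (r, c)"
    using rc by (simp add: moment_map_i_entry tau_sigma_term del: index_mult_mat(1))
qed

lemma tau_sigma_of_moment_map:
  assumes m: "moment_map Q ord w x i = c \<cdot>\<^sub>m 1\<^sub>m (w i)"
  shows "tau_mat w x * sigma_mat w x = (c - 1) \<cdot>\<^sub>m 1\<^sub>m (w i)"
proof (rule eq_matI)
  fix r k assume "r < dim_row ((c - 1) \<cdot>\<^sub>m 1\<^sub>m (w i))" "k < dim_col ((c - 1) \<cdot>\<^sub>m 1\<^sub>m (w i))"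
  then show "(tau_mat w x * sigma_mat w x) $$ (r, k) = ((c - 1) \<cdot>\<^sub>m 1\<^sub>m (w i)) $$ (r, k)"
    using arg_cong[OF moment_map_i[unfolded m], of "\<lambda>A. A $$ (r, k)"]
    by (simp add: algebra_simps del: index_mult_mat(1))
qed auto

text \<open>In a column with label k, truncation keeps the terms of \<tau>\<sigma> from arrows
  before k; by telescoping they add up to the partial product at k minus 1, applied to the column of
  \<open>Y\<close>. The matrix \<open>Y\<close> is arbitrary here because the formula also serves to
  show that X is unique.\<close>

lemma tau_upper_entry:
  assumes Y: "Y \<in> carrier_mat (w i) N" and r: "r < w i" and c: "c < N"
  shows "(tau_mat w x * up (sigma_mat w x * Y)) $$ (r, c) =
    (partial_prod Q ord i w x (blk Hi d c) *\<^sub>v col Y c) $ r - Y $$ (r, c)"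
proof -
  let ?k = "blk Hi d c"
  have k: "?k \<in> Hi" using blk_loc(1)[OF finite_Hi c] .
  have part: "(\<Sum>l = 0..<N. if (blk Hi d l, ?k) \<in> ord then tau_mat w x $$ (r, l) * sigma_mat w x $$ (l, s) else 0) =
      partial_prod Q ord i w x ?k $$ (r, s) - (1\<^sub>m (w i) :: complex mat) $$ (r, s)" if s: "s < w i" for s
  proof -
    have "(\<Sum>l = 0..<N. if (blk Hi d l, ?k) \<in> ord then tau_mat w x $$ (r, l) * sigma_mat w x $$ (l, s) else 0) =
      (\<Sum>l = 0..<N. (\<lambda>h a. if (h, ?k) \<in> ord then
         (partial_prod Q ord i w x h * x h) $$ (r, a) * x (opp h) $$ (a, s) else 0) (blk Hi d l) (loc Hi d l))"
      using r s by (intro sum.cong) (auto simp: tau_mat_def sigma_mat_def row_blocks_def col_blocks_def simp del: index_mult_mat(1))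
    also have "\<dots> = (\<Sum>h\<in>Hi. \<Sum>a = 0..<d h. if (h, ?k) \<in> ord then
         (partial_prod Q ord i w x h * x h) $$ (r, a) * x (opp h) $$ (a, s) else 0)"
      by (rule sum_blocks[OF finite_Hi])
    also have "\<dots> = (\<Sum>h\<in>Hi. if (h, ?k) \<in> ord then
         (partial_prod Q ord i w x h * (x h * x (opp h))) $$ (r, s) else 0)"
    proof (rule sum.cong[OF refl])
      fix h assume h: "h \<in> Hi"
      have "(partial_prod Q ord i w x h * x h * x (opp h)) $$ (r, s) =
          (\<Sum>a = 0..<d h. (partial_prod Q ord i w x h * x h) $$ (r, a) * x (opp h) $$ (a, s))"
        by (rule mult_mat_entry[OF tau_block_carrier[OF h] x_out_carrier[OF h] r s])
      then show "(\<Sum>a = 0..<d h. if (h, ?k) \<in> ord then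
          (partial_prod Q ord i w x h * x h) $$ (r, a) * x (opp h) $$ (a, s) else 0) =
          (if (h, ?k) \<in> ord then (partial_prod Q ord i w x h * (x h * x (opp h))) $$ (r, s) else 0)"
        using tau_sigma_term[OF h] by simp
    qed
    also have "\<dots> = (\<Sum>h | h \<in> Hi \<and> (h, ?k) \<in> ord. (partial_prod Q ord i w x h * (x h * x (opp h))) $$ (r, s))"
      using finite_Hi by (simp add: sum.inter_filter)
    finally show ?thesis using partial_prod_entry[OF k r s] by simp
  qed
  have "(tau_mat w x * up (sigma_mat w x * Y)) $$ (r, c) =
      (\<Sum>l = 0..<N. tau_mat w x $$ (r, l) * (if (blk Hi d l, ?k) \<in> ord then
        (\<Sum>s = 0..<w i. sigma_mat w x $$ (l, s) * Y $$ (s, c)) else 0))"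
    using r c Y by (auto simp: upper_blocks_def scalar_prod_def intro!: sum.cong)
  also have "\<dots> = (\<Sum>l = 0..<N. \<Sum>s = 0..<w i. (if (blk Hi d l, ?k) \<in> ord then
        tau_mat w x $$ (r, l) * sigma_mat w x $$ (l, s) else 0) * Y $$ (s, c))"
    by (intro sum.cong) (auto simp: sum_distrib_left mult.assoc)
  also have "\<dots> = (\<Sum>s = 0..<w i. \<Sum>l = 0..<N. (if (blk Hi d l, ?k) \<in> ord then
        tau_mat w x $$ (r, l) * sigma_mat w x $$ (l, s) else 0) * Y $$ (s, c))"
    by (rule sum.swap)
  also have "\<dots> = (\<Sum>s = 0..<w i.
      (partial_prod Q ord i w x ?k $$ (r, s) - (1\<^sub>m (w i) :: complex mat) $$ (r, s)) * Y $$ (s, c))"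
    using part by (intro sum.cong) (auto simp: sum_distrib_right[symmetric])
  also have "\<dots> = (\<Sum>s = 0..<w i. partial_prod Q ord i w x ?k $$ (r, s) * Y $$ (s, c)) -
      (\<Sum>s = 0..<w i. (1\<^sub>m (w i) :: complex mat) $$ (r, s) * Y $$ (s, c))"
    by (simp add: left_diff_distrib sum_subtractf)
  also have "(\<Sum>s = 0..<w i. (1\<^sub>m (w i) :: complex mat) $$ (r, s) * Y $$ (s, c)) = Y $$ (r, c)"
    using r by (simp add: if_distrib[of "\<lambda>t. t * _"] sum.delta cong: if_cong)
  also have "(\<Sum>s = 0..<w i. partial_prod Q ord i w x ?k $$ (r, s) * Y $$ (s, c)) =
      (partial_prod Q ord i w x ?k *\<^sub>v col Y c) $ r"
    using r c Y partial_prod_carrier[of ?k] by (simp add: scalar_prod_def)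
  finally show ?thesis .
qed

lemma tau_mat_entry:
  assumes r: "r < w i" and c: "c < N"
  shows "tau_mat w x $$ (r, c) = (partial_prod Q ord i w x (blk Hi d c) *\<^sub>v col (in_mat w x) c) $ r"
proof -
  let ?k = "blk Hi d c"
  have k: "?k \<in> Hi" "loc Hi d c < d ?k" using blk_loc[OF finite_Hi c] by auto
  have "col (in_mat w x) c = col (x ?k) (loc Hi d c)"
    using x_in_carrier[OF k(1)] c k(2) by (intro eq_vecI) (auto simp: in_mat_def col_blocks_def)
  then show ?thesis
    using r c k x_in_carrier[OF k(1)] partial_prod_carrier[of ?k]
    by (simp add: tau_mat_def col_blocks_def)
qed

text \<open>For Y = X the partial product applied to a column of X is the column of \<tau>, so the
  formula for the truncated product reads \<tau>U = \<tau> - X.\<close>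

lemma tau_mat_eq: "tau_mat w x = in_mat w x + tau_mat w x * up (sigma_mat w x * in_mat w x)"
  by (rule eq_matI) (auto simp: tau_mat_entry tau_upper_entry simp del: index_mult_mat(1) index_mult_mat_vec)

lemma in_mat_eq: "in_mat w x = tau_mat w x * (1\<^sub>m N - up (sigma_mat w x * in_mat w x))"
proof (rule eq_matI)
  let ?U = "up (sigma_mat w x * in_mat w x)"
  fix r c assume "r < dim_row (tau_mat w x * (1\<^sub>m N - ?U))" "c < dim_col (tau_mat w x * (1\<^sub>m N - ?U))"
  then have rc: "r < w i" "c < N" by auto
  from arg_cong[OF tau_mat_eq, of "\<lambda>A. A $$ (r, c)"]
  show "in_mat w x $$ (r, c) = (tau_mat w x * (1\<^sub>m N - ?U)) $$ (r, c)"
    using rc by (simp add: mat_ring del: index_mult_mat(1))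
qed auto

text \<open>The equation is implicit, since the truncated matrix contains \<open>Y\<close>. Column
  by column it says that the partial product takes the same value on the columns of \<open>Y\<close>
  and of X, and the determinant conditions make partial products invertible. Thus \<sigma> and
  \<tau> determine the incoming arrows.\<close>

lemma in_mat_unique:
  assumes Y: "Y \<in> carrier_mat (w i) N" and eq: "tau_mat w x = Y + tau_mat w x * up (sigma_mat w x * Y)"
    and det: "\<And>h. h \<in> Hi \<Longrightarrow> det (one_plus Q w x h) \<noteq> 0"
  shows "Y = in_mat w x"
proof (rule eq_matI)
  fix r c assume "r < dim_row (in_mat w x)" "c < dim_col (in_mat w x)"
  then have r: "r < w i" and c: "c < N" by simp_all
  let ?P = "partial_prod Q ord i w x (blk Hi d c)"
  have "det ?P \<noteq> 0"
    unfolding partial_prod_def using finite_Hi Hi_darrows one_plus_Hi_carrier det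
    by (intro ordered_prod_det_nonzero[OF ord]) auto
  then have inj: "inj_mat ?P"
    using inj_mat_left_inverse[OF partial_prod_carrier mat_inv(1,3)[OF partial_prod_carrier]] by blast
  have eq_c: "?P *\<^sub>v col Y c = ?P *\<^sub>v col (in_mat w x) c"
  proof (rule eq_vecI)
    fix r assume "r < dim_vec (?P *\<^sub>v col (in_mat w x) c)"
    then have r: "r < w i" using partial_prod_carrier[of "blk Hi d c"] by simp
    have "tau_mat w x $$ (r, c) = (Y + tau_mat w x * up (sigma_mat w x * Y)) $$ (r, c)" using eq by simp
    also have "\<dots> = (?P *\<^sub>v col Y c) $ r"
      using tau_upper_entry[OF Y r c] r c Y by (simp del: index_mult_mat(1) index_mult_mat_vec)
    finally show "(?P *\<^sub>v col Y c) $ r = (?P *\<^sub>v col (in_mat w x) c) $ r"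
      using tau_mat_entry[OF r c] by simp
  qed simp
  have "col Y c = col (in_mat w x) c"
    by (rule inj_mat_right_factor_vec[OF partial_prod_carrier inj col_carrier_vec[OF c Y]
          col_carrier_vec[OF c vertex_mats_carrier(2)] eq_c])
  then have "col Y c $ r = col (in_mat w x) c $ r" by simp
  then show "Y $$ (r, c) = in_mat w x $$ (r, c)"
    using r c Y by simp
qed (use Y in auto)

lemma sigma_in_entry:
  assumes "r < N" "c < N"
  shows "(sigma_mat w x * in_mat w x) $$ (r, c) = (x (opp (blk Hi d r)) * x (blk Hi d c)) $$ (loc Hi d r, loc Hi d c)"
  unfolding sigma_mat_def in_mat_def
  by (rule row_col_blocks_entry[OF finite_Hi x_out_carrier x_in_carrier assms])

lemma sigma_conv:
  assumes "u \<in> carrier_vec (w i)"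
  shows "sigma_mat w x *\<^sub>v u = blocks_vec Hi d (sigma Q i x u)"
proof -
  have "sigma_mat w x *\<^sub>v u = blocks_vec Hi d (\<lambda>h. x (opp h) *\<^sub>v u)"
    unfolding sigma_mat_def by (rule row_blocks_mult_vec[OF finite_Hi x_out_carrier assms])
  also have "\<dots> = blocks_vec Hi d (sigma Q i x u)"
    by (rule blocks_vec_cong[OF finite_Hi]) (simp add: sigma_def)
  finally show ?thesis .
qed

lemma sigma_Vhat:
  assumes "u \<in> carrier_vec (w i)"
  shows "sigma Q i x u \<in> Vhat Q i v"
  using mult_mat_vec_carrier[OF x_out_carrier assms] by (auto simp: sigma_def Vhat_def)

lemma tau_conv:
  assumes f: "f \<in> Vhat Q i v"
  shows "tau Q ord i w x f = tau_mat w x *\<^sub>v blocks_vec Hi d f"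
proof (rule eq_vecI)
  have fc: "f h \<in> carrier_vec (d h)" if "h \<in> Hi" for h using f that by (auto simp: Vhat_def)
  have car: "(partial_prod Q ord i w x h * x h) *\<^sub>v f h \<in> carrier_vec (w i)" if "h \<in> Hi" for h
    using tau_block_carrier[OF that] fc[OF that] by (rule mult_mat_vec_carrier)
  show "dim_vec (tau Q ord i w x f) = dim_vec (tau_mat w x *\<^sub>v blocks_vec Hi d f)"
    unfolding tau_def using finsum_vec_closed[of "\<lambda>h. (partial_prod Q ord i w x h * x h) *\<^sub>v f h" Hi "w i"] car
    by (auto simp: Pi_def)
  fix r assume "r < dim_vec (tau_mat w x *\<^sub>v blocks_vec Hi d f)"
  then have r: "r < w i" by simp
  have "(tau_mat w x *\<^sub>v blocks_vec Hi d f) $ r =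
      (\<Sum>h\<in>Hi. ((partial_prod Q ord i w x h * x h) *\<^sub>v f h) $ r)"
    unfolding tau_mat_def by (rule col_blocks_mult_vec[OF finite_Hi tau_block_carrier fc r])
  also have "\<dots> = tau Q ord i w x f $ r"
    unfolding tau_def by (rule index_finsum_vec[OF finite_Hi r, symmetric]) (use car in auto)
  finally show "tau Q ord i w x f $ r = (tau_mat w x *\<^sub>v blocks_vec Hi d f) $ r" by simp
qed

end

lemma Vhat_ext:
  assumes "f \<in> Vhat Q i v" "g \<in> Vhat Q i v" "blocks_vec Hi d f = blocks_vec Hi d g"
  shows "f = g"
proof (rule PiE_ext[of f Hi "\<lambda>h. carrier_vec (d h)"])
  fix h assume "h \<in> Hi"
  then show "f h = g h"
    using assms by (intro blocks_vec_eqD[OF finite_Hi assms(3)]) (auto simp: Vhat_def)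
qed (use assms in \<open>auto simp: Vhat_def\<close>)

lemma Vhat_surj:
  assumes "u \<in> carrier_vec N"
  obtains f where "f \<in> Vhat Q i v" "u = blocks_vec Hi d f"
  using blocks_vec_surj[OF finite_Hi assms] that[of "\<lambda>h\<in>Hi. vec (d h) (\<lambda>a. u $ idx Hi d h a)"]
  by (auto simp: Vhat_def)

end

section \<open>Linked pairs of representations\<close>

context quiver_vertex
begin

text \<open>The difference D of the two matrices satisfies D = DU and therefore vanishes.\<close>

lemma cancel_one_minus_upper:
  assumes A: "A \<in> carrier_mat m N" and B: "B \<in> carrier_mat m N"
    and eq: "A * (1\<^sub>m N - up W) = B * (1\<^sub>m N - up W)"
  shows "A = B"
proof -
  have "A - B = (A - B) * up W"
  proof (rule eq_matI)
    fix r c assume "r < dim_row ((A - B) * up W)" "c < dim_col ((A - B) * up W)"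
    then have rc: "r < m" "c < N" using A B by auto
    have "(A * (1\<^sub>m N - up W)) $$ (r, c) = (B * (1\<^sub>m N - up W)) $$ (r, c)" using eq by simp
    then have "A $$ (r, c) - (A * up W) $$ (r, c) = B $$ (r, c) - (B * up W) $$ (r, c)"
      using A B rc by (simp add: mat_ring del: index_mult_mat(1))
    then show "(A - B) $$ (r, c) = ((A - B) * up W) $$ (r, c)"
      using A B rc by (simp add: mat_ring algebra_simps del: index_mult_mat(1))
  qed (use A B in auto)
  then have Z: "A - B = 0\<^sub>m m N"
    using A B by (intro upper_blocks_fixpoint_zero[OF finite_Hi ord Hi_darrows]) auto
  show ?thesis
  proof (rule eq_matI)
    fix r c assume "r < dim_row B" "c < dim_col B"
    then have rc: "r < m" "c < N" using B by auto
    have "(A - B) $$ (r, c) = 0" using Z rc by simp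
    then show "A $$ (r, c) = B $$ (r, c)" using rc B A by simp
  qed (use A B in auto)
qed

text \<open>
  \<open>blk_rel s\<close> says that \<open>1 + \<sigma>\<tau> = s (1 + \<sigma>'\<tau>')\<close>, expressed through the factors of the block
  decomposition \<open>1 + \<sigma>\<tau> = (1 + \<sigma>X - U) (1 - U)\<^sup>-\<^sup>1\<close>, where \<open>X\<close> is the row of the \<open>x\<^sub>h\<close>
  and \<open>U\<close> the strictly upper triangular part of \<open>\<sigma>X\<close>.
\<close>

definition blk_rel :: "complex \<Rightarrow> ('v \<Rightarrow> nat) \<Rightarrow> ('v \<Rightarrow> nat) \<Rightarrow>
    ('a + 'a \<Rightarrow> complex mat) \<Rightarrow> ('a + 'a \<Rightarrow> complex mat) \<Rightarrow> bool" where
  "blk_rel s w w' x x' \<longleftrightarrow>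
     up (sigma_mat w' x' * in_mat w' x') = up (sigma_mat w x * in_mat w x) \<and>
     1\<^sub>m N + sigma_mat w x * in_mat w x - up (sigma_mat w x * in_mat w x) =
       s \<cdot>\<^sub>m (1\<^sub>m N + sigma_mat w' x' * in_mat w' x' - up (sigma_mat w x * in_mat w x))"

lemma one_plus_sigma_tau:
  assumes "adm w" "x \<in> reps Q w"
  shows "(1\<^sub>m N + sigma_mat w x * tau_mat w x) * (1\<^sub>m N - up (sigma_mat w x * in_mat w x)) =
    1\<^sub>m N + sigma_mat w x * in_mat w x - up (sigma_mat w x * in_mat w x)"
proof -
  let ?U = "up (sigma_mat w x * in_mat w x)"
  have "in_mat w x = tau_mat w x - tau_mat w x * ?U"
    by (subst in_mat_eq[OF assms]) (simp add: mat_ring)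
  then have "sigma_mat w x * in_mat w x = sigma_mat w x * (tau_mat w x - tau_mat w x * ?U)" by simp
  also have "\<dots> = sigma_mat w x * tau_mat w x - sigma_mat w x * (tau_mat w x * ?U)"
    by (simp add: mat_ring)
  finally have E: "sigma_mat w x * in_mat w x = sigma_mat w x * tau_mat w x - sigma_mat w x * (tau_mat w x * ?U)" .
  have *: "(sigma_mat w x * in_mat w x) $$ (r, c) =
    (sigma_mat w x * tau_mat w x) $$ (r, c) - (sigma_mat w x * (tau_mat w x * ?U)) $$ (r, c)"
    if "r < N" "c < N" for r c
    using arg_cong[OF E, of "\<lambda>A. A $$ (r, c)"] that by (simp del: index_mult_mat(1))
  have "(1\<^sub>m N + sigma_mat w x * tau_mat w x) * (1\<^sub>m N - ?U) =
      1\<^sub>m N - ?U + (sigma_mat w x * tau_mat w x - sigma_mat w x * (tau_mat w x * ?U))"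
    by (simp add: mat_ring) (auto intro!: eq_matI simp del: index_mult_mat(1))
  also have "\<dots> = 1\<^sub>m N + sigma_mat w x * in_mat w x - ?U"
    by (rule eq_matI) (auto simp: * simp del: index_mult_mat(1))
  finally show ?thesis .
qed

lemma tau_mat_unique:
  assumes "adm w" "x \<in> reps Q w" and T: "T \<in> carrier_mat (w i) N"
    and eq: "T * (1\<^sub>m N - up (sigma_mat w x * in_mat w x)) = in_mat w x"
  shows "tau_mat w x = T"
  by (rule cancel_one_minus_upper[OF _ T, of _ "sigma_mat w x * in_mat w x"])
    (simp_all add: eq in_mat_eq[OF assms(1,2), symmetric])

text \<open>Cuts prescribed matrices \<sigma> = \<open>S\<close> and X = \<open>X\<close> back into
  arrows at \<open>i\<close> and keeps the arrows of \<open>x\<close> that do not meet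
  \<open>i\<close>.\<close>

definition rebuild :: "('v \<Rightarrow> nat) \<Rightarrow> ('a + 'a \<Rightarrow> complex mat) \<Rightarrow> complex mat \<Rightarrow> complex mat \<Rightarrow>
    'a + 'a \<Rightarrow> complex mat" where
  "rebuild w x S X = (\<lambda>h\<in>darrows Q.
     if h \<in> Hi then mat (w i) (d h) (\<lambda>(a, b). X $$ (a, idx Hi d h b))
     else if opp h \<in> Hi then mat (d (opp h)) (w i) (\<lambda>(a, b). S $$ (idx Hi d (opp h) a, b))
     else x h)"

lemma rebuild_other: "h \<in> darrows Q - (Hi \<union> opp ` Hi) \<Longrightarrow> rebuild w x S X h = x h"
proof -
  assume h: "h \<in> darrows Q - (Hi \<union> opp ` Hi)"
  have "opp h \<notin> Hi" using h by (metis DiffE UnCI imageI opp_opp)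
  then show ?thesis using h by (simp add: rebuild_def)
qed

lemma rebuild_in: "h \<in> Hi \<Longrightarrow> rebuild w x S X h = mat (w i) (d h) (\<lambda>(a, b). X $$ (a, idx Hi d h b))"
  using Hi_darrows by (auto simp: rebuild_def)

lemma rebuild_out: "h \<in> Hi \<Longrightarrow> rebuild w x S X (opp h) = mat (d h) (w i) (\<lambda>(a, b). S $$ (idx Hi d h a, b))"
  using Hi_darrows opp_notin_Hi by (auto simp: rebuild_def)

lemma rebuild_reps:
  assumes "adm w" "adm w0" "x \<in> reps Q w0"
  shows "rebuild w x S X \<in> reps Q w"
  unfolding reps_def
proof
  fix h assume h: "h \<in> darrows Q"
  then show "rebuild w x S X h \<in> carrier_mat (w (in_v Q h)) (w (out_v Q h))"
  proof (cases h rule: darrows_cases)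
    case in_i
    then show ?thesis using adm_d[OF assms(1)] by (simp add: rebuild_in in_v_Hi)
  next
    case (out_i k)
    then show ?thesis using adm_d[OF assms(1)] by (simp add: rebuild_out in_v_Hi)
  next
    case other
    then have "w (in_v Q h) = w0 (in_v Q h)" "w (out_v Q h) = w0 (out_v Q h)"
      using assms(1,2) other_not_i in_v_verts[OF h] out_v_verts[OF h] unfolding adm_def by auto
    then show ?thesis using rebuild_other[OF other] x_carrier[OF assms(2,3) h] by simp
  qed
next
  fix h assume "h \<notin> darrows Q"
  then show "rebuild w x S X h = undefined" by (simp add: rebuild_def)
qed

lemma sigma_mat_rebuild:
  assumes "S \<in> carrier_mat N (w i)"
  shows "sigma_mat w (rebuild w x S X) = S"
  by (rule eq_matI) (use assms blk_loc[OF finite_Hi, of _ d] in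
    \<open>auto simp: sigma_mat_def row_blocks_def rebuild_out\<close>)

lemma in_mat_rebuild:
  assumes "X \<in> carrier_mat (w i) N"
  shows "in_mat w (rebuild w x S X) = X"
  by (rule eq_matI) (use assms blk_loc[OF finite_Hi, of _ d] in
    \<open>auto simp: in_mat_def col_blocks_def rebuild_in\<close>)

lemma upper_blocks_eqI:
  assumes "\<And>r c. r < N \<Longrightarrow> c < N \<Longrightarrow> (blk Hi d r, blk Hi d c) \<in> ord \<Longrightarrow> A $$ (r, c) = B $$ (r, c)"
  shows "up A = up B"
  by (rule eq_matI) (use assms in \<open>auto simp: upper_blocks_def\<close>)

lemma ord_irrefl: "(h, h) \<notin> ord"
  using ord unfolding strict_linear_order_on_def irrefl_def by blast

lemma blk_ord_neq: "(blk Hi d r, blk Hi d c) \<in> ord \<Longrightarrow> r \<noteq> c"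
  using ord_irrefl by metis

text \<open>
  In both constructions the new \<open>\<sigma>\<close>, \<open>X\<close> satisfy \<open>\<sigma>'X' = s\<^sup>-\<^sup>1(1 + \<sigma>X - U) - (1 - U)\<close> and
  \<open>\<sigma>X = s(1 + \<sigma>'X' - U') - (1 - U')\<close> respectively, hence have the same \<open>U\<close>.
\<close>

lemma blk_rel_of_sigma_in:
  assumes eq: "sigma_mat w' x' * in_mat w' x' =
      inverse s \<cdot>\<^sub>m (1\<^sub>m N + sigma_mat w x * in_mat w x - up (sigma_mat w x * in_mat w x)) -
      (1\<^sub>m N - up (sigma_mat w x * in_mat w x))" and s: "s \<noteq> 0"
  shows "blk_rel s w w' x x'"
proof -
  let ?M = "sigma_mat w x * in_mat w x" and ?M' = "sigma_mat w' x' * in_mat w' x'"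
  have M': "?M' $$ (r, c) = inverse s * ((1\<^sub>m N :: complex mat) $$ (r, c) + ?M $$ (r, c) - up ?M $$ (r, c)) -
      ((1\<^sub>m N :: complex mat) $$ (r, c) - up ?M $$ (r, c))" if "r < N" "c < N" for r c
    unfolding eq using that by (simp del: index_mult_mat(1) index_one_mat)
  have "up ?M' = up ?M"
    by (rule upper_blocks_eqI) (use blk_ord_neq in \<open>auto simp: M' upper_blocks_def simp del: index_mult_mat(1)\<close>)
  moreover have "1\<^sub>m N + ?M - up ?M = s \<cdot>\<^sub>m (1\<^sub>m N + ?M' - up ?M)"
    by (rule eq_matI) (use s in \<open>auto simp: M' simp del: index_mult_mat(1) index_one_mat\<close>)
  ultimately show ?thesis unfolding blk_rel_def by simp
qed

lemma blk_rel_of_sigma_in':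
  assumes eq: "sigma_mat w x * in_mat w x =
      s \<cdot>\<^sub>m (1\<^sub>m N + sigma_mat w' x' * in_mat w' x' - up (sigma_mat w' x' * in_mat w' x')) -
      (1\<^sub>m N - up (sigma_mat w' x' * in_mat w' x'))"
  shows "blk_rel s w w' x x'"
proof -
  let ?M = "sigma_mat w x * in_mat w x" and ?M' = "sigma_mat w' x' * in_mat w' x'"
  have M: "?M $$ (r, c) = s * ((1\<^sub>m N :: complex mat) $$ (r, c) + ?M' $$ (r, c) - up ?M' $$ (r, c)) -
      ((1\<^sub>m N :: complex mat) $$ (r, c) - up ?M' $$ (r, c))" if "r < N" "c < N" for r c
    unfolding eq using that by (simp del: index_mult_mat(1) index_one_mat)
  have U: "up ?M = up ?M'"
    by (rule upper_blocks_eqI) (use blk_ord_neq in \<open>auto simp: M upper_blocks_def simp del: index_mult_mat(1)\<close>)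
  have "1\<^sub>m N + ?M - up ?M = s \<cdot>\<^sub>m (1\<^sub>m N + ?M' - up ?M)"
    unfolding U by (rule eq_matI) (auto simp: M simp del: index_mult_mat(1) index_one_mat)
  then show ?thesis unfolding blk_rel_def using U by simp
qed

text \<open>The part of the correspondence that the constructions produce directly. Determinants,
  moment map values and stability are left out, because they are shown to pass along a link from
  either side to the other.\<close>

definition linked :: "complex \<Rightarrow> ('v \<Rightarrow> nat) \<Rightarrow> ('v \<Rightarrow> nat) \<Rightarrow>
    ('a + 'a \<Rightarrow> complex mat) \<Rightarrow> ('a + 'a \<Rightarrow> complex mat) \<Rightarrow> bool" where
  "linked s w w' x x' \<longleftrightarrow> x \<in> reps Q w \<and> x' \<in> reps Q w' \<and>
     (\<forall>h\<in>darrows Q - (Hi \<union> opp ` Hi). x h = x' h) \<and> blk_rel s w w' x x' \<and>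
     (\<exists>L R. split_exact (w' i) N (w i) (sigma_mat w' x') (tau_mat w x) L R)"

text \<open>The solution X' of \<sigma>'X' = M for the right-hand side M that forces
  \<open>blk_rel\<close>: apply the retraction \<open>L\<close> of \<sigma>' to M.\<close>

definition reflect_in :: "complex \<Rightarrow> ('v \<Rightarrow> nat) \<Rightarrow> complex mat \<Rightarrow> ('a + 'a \<Rightarrow> complex mat) \<Rightarrow> complex mat" where
  "reflect_in s w L x = L * (inverse s \<cdot>\<^sub>m (1\<^sub>m N + sigma_mat w x * in_mat w x - up (sigma_mat w x * in_mat w x)) -
      (1\<^sub>m N - up (sigma_mat w x * in_mat w x)))"

text \<open>The prescribed value M of \<sigma>'X' is killed by \<tau>, because \<tau>\<sigma> = s -
  1. So M lies in the kernel of \<tau>, on which \<open>S * L\<close> is the identity, and X' = LM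
  indeed satisfies SX' = M.\<close>

lemma linked_rebuild:
  assumes w: "adm w" and w': "adm w'" and x: "x \<in> reps Q w" and s: "s \<noteq> 0"
    and ts: "tau_mat w x * sigma_mat w x = (s - 1) \<cdot>\<^sub>m 1\<^sub>m (w i)"
    and split: "split_exact (w' i) N (w i) S (tau_mat w x) L R"
  shows "linked s w w' x (rebuild w' x S (reflect_in s w L x))"
proof -
  let ?\<sigma> = "sigma_mat w x" and ?X = "in_mat w x" and ?\<tau> = "tau_mat w x"
  let ?U = "up (?\<sigma> * ?X)"
  let ?M = "inverse s \<cdot>\<^sub>m (1\<^sub>m N + ?\<sigma> * ?X - ?U) - (1\<^sub>m N - ?U)"
  let ?x' = "rebuild w' x S (reflect_in s w L x)"
  have S: "S \<in> carrier_mat N (w' i)" and L: "L \<in> carrier_mat (w' i) N" and R: "R \<in> carrier_mat N (w i)"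
    and SL: "S * L + R * ?\<tau> = 1\<^sub>m N"
    using split unfolding split_exact_def by blast+
  have X': "reflect_in s w L x \<in> carrier_mat (w' i) N" using L by (auto simp: reflect_in_def intro!: carrier_matI)
  have sig': "sigma_mat w' ?x' = S" and in': "in_mat w' ?x' = reflect_in s w L x"
    by (rule sigma_mat_rebuild, rule S, rule in_mat_rebuild, rule X')
  have \<tau>e: "?\<tau> $$ (r, c) = ?X $$ (r, c) + (?\<tau> * ?U) $$ (r, c)" if "r < w i" "c < N" for r c
    using arg_cong[OF tau_mat_eq[OF w x], of "\<lambda>A. A $$ (r, c)"] that by (simp del: index_mult_mat(1))
  have "?\<tau> * (?\<sigma> * ?X) = ?\<tau> * ?\<sigma> * ?X" by (simp add: mat_ring)
  also have "\<dots> = (s - 1) \<cdot>\<^sub>m ?X" unfolding ts by (simp add: mat_ring)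
  finally have tsx: "?\<tau> * (?\<sigma> * ?X) = (s - 1) \<cdot>\<^sub>m ?X" .
  \<comment> \<open>By \<tau> - \<tau>U = X the first bracket is s times X and the subtracted term
    is X.\<close>
  have "?\<tau> * ?M = inverse s \<cdot>\<^sub>m (?\<tau> + (s - 1) \<cdot>\<^sub>m ?X - ?\<tau> * ?U) - (?\<tau> - ?\<tau> * ?U)"
    by (simp add: mat_ring tsx)
  also have "\<dots> = 0\<^sub>m (w i) N"
    by (rule eq_matI) (use s in \<open>auto simp: \<tau>e field_simps simp del: index_mult_mat(1)\<close>)
  finally have \<tau>M: "?\<tau> * ?M = 0\<^sub>m (w i) N" .
  have "?M = (S * L + R * ?\<tau>) * ?M" unfolding SL by (simp add: mult_mat_one_left)
  also have "\<dots> = S * (L * ?M) + R * (?\<tau> * ?M)"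
    using S L R by (simp add: mult_mat_add_left mult_mat_assoc)
  also have "\<dots> = S * (L * ?M)"
    unfolding \<tau>M using S L R by (simp add: mult_mat_zero_right zero_add_mat)
  finally have SLM: "?M = S * (L * ?M)" .
  have "sigma_mat w' ?x' * in_mat w' ?x' = S * reflect_in s w L x" by (simp only: sig' in')
  also have "\<dots> = ?M" unfolding reflect_in_def by (rule SLM[symmetric])
  finally have "sigma_mat w' ?x' * in_mat w' ?x' = ?M" .
  then have "blk_rel s w w' x ?x'" using blk_rel_of_sigma_in s by blast
  then show ?thesis
    unfolding linked_def using x rebuild_reps[OF w' w x] rebuild_other split sig' by auto
qed

definition coreflect_in :: "('v \<Rightarrow> nat) \<Rightarrow> complex mat \<Rightarrow> ('a + 'a \<Rightarrow> complex mat) \<Rightarrow> complex mat" where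
  "coreflect_in w' T x' = T * (1\<^sub>m N - up (sigma_mat w' x' * in_mat w' x'))"

text \<open>The factor in front of \<open>R\<close> is the value that \<sigma>\<tau> must have. It
  kills \<sigma>' and hence factors through the cokernel map T; composing it with the section
  \<open>R\<close> of T gives \<sigma>.\<close>

definition coreflect_out :: "complex \<Rightarrow> ('v \<Rightarrow> nat) \<Rightarrow> complex mat \<Rightarrow> ('a + 'a \<Rightarrow> complex mat) \<Rightarrow> complex mat" where
  "coreflect_out s w' R x' = (s \<cdot>\<^sub>m (1\<^sub>m N + sigma_mat w' x' * tau_mat w' x') - 1\<^sub>m N) * R"

text \<open>Let A be the required value of \<sigma>\<tau>. Since \<tau>'\<sigma>' = 1/s - 1, A
  vanishes on the range of \<sigma>', and the splitting gives A = ART. With \<sigma> = AR and X =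
  T(1 - U) the product \<sigma>X is then A(1 - U), computed by the block factorization of
  \<open>x'\<close>.\<close>

lemma linked_corebuild:
  assumes w: "adm w" and w': "adm w'" and x': "x' \<in> reps Q w'" and s: "s \<noteq> 0"
    and ts: "tau_mat w' x' * sigma_mat w' x' = (inverse s - 1) \<cdot>\<^sub>m 1\<^sub>m (w' i)"
    and split: "split_exact (w' i) N (w i) (sigma_mat w' x') T L R"
  shows "linked s w w' (rebuild w x' (coreflect_out s w' R x') (coreflect_in w' T x')) x'"
proof -
  let ?\<sigma> = "sigma_mat w' x'" and ?X = "in_mat w' x'" and ?\<tau> = "tau_mat w' x'"
  let ?U = "up (?\<sigma> * ?X)"
  let ?A = "s \<cdot>\<^sub>m (1\<^sub>m N + ?\<sigma> * ?\<tau>) - 1\<^sub>m N"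
  let ?x = "rebuild w x' (coreflect_out s w' R x') (coreflect_in w' T x')"
  have T: "T \<in> carrier_mat (w i) N" and L: "L \<in> carrier_mat (w' i) N" and R: "R \<in> carrier_mat N (w i)"
    and SL: "?\<sigma> * L + R * T = 1\<^sub>m N"
    using split unfolding split_exact_def by blast+
  have sig: "sigma_mat w ?x = ?A * R" and in_x: "in_mat w ?x = T * (1\<^sub>m N - ?U)"
    unfolding coreflect_in_def coreflect_out_def using T R
    by (auto intro!: sigma_mat_rebuild in_mat_rebuild carrier_matI)
  have "?\<sigma> * (?\<tau> * ?\<sigma>) = (inverse s - 1) \<cdot>\<^sub>m ?\<sigma>"
    unfolding ts by (simp add: mat_ring)
  then have "?A * ?\<sigma> = s \<cdot>\<^sub>m (?\<sigma> + (inverse s - 1) \<cdot>\<^sub>m ?\<sigma>) - ?\<sigma>"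
    by (simp add: mat_ring)
  also have "\<dots> = 0\<^sub>m N (w' i)"
    by (rule eq_matI) (use s in \<open>auto simp: field_simps\<close>)
  finally have A\<sigma>: "?A * ?\<sigma> = 0\<^sub>m N (w' i)" .
  have "?A = ?A * (?\<sigma> * L + R * T)" unfolding SL by (simp add: mult_mat_one_right)
  also have "\<dots> = ?A * ?\<sigma> * L + ?A * R * T"
    using L R T by (simp add: mult_mat_add_right mult_mat_assoc)
  also have "\<dots> = ?A * R * T"
    unfolding A\<sigma> using L R T by (simp add: mult_mat_zero_left zero_add_mat)
  finally have ART: "?A * R * T = ?A" by simp
  have "sigma_mat w ?x * in_mat w ?x = ?A * R * T * (1\<^sub>m N - ?U)"
    unfolding sig in_x using R T by (simp add: mult_mat_assoc)
  also have "\<dots> = s \<cdot>\<^sub>m ((1\<^sub>m N + ?\<sigma> * ?\<tau>) * (1\<^sub>m N - ?U)) - (1\<^sub>m N - ?U)"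
    unfolding ART by (simp add: mult_mat_minus_left mult_mat_smult_left mult_mat_one_left)
  also have "\<dots> = s \<cdot>\<^sub>m (1\<^sub>m N + ?\<sigma> * ?X - ?U) - (1\<^sub>m N - ?U)"
    unfolding one_plus_sigma_tau[OF w' x'] ..
  finally have rel: "blk_rel s w w' ?x x'" by (rule blk_rel_of_sigma_in')
  have x: "?x \<in> reps Q w" by (rule rebuild_reps[OF w w' x'])
  \<comment> \<open>Both sides share U, so X = T(1 - U) is the equation that characterizes \<tau> of
    the rebuilt representation.\<close>
  have "tau_mat w ?x = T"
    using rel in_x by (intro tau_mat_unique[OF w x T]) (simp add: blk_rel_def)
  then show ?thesis
    unfolding linked_def using x x' rebuild_other split rel by auto
qed

section \<open>Transfer of determinants and moment map values along a link\<close>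

context
  fixes s w w' x x'
  assumes w: "adm w" and w': "adm w'" and s: "s \<noteq> (0::complex)" and linked: "linked s w w' x x'"
begin

lemma linked_reps: "x \<in> reps Q w" "x' \<in> reps Q w'"
  using linked unfolding linked_def by auto

lemma linked_other: "h \<in> darrows Q - (Hi \<union> opp ` Hi) \<Longrightarrow> x h = x' h"
  using linked unfolding linked_def by auto

text \<open>Both block factorizations end in the same factor 1 - U, which is cancelled. This is
  relation (R3) with the identity added to both sides.\<close>

lemma linked_sigma_tau:
  "1\<^sub>m N + sigma_mat w x * tau_mat w x = s \<cdot>\<^sub>m (1\<^sub>m N + sigma_mat w' x' * tau_mat w' x')"
proof (rule cancel_one_minus_upper)
  let ?U = "up (sigma_mat w x * in_mat w x)"
  have rel: "up (sigma_mat w' x' * in_mat w' x') = ?U"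
    "1\<^sub>m N + sigma_mat w x * in_mat w x - ?U = s \<cdot>\<^sub>m (1\<^sub>m N + sigma_mat w' x' * in_mat w' x' - ?U)"
    using linked unfolding linked_def blk_rel_def by blast+
  have "s \<cdot>\<^sub>m (1\<^sub>m N + sigma_mat w' x' * tau_mat w' x') * (1\<^sub>m N - ?U) =
    s \<cdot>\<^sub>m ((1\<^sub>m N + sigma_mat w' x' * tau_mat w' x') * (1\<^sub>m N - ?U))"
    by (rule mult_mat_smult_left) simp
  also have "\<dots> = 1\<^sub>m N + sigma_mat w x * in_mat w x - ?U"
    using one_plus_sigma_tau[OF w' linked_reps(2)] rel by simp
  finally show "(1\<^sub>m N + sigma_mat w x * tau_mat w x) * (1\<^sub>m N - ?U) =
      s \<cdot>\<^sub>m (1\<^sub>m N + sigma_mat w' x' * tau_mat w' x') * (1\<^sub>m N - ?U)"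
    using one_plus_sigma_tau[OF w linked_reps(1)] by simp
qed auto

text \<open>Compare diagonal blocks in \<open>blk_rel\<close>: U vanishes there because the order is
  irreflexive, and the diagonal block of \<sigma>X at \<open>h\<close> is
  \<open>x (opp h) * x h\<close>.\<close>

lemma linked_one_plus_out:
  assumes h: "h \<in> Hi"
  shows "one_plus Q w x (opp h) = s \<cdot>\<^sub>m one_plus Q w' x' (opp h)"
proof -
  let ?M = "sigma_mat w x * in_mat w x" and ?M' = "sigma_mat w' x' * in_mat w' x'"
  note c = x_in_carrier[OF w linked_reps(1) h] x_out_carrier[OF w linked_reps(1) h]
    x_in_carrier[OF w' linked_reps(2) h] x_out_carrier[OF w' linked_reps(2) h]
  have "1\<^sub>m (d h) + x (opp h) * x h = s \<cdot>\<^sub>m (1\<^sub>m (d h) + x' (opp h) * x' h)"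
  proof (rule eq_matI)
    fix a b assume "a < dim_row (s \<cdot>\<^sub>m (1\<^sub>m (d h) + x' (opp h) * x' h))" "b < dim_col (s \<cdot>\<^sub>m (1\<^sub>m (d h) + x' (opp h) * x' h))"
    then have ab: "a < d h" "b < d h" using c by auto
    let ?r = "idx Hi d h a" and ?c = "idx Hi d h b"
    note ra = idx[where K = Hi and d = d, OF finite_Hi h, of a] and rb = idx[where K = Hi and d = d, OF finite_Hi h, of b]
    have up0: "up ?M $$ (?r, ?c) = 0"
      using ra rb ab ord_irrefl by (simp add: upper_blocks_def)
    have rc: "?r = ?c \<longleftrightarrow> a = b" using ra rb ab by metis
    have "(1\<^sub>m N + ?M - up ?M) $$ (?r, ?c) = (s \<cdot>\<^sub>m (1\<^sub>m N + ?M' - up ?M)) $$ (?r, ?c)"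
      using linked unfolding linked_def blk_rel_def by simp
    then have "(if a = b then 1 else 0) + ?M $$ (?r, ?c) = s * ((if a = b then 1 else 0) + ?M' $$ (?r, ?c))"
      using ra rb ab up0 rc by (simp del: index_mult_mat(1))
    then show "(1\<^sub>m (d h) + x (opp h) * x h) $$ (a, b) = (s \<cdot>\<^sub>m (1\<^sub>m (d h) + x' (opp h) * x' h)) $$ (a, b)"
      using sigma_in_entry[OF w linked_reps(1) ra(1) rb(1)] sigma_in_entry[OF w' linked_reps(2) ra(1) rb(1)]
        ra rb ab c by (simp del: index_mult_mat(1))
  qed (use c in auto)
  then show ?thesis
    using adm_d[OF w h] adm_d[OF w' h] by (simp add: one_plus_def)
qed

lemma linked_one_plus_other:
  assumes h: "h \<in> darrows Q - (Hi \<union> opp ` Hi)"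
  shows "one_plus Q w x h = one_plus Q w' x' h"
proof -
  have "opp h \<in> darrows Q - (Hi \<union> opp ` Hi)"
    using h by (auto simp: image_iff) (metis opp_opp)
  moreover have "w (in_v Q h) = w' (in_v Q h)"
    using w w' other_not_i[OF h] in_v_verts[of h] h unfolding adm_def by auto
  ultimately show ?thesis using linked_other[OF h] linked_other[of "opp h"] by (simp add: one_plus_def)
qed

lemma det_one_plus_opp:
  assumes "adm w0" "y \<in> reps Q w0" "h \<in> darrows Q"
  shows "det (one_plus Q w0 y h) \<noteq> 0 \<longleftrightarrow> det (one_plus Q w0 y (opp h)) \<noteq> 0"
  using det_one_plus_commute[OF x_carrier[OF assms] x_carrier[OF assms(1,2), of "opp h", unfolded in_v_opp out_v_opp]]
    det_one_plus_commute[OF x_carrier[OF assms(1,2), of "opp h", unfolded in_v_opp out_v_opp] x_carrier[OF assms]] assms(3)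
  by (auto simp: one_plus_def)

text \<open>The link controls \<open>x (opp h) * x h\<close> only; for an arrow into
  \<open>i\<close> the condition is first moved to its reverse.\<close>

lemma linked_det_iff:
  assumes h: "h \<in> darrows Q"
  shows "det (one_plus Q w x h) \<noteq> 0 \<longleftrightarrow> det (one_plus Q w' x' h) \<noteq> 0"
proof -
  have out: "det (one_plus Q w x (opp k)) \<noteq> 0 \<longleftrightarrow> det (one_plus Q w' x' (opp k)) \<noteq> 0" if "k \<in> Hi" for k
    unfolding linked_one_plus_out[OF that] by (rule det_smult_nonzero[OF s])
  from h show ?thesis
  proof (cases h rule: darrows_cases)
    case in_i
    then show ?thesis
      using out[OF in_i] det_one_plus_opp[OF w linked_reps(1) h] det_one_plus_opp[OF w' linked_reps(2) h] by simp
  next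
    case (out_i k)
    then show ?thesis using out by simp
  next
    case other
    then show ?thesis using linked_one_plus_other by simp
  qed
qed

text \<open>Among the factors at \<open>j\<close> only those of arrows coming from \<open>i\<close>
  change. They are reverses of arrows in \<open>Hi\<close> and enter with exponent -1, so inverting
  turns the factor s on the side of \<open>x\<close> into a factor s on the side of
  \<open>x'\<close>, once for every such arrow.\<close>

lemma linked_moment_map:
  assumes j: "j \<in> verts Q" "j \<noteq> i" and det: "\<And>h. h \<in> darrows Q \<Longrightarrow> det (one_plus Q w x h) \<noteq> 0"
  shows "moment_map Q ord w' x' j = s ^ card {h \<in> darrows Q. out_v Q h = i \<and> in_v Q h = j} \<cdot>\<^sub>m moment_map Q ord w x j"
proof -
  have wj: "w' j = w j" using w w' j unfolding adm_def by simp
  have sub: "in_arrows Q j \<subseteq> darrows Q" by (auto simp: in_arrows_def)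
  have fin: "finite (in_arrows Q j)" using finite_subset[OF sub finite_darrows] .
  define c where "c = (\<lambda>h. if out_v Q h = i then s else 1)"
  have one: "one_plus Q w x h \<in> carrier_mat (w j) (w j)" "one_plus Q w' x' h \<in> carrier_mat (w j) (w j)"
    "det (one_plus Q w' x' h) \<noteq> 0" "det (one_plus Q w x h) \<noteq> 0" if "h \<in> in_arrows Q j" for h
    using one_plus_carrier[OF w linked_reps(1), of h] one_plus_carrier[OF w' linked_reps(2), of h] that wj
      linked_det_iff det by (auto simp: in_arrows_def)
  have pow: "A [^]\<^bsub>GL n\<^esub> eps h \<in> carrier_mat n n" if "A \<in> carrier_mat n n" "det A \<noteq> 0" for A n h
  proof -
    have "A \<in> carrier (GL n)" using that by (simp add: GL_carrier)
    then show ?thesis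
      using that GL_inv[of A n] by (cases h) (auto simp: GL_pow_one GL_pow_minus_one)
  qed
  have F: "one_plus Q w' x' h [^]\<^bsub>GL (w' j)\<^esub> eps h = c h \<cdot>\<^sub>m (one_plus Q w x h [^]\<^bsub>GL (w j)\<^esub> eps h)"
    if h: "h \<in> in_arrows Q j" for h
  proof -
    have hd: "h \<in> darrows Q" using h sub by blast
    then show ?thesis
    proof (cases h rule: darrows_cases)
      case in_i
      then show ?thesis using j(2) h by (simp add: in_arrows_def)
    next
      case (out_i k)
      have c: "c h = s" using out_i in_v_Hi by (simp add: c_def)
      have e: "eps h = - 1" using out_i eps_Hi by (simp add: eps_opp)
      have "one_plus Q w x h = s \<cdot>\<^sub>m one_plus Q w' x' h" using linked_one_plus_out out_i by simp
      then have "inv\<^bsub>GL (w j)\<^esub> (one_plus Q w x h) = inverse s \<cdot>\<^sub>m inv\<^bsub>GL (w j)\<^esub> (one_plus Q w' x' h)"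
        using GL_inv_smult[OF one(2,3)[OF h] s] by simp
      then have "s \<cdot>\<^sub>m inv\<^bsub>GL (w j)\<^esub> (one_plus Q w x h) = inv\<^bsub>GL (w j)\<^esub> (one_plus Q w' x' h)"
        using s by (simp add: smult_smult_mat) (auto intro!: eq_matI)
      then show ?thesis
        unfolding c e wj using GL_pow_minus_one[OF one(1)[OF h]] GL_pow_minus_one[OF one(2)[OF h]] by simp
    next
      case other
      then have "c h = 1" using other_not_i by (simp add: c_def)
      then show ?thesis using linked_one_plus_other[OF other] wj by (auto intro!: eq_matI)
    qed
  qed
  have "moment_map Q ord w' x' j =
      ordered_prod ord (w' j) (\<lambda>h. c h \<cdot>\<^sub>m (one_plus Q w x h [^]\<^bsub>GL (w j)\<^esub> eps h)) (in_arrows Q j)"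
    unfolding moment_map_def by (rule ordered_prod_cong[OF ord F fin sub])
  also have "\<dots> = (\<Prod>h\<in>in_arrows Q j. c h) \<cdot>\<^sub>m moment_map Q ord w x j"
    unfolding moment_map_def wj using pow[OF one(1) one(4)] by (intro ordered_prod_smult[OF ord fin sub]) auto
  also have "(\<Prod>h\<in>in_arrows Q j. c h) = (\<Prod>h | h \<in> in_arrows Q j \<and> out_v Q h = i. s)"
    unfolding c_def by (rule prod.inter_filter[OF fin, symmetric])
  also have "{h \<in> in_arrows Q j. out_v Q h = i} = {h \<in> darrows Q. out_v Q h = i \<and> in_v Q h = j}"
    by (auto simp: in_arrows_def)
  finally show ?thesis by simp
qed

text \<open>Sandwich 1 + \<sigma>\<tau> = s(1 + \<sigma>'\<tau>'). Between \<tau> and its section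
  \<open>R\<close> the term with \<sigma>' dies and 1 + \<tau>\<sigma> = s remains; between the
  retraction \<open>L\<close> and \<sigma>' the term with \<tau> dies and 1 = s(1 +
  \<tau>'\<sigma>') remains.\<close>

lemma linked_moment_map_i:
  "moment_map Q ord w x i = s \<cdot>\<^sub>m 1\<^sub>m (w i) \<and> moment_map Q ord w' x' i = inverse s \<cdot>\<^sub>m 1\<^sub>m (w' i)"
proof -
  let ?\<sigma> = "sigma_mat w x" and ?\<tau> = "tau_mat w x" and ?\<sigma>' = "sigma_mat w' x'" and ?\<tau>' = "tau_mat w' x'"
  obtain L R where L: "L \<in> carrier_mat (w' i) N" "R \<in> carrier_mat N (w i)"
    "?\<tau> * ?\<sigma>' = 0\<^sub>m (w i) (w' i)" "L * ?\<sigma>' = 1\<^sub>m (w' i)" "?\<tau> * R = 1\<^sub>m (w i)"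
    using linked unfolding linked_def split_exact_def by blast
  note P = linked_sigma_tau
  have "?\<tau> * ((1\<^sub>m N + ?\<sigma> * ?\<tau>) * R) = s \<cdot>\<^sub>m (?\<tau> * ((1\<^sub>m N + ?\<sigma>' * ?\<tau>') * R))"
    unfolding P using L(1,2) by (simp add: mult_mat_smult_left mult_mat_smult_right)
  moreover have "?\<tau> * ((1\<^sub>m N + ?\<sigma> * ?\<tau>) * R) = 1\<^sub>m (w i) + ?\<tau> * ?\<sigma>"
    using L by (simp add: mat_ring)
  moreover have "?\<tau> * ((1\<^sub>m N + ?\<sigma>' * ?\<tau>') * R) = ?\<tau> * R + ?\<tau> * ?\<sigma>' * (?\<tau>' * R)"
    using L(1,2) by (simp add: mat_ring)
  ultimately have 1: "1\<^sub>m (w i) + ?\<tau> * ?\<sigma> = s \<cdot>\<^sub>m 1\<^sub>m (w i)"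
    using L by (simp add: mult_mat_zero_left)
  have "L * ((1\<^sub>m N + ?\<sigma> * ?\<tau>) * ?\<sigma>') = s \<cdot>\<^sub>m (L * ((1\<^sub>m N + ?\<sigma>' * ?\<tau>') * ?\<sigma>'))"
    unfolding P using L(1,2) by (simp add: mult_mat_smult_left mult_mat_smult_right)
  moreover have "L * ((1\<^sub>m N + ?\<sigma> * ?\<tau>) * ?\<sigma>') = L * ?\<sigma>' + L * (?\<sigma> * (?\<tau> * ?\<sigma>'))"
    using L(1,2) by (simp add: mat_ring)
  moreover have "L * ((1\<^sub>m N + ?\<sigma>' * ?\<tau>') * ?\<sigma>') = L * ?\<sigma>' + L * ?\<sigma>' * (?\<tau>' * ?\<sigma>')"
    using L(1,2) by (simp add: mat_ring)
  ultimately have "1\<^sub>m (w' i) = s \<cdot>\<^sub>m (1\<^sub>m (w' i) + ?\<tau>' * ?\<sigma>')"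
    using L by (simp add: mult_mat_zero_right mult_mat_one_left)
  then have "inverse s \<cdot>\<^sub>m 1\<^sub>m (w' i) = inverse s \<cdot>\<^sub>m (s \<cdot>\<^sub>m (1\<^sub>m (w' i) + ?\<tau>' * ?\<sigma>'))" by simp
  then have 2: "1\<^sub>m (w' i) + ?\<tau>' * ?\<sigma>' = inverse s \<cdot>\<^sub>m 1\<^sub>m (w' i)"
    unfolding smult_smult_mat using s by (simp add: one_smult_mat)
  show ?thesis
    unfolding moment_map_i[OF w linked_reps(1)] moment_map_i[OF w' linked_reps(2)] using 1 2 by simp
qed

end

end

section \<open>Stability\<close>

context quiver_vertex
begin

definition hat :: "('v \<Rightarrow> complex vec set) \<Rightarrow> complex vec set" where
  "hat S = {blocks_vec Hi d f | f. \<forall>h\<in>Hi. f h \<in> S (out_v Q h)}"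

definition subspaces :: "('v \<Rightarrow> complex vec set) \<Rightarrow> bool" where
  "subspaces S \<longleftrightarrow> (\<forall>h\<in>Hi. lin_subspace (d h) (S (out_v Q h)))"

lemma hat_cong: "(\<And>j. j \<noteq> i \<Longrightarrow> S j = S' j) \<Longrightarrow> hat S = hat S'"
  unfolding hat_def using out_v_Hi by auto

context
  fixes S assumes S: "subspaces S"
begin

lemma S_carrier: "h \<in> Hi \<Longrightarrow> u \<in> S (out_v Q h) \<Longrightarrow> u \<in> carrier_vec (d h)"
  using S unfolding subspaces_def lin_subspace_iff by blast

lemma hat_memI: "(\<And>h. h \<in> Hi \<Longrightarrow> f h \<in> S (out_v Q h)) \<Longrightarrow> blocks_vec Hi d f \<in> hat S"
  unfolding hat_def by blast

lemma hat_memD: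
  assumes "blocks_vec Hi d f \<in> hat S" "h \<in> Hi" "f h \<in> carrier_vec (d h)"
  shows "f h \<in> S (out_v Q h)"
proof -
  obtain g where g: "blocks_vec Hi d f = blocks_vec Hi d g" "\<forall>h\<in>Hi. g h \<in> S (out_v Q h)"
    using assms(1) unfolding hat_def by blast
  have "f h = g h"
    using blocks_vec_eqD[OF finite_Hi g(1) assms(2,3)] S_carrier[OF assms(2)] g(2) assms(2) by blast
  then show ?thesis using g(2) assms(2) by simp
qed

lemma hat_subspace: "lin_subspace N (hat S)"
  unfolding lin_subspace_iff
proof (intro conjI ballI allI)
  show "hat S \<subseteq> carrier_vec N" unfolding hat_def by auto
  have "0\<^sub>v N = blocks_vec Hi d (\<lambda>h. 0\<^sub>v (d h))"
    by (rule eq_vecI) (auto simp: blocks_vec_def blk_loc[OF finite_Hi, of _ d])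
  then show "0\<^sub>v N \<in> hat S" using S hat_memI[of "\<lambda>h. 0\<^sub>v (d h)"] unfolding subspaces_def lin_subspace_iff by auto
next
  fix u w assume "u \<in> hat S" "w \<in> hat S"
  then obtain f g where fg: "u = blocks_vec Hi d f" "w = blocks_vec Hi d g"
    "\<forall>h\<in>Hi. f h \<in> S (out_v Q h)" "\<forall>h\<in>Hi. g h \<in> S (out_v Q h)" unfolding hat_def by blast
  have "dim_vec (f h) = d h" "dim_vec (g h) = d h" if "h \<in> Hi" for h
    using fg that S_carrier[THEN carrier_vecD] by auto
  then have "u + w = blocks_vec Hi d (\<lambda>h. f h + g h)"
    unfolding fg(1,2) by (intro eq_vecI) (auto simp: blocks_vec_def blk_loc[OF finite_Hi, of _ d])
  then show "u + w \<in> hat S" using fg S unfolding subspaces_def lin_subspace_iff by (auto intro!: hat_memI)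
next
  fix c u assume "u \<in> hat S"
  then obtain f where f: "u = blocks_vec Hi d f" "\<forall>h\<in>Hi. f h \<in> S (out_v Q h)" unfolding hat_def by blast
  have "dim_vec (f h) = d h" if "h \<in> Hi" for h
    using f that S_carrier[THEN carrier_vecD] by auto
  then have "c \<cdot>\<^sub>v u = blocks_vec Hi d (\<lambda>h. c \<cdot>\<^sub>v f h)"
    unfolding f(1) by (intro eq_vecI) (auto simp: blocks_vec_def blk_loc[OF finite_Hi, of _ d])
  then show "c \<cdot>\<^sub>v u \<in> hat S" using f S unfolding subspaces_def lin_subspace_iff by (auto intro!: hat_memI)
qed

lemma hat_carrier: "f \<in> hat S \<Longrightarrow> f \<in> carrier_vec N"
  using hat_subspace unfolding lin_subspace_iff by blast

text \<open>Bases of the summands form a block diagonal matrix, which identifies the dimension of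
  \<open>hat S\<close> with the sum over arrows.\<close>

lemma hat_basis:
  obtains B where "B \<in> carrier_mat N (\<Sum>h\<in>Hi. subspace_dim (d h) (S (out_v Q h)))" "inj_mat B"
    "hat S = (\<lambda>u. B *\<^sub>v u) ` carrier_vec (\<Sum>h\<in>Hi. subspace_dim (d h) (S (out_v Q h)))"
proof -
  define k where "k = (\<lambda>h. subspace_dim (d h) (S (out_v Q h)))"
  have "\<forall>h\<in>Hi. \<exists>A. A \<in> carrier_mat (d h) (k h) \<and> inj_mat A \<and> S (out_v Q h) = (\<lambda>u. A *\<^sub>v u) ` carrier_vec (k h)"
    using S subspace_basis_mat unfolding subspaces_def k_def by blast
  then obtain B where B: "\<And>h. h \<in> Hi \<Longrightarrow> B h \<in> carrier_mat (d h) (k h)" "\<And>h. h \<in> Hi \<Longrightarrow> inj_mat (B h)"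
    "\<And>h. h \<in> Hi \<Longrightarrow> S (out_v Q h) = (\<lambda>u. B h *\<^sub>v u) ` carrier_vec (k h)" by metis
  have "hat S = (\<lambda>u. diag_blocks Hi d k B *\<^sub>v u) ` carrier_vec (blocks_dim Hi k)"
  proof (intro equalityI subsetI)
    fix f assume "f \<in> hat S"
    then obtain g where g: "f = blocks_vec Hi d g" "\<forall>h\<in>Hi. g h \<in> S (out_v Q h)" unfolding hat_def by blast
    then have "\<forall>h\<in>Hi. \<exists>u. u \<in> carrier_vec (k h) \<and> g h = B h *\<^sub>v u" using B(3) by blast
    then obtain u where u: "\<And>h. h \<in> Hi \<Longrightarrow> u h \<in> carrier_vec (k h)" "\<And>h. h \<in> Hi \<Longrightarrow> g h = B h *\<^sub>v u h" by metis
    have "diag_blocks Hi d k B *\<^sub>v blocks_vec Hi k u = blocks_vec Hi d (\<lambda>h. B h *\<^sub>v u h)"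
      by (rule diag_blocks_mult_vec[OF finite_Hi B(1) u(1)])
    also have "\<dots> = f"
      unfolding g(1) by (rule blocks_vec_cong[OF finite_Hi]) (simp add: u(2))
    finally have "f = diag_blocks Hi d k B *\<^sub>v blocks_vec Hi k u" by simp
    then show "f \<in> (\<lambda>u. diag_blocks Hi d k B *\<^sub>v u) ` carrier_vec (blocks_dim Hi k)"
      by (rule image_eqI) simp
  next
    fix f assume "f \<in> (\<lambda>u. diag_blocks Hi d k B *\<^sub>v u) ` carrier_vec (blocks_dim Hi k)"
    then obtain u where u: "u \<in> carrier_vec (blocks_dim Hi k)" "f = diag_blocks Hi d k B *\<^sub>v u" by blast
    define w where "w = (\<lambda>h\<in>Hi. vec (k h) (\<lambda>a. u $ idx Hi k h a))"
    have w: "u = blocks_vec Hi k w" "\<And>h. h \<in> Hi \<Longrightarrow> w h \<in> carrier_vec (k h)"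
      using blocks_vec_surj[OF finite_Hi u(1)] unfolding w_def by auto
    have "f = blocks_vec Hi d (\<lambda>h. B h *\<^sub>v w h)"
      unfolding u(2) w(1) by (rule diag_blocks_mult_vec[OF finite_Hi B(1) w(2)])
    then show "f \<in> hat S" using B(3) w(2) by (auto intro!: hat_memI)
  qed
  moreover have "blocks_dim Hi k = (\<Sum>h\<in>Hi. subspace_dim (d h) (S (out_v Q h)))"
    by (simp add: blocks_dim_def k_def)
  moreover have "inj_mat (diag_blocks Hi d k B)" by (rule inj_diag_blocks[OF finite_Hi B(1,2)])
  ultimately show ?thesis
    using that[of "diag_blocks Hi d k B"] blocks_carrier(4)[of Hi d k B] by simp
qed

lemma hat_zero: "(\<And>h. h \<in> Hi \<Longrightarrow> S (out_v Q h) = {0\<^sub>v (d h)}) \<Longrightarrow> hat S = {0\<^sub>v N}"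
proof -
  assume z: "\<And>h. h \<in> Hi \<Longrightarrow> S (out_v Q h) = {0\<^sub>v (d h)}"
  have "blocks_vec Hi d f = 0\<^sub>v N" if "\<forall>h\<in>Hi. f h \<in> S (out_v Q h)" for f
    using that z by (intro eq_vecI) (auto simp: blocks_vec_def blk_loc[OF finite_Hi, of _ d])
  then have "hat S \<subseteq> {0\<^sub>v N}" unfolding hat_def by blast
  then show ?thesis using hat_subspace unfolding lin_subspace_iff by blast
qed

lemma hat_full: "(\<And>h. h \<in> Hi \<Longrightarrow> S (out_v Q h) = carrier_vec (d h)) \<Longrightarrow> hat S = carrier_vec N"
proof -
  assume z: "\<And>h. h \<in> Hi \<Longrightarrow> S (out_v Q h) = carrier_vec (d h)"
  have "u \<in> hat S" if "u \<in> carrier_vec N" for u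
    by (subst blocks_vec_surj[OF finite_Hi that]) (rule hat_memI, use z in auto)
  then show ?thesis using hat_subspace unfolding lin_subspace_iff by blast
qed

definition preserves_hat :: "complex mat \<Rightarrow> bool" where
  "preserves_hat A \<longleftrightarrow> A \<in> carrier_mat N N \<and> (\<forall>f\<in>hat S. A *\<^sub>v f \<in> hat S)"

lemma preserves_hat_intros:
  "preserves_hat A \<Longrightarrow> preserves_hat B \<Longrightarrow> preserves_hat (A + B)"
  "preserves_hat A \<Longrightarrow> preserves_hat B \<Longrightarrow> preserves_hat (A - B)"
  "preserves_hat A \<Longrightarrow> preserves_hat (c \<cdot>\<^sub>m A)"
  "preserves_hat (1\<^sub>m N)"
proof -
  have sub: "lin_subspace N (hat S)" by (rule hat_subspace)
  show "preserves_hat A \<Longrightarrow> preserves_hat B \<Longrightarrow> preserves_hat (A + B)"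
    using sub hat_carrier unfolding preserves_hat_def lin_subspace_iff
    by (auto simp: add_mult_distrib_mat_vec)
  have "(A - B) *\<^sub>v f = A *\<^sub>v f + (-1) \<cdot>\<^sub>v (B *\<^sub>v f)" if "A \<in> carrier_mat N N" "B \<in> carrier_mat N N" "f \<in> carrier_vec N" for f
    using that by (intro eq_vecI) (auto simp: scalar_prod_def sum_subtractf left_diff_distrib)
  then show "preserves_hat A \<Longrightarrow> preserves_hat B \<Longrightarrow> preserves_hat (A - B)"
    using sub hat_carrier unfolding preserves_hat_def lin_subspace_iff by auto
  have "(c \<cdot>\<^sub>m A) *\<^sub>v f = c \<cdot>\<^sub>v (A *\<^sub>v f)" if "A \<in> carrier_mat N N" "f \<in> carrier_vec N" for f
    using that by (intro eq_vecI) (auto simp: scalar_prod_def sum_distrib_left mult.assoc)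
  then show "preserves_hat A \<Longrightarrow> preserves_hat (c \<cdot>\<^sub>m A)"
    using sub hat_carrier unfolding preserves_hat_def lin_subspace_iff by auto
  show "preserves_hat (1\<^sub>m N)"
    using hat_carrier unfolding preserves_hat_def by simp
qed

lemma single_block_hat:
  assumes h: "h \<in> Hi" and u: "u \<in> S (out_v Q h)"
  shows "blocks_vec Hi d (\<lambda>k. if k = h then u else 0\<^sub>v (d k)) \<in> hat S"
  using h u S unfolding subspaces_def lin_subspace_iff by (auto intro!: hat_memI)

lemma in_mat_single_block:
  assumes w: "adm w" and x: "x \<in> reps Q w" and h: "h \<in> Hi" and u: "u \<in> S (out_v Q h)"
  shows "in_mat w x *\<^sub>v blocks_vec Hi d (\<lambda>k. if k = h then u else 0\<^sub>v (d k)) = x h *\<^sub>v u"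
proof (rule eq_vecI)
  note c = x_in_carrier[OF w x]
  fix r assume "r < dim_vec (x h *\<^sub>v u)"
  then have r: "r < w i" using c[OF h] by simp
  have "(in_mat w x *\<^sub>v blocks_vec Hi d (\<lambda>k. if k = h then u else 0\<^sub>v (d k))) $ r =
      (\<Sum>k\<in>Hi. (x k *\<^sub>v (if k = h then u else 0\<^sub>v (d k))) $ r)"
    unfolding in_mat_def
    by (rule col_blocks_mult_vec[OF finite_Hi c _ r]) (use S_carrier[OF h u] in auto)
  also have "\<dots> = (\<Sum>k\<in>Hi. if k = h then (x h *\<^sub>v u) $ r else 0)"
  proof (rule sum.cong[OF refl])
    fix k assume k: "k \<in> Hi"
    have "x k *\<^sub>v 0\<^sub>v (d k) = 0\<^sub>v (w i)" using c[OF k] by (simp add: mult_mat_zero_vec)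
    then show "(x k *\<^sub>v (if k = h then u else 0\<^sub>v (d k))) $ r = (if k = h then (x h *\<^sub>v u) $ r else 0)"
      using r by (simp del: index_mult_mat_vec)
  qed
  finally show "(in_mat w x *\<^sub>v blocks_vec Hi d (\<lambda>k. if k = h then u else 0\<^sub>v (d k))) $ r = (x h *\<^sub>v u) $ r"
    using finite_Hi h by (simp del: index_mult_mat_vec)
qed (use x_in_carrier[OF w x h] in simp)

context
  fixes w x
  assumes w: "adm w" and x: "x \<in> reps Q w" and inv: "invariant_subspace Q w x S"
begin

lemma inv_i: "lin_subspace (w i) (S i)"
  using inv i unfolding invariant_subspace_def by blast

lemma inv_in: "h \<in> Hi \<Longrightarrow> u \<in> S (out_v Q h) \<Longrightarrow> x h *\<^sub>v u \<in> S i"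
  using inv Hi_darrows in_v_Hi unfolding invariant_subspace_def by fastforce

lemma inv_out: "h \<in> Hi \<Longrightarrow> u \<in> S i \<Longrightarrow> x (opp h) *\<^sub>v u \<in> S (out_v Q h)"
proof -
  assume "h \<in> Hi" "u \<in> S i"
  then have "opp h \<in> darrows Q" "u \<in> S (out_v Q (opp h))" using Hi_darrows in_v_Hi by auto
  then have "x (opp h) *\<^sub>v u \<in> S (in_v Q (opp h))" using inv unfolding invariant_subspace_def by blast
  then show ?thesis by simp
qed

lemma sigma_hat:
  assumes u: "u \<in> S i"
  shows "sigma_mat w x *\<^sub>v u \<in> hat S"
proof -
  have uc: "u \<in> carrier_vec (w i)" using u inv_i unfolding lin_subspace_iff by blast
  have "sigma_mat w x *\<^sub>v u = blocks_vec Hi d (\<lambda>h. x (opp h) *\<^sub>v u)"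
    unfolding sigma_mat_def by (rule row_blocks_mult_vec[OF finite_Hi x_out_carrier[OF w x] uc])
  then show ?thesis using inv_out[OF _ u] by (auto intro!: hat_memI)
qed

lemma in_hat:
  assumes f: "f \<in> hat S"
  shows "in_mat w x *\<^sub>v f \<in> S i"
proof -
  obtain g where g: "f = blocks_vec Hi d g" "\<forall>h\<in>Hi. g h \<in> S (out_v Q h)"
    using f unfolding hat_def by blast
  show ?thesis unfolding g(1) in_mat_def
    using g(2) S_carrier inv_in by (intro lin_subspace_col_blocks[OF inv_i finite_Hi x_in_carrier[OF w x]]) auto
qed

lemma partial_prod_inv:
  assumes u: "u \<in> S i"
  shows "partial_prod Q ord i w x h *\<^sub>v u \<in> S i"
  unfolding partial_prod_def
proof (rule ordered_prod_invariant[OF ord])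
  show "finite {h' \<in> Hi. (h', h) \<in> ord}" "{h' \<in> Hi. (h', h) \<in> ord} \<subseteq> darrows Q"
    using finite_Hi Hi_darrows by auto
  show "one_plus Q w x a \<in> carrier_mat (w i) (w i)" if "a \<in> {h' \<in> Hi. (h', h) \<in> ord}" for a
    using one_plus_Hi_carrier[OF w x] that by blast
  show Si: "S i \<subseteq> carrier_vec (w i)" using inv_i unfolding lin_subspace_iff by blast
  fix a u assume a: "a \<in> {h' \<in> Hi. (h', h) \<in> ord}" and u: "u \<in> S i"
  then have a: "a \<in> Hi" and uc: "u \<in> carrier_vec (w i)" using Si by auto
  note c = x_in_carrier[OF w x a] x_out_carrier[OF w x a]
  have "one_plus Q w x a *\<^sub>v u = u + x a *\<^sub>v (x (opp a) *\<^sub>v u)"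
    unfolding one_plus_Hi[OF w x a] using c uc
    by (subst add_mult_distrib_mat_vec[of _ "w i" "w i"]) auto
  then show "one_plus Q w x a *\<^sub>v u \<in> S i"
    using inv_in[OF a inv_out[OF a u]] u inv_i unfolding lin_subspace_iff by auto
qed (rule u)

lemma tau_hat:
  assumes f: "f \<in> hat S"
  shows "tau_mat w x *\<^sub>v f \<in> S i"
proof -
  obtain g where g: "f = blocks_vec Hi d g" "\<forall>h\<in>Hi. g h \<in> S (out_v Q h)"
    using f unfolding hat_def by blast
  show ?thesis unfolding g(1) tau_mat_def
  proof (rule lin_subspace_col_blocks[OF inv_i finite_Hi tau_block_carrier[OF w x]])
    fix h assume h: "h \<in> Hi"
    show gh: "g h \<in> carrier_vec (d h)" using g(2) S_carrier h by blast
    have "partial_prod Q ord i w x h * x h *\<^sub>v g h = partial_prod Q ord i w x h *\<^sub>v (x h *\<^sub>v g h)"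
      by (rule assoc_mult_mat_vec[OF partial_prod_carrier[OF w x] x_in_carrier[OF w x h] gh])
    then show "partial_prod Q ord i w x h * x h *\<^sub>v g h \<in> S i"
      using partial_prod_inv inv_in[OF h] g(2) h by simp
  qed
qed

lemma preserves_hat_sigma_in: "preserves_hat (sigma_mat w x * in_mat w x)"
  unfolding preserves_hat_def
  using sigma_hat[OF in_hat] hat_carrier[THEN carrier_vecD] by (auto simp: mult_mat_mult_vec intro!: carrier_matI)

lemma preserves_hat_sigma_tau: "preserves_hat (sigma_mat w x * tau_mat w x)"
  unfolding preserves_hat_def
  using sigma_hat[OF tau_hat] hat_carrier[THEN carrier_vecD] by (auto simp: mult_mat_mult_vec intro!: carrier_matI)

text \<open>Truncating the matrix amounts to truncating the vector: the block at \<open>h\<close> of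
  the image of f is \<open>x (opp h)\<close> applied to X of the part of f in blocks after
  \<open>h\<close>. That part stays in \<open>hat S\<close>, since \<open>hat S\<close> is a direct
  sum over blocks.\<close>

lemma preserves_hat_upper: "preserves_hat (up (sigma_mat w x * in_mat w x))"
  unfolding preserves_hat_def
proof (intro conjI ballI)
  fix f assume "f \<in> hat S"
  then obtain g where g: "f = blocks_vec Hi d g" "\<forall>h\<in>Hi. g h \<in> S (out_v Q h)"
    unfolding hat_def by blast
  have fc: "f \<in> carrier_vec N" using g by simp
  \<comment> \<open>The part of the family \<open>g\<close> in the blocks after \<open>h\<close>,
    with zero elsewhere.\<close>
  define G where "G = (\<lambda>h. blocks_vec Hi d (\<lambda>k. if (h, k) \<in> ord then g k else 0\<^sub>v (d k)))"
  have G: "G h \<in> hat S" for h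
    unfolding G_def using g(2) S unfolding subspaces_def lin_subspace_iff by (auto intro!: hat_memI)
  have Gi: "in_mat w x *\<^sub>v G h \<in> S i" for h by (rule in_hat[OF G])
  have Gc: "in_mat w x *\<^sub>v G h \<in> carrier_vec (w i)" for h using Gi inv_i unfolding lin_subspace_iff by blast
  have "up (sigma_mat w x * in_mat w x) *\<^sub>v f = blocks_vec Hi d (\<lambda>h. x (opp h) *\<^sub>v (in_mat w x *\<^sub>v G h))"
  proof (rule eq_vecI)
    fix r assume "r < dim_vec (blocks_vec Hi d (\<lambda>h. x (opp h) *\<^sub>v (in_mat w x *\<^sub>v G h)))"
    then have r: "r < N" by simp
    let ?h = "blk Hi d r"
    note b = blk_loc[OF finite_Hi r]
    have "(up (sigma_mat w x * in_mat w x) *\<^sub>v f) $ r =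
        (\<Sum>c = 0..<N. (sigma_mat w x * in_mat w x) $$ (r, c) * G ?h $ c)"
      using r fc g(1) blk_loc[OF finite_Hi, of _ d]
      by (auto simp: upper_blocks_def scalar_prod_def G_def blocks_vec_def simp del: index_mult_mat(1) intro!: sum.cong)
    also have "\<dots> = ((sigma_mat w x * in_mat w x) *\<^sub>v G ?h) $ r"
      using r hat_carrier[OF G[of ?h]] by (simp add: scalar_prod_def del: index_mult_mat(1))
    also have "(sigma_mat w x * in_mat w x) *\<^sub>v G ?h = sigma_mat w x *\<^sub>v (in_mat w x *\<^sub>v G ?h)"
      using hat_carrier[OF G[of ?h]] by (simp add: mult_mat_mult_vec)
    also have "\<dots> = blocks_vec Hi d (\<lambda>h. x (opp h) *\<^sub>v (in_mat w x *\<^sub>v G ?h))"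
      unfolding sigma_mat_def by (rule row_blocks_mult_vec[OF finite_Hi x_out_carrier[OF w x] Gc])
    finally show "(up (sigma_mat w x * in_mat w x) *\<^sub>v f) $ r =
        blocks_vec Hi d (\<lambda>h. x (opp h) *\<^sub>v (in_mat w x *\<^sub>v G h)) $ r"
      using r by (simp add: blocks_vec_def del: index_mult_mat_vec)
  qed simp
  then show "up (sigma_mat w x * in_mat w x) *\<^sub>v f \<in> hat S"
    using inv_out[OF _ Gi] by (auto intro!: hat_memI)
qed simp

end

end

lemma invariant_subspaces:
  assumes "adm w" "invariant_subspace Q w x S"
  shows "subspaces S"
  using assms out_v_Hi_verts adm_d unfolding invariant_subspace_def subspaces_def by fastforce

text \<open>From X = \<tau>(1 - U). It makes the image of \<tau>, taken at \<open>i\<close> with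
  everything at the other vertices, an invariant subspace.\<close>

lemma in_image_tau:
  assumes w: "adm w" and x: "x \<in> reps Q w" and h: "h \<in> Hi" and u: "u \<in> carrier_vec (d h)"
  shows "x h *\<^sub>v u \<in> (\<lambda>f. tau_mat w x *\<^sub>v f) ` carrier_vec N"
proof -
  let ?f = "blocks_vec Hi d (\<lambda>k. if k = h then u else 0\<^sub>v (d k))" and ?A = "1\<^sub>m N - up (sigma_mat w x * in_mat w x)"
  have A: "?A \<in> carrier_mat N N" by (auto intro!: carrier_matI)
  have f: "?f \<in> carrier_vec N" by auto
  have "subspaces (\<lambda>j. carrier_vec (v j))" unfolding subspaces_def by (simp add: lin_subspace_carrier)
  then have "x h *\<^sub>v u = in_mat w x *\<^sub>v ?f"
    using in_mat_single_block[of "\<lambda>j. carrier_vec (v j)" w x h u] w x h u by simp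
  also have "\<dots> = tau_mat w x *\<^sub>v (?A *\<^sub>v ?f)"
    by (subst in_mat_eq[OF w x], rule mult_mat_mult_vec) (use A f in auto)
  finally show ?thesis using mult_mat_vec_carrier[OF A f] by blast
qed

section \<open>Weights of dimension vectors under the reflection of \<theta>\<close>

lemma finite_verts: "finite (verts Q)"
  using fin_Q by (simp add: fin_digraph_def fin_digraph_axioms_def)

text \<open>Grouping the arrows into \<open>i\<close> by their sources turns the multiplicities in
  \<open>\<theta>'\<close> into a sum over \<open>Hi\<close>, which is the dimension that
  \<open>k\<close> induces on the sum of the neighbouring spaces.\<close>

lemma reflected_theta_sum:
  fixes \<theta> \<theta>' :: "'v \<Rightarrow> rat" and k :: "'v \<Rightarrow> nat"
  assumes "\<theta>' i = - \<theta> i"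
    and \<theta>': "\<And>j. j \<in> verts Q - {i} \<Longrightarrow> \<theta>' j = \<theta> j + of_nat (card {h \<in> Hi. out_v Q h = j}) * \<theta> i"
  shows "(\<Sum>j\<in>verts Q. \<theta>' j * of_nat (k j)) =
    (\<Sum>j\<in>verts Q - {i}. \<theta> j * of_nat (k j)) + \<theta> i * (of_nat (\<Sum>h\<in>Hi. k (out_v Q h)) - of_nat (k i))"
proof -
  have "(\<Sum>j\<in>verts Q - {i}. of_nat (card {h \<in> Hi. out_v Q h = j}) * of_nat (k j)) =
      (\<Sum>j\<in>verts Q - {i}. \<Sum>h | h \<in> Hi \<and> out_v Q h = j. (of_nat (k (out_v Q h)) :: rat))"
    by (intro sum.cong) auto
  also have "\<dots> = (\<Sum>h\<in>Hi. of_nat (k (out_v Q h)))"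
    using out_v_Hi_verts finite_verts by (intro sum.group[OF finite_Hi]) auto
  finally have *: "(\<Sum>j\<in>verts Q - {i}. of_nat (card {h \<in> Hi. out_v Q h = j}) * of_nat (k j)) =
      (\<Sum>h\<in>Hi. (of_nat (k (out_v Q h)) :: rat))" .
  have "(\<Sum>j\<in>verts Q. \<theta>' j * of_nat (k j)) = \<theta>' i * of_nat (k i) + (\<Sum>j\<in>verts Q - {i}. \<theta>' j * of_nat (k j))"
    by (rule sum.remove[OF finite_verts i])
  also have "(\<Sum>j\<in>verts Q - {i}. \<theta>' j * of_nat (k j)) =
      (\<Sum>j\<in>verts Q - {i}. \<theta> j * of_nat (k j) + \<theta> i * (of_nat (card {h \<in> Hi. out_v Q h = j}) * of_nat (k j)))"
    by (intro sum.cong) (auto simp: \<theta>' algebra_simps)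
  also have "\<dots> = (\<Sum>j\<in>verts Q - {i}. \<theta> j * of_nat (k j)) + \<theta> i * (\<Sum>h\<in>Hi. of_nat (k (out_v Q h)))"
    unfolding sum.distrib sum_distrib_left[symmetric] * ..
  finally show ?thesis using assms(1) by (simp add: algebra_simps)
qed

context
  fixes s w w' x x' and \<theta> \<theta>' :: "'v \<Rightarrow> rat"
  assumes w: "adm w" and w': "adm w'" and s: "s \<noteq> (0::complex)" and linked: "linked s w w' x x'"
    and N: "w i + w' i = N"
    and \<theta>'i: "\<theta>' i = - \<theta> i"
    and \<theta>': "\<And>j. j \<in> verts Q - {i} \<Longrightarrow> \<theta>' j = \<theta> j + of_nat (card {h \<in> Hi. out_v Q h = j}) * \<theta> i"
    and \<theta>i: "\<theta> i \<le> 0" and \<theta>0: "\<theta> i = 0 \<Longrightarrow> s \<noteq> 1"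
begin

lemma w_eq: "j \<in> verts Q - {i} \<Longrightarrow> w' j = w j"
  using w w' unfolding adm_def by simp

lemma theta_dim_sum:
  "(\<Sum>j\<in>verts Q. \<theta>' j * of_nat (w' j)) = (\<Sum>j\<in>verts Q. \<theta> j * of_nat (w j))"
proof -
  have sum_N: "(\<Sum>h\<in>Hi. w' (out_v Q h)) = N"
    unfolding blocks_dim_def using adm_d[OF w'] by simp
  have "(\<Sum>j\<in>verts Q. \<theta>' j * of_nat (w' j)) =
      (\<Sum>j\<in>verts Q - {i}. \<theta> j * of_nat (w' j)) + \<theta> i * (of_nat N - of_nat (w' i))"
    using reflected_theta_sum[where \<theta> = \<theta> and \<theta>' = \<theta>' and k = w', OF \<theta>'i \<theta>'] unfolding sum_N .
  also have "of_nat N - of_nat (w' i) = (of_nat (w i) :: rat)"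
    using N by (metis add_diff_cancel_right' of_nat_add)
  also have "(\<Sum>j\<in>verts Q - {i}. \<theta> j * of_nat (w' j)) = (\<Sum>j\<in>verts Q - {i}. \<theta> j * of_nat (w j))"
    using w_eq by (intro sum.cong) auto
  finally show ?thesis
    using sum.remove[OF finite_verts i, of "\<lambda>j. \<theta> j * of_nat (w j)"] by simp
qed

text \<open>The weights of the two subspaces differ by \<open>\<theta> i\<close> times the defect of
  exactness, in dimensions, of \<open>0 \<rightarrow> S' i \<rightarrow> hat S \<rightarrow> S i
  \<rightarrow> 0\<close>. With \<open>\<theta> i \<le> 0\<close>, the sign of that defect decides
  the comparison.\<close>

lemma theta_subspace_sum:
  assumes eq: "\<And>j. j \<noteq> i \<Longrightarrow> S j = S' j"
  shows "(\<Sum>j\<in>verts Q. \<theta>' j * of_nat (subspace_dim (w' j) (S' j))) =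
      (\<Sum>j\<in>verts Q. \<theta> j * of_nat (subspace_dim (w j) (S j))) +
      \<theta> i * (of_nat (\<Sum>h\<in>Hi. subspace_dim (d h) (S (out_v Q h))) - of_nat (subspace_dim (w' i) (S' i))
        - of_nat (subspace_dim (w i) (S i)))"
proof -
  have sum_eq: "(\<Sum>h\<in>Hi. subspace_dim (w' (out_v Q h)) (S' (out_v Q h))) = (\<Sum>h\<in>Hi. subspace_dim (d h) (S (out_v Q h)))"
    using adm_d[OF w'] eq out_v_Hi by (intro sum.cong) auto
  have "(\<Sum>j\<in>verts Q. \<theta>' j * of_nat (subspace_dim (w' j) (S' j))) =
      (\<Sum>j\<in>verts Q - {i}. \<theta> j * of_nat (subspace_dim (w' j) (S' j))) +
      \<theta> i * (of_nat (\<Sum>h\<in>Hi. subspace_dim (d h) (S (out_v Q h))) - of_nat (subspace_dim (w' i) (S' i)))"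
    using reflected_theta_sum[where \<theta> = \<theta> and \<theta>' = \<theta>' and k = "\<lambda>j. subspace_dim (w' j) (S' j)", OF \<theta>'i \<theta>']
    unfolding sum_eq .
  also have "(\<Sum>j\<in>verts Q - {i}. \<theta> j * of_nat (subspace_dim (w' j) (S' j))) =
      (\<Sum>j\<in>verts Q - {i}. \<theta> j * of_nat (subspace_dim (w j) (S j)))"
    using w_eq eq by (intro sum.cong) auto
  finally show ?thesis
    using sum.remove[OF finite_verts i, of "\<lambda>j. \<theta> j * of_nat (subspace_dim (w j) (S j))"]
    by (simp add: algebra_simps)
qed

lemmas reps = linked_reps[OF w w' s linked]

lemma upper_eq: "up (sigma_mat w' x' * in_mat w' x') = up (sigma_mat w x * in_mat w x)"
  using linked unfolding linked_def blk_rel_def by blast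

lemma sigma_in_eq:
  "sigma_mat w' x' * in_mat w' x' =
    inverse s \<cdot>\<^sub>m (1\<^sub>m N + sigma_mat w x * in_mat w x - up (sigma_mat w x * in_mat w x)) -
    1\<^sub>m N + up (sigma_mat w x * in_mat w x)"
proof (rule eq_matI)
  let ?M = "sigma_mat w x * in_mat w x" and ?M' = "sigma_mat w' x' * in_mat w' x'"
  fix r c assume "r < dim_row (inverse s \<cdot>\<^sub>m (1\<^sub>m N + ?M - up ?M) - 1\<^sub>m N + up ?M)"
    "c < dim_col (inverse s \<cdot>\<^sub>m (1\<^sub>m N + ?M - up ?M) - 1\<^sub>m N + up ?M)"
  then have rc: "r < N" "c < N" by auto
  have "1\<^sub>m N + ?M - up ?M = s \<cdot>\<^sub>m (1\<^sub>m N + ?M' - up ?M)"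
    using linked unfolding linked_def blk_rel_def by blast
  from arg_cong[OF this, of "\<lambda>A. A $$ (r, c)"]
  show "?M' $$ (r, c) = (inverse s \<cdot>\<^sub>m (1\<^sub>m N + ?M - up ?M) - 1\<^sub>m N + up ?M) $$ (r, c)"
    using rc s by (simp add: field_simps del: index_mult_mat(1) index_one_mat(1))
qed auto

lemma sigma_tau_eq:
  "sigma_mat w x * tau_mat w x = s \<cdot>\<^sub>m (1\<^sub>m N + sigma_mat w' x' * tau_mat w' x') - 1\<^sub>m N"
proof (rule eq_matI)
  let ?M = "sigma_mat w x * tau_mat w x" and ?M' = "sigma_mat w' x' * tau_mat w' x'"
  fix r c assume "r < dim_row (s \<cdot>\<^sub>m (1\<^sub>m N + ?M') - 1\<^sub>m N)" "c < dim_col (s \<cdot>\<^sub>m (1\<^sub>m N + ?M') - 1\<^sub>m N)"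
  then have rc: "r < N" "c < N" by auto
  from arg_cong[OF linked_sigma_tau[OF w w' s linked], of "\<lambda>A. A $$ (r, c)"]
  show "?M $$ (r, c) = (s \<cdot>\<^sub>m (1\<^sub>m N + ?M') - 1\<^sub>m N) $$ (r, c)"
    using rc by (simp add: algebra_simps del: index_mult_mat(1) index_one_mat(1))
qed auto

lemma tau_sigma_smult:
  "tau_mat w x * sigma_mat w x = (s - 1) \<cdot>\<^sub>m 1\<^sub>m (w i)"
  "tau_mat w' x' * sigma_mat w' x' = (inverse s - 1) \<cdot>\<^sub>m 1\<^sub>m (w' i)"
  using linked_moment_map_i[OF w w' s linked]
  by (intro tau_sigma_of_moment_map[OF w reps(1)] tau_sigma_of_moment_map[OF w' reps(2)]; blast)+

text \<open>
  The sequence \<open>0 \<rightarrow> W' \<rightarrow> hat S \<rightarrow> W \<rightarrow> 0\<close> induced by \<open>\<sigma>'\<close> and \<open>\<tau>\<close> is exact except possibly in the middle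
  in the first case, and except possibly at \<open>W\<close> in the second.
\<close>

lemma linked_dims_le:
  assumes S': "subspaces S" "lin_subspace (w' i) W'" and W: "W = (\<lambda>f. tau_mat w x *\<^sub>v f) ` hat S"
    and sub: "lin_subspace (w i) W"
    and sW': "\<And>u. u \<in> W' \<Longrightarrow> sigma_mat w' x' *\<^sub>v u \<in> hat S"
  shows "subspace_dim (w i) W + subspace_dim (w' i) W' \<le> (\<Sum>h\<in>Hi. subspace_dim (d h) (S (out_v Q h)))"
proof -
  let ?k = "\<Sum>h\<in>Hi. subspace_dim (d h) (S (out_v Q h))"
  obtain B where B: "B \<in> carrier_mat N ?k" "inj_mat B" "hat S = (\<lambda>u. B *\<^sub>v u) ` carrier_vec ?k"
    using hat_basis[OF S'(1)] by blast
  obtain C where C: "C \<in> carrier_mat (w i) (subspace_dim (w i) W)" "inj_mat C"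
    "W = (\<lambda>u. C *\<^sub>v u) ` carrier_vec (subspace_dim (w i) W)"
    using subspace_basis_mat[OF sub] by blast
  obtain D where D: "D \<in> carrier_mat (w' i) (subspace_dim (w' i) W')" "inj_mat D"
    "W' = (\<lambda>u. D *\<^sub>v u) ` carrier_vec (subspace_dim (w' i) W')"
    using subspace_basis_mat[OF S'(2)] by blast
  obtain L R where LR: "split_exact (w' i) N (w i) (sigma_mat w' x') (tau_mat w x) L R"
    using linked unfolding linked_def by blast
  have L: "L \<in> carrier_mat (w' i) N" "tau_mat w x * sigma_mat w' x' = 0\<^sub>m (w i) (w' i)" "L * sigma_mat w' x' = 1\<^sub>m (w' i)"
    using LR unfolding split_exact_def by auto
  \<comment> \<open>\<open>Y\<close> lifts a basis of W through \<tau> to coordinates in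
    \<open>hat S\<close>; below, \<open>Z\<close> holds the coordinates of the image under \<sigma>'
    of a basis of W'. Their ranges are independent because \<tau>\<sigma>' = 0 and \<sigma>' is
    injective.\<close>
  have "\<exists>Y\<in>carrier_mat ?k (subspace_dim (w i) W). C = tau_mat w x * B * Y"
  proof (rule range_subset_factor[OF C(1)])
    show "tau_mat w x * B \<in> carrier_mat (w i) ?k" using B(1) by auto
    fix u :: "complex vec" assume "u \<in> carrier_vec (subspace_dim (w i) W)"
    then have "C *\<^sub>v u \<in> W" by (subst C(3)) blast
    then obtain z where "z \<in> carrier_vec ?k" "C *\<^sub>v u = tau_mat w x *\<^sub>v (B *\<^sub>v z)"
      unfolding W B(3) by blast
    then show "C *\<^sub>v u \<in> (\<lambda>u. tau_mat w x * B *\<^sub>v u) ` carrier_vec ?k"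
      using B(1) by (intro image_eqI[of _ _ z]) (auto simp: mult_mat_mult_vec)
  qed
  then obtain Y where Y: "Y \<in> carrier_mat ?k (subspace_dim (w i) W)" "C = tau_mat w x * B * Y" by blast
  have "\<exists>Z\<in>carrier_mat ?k (subspace_dim (w' i) W'). sigma_mat w' x' * D = B * Z"
  proof (rule range_subset_factor[OF _ B(1)])
    show "sigma_mat w' x' * D \<in> carrier_mat N (subspace_dim (w' i) W')" using D(1) by auto
    fix u :: "complex vec" assume u: "u \<in> carrier_vec (subspace_dim (w' i) W')"
    then have "D *\<^sub>v u \<in> W'" by (subst D(3)) blast
    then have "sigma_mat w' x' *\<^sub>v (D *\<^sub>v u) \<in> hat S" by (rule sW')
    then show "sigma_mat w' x' * D *\<^sub>v u \<in> (\<lambda>u. B *\<^sub>v u) ` carrier_vec ?k"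
      unfolding B(3) using D(1) u by (simp add: mult_mat_mult_vec)
  qed
  then obtain Z where Z: "Z \<in> carrier_mat ?k (subspace_dim (w' i) W')" "sigma_mat w' x' * D = B * Z" by blast
  show ?thesis
  proof (rule independent_ranges_dim_le[OF Y(1) Z(1)])
    fix u z assume u: "u \<in> carrier_vec (subspace_dim (w i) W)" and z: "z \<in> carrier_vec (subspace_dim (w' i) W')"
      and eq: "Y *\<^sub>v u + Z *\<^sub>v z = 0\<^sub>v ?k"
    have Yu: "Y *\<^sub>v u \<in> carrier_vec ?k" and Zz: "Z *\<^sub>v z \<in> carrier_vec ?k" using Y(1) Z(1) u z by auto
    have tB: "tau_mat w x * B \<in> carrier_mat (w i) ?k" using B(1) by auto
    have Du: "D *\<^sub>v z \<in> carrier_vec (w' i)" using D(1) z by auto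
    have Zz': "B *\<^sub>v (Z *\<^sub>v z) = sigma_mat w' x' *\<^sub>v (D *\<^sub>v z)"
    proof -
      have "B *\<^sub>v (Z *\<^sub>v z) = B * Z *\<^sub>v z" using B(1) Z(1) z by (simp add: mult_mat_mult_vec)
      also have "\<dots> = sigma_mat w' x' *\<^sub>v (D *\<^sub>v z)" unfolding Z(2)[symmetric] using D(1) z by (simp add: mult_mat_mult_vec)
      finally show ?thesis .
    qed
    have "tau_mat w x * B *\<^sub>v (Z *\<^sub>v z) = tau_mat w x *\<^sub>v (B *\<^sub>v (Z *\<^sub>v z))"
      by (rule assoc_mult_mat_vec[OF vertex_mats_carrier(3) B(1) Zz])
    also have "\<dots> = tau_mat w x * sigma_mat w' x' *\<^sub>v (D *\<^sub>v z)"
      unfolding Zz' by (rule mult_mat_mult_vec[symmetric]) (use Du D(1) in auto)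
    also have "\<dots> = 0\<^sub>v (w i)" unfolding L(2) by (rule zero_mat_mult_vec[OF Du])
    finally have tZ: "tau_mat w x * B *\<^sub>v (Z *\<^sub>v z) = 0\<^sub>v (w i)" .
    have "C *\<^sub>v u = tau_mat w x * B *\<^sub>v (Y *\<^sub>v u)"
      unfolding Y(2) by (rule assoc_mult_mat_vec[OF tB Y(1) u])
    also have "\<dots> = tau_mat w x * B *\<^sub>v (Y *\<^sub>v u) + tau_mat w x * B *\<^sub>v (Z *\<^sub>v z)"
      unfolding tZ using mult_mat_vec_carrier[OF tB Yu] by simp
    also have "\<dots> = tau_mat w x * B *\<^sub>v (Y *\<^sub>v u + Z *\<^sub>v z)"
      by (rule mult_add_distrib_mat_vec[OF tB Yu Zz, symmetric])
    also have "\<dots> = 0\<^sub>v (w i)" unfolding eq using tB by (subst mult_mat_zero_vec) auto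
    finally have u0: "u = 0\<^sub>v (subspace_dim (w i) W)" using inj_matD[OF C(2,1) u] by blast
    have "Y *\<^sub>v u = 0\<^sub>v ?k" unfolding u0 using Y(1) by (subst mult_mat_zero_vec) auto
    then have "Z *\<^sub>v z = 0\<^sub>v ?k" using eq Zz by simp
    then have "sigma_mat w' x' *\<^sub>v (D *\<^sub>v z) = 0\<^sub>v N"
      using Zz' B(1) by (simp add: mult_mat_zero_vec)
    moreover have "L * sigma_mat w' x' *\<^sub>v (D *\<^sub>v z) = L *\<^sub>v (sigma_mat w' x' *\<^sub>v (D *\<^sub>v z))"
      by (rule mult_mat_mult_vec) (use L(1) D(1) in auto)
    ultimately have "L * sigma_mat w' x' *\<^sub>v (D *\<^sub>v z) = 0\<^sub>v (w' i)"
      using L(1) by (simp add: mult_mat_zero_vec)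
    then have "D *\<^sub>v z = 0\<^sub>v (w' i)" unfolding L(3) using Du by simp
    then have "z = 0\<^sub>v (subspace_dim (w' i) W')" using inj_matD[OF D(2,1) z] by blast
    then show "u = 0\<^sub>v (subspace_dim (w i) W) \<and> z = 0\<^sub>v (subspace_dim (w' i) W')" using u0 by blast
  qed
qed

lemma linked_dims_ge:
  assumes S': "subspaces S" "lin_subspace (w i) W"
    and W': "W' = {u \<in> carrier_vec (w' i). sigma_mat w' x' *\<^sub>v u \<in> hat S}"
    and sub: "lin_subspace (w' i) W'"
    and tW: "\<And>f. f \<in> hat S \<Longrightarrow> tau_mat w x *\<^sub>v f \<in> W"
  shows "(\<Sum>h\<in>Hi. subspace_dim (d h) (S (out_v Q h))) \<le> subspace_dim (w i) W + subspace_dim (w' i) W'"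
proof -
  let ?k = "\<Sum>h\<in>Hi. subspace_dim (d h) (S (out_v Q h))"
  obtain B where B: "B \<in> carrier_mat N ?k" "inj_mat B" "hat S = (\<lambda>u. B *\<^sub>v u) ` carrier_vec ?k"
    using hat_basis[OF S'(1)] by blast
  obtain C where C: "C \<in> carrier_mat (w i) (subspace_dim (w i) W)" "inj_mat C"
    "W = (\<lambda>u. C *\<^sub>v u) ` carrier_vec (subspace_dim (w i) W)"
    using subspace_basis_mat[OF S'(2)] by blast
  obtain D where D: "D \<in> carrier_mat (w' i) (subspace_dim (w' i) W')" "inj_mat D"
    "W' = (\<lambda>u. D *\<^sub>v u) ` carrier_vec (subspace_dim (w' i) W')"
    using subspace_basis_mat[OF sub] by blast
  have "w' i = subspace_dim (w' i) W' + (w' i - subspace_dim (w' i) W')"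
    using inj_mat_cols_le_rows[OF D(1,2)] by simp
  then obtain E where E: "E \<in> carrier_mat (subspace_dim (w' i) W') (w' i)" "E * D = 1\<^sub>m (subspace_dim (w' i) W')"
    using inj_mat_complement[OF D(1,2)] by blast
  obtain L R where LR: "split_exact (w' i) N (w i) (sigma_mat w' x') (tau_mat w x) L R"
    using linked unfolding linked_def by blast
  have L: "L \<in> carrier_mat (w' i) N" "R \<in> carrier_mat N (w i)" "sigma_mat w' x' * L + R * tau_mat w x = 1\<^sub>m N"
    using LR unfolding split_exact_def by auto
  have "\<exists>Z\<in>carrier_mat (subspace_dim (w i) W) ?k. tau_mat w x * B = C * Z"
  proof (rule range_subset_factor[OF _ C(1)])
    show "tau_mat w x * B \<in> carrier_mat (w i) ?k" using B(1) by auto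
    fix u :: "complex vec" assume u: "u \<in> carrier_vec ?k"
    then have "B *\<^sub>v u \<in> hat S" unfolding B(3) by blast
    then have "tau_mat w x *\<^sub>v (B *\<^sub>v u) \<in> (\<lambda>u. C *\<^sub>v u) ` carrier_vec (subspace_dim (w i) W)"
      using tW C(3) by blast
    then show "tau_mat w x * B *\<^sub>v u \<in> (\<lambda>u. C *\<^sub>v u) ` carrier_vec (subspace_dim (w i) W)"
      using B(1) u by (simp add: mult_mat_mult_vec)
  qed
  then obtain Z where Z: "Z \<in> carrier_mat (subspace_dim (w i) W) ?k" "tau_mat w x * B = C * Z" by blast
  \<comment> \<open>With \<open>E\<close> a left inverse of the basis of W', this reads off the
    coordinates of the retraction to W'. A vector of \<open>hat S\<close> killed by \<tau> equals
    \<sigma>' of its retraction, so these coordinates determine it.\<close>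
  have ELB: "E * (L * B) \<in> carrier_mat (subspace_dim (w' i) W') ?k"
    using E(1) L(1) B(1) by auto
  show ?thesis
  proof (rule joint_injective_dim_le[OF Z(1) ELB])
    fix u assume u: "u \<in> carrier_vec ?k" and Zu: "Z *\<^sub>v u = 0\<^sub>v (subspace_dim (w i) W)"
      and Eu: "E * (L * B) *\<^sub>v u = 0\<^sub>v (subspace_dim (w' i) W')"
    have Bu: "B *\<^sub>v u \<in> hat S" unfolding B(3) using u by blast
    have Buc: "B *\<^sub>v u \<in> carrier_vec N" using hat_carrier[OF S'(1) Bu] .
    have LBu: "L *\<^sub>v (B *\<^sub>v u) \<in> carrier_vec (w' i)" using L(1) Buc by auto
    have "tau_mat w x *\<^sub>v (B *\<^sub>v u) = C * Z *\<^sub>v u"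
      unfolding Z(2)[symmetric] using B(1) u by (simp add: mult_mat_mult_vec)
    also have "\<dots> = 0\<^sub>v (w i)"
      using C(1) Z(1) u Zu by (simp add: mult_mat_mult_vec mult_mat_zero_vec)
    finally have tBu: "tau_mat w x *\<^sub>v (B *\<^sub>v u) = 0\<^sub>v (w i)" .
    have "B *\<^sub>v u = (sigma_mat w' x' * L + R * tau_mat w x) *\<^sub>v (B *\<^sub>v u)" unfolding L(3) using Buc by simp
    also have "\<dots> = sigma_mat w' x' *\<^sub>v (L *\<^sub>v (B *\<^sub>v u)) + R *\<^sub>v (tau_mat w x *\<^sub>v (B *\<^sub>v u))"
      using L(1,2) B(1) Buc by (subst add_mult_distrib_mat_vec[of _ N N]) (auto simp: mult_mat_mult_vec)
    also have "\<dots> = sigma_mat w' x' *\<^sub>v (L *\<^sub>v (B *\<^sub>v u))"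
    proof -
      have "R *\<^sub>v 0\<^sub>v (w i) = 0\<^sub>v N" using L(2) by (simp add: mult_mat_zero_vec)
      moreover have "sigma_mat w' x' *\<^sub>v (L *\<^sub>v (B *\<^sub>v u)) \<in> carrier_vec N"
        by (rule mult_mat_vec_carrier[OF _ LBu]) simp
      ultimately show ?thesis unfolding tBu by simp
    qed
    finally have eq: "B *\<^sub>v u = sigma_mat w' x' *\<^sub>v (L *\<^sub>v (B *\<^sub>v u))" .
    then have "L *\<^sub>v (B *\<^sub>v u) \<in> W'" unfolding W' using Bu LBu by auto
    then have "L *\<^sub>v (B *\<^sub>v u) \<in> (\<lambda>u. D *\<^sub>v u) ` carrier_vec (subspace_dim (w' i) W')" using D(3) by blast
    then obtain y where y: "y \<in> carrier_vec (subspace_dim (w' i) W')" "L *\<^sub>v (B *\<^sub>v u) = D *\<^sub>v y" by blast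
    have "y = E * D *\<^sub>v y" unfolding E(2) using y(1) by simp
    also have "\<dots> = E *\<^sub>v (L *\<^sub>v (B *\<^sub>v u))" unfolding y(2) by (rule assoc_mult_mat_vec[OF E(1) D(1) y(1)])
    also have "\<dots> = E * (L * B) *\<^sub>v u"
      using E(1) L(1) B(1) u by (simp add: mult_mat_mult_vec)
    also have "\<dots> = 0\<^sub>v (subspace_dim (w' i) W')" by (rule Eu)
    finally have y0: "y = 0\<^sub>v (subspace_dim (w' i) W')" .
    have "L *\<^sub>v (B *\<^sub>v u) = 0\<^sub>v (w' i)" unfolding y(2) y0 using D(1) by (simp add: mult_mat_zero_vec)
    then have "B *\<^sub>v u = 0\<^sub>v N" using eq by (simp add: mult_mat_zero_vec)
    then show "u = 0\<^sub>v ?k" using inj_matD[OF B(2,1) u] by blast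
  qed
qed

text \<open>With \<tau>(hat S') at \<open>i\<close> the defect of exactness is nonnegative, so
  \<open>\<theta> i \<le> 0\<close> bounds the weight of S' by that of S, and stability of
  \<open>x\<close> applies unless S is everything. In that case S' is everything away from
  \<open>i\<close> and its weight is \<open>\<theta> i\<close> times the codimension at
  \<open>i\<close>.\<close>

lemma stable_reflect:
  assumes st: "stable Q w \<theta> x"
  shows "stable Q w' \<theta>' x'"
  unfolding stable_def
proof (intro conjI allI impI)
  show "(\<Sum>j\<in>verts Q. \<theta>' j * of_nat (w' j)) = 0"
    unfolding theta_dim_sum using st unfolding stable_def by blast
  fix S' assume "invariant_subspace Q w' x' S' \<and> \<not> (\<forall>j\<in>verts Q. S' j = {0\<^sub>v (w' j)}) \<and>
    \<not> (\<forall>j\<in>verts Q. S' j = carrier_vec (w' j))"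
  then have inv': "invariant_subspace Q w' x' S'" and nz: "\<not> (\<forall>j\<in>verts Q. S' j = {0\<^sub>v (w' j)})"
    and nf: "\<not> (\<forall>j\<in>verts Q. S' j = carrier_vec (w' j))" by blast+
  have sub': "subspaces S'" by (rule invariant_subspaces[OF w' inv'])
  have S'i: "lin_subspace (w' i) (S' i)" by (rule inv_i[OF sub' w' reps(2) inv'])
  define W where "W = (\<lambda>f. tau_mat w x *\<^sub>v f) ` hat S'"
  define S where "S = S'(i := W)"
  have SS': "S j = S' j" if "j \<noteq> i" for j using that by (simp add: S_def)
  have hat: "hat S = hat S'" by (rule hat_cong[OF SS'])
  have hs: "lin_subspace N (hat S')" by (rule hat_subspace[OF sub'])
  have fN: "f \<in> carrier_vec N" if "f \<in> hat S'" for f using that hat_carrier[OF sub'] by blast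
  have tc: "tau_mat w x *\<^sub>v f \<in> carrier_vec (w i)" for f by (rule carrier_vecI) simp
  have Wsub: "lin_subspace (w i) W"
    unfolding W_def by (rule lin_subspace_image[OF vertex_mats_carrier(3) hs])
  \<comment> \<open>Invariance of S under \<open>x\<close> is still to be shown, so preservation of
    \<open>hat S'\<close> is taken from \<open>x'\<close>: both sides have the same U, and
    \<sigma>\<tau> is an affine expression in \<sigma>'\<tau>'.\<close>
  have phU: "preserves_hat S' (1\<^sub>m N - up (sigma_mat w x * in_mat w x))"
    using preserves_hat_upper[OF sub' w' reps(2) inv'] preserves_hat_intros[OF sub'] unfolding upper_eq by blast
  have phT: "preserves_hat S' (sigma_mat w x * tau_mat w x)"
    unfolding sigma_tau_eq using preserves_hat_sigma_tau[OF sub' w' reps(2) inv'] preserves_hat_intros[OF sub'] by blast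
  have inv: "invariant_subspace Q w x S"
    unfolding invariant_subspace_def
  proof (intro conjI ballI)
    fix j assume j: "j \<in> verts Q"
    show "lin_subspace (w j) (S j)"
    proof (cases "j = i")
      case False
      then show ?thesis using inv' j w_eq[of j] SS' unfolding invariant_subspace_def by auto
    qed (simp add: S_def Wsub)
  next
    fix h u assume h: "h \<in> darrows Q" and u: "u \<in> S (out_v Q h)"
    from h show "x h *\<^sub>v u \<in> S (in_v Q h)"
    proof (cases h rule: darrows_cases)
      case in_i
      then have u': "u \<in> S' (out_v Q h)" using u SS' out_v_Hi by auto
      let ?f = "blocks_vec Hi d (\<lambda>k. if k = h then u else 0\<^sub>v (d k))"
      have f: "?f \<in> hat S'" by (rule single_block_hat[OF sub' in_i u'])
      have "x h *\<^sub>v u = in_mat w x *\<^sub>v ?f"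
        using in_mat_single_block[OF sub' w reps(1) in_i u'] by simp
      also have "\<dots> = tau_mat w x *\<^sub>v ((1\<^sub>m N - up (sigma_mat w x * in_mat w x)) *\<^sub>v ?f)"
        by (subst in_mat_eq[OF w reps(1)]) (simp add: mult_mat_mult_vec)
      finally have "x h *\<^sub>v u \<in> W" using phU f unfolding preserves_hat_def[OF sub'] W_def by blast
      then show ?thesis by (simp add: in_v_Hi[OF in_i] S_def)
    next
      case (out_i k)
      then have "u \<in> W" using u in_v_Hi by (simp add: S_def)
      then obtain f where f: "f \<in> hat S'" "u = tau_mat w x *\<^sub>v f" unfolding W_def by blast
      have uc: "u \<in> carrier_vec (w i)" unfolding f(2) by (rule tc)
      have "sigma_mat w x *\<^sub>v u = sigma_mat w x * tau_mat w x *\<^sub>v f"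
        unfolding f(2) by (rule mult_mat_mult_vec[symmetric]) (use fN[OF f(1)] in auto)
      then have "sigma_mat w x *\<^sub>v u \<in> hat S'" using phT f(1) unfolding preserves_hat_def[OF sub'] by auto
      moreover have "sigma_mat w x *\<^sub>v u = blocks_vec Hi d (\<lambda>h. x (opp h) *\<^sub>v u)"
        unfolding sigma_mat_def by (rule row_blocks_mult_vec[OF finite_Hi x_out_carrier[OF w reps(1)] uc])
      ultimately have "x (opp k) *\<^sub>v u \<in> S' (out_v Q k)"
        using hat_memD[OF sub' _ out_i(1), of "\<lambda>h. x (opp h) *\<^sub>v u"]
          mult_mat_vec_carrier[OF x_out_carrier[OF w reps(1) out_i(1)] uc] by simp
      then show ?thesis using out_i SS' out_v_Hi by auto
    next
      case other
      then have "x h = x' h" by (rule linked_other[OF w w' s linked])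
      then show ?thesis
        using inv' h u SS' other_not_i[OF other] unfolding invariant_subspace_def by auto
    qed
  qed
  have Wi: "S i = W" by (simp add: S_def)
  have dims: "subspace_dim (w i) W + subspace_dim (w' i) (S' i) \<le> (\<Sum>h\<in>Hi. subspace_dim (d h) (S' (out_v Q h)))"
    by (rule linked_dims_le[OF sub' S'i W_def Wsub]) (rule sigma_hat[OF sub' w' reps(2) inv'])
  have dimsS: "(\<Sum>h\<in>Hi. subspace_dim (d h) (S (out_v Q h))) = (\<Sum>h\<in>Hi. subspace_dim (d h) (S' (out_v Q h)))"
    using SS' out_v_Hi by (intro sum.cong) auto
  have nonneg: "0 \<le> (of_nat (\<Sum>h\<in>Hi. subspace_dim (d h) (S (out_v Q h))) - of_nat (subspace_dim (w' i) (S' i))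
        - of_nat (subspace_dim (w i) (S i)) :: rat)"
  proof -
    have "of_nat (subspace_dim (w i) W + subspace_dim (w' i) (S' i)) \<le>
        (of_nat (\<Sum>h\<in>Hi. subspace_dim (d h) (S' (out_v Q h))) :: rat)"
      using dims by (simp only: of_nat_le_iff)
    then show ?thesis unfolding dimsS Wi by simp
  qed
  have le: "(\<Sum>j\<in>verts Q. \<theta>' j * of_nat (subspace_dim (w' j) (S' j))) \<le>
      (\<Sum>j\<in>verts Q. \<theta> j * of_nat (subspace_dim (w j) (S j)))"
    using theta_subspace_sum[where S = S and S' = S', OF SS'] mult_nonpos_nonneg[OF \<theta>i nonneg] by linarith
  obtain L R where LR: "L \<in> carrier_mat (w' i) N" "L * sigma_mat w' x' = 1\<^sub>m (w' i)"
    using linked unfolding linked_def split_exact_def by blast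
  \<comment> \<open>If S were zero, \<open>hat S'\<close> would be zero, and \<sigma>' maps
    \<open>S' i\<close> injectively into it.\<close>
  have "\<not> (\<forall>j\<in>verts Q. S j = {0\<^sub>v (w j)})"
  proof
    assume z: "\<forall>j\<in>verts Q. S j = {0\<^sub>v (w j)}"
    have z': "S' j = {0\<^sub>v (w' j)}" if "j \<in> verts Q" "j \<noteq> i" for j
      using z that SS' w_eq[of j] by auto
    have "hat S' = {0\<^sub>v N}"
      using z' out_v_Hi_verts adm_d[OF w'] by (intro hat_zero[OF sub']) auto
    then have "u = 0\<^sub>v (w' i)" if "u \<in> S' i" for u
      using sigma_hat[OF sub' w' reps(2) inv' that] inj_matD[OF inj_mat_left_inverse[OF vertex_mats_carrier(1) LR] vertex_mats_carrier(1)]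
        that S'i unfolding lin_subspace_iff by blast
    then have "S' i = {0\<^sub>v (w' i)}" using S'i unfolding lin_subspace_iff by blast
    then show False using nz z' by blast
  qed
  then have st': "(\<Sum>j\<in>verts Q. \<theta> j * of_nat (subspace_dim (w j) (S j))) < 0"
    if "\<not> (\<forall>j\<in>verts Q. S j = carrier_vec (w j))"
    using st inv that unfolding stable_def by blast
  show "(\<Sum>j\<in>verts Q. \<theta>' j * of_nat (subspace_dim (w' j) (S' j))) < 0"
  proof (cases "\<forall>j\<in>verts Q. S j = carrier_vec (w j)")
    case False
    then show ?thesis using st' le by simp
  next
    case True
    have f': "S' j = carrier_vec (w' j)" if "j \<in> verts Q" "j \<noteq> i" for j
      using True that SS' w_eq[of j] by auto
    then have nfi: "S' i \<noteq> carrier_vec (w' i)" using nf by blast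
    have "hat S' = carrier_vec N"
      using f' out_v_Hi_verts adm_d[OF w'] by (intro hat_full[OF sub']) auto
    \<comment> \<open>Otherwise s differs from 1 and \<tau>'\<sigma>' is a nonzero scalar. As
      \<open>hat S'\<close> is everything, \<tau>' maps the whole range of \<sigma>' into
      \<open>S' i\<close>, which would then be full.\<close>
    then have "\<theta> i \<noteq> 0"
    proof (rule_tac notI)
      assume h: "hat S' = carrier_vec N" and "\<theta> i = 0"
      then have s1: "inverse s - 1 \<noteq> 0" using \<theta>0 by auto
      have "u \<in> S' i" if u: "u \<in> carrier_vec (w' i)" for u
      proof -
        have "tau_mat w' x' *\<^sub>v (sigma_mat w' x' *\<^sub>v u) = (inverse s - 1) \<cdot>\<^sub>v u"
          using u tau_sigma_smult(2) by (simp add: mult_mat_mult_vec[symmetric] smult_one_mult_vec)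
        moreover have "sigma_mat w' x' *\<^sub>v u \<in> hat S'" unfolding h by (rule carrier_vecI) simp
        ultimately have "(inverse s - 1) \<cdot>\<^sub>v u \<in> S' i" using tau_hat[OF sub' w' reps(2) inv'] by metis
        then have "inverse (inverse s - 1) \<cdot>\<^sub>v ((inverse s - 1) \<cdot>\<^sub>v u) \<in> S' i"
          using S'i unfolding lin_subspace_iff by blast
        then show ?thesis using s1 by (simp add: smult_smult_assoc)
      qed
      then have "S' i = carrier_vec (w' i)" using S'i unfolding lin_subspace_iff by blast
      then show False using nfi by blast
    qed
    then have neg: "\<theta> i < 0" using \<theta>i by simp
    have dless: "subspace_dim (w' i) (S' i) < w' i" by (rule subspace_dim_less[OF S'i nfi])
    \<comment> \<open>The total weight of V' is zero and S' is full away from \<open>i\<close>, so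
      only the codimension at \<open>i\<close> contributes.\<close>
    have "(\<Sum>j\<in>verts Q. \<theta>' j * of_nat (subspace_dim (w' j) (S' j))) =
        \<theta>' i * of_nat (subspace_dim (w' i) (S' i)) + (\<Sum>j\<in>verts Q - {i}. \<theta>' j * of_nat (subspace_dim (w' j) (S' j)))"
      by (rule sum.remove[OF finite_verts i])
    also have "(\<Sum>j\<in>verts Q - {i}. \<theta>' j * of_nat (subspace_dim (w' j) (S' j))) = (\<Sum>j\<in>verts Q - {i}. \<theta>' j * of_nat (w' j))"
      using f' subspace_dim_carrier by (intro sum.cong) auto
    also have "\<dots> = - (\<theta>' i * of_nat (w' i))"
      using \<open>(\<Sum>j\<in>verts Q. \<theta>' j * of_nat (w' j)) = 0\<close> sum.remove[OF finite_verts i, of "\<lambda>j. \<theta>' j * of_nat (w' j)"]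
      by (simp add: eq_neg_iff_add_eq_0 add.commute)
    also have "\<theta>' i * of_nat (subspace_dim (w' i) (S' i)) + - (\<theta>' i * of_nat (w' i)) =
        \<theta> i * (of_nat (w' i) - of_nat (subspace_dim (w' i) (S' i)))"
      unfolding \<theta>'i by (simp add: algebra_simps)
    also have "\<dots> < 0" using neg dless by (simp add: mult_neg_pos)
    finally show ?thesis .
  qed
qed

text \<open>Dual to \<open>stable_reflect\<close>: with the preimage of \<open>hat S\<close> under
  \<sigma>' at \<open>i\<close> the defect is nonpositive, and the weight of S is again bounded by
  that of S'. The remaining case is S' = 0, where S is concentrated at \<open>i\<close> and has
  weight \<open>\<theta> i\<close> times its dimension there.\<close>

lemma stable_coreflect:
  assumes st: "stable Q w' \<theta>' x'"
  shows "stable Q w \<theta> x"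
  unfolding stable_def
proof (intro conjI allI impI)
  show "(\<Sum>j\<in>verts Q. \<theta> j * of_nat (w j)) = 0"
    unfolding theta_dim_sum[symmetric] using st unfolding stable_def by blast
  fix S assume "invariant_subspace Q w x S \<and> \<not> (\<forall>j\<in>verts Q. S j = {0\<^sub>v (w j)}) \<and>
    \<not> (\<forall>j\<in>verts Q. S j = carrier_vec (w j))"
  then have inv: "invariant_subspace Q w x S" and nz: "\<not> (\<forall>j\<in>verts Q. S j = {0\<^sub>v (w j)})"
    and nf: "\<not> (\<forall>j\<in>verts Q. S j = carrier_vec (w j))" by blast+
  have sub: "subspaces S" by (rule invariant_subspaces[OF w inv])
  have Si: "lin_subspace (w i) (S i)" by (rule inv_i[OF sub w reps(1) inv])
  define W' where "W' = {u \<in> carrier_vec (w' i). sigma_mat w' x' *\<^sub>v u \<in> hat S}"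
  define S' where "S' = S(i := W')"
  have SS': "S j = S' j" if "j \<noteq> i" for j using that by (simp add: S'_def)
  have hs: "lin_subspace N (hat S)" by (rule hat_subspace[OF sub])
  have Wsub: "lin_subspace (w' i) W'"
    unfolding W'_def by (rule lin_subspace_preimage[OF vertex_mats_carrier(1) hs])
  \<comment> \<open>Stability of S' under the incoming arrows of \<open>x'\<close> means that
    \<sigma>'X' preserves \<open>hat S\<close>. This product is expressed through matrices of
    \<open>x\<close>, for which S is known to be invariant.\<close>
  have phX: "preserves_hat S (sigma_mat w' x' * in_mat w' x')"
    unfolding sigma_in_eq
    by (intro preserves_hat_intros[OF sub] preserves_hat_upper[OF sub w reps(1) inv]
        preserves_hat_sigma_in[OF sub w reps(1) inv])
  have inv': "invariant_subspace Q w' x' S'"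
    unfolding invariant_subspace_def
  proof (intro conjI ballI)
    fix j assume j: "j \<in> verts Q"
    show "lin_subspace (w' j) (S' j)"
    proof (cases "j = i")
      case False
      then show ?thesis using inv j w_eq[of j] SS'[of j] unfolding invariant_subspace_def by auto
    qed (simp add: S'_def Wsub)
  next
    fix h u assume h: "h \<in> darrows Q" and u: "u \<in> S' (out_v Q h)"
    from h show "x' h *\<^sub>v u \<in> S' (in_v Q h)"
    proof (cases h rule: darrows_cases)
      case in_i
      then have u': "u \<in> S (out_v Q h)" using u SS'[of "out_v Q h"] out_v_Hi by auto
      let ?f = "blocks_vec Hi d (\<lambda>k. if k = h then u else 0\<^sub>v (d k))"
      have f: "?f \<in> hat S" by (rule single_block_hat[OF sub in_i u'])
      have e: "x' h *\<^sub>v u = in_mat w' x' *\<^sub>v ?f"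
        using in_mat_single_block[OF sub w' reps(2) in_i u'] by simp
      have "sigma_mat w' x' *\<^sub>v (in_mat w' x' *\<^sub>v ?f) = sigma_mat w' x' * in_mat w' x' *\<^sub>v ?f"
        by (rule mult_mat_mult_vec[symmetric]) auto
      then have "sigma_mat w' x' *\<^sub>v (x' h *\<^sub>v u) \<in> hat S" using phX f unfolding preserves_hat_def[OF sub] e by simp
      moreover have "x' h *\<^sub>v u \<in> carrier_vec (w' i)" unfolding e by (rule carrier_vecI) simp
      ultimately show ?thesis using in_v_Hi[OF in_i] by (simp add: S'_def W'_def)
    next
      case (out_i k)
      then have u': "u \<in> carrier_vec (w' i)" "sigma_mat w' x' *\<^sub>v u \<in> hat S" using u in_v_Hi by (auto simp: S'_def W'_def)
      have "sigma_mat w' x' *\<^sub>v u = blocks_vec Hi d (\<lambda>h. x' (opp h) *\<^sub>v u)"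
        unfolding sigma_mat_def by (rule row_blocks_mult_vec[OF finite_Hi x_out_carrier[OF w' reps(2)] u'(1)])
      then have "x' (opp k) *\<^sub>v u \<in> S (out_v Q k)"
        using hat_memD[OF sub _ out_i(1), of "\<lambda>h. x' (opp h) *\<^sub>v u"] u'(2)
          mult_mat_vec_carrier[OF x_out_carrier[OF w' reps(2) out_i(1)] u'(1)] by simp
      then show ?thesis using out_i SS'[of "out_v Q k"] out_v_Hi by auto
    next
      case other
      then have "x h = x' h" by (rule linked_other[OF w w' s linked])
      then show ?thesis
        using inv h u SS'[of "in_v Q h"] SS'[of "out_v Q h"] other_not_i[OF other] unfolding invariant_subspace_def by auto
    qed
  qed
  have Wi: "S' i = W'" by (simp add: S'_def)
  have dims: "(\<Sum>h\<in>Hi. subspace_dim (d h) (S (out_v Q h))) \<le> subspace_dim (w i) (S i) + subspace_dim (w' i) W'"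
    by (rule linked_dims_ge[OF sub Si W'_def Wsub]) (rule tau_hat[OF sub w reps(1) inv])
  have nonpos: "(of_nat (\<Sum>h\<in>Hi. subspace_dim (d h) (S (out_v Q h))) - of_nat (subspace_dim (w' i) (S' i))
        - of_nat (subspace_dim (w i) (S i)) :: rat) \<le> 0"
  proof -
    have "(of_nat (\<Sum>h\<in>Hi. subspace_dim (d h) (S (out_v Q h))) :: rat) \<le>
        of_nat (subspace_dim (w i) (S i) + subspace_dim (w' i) W')"
      using dims by (simp only: of_nat_le_iff)
    then show ?thesis unfolding Wi by simp
  qed
  have le: "(\<Sum>j\<in>verts Q. \<theta> j * of_nat (subspace_dim (w j) (S j))) \<le>
      (\<Sum>j\<in>verts Q. \<theta>' j * of_nat (subspace_dim (w' j) (S' j)))"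
    using theta_subspace_sum[where S = S and S' = S', OF SS'] mult_nonpos_nonpos[OF \<theta>i nonpos] by linarith
  obtain L R where LR: "R \<in> carrier_mat N (w i)" "tau_mat w x * R = 1\<^sub>m (w i)"
    using linked unfolding linked_def split_exact_def by blast
  \<comment> \<open>If S' were everything, \<open>hat S\<close> would be the whole space, and since
    \<tau> is onto, \<open>S i\<close> would be full as well.\<close>
  have "\<not> (\<forall>j\<in>verts Q. S' j = carrier_vec (w' j))"
  proof
    assume z: "\<forall>j\<in>verts Q. S' j = carrier_vec (w' j)"
    have z': "S j = carrier_vec (w j)" if "j \<in> verts Q" "j \<noteq> i" for j
      using z that SS'[of j] w_eq[of j] by auto
    have h: "hat S = carrier_vec N"
      using z' out_v_Hi_verts adm_d[OF w] by (intro hat_full[OF sub]) auto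
    have "u \<in> S i" if u: "u \<in> carrier_vec (w i)" for u
    proof -
      have "tau_mat w x *\<^sub>v (R *\<^sub>v u) = u" using LR u by (simp add: mult_mat_mult_vec[symmetric])
      moreover have "R *\<^sub>v u \<in> hat S" unfolding h using LR(1) u by auto
      ultimately show ?thesis using tau_hat[OF sub w reps(1) inv] by metis
    qed
    then have "S i = carrier_vec (w i)" using Si unfolding lin_subspace_iff by blast
    then show False using nf z' by blast
  qed
  then have st': "(\<Sum>j\<in>verts Q. \<theta>' j * of_nat (subspace_dim (w' j) (S' j))) < 0"
    if "\<not> (\<forall>j\<in>verts Q. S' j = {0\<^sub>v (w' j)})"
    using st inv' that unfolding stable_def by blast
  show "(\<Sum>j\<in>verts Q. \<theta> j * of_nat (subspace_dim (w j) (S j))) < 0"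
  proof (cases "\<forall>j\<in>verts Q. S' j = {0\<^sub>v (w' j)}")
    case False
    then show ?thesis using st' le by simp
  next
    case True
    have f': "S j = {0\<^sub>v (w j)}" if "j \<in> verts Q" "j \<noteq> i" for j
      using True that SS'[of j] w_eq[of j] by auto
    then have nzi: "S i \<noteq> {0\<^sub>v (w i)}" using nz by blast
    have h: "hat S = {0\<^sub>v N}"
      using f' out_v_Hi_verts adm_d[OF w] by (intro hat_zero[OF sub]) auto
    \<comment> \<open>Otherwise s differs from 1; but the nonzero scalar \<tau>\<sigma> acts on
      \<open>S i\<close> through \<open>hat S\<close>, which is zero.\<close>
    have "\<theta> i \<noteq> 0"
    proof
      assume "\<theta> i = 0"
      then have s1: "s - 1 \<noteq> 0" using \<theta>0 by auto
      have "u = 0\<^sub>v (w i)" if u: "u \<in> S i" for u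
      proof -
        have uc: "u \<in> carrier_vec (w i)" using Si u unfolding lin_subspace_iff by blast
        have "sigma_mat w x *\<^sub>v u = 0\<^sub>v N" using sigma_hat[OF sub w reps(1) inv u] h by simp
        moreover have "tau_mat w x *\<^sub>v (sigma_mat w x *\<^sub>v u) = (s - 1) \<cdot>\<^sub>v u"
          using uc tau_sigma_smult(1) by (simp add: mult_mat_mult_vec[symmetric] smult_one_mult_vec)
        ultimately have "(s - 1) \<cdot>\<^sub>v u = 0\<^sub>v (w i)" by (simp add: mult_mat_zero_vec)
        then have "inverse (s - 1) \<cdot>\<^sub>v ((s - 1) \<cdot>\<^sub>v u) = 0\<^sub>v (w i)"
          by (auto intro: eq_vecI)
        then show ?thesis using s1 by (simp add: smult_smult_assoc)
      qed
      then have "S i = {0\<^sub>v (w i)}" using Si unfolding lin_subspace_iff by blast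
      then show False using nzi by blast
    qed
    then have neg: "\<theta> i < 0" using \<theta>i by simp
    have "(\<Sum>j\<in>verts Q. \<theta> j * of_nat (subspace_dim (w j) (S j))) =
        \<theta> i * of_nat (subspace_dim (w i) (S i)) + (\<Sum>j\<in>verts Q - {i}. \<theta> j * of_nat (subspace_dim (w j) (S j)))"
      by (rule sum.remove[OF finite_verts i])
    also have "(\<Sum>j\<in>verts Q - {i}. \<theta> j * of_nat (subspace_dim (w j) (S j))) = 0"
      using f' subspace_dim_zero by (intro sum.neutral) auto
    also have "\<theta> i * of_nat (subspace_dim (w i) (S i)) + 0 < 0"
      using neg subspace_dim_pos[OF Si nzi] by (simp add: mult_neg_pos)
    finally show ?thesis .
  qed
qed

end

end

section \<open>The correspondence in terms of linked pairs\<close>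

locale vertex_reflection = quiver_vertex Q ord i v
  for Q :: "('v, 'a) pre_digraph" and ord :: "('a + 'a) rel" and i :: 'v and v :: "'v \<Rightarrow> nat" +
  fixes v' :: "'v \<Rightarrow> nat" and q q' :: "'v \<Rightarrow> complex" and \<theta> \<theta>' :: "'v \<Rightarrow> rat"
  assumes q_nonzero: "\<forall>j\<in>verts Q. q j \<noteq> 0"
    and theta_dim: "(\<Sum>j\<in>verts Q. \<theta> j * of_nat (v j)) = 0"
    and q': "q' = refl_q Q i q"
    and \<theta>': "\<theta>' = refl_theta Q i \<theta>"
    and v': "\<forall>j\<in>verts Q. int (v' j) = refl_dim Q i (\<lambda>k. int (v k)) j"
    and theta_i: "\<theta> i \<le> 0" and theta_i_zero: "\<theta> i = 0 \<longrightarrow> q i \<noteq> 1"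
begin

abbreviation s where "s \<equiv> q i"

lemma s_nonzero: "s \<noteq> 0" using q_nonzero i by blast

lemma arrows_from_i:
  "card {h \<in> darrows Q. out_v Q h = i \<and> in_v Q h = j} = card {h \<in> Hi. out_v Q h = j}"
proof -
  have "{h \<in> darrows Q. out_v Q h = i \<and> in_v Q h = j} = opp ` {h \<in> Hi. out_v Q h = j}"
  proof (intro equalityI subsetI)
    fix h assume "h \<in> {h \<in> darrows Q. out_v Q h = i \<and> in_v Q h = j}"
    then have "opp h \<in> {h \<in> Hi. out_v Q h = j}" by (auto simp: in_arrows_def)
    then show "h \<in> opp ` {h \<in> Hi. out_v Q h = j}" by (metis imageI opp_opp)
  qed (auto simp: in_arrows_def)
  moreover have "inj_on opp {h \<in> Hi. out_v Q h = j}" by (metis inj_onI opp_opp)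
  ultimately show ?thesis by (simp add: card_image)
qed

lemma pairing_coord:
  assumes "j \<in> verts Q"
  shows "pairing Q (coord_vec i) (coord_vec j) =
    (if j = i then 2 else 0) - int (card {h \<in> Hi. out_v Q h = j})"
proof -
  have "(\<Sum>k\<in>verts Q. coord_vec i k * coord_vec j k) = (\<Sum>k\<in>verts Q. if k = i then (if j = i then 1 else 0) else 0)"
    by (intro sum.cong) (auto simp: coord_vec_def)
  then have 1: "(\<Sum>k\<in>verts Q. coord_vec i k * coord_vec j k) = (if j = i then 1 else 0)"
    using finite_verts i by simp
  have "(\<Sum>h\<in>darrows Q. coord_vec i (out_v Q h) * coord_vec j (in_v Q h)) =
      (\<Sum>h\<in>darrows Q. if out_v Q h = i \<and> in_v Q h = j then 1 else 0)"
    by (intro sum.cong) (auto simp: coord_vec_def)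
  also have "\<dots> = (\<Sum>h | h \<in> darrows Q \<and> (out_v Q h = i \<and> in_v Q h = j). 1)"
    by (rule sum.inter_filter[OF finite_darrows, symmetric])
  also have "\<dots> = int (card {h \<in> Hi. out_v Q h = j})"
    using arrows_from_i by simp
  finally show ?thesis unfolding pairing_def 1 by simp
qed

lemma card_loop: "card {h \<in> Hi. out_v Q h = i} = 0"
  using out_v_Hi by (auto simp: card_eq_0_iff)

text \<open>Loop-freeness makes the pairing of the coordinate vector at \<open>i\<close> with itself
  equal to 2, so the exponent is -2.\<close>

lemma q'_i: "q' i = inverse s"
  unfolding q' refl_q_def pairing_coord[OF i] card_loop
  using s_nonzero by (simp add: power_int_minus power2_eq_square field_simps)

lemma q'_other: "j \<in> verts Q \<Longrightarrow> j \<noteq> i \<Longrightarrow> q' j = q j * s ^ card {h \<in> Hi. out_v Q h = j}"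
  unfolding q' refl_q_def by (simp add: pairing_coord)

lemma \<theta>'_i: "\<theta>' i = - \<theta> i"
  unfolding \<theta>' refl_theta_def pairing_coord[OF i] card_loop by simp

lemma \<theta>'_other: "j \<in> verts Q - {i} \<Longrightarrow> \<theta>' j = \<theta> j + of_nat (card {h \<in> Hi. out_v Q h = j}) * \<theta> i"
  unfolding \<theta>' refl_theta_def by (simp add: pairing_coord)

lemma adm_v: "adm v" by (simp add: adm_def)

lemma adm_v': "adm v'"
  unfolding adm_def
proof
  fix j assume j: "j \<in> verts Q - {i}"
  then have "int (v' j) = refl_dim Q i (\<lambda>k. int (v k)) j" using v' by blast
  then show "v' j = v j" using j by (simp add: refl_dim_def coord_vec_def)
qed

text \<open>The pairing of the dimension vector with the coordinate vector at \<open>i\<close> is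
  \<open>2 * v i - N\<close>. So the reflected dimension at \<open>i\<close> is that of the kernel
  of a map from \<open>N\<close> dimensions onto \<open>v i\<close> dimensions.\<close>

lemma v_add_v': "v i + v' i = N"
proof -
  have "(\<Sum>k\<in>verts Q. int (v k) * coord_vec i k) = (\<Sum>k\<in>verts Q. if k = i then int (v i) else 0)"
    by (intro sum.cong) (auto simp: coord_vec_def)
  then have 1: "(\<Sum>k\<in>verts Q. int (v k) * coord_vec i k) = int (v i)"
    using finite_verts i by simp
  have "(\<Sum>h\<in>darrows Q. int (v (out_v Q h)) * coord_vec i (in_v Q h)) =
      (\<Sum>h\<in>darrows Q. if in_v Q h = i then int (v (out_v Q h)) else 0)"
    by (intro sum.cong) (auto simp: coord_vec_def)
  also have "\<dots> = (\<Sum>h | h \<in> darrows Q \<and> in_v Q h = i. int (v (out_v Q h)))"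
    by (rule sum.inter_filter[OF finite_darrows, symmetric])
  also have "\<dots> = int N" by (simp add: blocks_dim_def in_arrows_def)
  finally have "pairing Q (\<lambda>k. int (v k)) (coord_vec i) = 2 * int (v i) - int N"
    unfolding pairing_def 1 by simp
  then have "int (v' i) = int N - int (v i)"
    using v' i unfolding refl_dim_def coord_vec_def by simp
  then show ?thesis by simp
qed

abbreviation Z where "Z \<equiv> stable_fibre Q ord v q \<theta>"
abbreviation Z' where "Z' \<equiv> stable_fibre Q ord v' q' \<theta>'"
abbreviation P where "P \<equiv> corr Q ord i v v' q \<theta> q' \<theta>'"

lemma Z_iff: "x \<in> stable_fibre Q ord w r \<eta> \<longleftrightarrow> x \<in> reps Q w \<and> (\<forall>h\<in>darrows Q. det (one_plus Q w x h) \<noteq> 0) \<and>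
    (\<forall>j\<in>verts Q. moment_map Q ord w x j = r j \<cdot>\<^sub>m 1\<^sub>m (w j)) \<and> stable Q w \<eta> x"
  unfolding stable_fibre_def moment_fibre_def reps0_def by auto

lemma Vhat_image_blocks_vec: "blocks_vec Hi d ` Vhat Q i v = carrier_vec N"
proof (intro equalityI subsetI)
  fix u :: "complex vec" assume "u \<in> carrier_vec N"
  then show "u \<in> blocks_vec Hi d ` Vhat Q i v" by (rule Vhat_surj) blast
qed auto

text \<open>Membership of one component in its fibre suffices, since every remaining condition
  passes along the link. The rest translates matrix identities into statements about families of
  vectors.\<close>

lemma linked_corr:
  assumes l: "linked s v v' x x'" and Z: "x \<in> Z \<or> x' \<in> Z'"
  shows "(x, x') \<in> P"
proof -
  note l' = adm_v adm_v' s_nonzero l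
  note reps = linked_reps[OF l']
  have det: "det (one_plus Q v x h) \<noteq> 0" "det (one_plus Q v' x' h) \<noteq> 0" if "h \<in> darrows Q" for h
    using Z linked_det_iff[OF l' that] that unfolding Z_iff by auto
  have mm: "moment_map Q ord v' x' j = s ^ card {h \<in> Hi. out_v Q h = j} \<cdot>\<^sub>m moment_map Q ord v x j"
    if "j \<in> verts Q" "j \<noteq> i" for j
    using linked_moment_map[OF l' that det(1)] unfolding arrows_from_i by simp
  have mom: "moment_map Q ord v x j = q j \<cdot>\<^sub>m 1\<^sub>m (v j) \<and> moment_map Q ord v' x' j = q' j \<cdot>\<^sub>m 1\<^sub>m (v' j)"
    if j: "j \<in> verts Q" for j
  proof (cases "j = i")
    case True
    then show ?thesis using linked_moment_map_i[OF l'] q'_i by simp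
  next
    case False
    let ?c = "s ^ card {h \<in> Hi. out_v Q h = j}"
    have vj: "v' j = v j" using adm_v' j False unfolding adm_def by simp
    from Z show ?thesis
    proof
      assume "x \<in> Z"
      then have "moment_map Q ord v x j = q j \<cdot>\<^sub>m 1\<^sub>m (v j)" using j unfolding Z_iff by blast
      then show ?thesis
        using mm[OF j False] vj q'_other[OF j False] by (simp add: smult_smult_mat mult.commute)
    next
      assume "x' \<in> Z'"
      then have e: "moment_map Q ord v' x' j = q' j \<cdot>\<^sub>m 1\<^sub>m (v' j)" using j unfolding Z_iff by blast
      \<comment> \<open>Coming from the side of \<open>x'\<close>, the power of s between the moment
        map values has to be divided out.\<close>
      have "inverse ?c \<cdot>\<^sub>m (?c \<cdot>\<^sub>m moment_map Q ord v x j) = inverse ?c \<cdot>\<^sub>m (q' j \<cdot>\<^sub>m 1\<^sub>m (v' j))"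
        using mm[OF j False] e by simp
      then show ?thesis
        using e s_nonzero vj q'_other[OF j False] by (simp add: smult_smult_mat one_smult_mat field_simps)
    qed
  qed
  note st = adm_v adm_v' s_nonzero l v_add_v' \<theta>'_i \<theta>'_other theta_i
  have stab: "stable Q v \<theta> x \<and> stable Q v' \<theta>' x'"
    using Z stable_reflect[OF st] stable_coreflect[OF st] theta_i_zero unfolding Z_iff by blast
  obtain L R where split: "split_exact (v' i) N (v i) (sigma_mat v' x') (tau_mat v x) L R"
    using l unfolding linked_def by blast
  note im = images_of_split_exact[OF split]
  have inj: "inj_on (sigma Q i x') (carrier_vec (v' i))"
  proof (rule inj_onI)
    fix a b assume ab: "a \<in> carrier_vec (v' i)" "b \<in> carrier_vec (v' i)" "sigma Q i x' a = sigma Q i x' b"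
    then have "sigma_mat v' x' *\<^sub>v a = sigma_mat v' x' *\<^sub>v b"
      using sigma_conv[OF adm_v' reps(2)] by simp
    then show "a = b" using inj_mat_right_factor_vec[OF vertex_mats_carrier(1) im(1) ab(1,2)] by simp
  qed
  have surj: "tau Q ord i v x ` Vhat Q i v = carrier_vec (v i)"
  proof -
    have "tau Q ord i v x ` Vhat Q i v = (\<lambda>f. tau_mat v x *\<^sub>v blocks_vec Hi d f) ` Vhat Q i v"
      by (rule image_cong[OF refl tau_conv[OF adm_v reps(1)]])
    also have "\<dots> = (\<lambda>u. tau_mat v x *\<^sub>v u) ` (blocks_vec Hi d ` Vhat Q i v)" by (simp add: image_image)
    finally show ?thesis unfolding Vhat_image_blocks_vec im(2) .
  qed
  have ker: "sigma Q i x' ` carrier_vec (v' i) = {w \<in> Vhat Q i v. tau Q ord i v x w = 0\<^sub>v (v i)}"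
  proof (intro equalityI subsetI)
    fix f assume "f \<in> sigma Q i x' ` carrier_vec (v' i)"
    then obtain u where u: "u \<in> carrier_vec (v' i)" "f = sigma Q i x' u" by blast
    have f: "f \<in> Vhat Q i v" unfolding u(2) by (rule sigma_Vhat[OF adm_v' reps(2) u(1)])
    have "sigma_mat v' x' *\<^sub>v u \<in> {u \<in> carrier_vec N. tau_mat v x *\<^sub>v u = 0\<^sub>v (v i)}"
      unfolding im(3)[symmetric] using u(1) by blast
    then have "tau Q ord i v x f = 0\<^sub>v (v i)"
      unfolding tau_conv[OF adm_v reps(1) f] unfolding u(2) sigma_conv[OF adm_v' reps(2) u(1), symmetric] by blast
    then show "f \<in> {w \<in> Vhat Q i v. tau Q ord i v x w = 0\<^sub>v (v i)}" using f by blast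
  next
    fix f assume "f \<in> {w \<in> Vhat Q i v. tau Q ord i v x w = 0\<^sub>v (v i)}"
    then have f: "f \<in> Vhat Q i v" "tau_mat v x *\<^sub>v blocks_vec Hi d f = 0\<^sub>v (v i)"
      using tau_conv[OF adm_v reps(1)] by auto
    have "blocks_vec Hi d f \<in> (\<lambda>u. sigma_mat v' x' *\<^sub>v u) ` carrier_vec (v' i)" unfolding im(3) using f(2) by simp
    then obtain u where u: "u \<in> carrier_vec (v' i)" "blocks_vec Hi d f = sigma_mat v' x' *\<^sub>v u" by blast
    have "f = sigma Q i x' u"
      by (rule Vhat_ext[OF f(1) sigma_Vhat[OF adm_v' reps(2) u(1)]])
        (simp add: u(2) sigma_conv[OF adm_v' reps(2) u(1)])
    then show "f \<in> sigma Q i x' ` carrier_vec (v' i)" using u(1) by blast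
  qed
  have r3: "sigma Q i x (tau Q ord i v x f) h =
      s \<cdot>\<^sub>v sigma Q i x' (tau Q ord i v' x' f) h + (s - 1) \<cdot>\<^sub>v f h"
    if f: "f \<in> Vhat Q i v" and h: "h \<in> Hi" for f h
  proof -
    let ?f = "blocks_vec Hi d f"
    have fc: "f k \<in> carrier_vec (d k)" if "k \<in> Hi" for k using f that by (auto simp: Vhat_def)
    have t: "tau Q ord i v x f = tau_mat v x *\<^sub>v ?f" "tau Q ord i v' x' f = tau_mat v' x' *\<^sub>v ?f"
      using tau_conv[OF adm_v reps(1) f] tau_conv[OF adm_v' reps(2) f] by auto
    have tc: "tau Q ord i v x f \<in> carrier_vec (v i)" "tau Q ord i v' x' f \<in> carrier_vec (v' i)"
      unfolding t by (auto intro!: carrier_vecI)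
    let ?a = "sigma Q i x (tau Q ord i v x f)" and ?b = "sigma Q i x' (tau Q ord i v' x' f)"
    have ab: "?a \<in> Vhat Q i v" "?b \<in> Vhat Q i v"
      using sigma_Vhat[OF adm_v reps(1) tc(1)] sigma_Vhat[OF adm_v' reps(2) tc(2)] by auto
    have abc: "?a k \<in> carrier_vec (d k)" "?b k \<in> carrier_vec (d k)" if "k \<in> Hi" for k
      using ab that by (auto simp: Vhat_def)
    have A: "blocks_vec Hi d ?a = sigma_mat v x * tau_mat v x *\<^sub>v ?f"
      unfolding sigma_conv[OF adm_v reps(1) tc(1), symmetric] unfolding t
      by (rule mult_mat_mult_vec[symmetric]) auto
    have B: "blocks_vec Hi d ?b = sigma_mat v' x' * tau_mat v' x' *\<^sub>v ?f"
      unfolding sigma_conv[OF adm_v' reps(2) tc(2), symmetric] unfolding t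
      by (rule mult_mat_mult_vec[symmetric]) auto
    have "(1\<^sub>m N + sigma_mat v x * tau_mat v x) *\<^sub>v ?f = ?f + blocks_vec Hi d ?a"
      unfolding A by (subst add_mult_distrib_mat_vec[of _ N N]) auto
    moreover have "(s \<cdot>\<^sub>m (1\<^sub>m N + sigma_mat v' x' * tau_mat v' x')) *\<^sub>v ?f = s \<cdot>\<^sub>v (?f + blocks_vec Hi d ?b)"
    proof -
      have "(s \<cdot>\<^sub>m (1\<^sub>m N + sigma_mat v' x' * tau_mat v' x')) *\<^sub>v ?f =
          s \<cdot>\<^sub>v ((1\<^sub>m N + sigma_mat v' x' * tau_mat v' x') *\<^sub>v ?f)"
        by (intro eq_vecI) (auto simp: scalar_prod_def sum_distrib_left mult.assoc simp del: index_add_mat(1) index_mult_mat(1))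
      also have "(1\<^sub>m N + sigma_mat v' x' * tau_mat v' x') *\<^sub>v ?f = ?f + blocks_vec Hi d ?b"
        unfolding B by (subst add_mult_distrib_mat_vec[of _ N N]) auto
      finally show ?thesis .
    qed
    ultimately have E: "?f + blocks_vec Hi d ?a = s \<cdot>\<^sub>v (?f + blocks_vec Hi d ?b)"
      using linked_sigma_tau[OF l'] by simp
    have dims: "dim_vec (?a k) = d k" "dim_vec (?b k) = d k" "dim_vec (f k) = d k" if "k \<in> Hi" for k
      using abc[OF that] fc[OF that] by auto
    have "blocks_vec Hi d ?a = blocks_vec Hi d (\<lambda>k. s \<cdot>\<^sub>v ?b k + (s - 1) \<cdot>\<^sub>v f k)"
    proof (rule eq_vecI)
      fix r assume "r < dim_vec (blocks_vec Hi d (\<lambda>k. s \<cdot>\<^sub>v ?b k + (s - 1) \<cdot>\<^sub>v f k))"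
      then have r: "r < N" by simp
      note b = blk_loc[OF finite_Hi r]
      from arg_cong[OF E, of "\<lambda>u. u $ r"]
      show "blocks_vec Hi d ?a $ r = blocks_vec Hi d (\<lambda>k. s \<cdot>\<^sub>v ?b k + (s - 1) \<cdot>\<^sub>v f k) $ r"
        using r b dims[OF b(1)] by (simp add: blocks_vec_def algebra_simps)
    qed simp
    then show ?thesis
      by (rule blocks_vec_eqD[OF finite_Hi _ h]) (use abc[OF h] fc[OF h] in auto)
  qed
  show ?thesis
    unfolding corr_def
    using reps linked_other[OF l'] inj ker surj r3 det mom stab by (simp only: mem_Collect_eq case_prod_conv) blast
qed

section \<open>Reading the correspondence as matrix identities\<close>

lemma corr_memD:
  assumes "(x, x') \<in> P"
  shows "x \<in> Z" "x' \<in> Z'"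
  using assms unfolding corr_def Z_iff by blast+

text \<open>Condition (R2) in coordinates, with splittings chosen at the single point.\<close>

lemma corr_split_exact:
  assumes P: "(x, x') \<in> P"
  shows "\<exists>L R. split_exact (v' i) N (v i) (sigma_mat v' x') (tau_mat v x) L R"
proof -
  have reps: "x \<in> reps Q v" "x' \<in> reps Q v'"
    and inj: "inj_on (sigma Q i x') (carrier_vec (v' i))"
    and ker: "sigma Q i x' ` carrier_vec (v' i) = {w \<in> Vhat Q i v. tau Q ord i v x w = 0\<^sub>v (v i)}"
    and surj: "tau Q ord i v x ` Vhat Q i v = carrier_vec (v i)"
    using P unfolding corr_def by blast+
  show ?thesis
  proof (rule split_exact_of_images)
    show "inj_mat (sigma_mat v' x')"
      unfolding inj_mat_def
    proof (intro ballI impI)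
      fix u assume "u \<in> carrier_vec (dim_col (sigma_mat v' x'))" "sigma_mat v' x' *\<^sub>v u = 0\<^sub>v (dim_row (sigma_mat v' x'))"
      then have u: "u \<in> carrier_vec (v' i)" "sigma_mat v' x' *\<^sub>v u = 0\<^sub>v N" by auto
      have z: "0\<^sub>v (v' i) \<in> carrier_vec (v' i)" by simp
      have "sigma_mat v' x' *\<^sub>v 0\<^sub>v (v' i) = 0\<^sub>v N" by (simp add: mult_mat_zero_vec)
      then have "blocks_vec Hi d (sigma Q i x' u) = blocks_vec Hi d (sigma Q i x' (0\<^sub>v (v' i)))"
        using u sigma_conv[OF adm_v' reps(2) u(1)] sigma_conv[OF adm_v' reps(2) z] by simp
      then have "sigma Q i x' u = sigma Q i x' (0\<^sub>v (v' i))"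
        by (rule Vhat_ext[OF sigma_Vhat[OF adm_v' reps(2) u(1)] sigma_Vhat[OF adm_v' reps(2) z]])
      then show "u = 0\<^sub>v (dim_col (sigma_mat v' x'))" using inj_onD[OF inj _ u(1) z] by simp
    qed
    have "(\<lambda>u. tau_mat v x *\<^sub>v u) ` (blocks_vec Hi d ` Vhat Q i v) = tau Q ord i v x ` Vhat Q i v"
      unfolding image_image by (rule image_cong[OF refl tau_conv[OF adm_v reps(1), symmetric]])
    then show "(\<lambda>u. tau_mat v x *\<^sub>v u) ` carrier_vec N = carrier_vec (v i)"
      unfolding Vhat_image_blocks_vec surj .
    have "(\<lambda>u. sigma_mat v' x' *\<^sub>v u) ` carrier_vec (v' i) = blocks_vec Hi d ` (sigma Q i x' ` carrier_vec (v' i))"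
      unfolding image_image by (rule image_cong[OF refl sigma_conv[OF adm_v' reps(2)]])
    also have "\<dots> = {u \<in> blocks_vec Hi d ` Vhat Q i v. tau_mat v x *\<^sub>v u = 0\<^sub>v (v i)}"
      unfolding ker using tau_conv[OF adm_v reps(1)] by auto
    finally show "(\<lambda>u. sigma_mat v' x' *\<^sub>v u) ` carrier_vec (v' i) = {u \<in> carrier_vec N. tau_mat v x *\<^sub>v u = 0\<^sub>v (v i)}"
      unfolding Vhat_image_blocks_vec .
  qed auto
qed

text \<open>Condition (R3) in coordinates, by testing both sides on all block vectors.\<close>

lemma corr_sigma_tau:
  assumes P: "(x, x') \<in> P"
  shows "sigma_mat v x * tau_mat v x = s \<cdot>\<^sub>m (sigma_mat v' x' * tau_mat v' x') + (s - 1) \<cdot>\<^sub>m 1\<^sub>m N"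
proof (rule mat_eq_iff_mult_vec)
  have reps: "x \<in> reps Q v" "x' \<in> reps Q v'"
    and r3: "\<And>f h. f \<in> Vhat Q i v \<Longrightarrow> h \<in> Hi \<Longrightarrow> sigma Q i x (tau Q ord i v x f) h =
          s \<cdot>\<^sub>v sigma Q i x' (tau Q ord i v' x' f) h + (s - 1) \<cdot>\<^sub>v f h"
    using P unfolding corr_def by blast+
  fix u :: "complex vec" assume "u \<in> carrier_vec N"
  then obtain f where f: "f \<in> Vhat Q i v" "u = blocks_vec Hi d f" by (rule Vhat_surj)
  have fc: "f k \<in> carrier_vec (d k)" if "k \<in> Hi" for k using f that by (auto simp: Vhat_def)
  have t: "tau Q ord i v x f = tau_mat v x *\<^sub>v u" "tau Q ord i v' x' f = tau_mat v' x' *\<^sub>v u"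
    using tau_conv[OF adm_v reps(1) f(1)] tau_conv[OF adm_v' reps(2) f(1)] f(2) by auto
  have tc: "tau Q ord i v x f \<in> carrier_vec (v i)" "tau Q ord i v' x' f \<in> carrier_vec (v' i)"
    unfolding t by (auto intro!: carrier_vecI)
  let ?a = "sigma Q i x (tau Q ord i v x f)" and ?b = "sigma Q i x' (tau Q ord i v' x' f)"
  have bc: "?b k \<in> carrier_vec (d k)" if "k \<in> Hi" for k
    using sigma_Vhat[OF adm_v' reps(2) tc(2)] that by (auto simp: Vhat_def)
  have dims: "dim_vec (?b k) = d k" "dim_vec (f k) = d k" if "k \<in> Hi" for k
    using bc[OF that] fc[OF that] by auto
  have "sigma_mat v x * tau_mat v x *\<^sub>v u = blocks_vec Hi d ?a"
    unfolding sigma_conv[OF adm_v reps(1) tc(1), symmetric] unfolding t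
    by (rule mult_mat_mult_vec) (auto simp: f(2))
  also have "\<dots> = blocks_vec Hi d (\<lambda>k. s \<cdot>\<^sub>v ?b k + (s - 1) \<cdot>\<^sub>v f k)"
    by (rule blocks_vec_cong[OF finite_Hi r3[OF f(1)]])
  also have "\<dots> = s \<cdot>\<^sub>v blocks_vec Hi d ?b + (s - 1) \<cdot>\<^sub>v u"
    unfolding f(2) by (intro eq_vecI) (auto simp: blocks_vec_def blk_loc[OF finite_Hi, of _ d] dims)
  also have "blocks_vec Hi d ?b = sigma_mat v' x' * tau_mat v' x' *\<^sub>v u"
    unfolding sigma_conv[OF adm_v' reps(2) tc(2), symmetric] unfolding t
    by (rule mult_mat_mult_vec[symmetric]) (auto simp: f(2))
  also have "s \<cdot>\<^sub>v (sigma_mat v' x' * tau_mat v' x' *\<^sub>v u) + (s - 1) \<cdot>\<^sub>v u =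
      (s \<cdot>\<^sub>m (sigma_mat v' x' * tau_mat v' x') + (s - 1) \<cdot>\<^sub>m 1\<^sub>m N) *\<^sub>v u"
  proof -
    have "(s \<cdot>\<^sub>m (sigma_mat v' x' * tau_mat v' x')) *\<^sub>v u = s \<cdot>\<^sub>v (sigma_mat v' x' * tau_mat v' x' *\<^sub>v u)"
      unfolding f(2) by (intro eq_vecI) (auto simp: scalar_prod_def sum_distrib_left mult.assoc simp del: index_mult_mat(1))
    then show ?thesis
      using f(2) by (subst add_mult_distrib_mat_vec[of _ N N]) (auto simp: smult_one_mult_vec)
  qed
  finally show "sigma_mat v x * tau_mat v x *\<^sub>v u =
      (s \<cdot>\<^sub>m (sigma_mat v' x' * tau_mat v' x') + (s - 1) \<cdot>\<^sub>m 1\<^sub>m N) *\<^sub>v u" .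
qed (auto intro!: carrier_matI)

end

section \<open>Orbits\<close>

context quiver_vertex
begin

lemma GL_prod_carrier: "g \<in> carrier (GL_prod Q w) \<Longrightarrow> j \<in> verts Q \<Longrightarrow> g j \<in> carrier (GL (w j))"
  unfolding GL_prod_def by auto

lemma GL_prod_mat: "g \<in> carrier (GL_prod Q w) \<Longrightarrow> j \<in> verts Q \<Longrightarrow> g j \<in> carrier_mat (w j) (w j)"
  using GL_prod_carrier unfolding GL_carrier by blast

lemma GL_prod_group: "group (GL_prod Q w)"
  unfolding GL_prod_def using GL_group by (intro product_group)

lemma rep_act_reps:
  assumes g: "g \<in> carrier (GL_prod Q w)" and x: "x \<in> reps Q w"
  shows "rep_act Q w g x \<in> reps Q w"
  unfolding reps_def rep_act_def
proof (rule restrict_PiE_iff[THEN iffD2], intro ballI)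
  fix h assume h: "h \<in> darrows Q"
  have "x h \<in> carrier_mat (w (in_v Q h)) (w (out_v Q h))" using x h by (auto simp: reps_def)
  then show "g (in_v Q h) * x h * inv\<^bsub>GL (w (out_v Q h))\<^esub> g (out_v Q h) \<in> carrier_mat (w (in_v Q h)) (w (out_v Q h))"
    using GL_prod_mat[OF g in_v_verts[OF h]] GL_inv(1)[OF GL_prod_carrier[OF g out_v_verts[OF h]]] by auto
qed

text \<open>Clearing the inverse turns the action into an intertwining condition, the form in which
  it is compatible with the matrices \<sigma>, X and \<tau>.\<close>

lemma rep_act_eq_iff:
  assumes g: "g \<in> carrier (GL_prod Q w)" and x: "x \<in> reps Q w" and y: "y \<in> reps Q w"
  shows "y = rep_act Q w g x \<longleftrightarrow> (\<forall>h\<in>darrows Q. y h * g (out_v Q h) = g (in_v Q h) * x h)"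
proof -
  have *: "y h = rep_act Q w g x h \<longleftrightarrow> y h * g (out_v Q h) = g (in_v Q h) * x h" if h: "h \<in> darrows Q" for h
  proof -
    let ?o = "g (out_v Q h)" and ?j = "inv\<^bsub>GL (w (out_v Q h))\<^esub> g (out_v Q h)"
    note G = GL_prod_carrier[OF g out_v_verts[OF h]]
    note I = GL_inv[OF G]
    have c: "x h \<in> carrier_mat (w (in_v Q h)) (w (out_v Q h))" "y h \<in> carrier_mat (w (in_v Q h)) (w (out_v Q h))"
      "g (in_v Q h) \<in> carrier_mat (w (in_v Q h)) (w (in_v Q h))" "?o \<in> carrier_mat (w (out_v Q h)) (w (out_v Q h))"
      using x y h GL_prod_mat[OF g in_v_verts[OF h]] GL_prod_mat[OF g out_v_verts[OF h]] by (auto simp: reps_def)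
    show ?thesis
    proof
      assume "y h = rep_act Q w g x h"
      then have "y h * ?o = g (in_v Q h) * x h * ?j * ?o" using h by (simp add: rep_act_def)
      also have "\<dots> = g (in_v Q h) * x h * (?j * ?o)" using c I(1) by (simp add: mult_mat_assoc)
      finally show "y h * ?o = g (in_v Q h) * x h" unfolding I(3) using c by (simp add: mult_mat_one_right)
    next
      assume "y h * ?o = g (in_v Q h) * x h"
      then have "rep_act Q w g x h = y h * ?o * ?j" using h by (simp add: rep_act_def)
      also have "\<dots> = y h * (?o * ?j)" using c I(1) by (simp add: mult_mat_assoc)
      finally show "y h = rep_act Q w g x h" unfolding I(2) using c by (simp add: mult_mat_one_right)
    qed
  qed
  have z: "rep_act Q w g x \<in> reps Q w" by (rule rep_act_reps[OF g x])
  have "y = rep_act Q w g x \<longleftrightarrow> (\<forall>h\<in>darrows Q. y h = rep_act Q w g x h)"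
    using PiE_ext[OF y[unfolded reps_def] z[unfolded reps_def]] by auto
  then show ?thesis using * by simp
qed

lemma rep_act_one:
  assumes "x \<in> reps Q w"
  shows "rep_act Q w \<one>\<^bsub>GL_prod Q w\<^esub> x = x"
proof -
  interpret group "GL_prod Q w" by (rule GL_prod_group)
  have "x h * \<one>\<^bsub>GL_prod Q w\<^esub> (out_v Q h) = \<one>\<^bsub>GL_prod Q w\<^esub> (in_v Q h) * x h" if h: "h \<in> darrows Q" for h
  proof -
    have "x h \<in> carrier_mat (w (in_v Q h)) (w (out_v Q h))" using assms h by (auto simp: reps_def)
    then show ?thesis using in_v_verts[OF h] out_v_verts[OF h] by (simp add: GL_prod_def mat_ring)
  qed
  then have "x = rep_act Q w \<one>\<^bsub>GL_prod Q w\<^esub> x"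
    by (intro rep_act_eq_iff[OF one_closed assms assms, THEN iffD2] ballI)
  then show ?thesis by simp
qed

lemma rep_act_mult:
  assumes g: "g \<in> carrier (GL_prod Q w)" and k: "k \<in> carrier (GL_prod Q w)" and x: "x \<in> reps Q w"
  shows "rep_act Q w (g \<otimes>\<^bsub>GL_prod Q w\<^esub> k) x = rep_act Q w g (rep_act Q w k x)"
proof -
  interpret group "GL_prod Q w" by (rule GL_prod_group)
  let ?y = "rep_act Q w k x" and ?z = "rep_act Q w g (rep_act Q w k x)"
  have y: "?y \<in> reps Q w" by (rule rep_act_reps[OF k x])
  have z: "?z \<in> reps Q w" by (rule rep_act_reps[OF g y])
  have "?z h * (g \<otimes>\<^bsub>GL_prod Q w\<^esub> k) (out_v Q h) = (g \<otimes>\<^bsub>GL_prod Q w\<^esub> k) (in_v Q h) * x h" if h: "h \<in> darrows Q" for h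
  proof -
    let ?o = "out_v Q h" and ?n = "in_v Q h"
    have c: "x h \<in> carrier_mat (w ?n) (w ?o)" "?y h \<in> carrier_mat (w ?n) (w ?o)" "?z h \<in> carrier_mat (w ?n) (w ?o)"
      using x y z h by (auto simp: reps_def)
    have gk: "g ?n \<in> carrier_mat (w ?n) (w ?n)" "g ?o \<in> carrier_mat (w ?o) (w ?o)" "k ?n \<in> carrier_mat (w ?n) (w ?n)" "k ?o \<in> carrier_mat (w ?o) (w ?o)"
      using GL_prod_mat[OF g] GL_prod_mat[OF k] in_v_verts[OF h] out_v_verts[OF h] by auto
    have "?z h * (g ?o * k ?o) = ?z h * g ?o * k ?o" using c gk by (simp add: mult_mat_assoc)
    also have "?z h * g ?o = g ?n * ?y h" using rep_act_eq_iff[OF g y z] h by blast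
    also have "g ?n * ?y h * k ?o = g ?n * (?y h * k ?o)" using c gk by (simp add: mult_mat_assoc)
    also have "?y h * k ?o = k ?n * x h" using rep_act_eq_iff[OF k x y] h by blast
    also have "g ?n * (k ?n * x h) = g ?n * k ?n * x h" using c gk by (simp add: mult_mat_assoc)
    finally show ?thesis using in_v_verts[OF h] out_v_verts[OF h] by (simp add: GL_prod_def)
  qed
  then have "?z = rep_act Q w (g \<otimes>\<^bsub>GL_prod Q w\<^esub> k) x"
    by (intro rep_act_eq_iff[OF m_closed[OF g k] x z, THEN iffD2] ballI)
  then show ?thesis by simp
qed

text \<open>Only the clause on fibres of a geometric quotient is wanted. It is a statement about the
  group action, so the space of all representations with an empty set of coordinates serves as
  carrier.\<close>

lemma orbit_eq_iff_rep_act: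
  assumes "x \<in> reps Q w" "y \<in> reps Q w"
  shows "orbit (GL_prod Q w) (rep_act Q w) x = orbit (GL_prod Q w) (rep_act Q w) y \<longleftrightarrow>
    (\<exists>g\<in>carrier (GL_prod Q w). y = rep_act Q w g x)"
proof -
  have "geometric_quotient (GL_prod Q w) (rep_act Q w) (subvariety {} (reps Q w))
      (orbit_space (GL_prod Q w) (rep_act Q w) (subvariety {} (reps Q w))) (orbit (GL_prod Q w) (rep_act Q w))"
    by (rule geometric_quotient_orbit_space[OF GL_prod_group])
      (auto simp: rep_act_reps rep_act_one rep_act_mult)
  then show ?thesis
    using assms unfolding geometric_quotient_def by (auto simp: orbit_def)
qed

section \<open>Intertwining conditions in block form\<close>

abbreviation bdiag where "bdiag \<equiv> diag_blocks Hi d d"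

context
  fixes w x x1 and a :: "complex mat" and G :: "'a + 'a \<Rightarrow> complex mat"
  assumes w: "adm w" and x: "x \<in> reps Q w" and x1: "x1 \<in> reps Q w"
    and a: "a \<in> carrier_mat (w i) (w i)" and G: "\<And>h. h \<in> Hi \<Longrightarrow> G h \<in> carrier_mat (d h) (d h)"
begin

lemma in_mat_intertwine:
  "in_mat w x1 * bdiag G = a * in_mat w x \<longleftrightarrow> (\<forall>h\<in>Hi. x1 h * G h = a * x h)"
proof -
  have 1: "in_mat w x1 * bdiag G = col_blocks Hi d (w i) (\<lambda>h. x1 h * G h)"
    unfolding in_mat_def by (rule col_diag_blocks[OF finite_Hi G x_in_carrier[OF w x1]])
  have 2: "a * in_mat w x = col_blocks Hi d (w i) (\<lambda>h. a * x h)"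
    unfolding in_mat_def by (rule mult_col_blocks[OF finite_Hi a x_in_carrier[OF w x]])
  show ?thesis unfolding 1 2
    by (rule col_blocks_eq_iff[OF finite_Hi mult_carrier_mat[OF x_in_carrier[OF w x1] G]
        mult_carrier_mat[OF a x_in_carrier[OF w x]]])
qed

lemma sigma_mat_intertwine:
  "sigma_mat w x1 * a = bdiag G * sigma_mat w x \<longleftrightarrow> (\<forall>h\<in>Hi. x1 (opp h) * a = G h * x (opp h))"
proof -
  have 1: "sigma_mat w x1 * a = row_blocks Hi d (w i) (\<lambda>h. x1 (opp h) * a)"
    unfolding sigma_mat_def by (rule mult_row_blocks[OF finite_Hi a x_out_carrier[OF w x1]])
  have 2: "bdiag G * sigma_mat w x = row_blocks Hi d (w i) (\<lambda>h. G h * x (opp h))"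
    unfolding sigma_mat_def by (rule diag_row_blocks[OF finite_Hi G x_out_carrier[OF w x]])
  show ?thesis unfolding 1 2
    by (rule row_blocks_eq_iff[OF finite_Hi mult_carrier_mat[OF x_out_carrier[OF w x1] a]
        mult_carrier_mat[OF G x_out_carrier[OF w x]]])
qed

text \<open>The block diagonal matrix commutes with truncation and therefore intertwines the two
  matrices U; multiplying the claim by 1 - U turns it into the hypothesis on X.\<close>

lemma tau_mat_intertwine:
  assumes X: "in_mat w x1 * bdiag G = a * in_mat w x" and S: "sigma_mat w x1 * a = bdiag G * sigma_mat w x"
  shows "tau_mat w x1 * bdiag G = a * tau_mat w x"
proof (rule cancel_one_minus_upper)
  show "tau_mat w x1 * bdiag G \<in> carrier_mat (w i) N" "a * tau_mat w x \<in> carrier_mat (w i) N" using a by auto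
  let ?U = "up (sigma_mat w x * in_mat w x)" and ?U1 = "up (sigma_mat w x1 * in_mat w x1)"
  have "sigma_mat w x1 * in_mat w x1 * bdiag G = sigma_mat w x1 * (in_mat w x1 * bdiag G)" by (simp add: mult_mat_assoc)
  also have "\<dots> = sigma_mat w x1 * a * in_mat w x" unfolding X using a by (simp add: mult_mat_assoc)
  also have "\<dots> = bdiag G * (sigma_mat w x * in_mat w x)" unfolding S by (simp add: mult_mat_assoc)
  finally have e: "sigma_mat w x1 * in_mat w x1 * bdiag G = bdiag G * (sigma_mat w x * in_mat w x)" .
  have "?U1 * bdiag G = up (sigma_mat w x1 * in_mat w x1 * bdiag G)"
    by (rule upper_diag_blocks_right[OF finite_Hi, symmetric]) (auto intro!: carrier_matI)
  also have "\<dots> = bdiag G * ?U"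
    unfolding e by (rule upper_diag_blocks_left[OF finite_Hi]) (auto intro!: carrier_matI)
  finally have U: "?U1 * bdiag G = bdiag G * ?U" .
  have "tau_mat w x1 * bdiag G * (1\<^sub>m N - ?U) = tau_mat w x1 * bdiag G - tau_mat w x1 * (bdiag G * ?U)"
    by (simp add: mat_ring)
  also have "\<dots> = tau_mat w x1 * (1\<^sub>m N - ?U1) * bdiag G"
    unfolding U[symmetric] by (simp add: mat_ring)
  also have "\<dots> = a * in_mat w x" unfolding in_mat_eq[OF w x1, symmetric] by (rule X)
  also have "\<dots> = a * (tau_mat w x * (1\<^sub>m N - ?U))" by (simp only: in_mat_eq[OF w x, symmetric])
  also have "\<dots> = a * tau_mat w x * (1\<^sub>m N - ?U)" using a by (simp add: mult_mat_assoc)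
  finally show "tau_mat w x1 * bdiag G * (1\<^sub>m N - ?U) = a * tau_mat w x * (1\<^sub>m N - ?U)" .
qed

text \<open>The converse rests on uniqueness: pulling the incoming arrows of \<open>x1\<close> back
  along the change of basis gives a matrix Y that solves the implicit equation for X of
  \<open>x\<close>.\<close>

lemma in_mat_intertwine_of_tau:
  assumes T: "tau_mat w x1 * bdiag G = a * tau_mat w x" and S: "sigma_mat w x1 * a = bdiag G * sigma_mat w x"
    and b: "b \<in> carrier_mat (w i) (w i)" "b * a = 1\<^sub>m (w i)" "a * b = 1\<^sub>m (w i)"
    and det: "\<And>h. h \<in> Hi \<Longrightarrow> det (one_plus Q w x h) \<noteq> 0"
  shows "in_mat w x1 * bdiag G = a * in_mat w x"
proof -
  define Y where "Y = b * (in_mat w x1 * bdiag G)"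
  have Y: "Y \<in> carrier_mat (w i) N" using b by (auto simp: Y_def intro!: carrier_matI)
  have "a * Y = a * b * (in_mat w x1 * bdiag G)" unfolding Y_def using a b(1) by (simp add: mult_mat_assoc)
  then have aY: "a * Y = in_mat w x1 * bdiag G" unfolding b(3) by (simp add: mult_mat_one_left)
  have "sigma_mat w x1 * in_mat w x1 * bdiag G = sigma_mat w x1 * (in_mat w x1 * bdiag G)" by (simp add: mult_mat_assoc)
  also have "\<dots> = sigma_mat w x1 * a * Y" unfolding aY[symmetric] using a Y by (simp add: mult_mat_assoc)
  also have "\<dots> = bdiag G * (sigma_mat w x * Y)" unfolding S using Y by (simp add: mult_mat_assoc)
  finally have e: "sigma_mat w x1 * in_mat w x1 * bdiag G = bdiag G * (sigma_mat w x * Y)" .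
  have "up (sigma_mat w x1 * in_mat w x1) * bdiag G = up (sigma_mat w x1 * in_mat w x1 * bdiag G)"
    by (rule upper_diag_blocks_right[OF finite_Hi, symmetric]) (auto intro!: carrier_matI)
  also have "\<dots> = bdiag G * up (sigma_mat w x * Y)"
    unfolding e by (rule upper_diag_blocks_left[OF finite_Hi]) (use Y in \<open>auto intro!: carrier_matI\<close>)
  finally have U: "up (sigma_mat w x1 * in_mat w x1) * bdiag G = bdiag G * up (sigma_mat w x * Y)" .
  have "tau_mat w x1 * bdiag G = (in_mat w x1 + tau_mat w x1 * up (sigma_mat w x1 * in_mat w x1)) * bdiag G"
    using tau_mat_eq[OF w x1] by simp
  also have "\<dots> = in_mat w x1 * bdiag G + tau_mat w x1 * (up (sigma_mat w x1 * in_mat w x1) * bdiag G)"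
    by (simp add: mat_ring)
  also have "\<dots> = a * Y + tau_mat w x1 * bdiag G * up (sigma_mat w x * Y)"
    unfolding U aY by (simp add: mult_mat_assoc)
  finally have E: "a * tau_mat w x = a * Y + a * (tau_mat w x * up (sigma_mat w x * Y))"
    unfolding T using a by (simp add: mult_mat_assoc)
  have "tau_mat w x = b * (a * tau_mat w x)"
    using a b by (simp add: mult_mat_assoc[symmetric] mult_mat_one_left)
  also have "\<dots> = b * a * Y + b * a * (tau_mat w x * up (sigma_mat w x * Y))"
    unfolding E using a b(1) Y by (simp add: mat_ring)
  finally have "tau_mat w x = Y + tau_mat w x * up (sigma_mat w x * Y)"
    unfolding b(2) using Y by (simp add: mult_mat_one_left)
  then have "Y = in_mat w x" by (rule in_mat_unique[OF w x Y _ det])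
  then show ?thesis using aY by simp
qed

end

lemma bdiag_cong: "(\<And>h. h \<in> Hi \<Longrightarrow> G h = G' h) \<Longrightarrow> bdiag G = bdiag G'"
  by (intro eq_matI) (auto simp: diag_blocks_def blk_loc(1)[OF finite_Hi])

lemma rep_act_eq_iff_blocks:
  assumes w: "adm w" and g: "g \<in> carrier (GL_prod Q w)" and x: "x \<in> reps Q w" and x1: "x1 \<in> reps Q w"
  shows "x1 = rep_act Q w g x \<longleftrightarrow>
    in_mat w x1 * bdiag (\<lambda>h. g (out_v Q h)) = g i * in_mat w x \<and>
    sigma_mat w x1 * g i = bdiag (\<lambda>h. g (out_v Q h)) * sigma_mat w x \<and>
    (\<forall>h\<in>darrows Q - (Hi \<union> opp ` Hi). x1 h * g (out_v Q h) = g (in_v Q h) * x h)"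
proof -
  have a: "g i \<in> carrier_mat (w i) (w i)" by (rule GL_prod_mat[OF g i])
  have G: "g (out_v Q h) \<in> carrier_mat (d h) (d h)" if "h \<in> Hi" for h
    using GL_prod_mat[OF g, of "out_v Q h"] out_v_Hi_verts[OF that] adm_d[OF w that] by auto
  have split: "(\<forall>h\<in>darrows Q. R h) \<longleftrightarrow> (\<forall>h\<in>Hi. R h) \<and> (\<forall>h\<in>Hi. R (opp h)) \<and> (\<forall>h\<in>darrows Q - (Hi \<union> opp ` Hi). R h)" for R
    using Hi_darrows by (auto elim: darrows_cases)
  show ?thesis
    unfolding rep_act_eq_iff[OF g x x1] split in_mat_intertwine[OF w x x1 a G, simplified]
      sigma_mat_intertwine[OF w x x1 a G, simplified]
    using in_v_Hi by auto
qed

end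

context vertex_reflection
begin

section \<open>The group acting on the correspondence and the fibres of the two projections\<close>

lemma corr_group_carrier:
  "(a, b, g) \<in> carrier (corr_group Q i v v') \<longleftrightarrow>
     a \<in> carrier (GL (v i)) \<and> b \<in> carrier (GL (v' i)) \<and> g \<in> (\<Pi>\<^sub>E j\<in>verts Q - {i}. carrier (GL (v j)))"
  by (simp add: corr_group_def)

lemma corr_group_group: "group (corr_group Q i v v')"
  unfolding corr_group_def by (intro DirProd_group GL_group product_group)

lemma extend_GL_prod:
  assumes w: "adm w" and a: "a \<in> carrier (GL (w i))" and g: "g \<in> (\<Pi>\<^sub>E j\<in>verts Q - {i}. carrier (GL (v j)))"
  shows "g(i := a) \<in> carrier (GL_prod Q w)"
proof -
  have "g j \<in> carrier (GL (w j))" if "j \<in> verts Q - {i}" for j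
    using g that w unfolding adm_def by (auto simp: PiE_iff)
  moreover have "g j = undefined" if "j \<notin> verts Q" for j
    using g that by (auto simp: PiE_iff extensional_def)
  ultimately show ?thesis
    using a i unfolding GL_prod_def by (auto simp: PiE_iff extensional_def)
qed

lemma restrict_GL_prod:
  assumes w: "adm w" and g: "g \<in> carrier (GL_prod Q w)"
  shows "restrict g (verts Q - {i}) \<in> (\<Pi>\<^sub>E j\<in>verts Q - {i}. carrier (GL (v j)))"
    and "(restrict g (verts Q - {i}))(i := g i) = g"
proof -
  show "restrict g (verts Q - {i}) \<in> (\<Pi>\<^sub>E j\<in>verts Q - {i}. carrier (GL (v j)))"
  proof -
    have "g j \<in> carrier (GL (v j))" if "j \<in> verts Q - {i}" for j
      using GL_prod_carrier[OF g, of j] that w unfolding adm_def by auto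
    then show ?thesis by (auto simp: PiE_iff)
  qed
  have "g j = undefined" if "j \<notin> verts Q" for j
    using g that unfolding GL_prod_def by (auto simp: PiE_iff extensional_def)
  then show "(restrict g (verts Q - {i}))(i := g i) = g" by auto
qed

lemma orbit_eq_iff_corr_act:
  assumes "p \<in> reps Q v \<times> reps Q v'" "p1 \<in> reps Q v \<times> reps Q v'"
  shows "orbit (corr_group Q i v v') (corr_act Q i v v') p = orbit (corr_group Q i v v') (corr_act Q i v v') p1 \<longleftrightarrow>
    (\<exists>k\<in>carrier (corr_group Q i v v'). p1 = corr_act Q i v v' k p)"
proof -
  let ?G = "corr_group Q i v v'" and ?\<phi> = "corr_act Q i v v'" and ?S = "subvariety {} (reps Q v \<times> reps Q v')"
  interpret G: group ?G by (rule corr_group_group)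
  have ext: "g(i := a) \<in> carrier (GL_prod Q v) \<and> g(i := b) \<in> carrier (GL_prod Q v')" if "(a, b, g) \<in> carrier ?G" for a b g
    using extend_GL_prod[OF adm_v] extend_GL_prod[OF adm_v'] that unfolding corr_group_carrier by blast
  have mult: "(\<lambda>j\<in>verts Q - {i}. g j * k j)(i := a * a') = (g(i := a)) \<otimes>\<^bsub>GL_prod Q w\<^esub> (k(i := a'))"
    for g k :: "'v \<Rightarrow> complex mat" and a a' w
    using i by (auto simp: GL_prod_def fun_eq_iff)
  have one: "(\<lambda>j\<in>verts Q - {i}. 1\<^sub>m (v j))(i := 1\<^sub>m (w i)) = \<one>\<^bsub>GL_prod Q w\<^esub>" if "adm w" for w
    using that i unfolding adm_def by (auto simp: GL_prod_def fun_eq_iff)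
  have "geometric_quotient ?G ?\<phi> ?S (orbit_space ?G ?\<phi> ?S) (orbit ?G ?\<phi>)"
  proof (rule geometric_quotient_orbit_space[OF corr_group_group])
    fix g x assume g: "g \<in> carrier ?G" and x: "x \<in> fs_carrier ?S"
    obtain a b k where k: "g = (a, b, k)" by (cases g)
    show "?\<phi> g x \<in> fs_carrier ?S"
      using x ext[of a b k] g unfolding k by (auto simp: corr_act_def rep_act_reps split: prod.split)
  next
    fix x assume x: "x \<in> fs_carrier ?S"
    show "?\<phi> \<one>\<^bsub>?G\<^esub> x = x"
      using x one[OF adm_v] one[OF adm_v'] by (auto simp: corr_act_def corr_group_def rep_act_one)
  next
    fix g h x assume g: "g \<in> carrier ?G" and h: "h \<in> carrier ?G" and x: "x \<in> fs_carrier ?S"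
    obtain a b k where k: "g = (a, b, k)" by (cases g)
    obtain a' b' k' where k': "h = (a', b', k')" by (cases h)
    have gh: "g \<otimes>\<^bsub>?G\<^esub> h = (a * a', b * b', \<lambda>j\<in>verts Q - {i}. k j * k' j)"
      unfolding k k' corr_group_def by simp
    show "?\<phi> (g \<otimes>\<^bsub>?G\<^esub> h) x = ?\<phi> g (?\<phi> h x)"
      unfolding gh unfolding k k' corr_act_def case_prod_beta fst_conv snd_conv
        mult[of k k' a a' v] mult[of k k' b b' v']
      using x ext[of a b k] ext[of a' b' k'] g h unfolding k k' by (auto simp: rep_act_mult)
  qed
  then have "\<forall>x\<in>fs_carrier ?S. \<forall>y\<in>fs_carrier ?S. orbit ?G ?\<phi> x = orbit ?G ?\<phi> y \<longleftrightarrow> y \<in> orbit ?G ?\<phi> x"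
    unfolding geometric_quotient_def by (rule conjunct1[OF conjunct2])
  then have "orbit ?G ?\<phi> p = orbit ?G ?\<phi> p1 \<longleftrightarrow> p1 \<in> orbit ?G ?\<phi> p"
    using assms unfolding fs_carrier_subvariety by blast
  also have "\<dots> \<longleftrightarrow> (\<exists>k\<in>carrier ?G. p1 = ?\<phi> k p)"
    unfolding orbit_def by blast
  finally show ?thesis .
qed

lemma corr_reps: "(x, x') \<in> P \<Longrightarrow> x \<in> reps Q v \<and> x' \<in> reps Q v'"
  unfolding corr_def by blast

lemma corr_other: "(x, x') \<in> P \<Longrightarrow> h \<in> darrows Q - (Hi \<union> opp ` Hi) \<Longrightarrow> x h = x' h"
  unfolding corr_def by blast

lemma corr_det: "(x, x') \<in> P \<Longrightarrow> h \<in> darrows Q \<Longrightarrow> det (one_plus Q v x h) \<noteq> 0 \<and> det (one_plus Q v' x' h) \<noteq> 0"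
  unfolding corr_def by blast

lemma bdiag_inverse:
  assumes "g \<in> carrier (GL_prod Q w)" and w: "adm w"
  obtains H where "bdiag (\<lambda>h. g (out_v Q h)) * bdiag H = 1\<^sub>m N" "bdiag H * bdiag (\<lambda>h. g (out_v Q h)) = 1\<^sub>m N"
proof -
  have G: "g (out_v Q h) \<in> carrier (GL (d h))" if "h \<in> Hi" for h
    using GL_prod_carrier[OF assms(1), of "out_v Q h"] out_v_Hi_verts[OF that] adm_d[OF w that] by auto
  define H where "H = (\<lambda>h. inv\<^bsub>GL (d h)\<^esub> g (out_v Q h))"
  have "bdiag (\<lambda>h. g (out_v Q h)) * bdiag H = 1\<^sub>m N" "bdiag H * bdiag (\<lambda>h. g (out_v Q h)) = 1\<^sub>m N"
    using G GL_inv[OF G] unfolding H_def GL_carrier by (auto intro!: diag_diag_blocks[OF finite_Hi])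
  then show ?thesis by (rule that)
qed

text \<open>The first components determine the kernels of \<tau>, which are the ranges of the two
  \<sigma>'; these differ by an invertible \<open>b\<close>. Relation (R3), with \<sigma>' cancelled
  on the left, then intertwines \<tau>', and \<sigma>' and \<tau>' determine X'.\<close>

lemma corr_fibre_left:
  assumes p: "(x, x') \<in> P" and p1: "(x1, x1') \<in> P" and g: "g \<in> carrier (GL_prod Q v)"
    and x1: "x1 = rep_act Q v g x"
  shows "\<exists>k\<in>carrier (corr_group Q i v v'). (x1, x1') = corr_act Q i v v' k (x, x')"
proof -
  note reps = corr_reps[OF p] corr_reps[OF p1]
  let ?G = "bdiag (\<lambda>h. g (out_v Q h))"
  let ?\<sigma> = "sigma_mat v x" and ?\<tau> = "tau_mat v x" and ?\<sigma>' = "sigma_mat v' x'" and ?\<tau>' = "tau_mat v' x'"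
  let ?\<sigma>1 = "sigma_mat v x1" and ?\<tau>1 = "tau_mat v x1" and ?\<sigma>1' = "sigma_mat v' x1'" and ?\<tau>1' = "tau_mat v' x1'"
  have Gh: "g (out_v Q h) \<in> carrier_mat (d h) (d h)" if "h \<in> Hi" for h
    using GL_prod_mat[OF g, of "out_v Q h"] out_v_Hi_verts[OF that] by auto
  have a: "g i \<in> carrier_mat (v i) (v i)" by (rule GL_prod_mat[OF g i])
  have X: "in_mat v x1 * ?G = g i * in_mat v x" and S: "?\<sigma>1 * g i = ?G * ?\<sigma>"
    and other: "\<forall>h\<in>darrows Q - (Hi \<union> opp ` Hi). x1 h * g (out_v Q h) = g (in_v Q h) * x h"
    using rep_act_eq_iff_blocks[OF adm_v g] reps x1 by blast+
  have T: "?\<tau>1 * ?G = g i * ?\<tau>"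
    by (rule tau_mat_intertwine[OF adm_v _ _ a Gh X S]) (use reps in auto)
  obtain H where H: "?G * bdiag H = 1\<^sub>m N" "bdiag H * ?G = 1\<^sub>m N"
    by (rule bdiag_inverse[OF g adm_v])
  obtain L R where "split_exact (v' i) N (v i) ?\<sigma>' ?\<tau> L R" using corr_split_exact[OF p] by blast
  then have L: "L \<in> carrier_mat (v' i) N" "R \<in> carrier_mat N (v i)"
    and LR: "?\<tau> * ?\<sigma>' = 0\<^sub>m (v i) (v' i)" "L * ?\<sigma>' = 1\<^sub>m (v' i)"
    unfolding split_exact_def by blast+
  obtain L1 R1 where "split_exact (v' i) N (v i) ?\<sigma>1' ?\<tau>1 L1 R1" using corr_split_exact[OF p1] by blast
  then have L1: "L1 \<in> carrier_mat (v' i) N" "R1 \<in> carrier_mat N (v i)"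
    and LR1: "L1 * ?\<sigma>1' = 1\<^sub>m (v' i)" "?\<sigma>1' * L1 + R1 * ?\<tau>1 = 1\<^sub>m N"
    unfolding split_exact_def by blast+
  \<comment> \<open>The coordinates, with respect to \<sigma>' of the second point, of the
    transported \<sigma>' of the first one; \<open>b'\<close> below arises in the same way from the
    inverse change of basis.\<close>
  define b where "b = L1 * ?G * ?\<sigma>'"
  have b: "b \<in> carrier_mat (v' i) (v' i)" using L1 by (auto simp: b_def intro!: carrier_matI)
  have S': "?\<sigma>1' * b = ?G * ?\<sigma>'"
  proof -
    have "?G * ?\<sigma>' = (?\<sigma>1' * L1 + R1 * ?\<tau>1) * (?G * ?\<sigma>')" unfolding LR1(2) by (simp add: mult_mat_one_left)
    also have "\<dots> = ?\<sigma>1' * b + R1 * (?\<tau>1 * ?G * ?\<sigma>')"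
      unfolding b_def using L1 by (simp add: mat_ring)
    also have "?\<tau>1 * ?G * ?\<sigma>' = g i * (?\<tau> * ?\<sigma>')" unfolding T using a by (simp add: mult_mat_assoc)
    also have "\<dots> = 0\<^sub>m (v i) (v' i)" unfolding LR(1) using a by (simp add: mult_mat_zero_right)
    finally show ?thesis using L1 b by (simp add: mult_mat_zero_right zero_add_mat)
  qed
  define b' where "b' = L * bdiag H * ?\<sigma>1'"
  have b': "b' \<in> carrier_mat (v' i) (v' i)" using L by (auto simp: b'_def intro!: carrier_matI)
  have b'b: "b' * b = 1\<^sub>m (v' i)"
  proof -
    have "b' * b = L * bdiag H * (?\<sigma>1' * b)" unfolding b'_def using L b by (simp add: mult_mat_assoc)
    also have "\<dots> = L * ((bdiag H * ?G) * ?\<sigma>')" unfolding S' using L by (simp add: mult_mat_assoc)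
    also have "\<dots> = 1\<^sub>m (v' i)" unfolding H(2) using LR(2) by (simp add: mult_mat_one_left)
    finally show ?thesis .
  qed
  have bb': "b * b' = 1\<^sub>m (v' i)" by (rule mat_mult_left_right_inverse[OF b' b b'b])
  have T': "?\<tau>1' * ?G = b * ?\<tau>'"
  proof -
    have ST: "?\<sigma>1 * ?\<tau>1 * ?G = ?G * (?\<sigma> * ?\<tau>)"
    proof -
      have "?\<sigma>1 * ?\<tau>1 * ?G = ?\<sigma>1 * (?\<tau>1 * ?G)" by (simp add: mult_mat_assoc)
      also have "\<dots> = ?\<sigma>1 * g i * ?\<tau>" unfolding T using a by (simp add: mult_mat_assoc)
      finally show ?thesis unfolding S by (simp add: mult_mat_assoc)
    qed
    \<comment> \<open>The scalar term of (R3) commutes with the change of basis and drops out; what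
      remains is divided by s.\<close>
    have "s \<cdot>\<^sub>m (?\<sigma>1' * ?\<tau>1' * ?G) + (s - 1) \<cdot>\<^sub>m ?G = s \<cdot>\<^sub>m (?G * (?\<sigma>' * ?\<tau>')) + (s - 1) \<cdot>\<^sub>m ?G"
      using ST unfolding corr_sigma_tau[OF p] corr_sigma_tau[OF p1] by (simp add: mat_ring)
    then have e: "?\<sigma>1' * ?\<tau>1' * ?G = ?G * (?\<sigma>' * ?\<tau>')"
    proof (intro eq_matI)
      fix r c assume E: "s \<cdot>\<^sub>m (?\<sigma>1' * ?\<tau>1' * ?G) + (s - 1) \<cdot>\<^sub>m ?G = s \<cdot>\<^sub>m (?G * (?\<sigma>' * ?\<tau>')) + (s - 1) \<cdot>\<^sub>m ?G"
        and "r < dim_row (?G * (?\<sigma>' * ?\<tau>'))" "c < dim_col (?G * (?\<sigma>' * ?\<tau>'))"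
      then have rc: "r < N" "c < N" by auto
      from arg_cong[OF E, of "\<lambda>A. A $$ (r, c)"]
      show "(?\<sigma>1' * ?\<tau>1' * ?G) $$ (r, c) = (?G * (?\<sigma>' * ?\<tau>')) $$ (r, c)"
        using rc s_nonzero by (simp del: index_mult_mat(1))
    qed auto
    have "?\<tau>1' * ?G = L1 * ?\<sigma>1' * (?\<tau>1' * ?G)" unfolding LR1(1) by (simp add: mult_mat_one_left)
    also have "\<dots> = L1 * (?\<sigma>1' * ?\<tau>1' * ?G)" using L1 by (simp add: mult_mat_assoc)
    also have "\<dots> = L1 * (?G * ?\<sigma>' * ?\<tau>')" unfolding e using L1 by (simp add: mult_mat_assoc)
    also have "\<dots> = L1 * ?\<sigma>1' * (b * ?\<tau>')" unfolding S'[symmetric] using L1 b by (simp add: mult_mat_assoc)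
    also have "\<dots> = b * ?\<tau>'" unfolding LR1(1) using b by (simp add: mult_mat_one_left)
    finally show ?thesis .
  qed
  have X': "in_mat v' x1' * ?G = b * in_mat v' x'"
    using reps corr_det[OF p] Hi_darrows
    by (intro in_mat_intertwine_of_tau[OF adm_v' _ _ b Gh T' S' b' b'b bb']) auto
  let ?g = "restrict g (verts Q - {i})"
  have bG: "b \<in> carrier (GL (v' i))" using b det_nonzero_inverse[OF b b' bb'] by (simp add: GL_carrier)
  have k: "(g i, b, ?g) \<in> carrier (corr_group Q i v v')"
    unfolding corr_group_carrier using GL_prod_carrier[OF g i] bG restrict_GL_prod(1)[OF adm_v g] by blast
  have gb: "?g(i := b) \<in> carrier (GL_prod Q v')"
    using extend_GL_prod[OF adm_v' bG] k unfolding corr_group_carrier by blast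
  have bd: "bdiag (\<lambda>h. (?g(i := b)) (out_v Q h)) = ?G"
    using out_v_Hi_verts by (intro bdiag_cong) auto
  have "x1' = rep_act Q v' (?g(i := b)) x'"
    unfolding rep_act_eq_iff_blocks[OF adm_v' gb reps(1)[THEN conjunct2] reps(2)[THEN conjunct2]] bd
  proof (intro conjI ballI)
    show "in_mat v' x1' * ?G = (?g(i := b)) i * in_mat v' x'" using X' by simp
    show "sigma_mat v' x1' * (?g(i := b)) i = ?G * sigma_mat v' x'" using S' by simp
    fix h assume h: "h \<in> darrows Q - (Hi \<union> opp ` Hi)"
    then have "x1 h * g (out_v Q h) = g (in_v Q h) * x h" using other by blast
    then show "x1' h * (?g(i := b)) (out_v Q h) = (?g(i := b)) (in_v Q h) * x' h"
      using other_not_i[OF h] in_v_verts[of h] out_v_verts[of h] h corr_other[OF p h] corr_other[OF p1 h] by simp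
  qed
  then have "(x1, x1') = corr_act Q i v v' (g i, b, ?g) (x, x')"
    using x1 restrict_GL_prod(2)[OF adm_v g] by (simp add: corr_act_def)
  then show ?thesis using k by blast
qed

text \<open>Dual to \<open>corr_fibre_left\<close>: \<tau> is a cokernel of \<sigma>', so the two
  maps \<tau> differ by an invertible \<open>a\<close>. Relation (R3), with \<tau> cancelled on the
  right, intertwines \<sigma>, and X follows.\<close>

lemma corr_fibre_right:
  assumes p: "(x, x') \<in> P" and p1: "(x1, x1') \<in> P" and g: "g \<in> carrier (GL_prod Q v')"
    and x1: "x1' = rep_act Q v' g x'"
  shows "\<exists>k\<in>carrier (corr_group Q i v v'). (x1, x1') = corr_act Q i v v' k (x, x')"
proof -
  note reps = corr_reps[OF p] corr_reps[OF p1]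
  let ?G = "bdiag (\<lambda>h. g (out_v Q h))"
  let ?\<sigma> = "sigma_mat v x" and ?\<tau> = "tau_mat v x" and ?\<sigma>' = "sigma_mat v' x'" and ?\<tau>' = "tau_mat v' x'"
  let ?\<sigma>1 = "sigma_mat v x1" and ?\<tau>1 = "tau_mat v x1" and ?\<sigma>1' = "sigma_mat v' x1'" and ?\<tau>1' = "tau_mat v' x1'"
  have Gh: "g (out_v Q h) \<in> carrier_mat (d h) (d h)" if "h \<in> Hi" for h
    using GL_prod_mat[OF g, of "out_v Q h"] out_v_Hi_verts[OF that] adm_d[OF adm_v' that] by auto
  have b: "g i \<in> carrier_mat (v' i) (v' i)" by (rule GL_prod_mat[OF g i])
  have X': "in_mat v' x1' * ?G = g i * in_mat v' x'" and S': "?\<sigma>1' * g i = ?G * ?\<sigma>'"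
    and other: "\<forall>h\<in>darrows Q - (Hi \<union> opp ` Hi). x1' h * g (out_v Q h) = g (in_v Q h) * x' h"
    using rep_act_eq_iff_blocks[OF adm_v' g] reps x1 by blast+
  have T': "?\<tau>1' * ?G = g i * ?\<tau>'"
    by (rule tau_mat_intertwine[OF adm_v' _ _ b Gh X' S']) (use reps in auto)
  obtain H where H: "?G * bdiag H = 1\<^sub>m N" "bdiag H * ?G = 1\<^sub>m N"
    by (rule bdiag_inverse[OF g adm_v'])
  obtain L R where "split_exact (v' i) N (v i) ?\<sigma>' ?\<tau> L R" using corr_split_exact[OF p] by blast
  then have L: "L \<in> carrier_mat (v' i) N" "R \<in> carrier_mat N (v i)"
    and LR: "?\<tau> * R = 1\<^sub>m (v i)" "?\<sigma>' * L + R * ?\<tau> = 1\<^sub>m N"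
    unfolding split_exact_def by blast+
  obtain L1 R1 where "split_exact (v' i) N (v i) ?\<sigma>1' ?\<tau>1 L1 R1" using corr_split_exact[OF p1] by blast
  then have L1: "L1 \<in> carrier_mat (v' i) N" "R1 \<in> carrier_mat N (v i)"
    and LR1: "?\<tau>1 * ?\<sigma>1' = 0\<^sub>m (v i) (v' i)" "?\<tau>1 * R1 = 1\<^sub>m (v i)"
    unfolding split_exact_def by blast+
  \<comment> \<open>The map on cokernels induced by the change of basis, computed on the section
    \<open>R\<close> of \<tau>.\<close>
  define a where "a = ?\<tau>1 * ?G * R"
  have a: "a \<in> carrier_mat (v i) (v i)" using L by (auto simp: a_def intro!: carrier_matI)
  have T: "?\<tau>1 * ?G = a * ?\<tau>"
  proof -
    have "?\<tau>1 * ?G = ?\<tau>1 * ?G * (?\<sigma>' * L + R * ?\<tau>)" unfolding LR(2) by (simp add: mult_mat_one_right)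
    also have "\<dots> = ?\<tau>1 * (?G * ?\<sigma>') * L + a * ?\<tau>"
      unfolding a_def using L by (simp add: mat_ring)
    also have "?\<tau>1 * (?G * ?\<sigma>') * L = ?\<tau>1 * ?\<sigma>1' * (g i * L)"
      unfolding S'[symmetric] using b L by (simp add: mult_mat_assoc)
    also have "\<dots> = 0\<^sub>m (v i) N" unfolding LR1(1) using b L by (simp add: mult_mat_zero_left)
    finally show ?thesis using a by (simp add: zero_add_mat)
  qed
  define a' where "a' = ?\<tau> * bdiag H * R1"
  have a': "a' \<in> carrier_mat (v i) (v i)" using L1 by (auto simp: a'_def intro!: carrier_matI)
  have aa': "a * a' = 1\<^sub>m (v i)"
  proof -
    have "a * a' = a * ?\<tau> * (bdiag H * R1)" unfolding a'_def using L1 a by (simp add: mult_mat_assoc)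
    also have "\<dots> = ?\<tau>1 * ((?G * bdiag H) * R1)" unfolding T[symmetric] using L1 by (simp add: mult_mat_assoc)
    also have "\<dots> = 1\<^sub>m (v i)" unfolding H(1) using LR1(2) L1 by (simp add: mult_mat_one_left)
    finally show ?thesis .
  qed
  have a'a: "a' * a = 1\<^sub>m (v i)" by (rule mat_mult_left_right_inverse[OF a a' aa'])
  have S: "?\<sigma>1 * a = ?G * ?\<sigma>"
  proof -
    have ST': "?\<sigma>1' * ?\<tau>1' * ?G = ?G * (?\<sigma>' * ?\<tau>')"
    proof -
      have "?\<sigma>1' * ?\<tau>1' * ?G = ?\<sigma>1' * (?\<tau>1' * ?G)" by (simp add: mult_mat_assoc)
      also have "\<dots> = ?\<sigma>1' * g i * ?\<tau>'" unfolding T' using b by (simp add: mult_mat_assoc)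
      finally show ?thesis unfolding S' by (simp add: mult_mat_assoc)
    qed
    have e: "?\<sigma>1 * ?\<tau>1 * ?G = ?G * (?\<sigma> * ?\<tau>)"
      unfolding corr_sigma_tau[OF p] corr_sigma_tau[OF p1] using ST' by (simp add: mat_ring)
    have "?\<sigma>1 * a = ?\<sigma>1 * (a * (?\<tau> * R))" unfolding LR(1) using a by (simp add: mult_mat_one_right)
    also have "\<dots> = ?\<sigma>1 * (a * ?\<tau>) * R" using a L by (simp add: mult_mat_assoc)
    also have "\<dots> = ?\<sigma>1 * ?\<tau>1 * ?G * R" unfolding T[symmetric] using L by (simp add: mult_mat_assoc)
    also have "\<dots> = ?G * (?\<sigma> * (?\<tau> * R))" unfolding e using L by (simp add: mult_mat_assoc)
    also have "\<dots> = ?G * ?\<sigma>" unfolding LR(1) by (simp add: mult_mat_one_right)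
    finally show ?thesis .
  qed
  have X: "in_mat v x1 * ?G = a * in_mat v x"
    using reps corr_det[OF p] Hi_darrows
    by (intro in_mat_intertwine_of_tau[OF adm_v _ _ a Gh T S a' a'a aa']) auto
  let ?g = "restrict g (verts Q - {i})"
  have aG: "a \<in> carrier (GL (v i))" using a det_nonzero_inverse[OF a a' aa'] by (simp add: GL_carrier)
  have k: "(a, g i, ?g) \<in> carrier (corr_group Q i v v')"
    unfolding corr_group_carrier using GL_prod_carrier[OF g i] aG restrict_GL_prod(1)[OF adm_v' g] by blast
  have ga: "?g(i := a) \<in> carrier (GL_prod Q v)"
    using extend_GL_prod[OF adm_v aG] k unfolding corr_group_carrier by blast
  have bd: "bdiag (\<lambda>h. (?g(i := a)) (out_v Q h)) = ?G"
    using out_v_Hi_verts by (intro bdiag_cong) auto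
  have "x1 = rep_act Q v (?g(i := a)) x"
    unfolding rep_act_eq_iff_blocks[OF adm_v ga reps(1)[THEN conjunct1] reps(2)[THEN conjunct1]] bd
  proof (intro conjI ballI)
    show "in_mat v x1 * ?G = (?g(i := a)) i * in_mat v x" using X by simp
    show "sigma_mat v x1 * (?g(i := a)) i = ?G * sigma_mat v x" using S by simp
    fix h assume h: "h \<in> darrows Q - (Hi \<union> opp ` Hi)"
    then have "x1' h * g (out_v Q h) = g (in_v Q h) * x' h" using other by blast
    then show "x1 h * (?g(i := a)) (out_v Q h) = (?g(i := a)) (in_v Q h) * x h"
      using other_not_i[OF h] in_v_verts[of h] out_v_verts[of h] h corr_other[OF p h] corr_other[OF p1 h] by simp
  qed
  then have "(x1, x1') = corr_act Q i v v' (a, g i, ?g) (x, x')"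
    using x1 restrict_GL_prod(2)[OF adm_v' g] by (simp add: corr_act_def)
  then show ?thesis using k by blast
qed

lemma corr_orbit_eq_iff:
  assumes p: "p \<in> P" and p1: "p1 \<in> P"
  shows "orbit (corr_group Q i v v') (corr_act Q i v v') p = orbit (corr_group Q i v v') (corr_act Q i v v') p1 \<longleftrightarrow>
      orbit (GL_prod Q v) (rep_act Q v) (fst p) = orbit (GL_prod Q v) (rep_act Q v) (fst p1)"
    and "orbit (corr_group Q i v v') (corr_act Q i v v') p = orbit (corr_group Q i v v') (corr_act Q i v v') p1 \<longleftrightarrow>
      orbit (GL_prod Q v') (rep_act Q v') (snd p) = orbit (GL_prod Q v') (rep_act Q v') (snd p1)"
proof -
  obtain x x' where x: "p = (x, x')" by (cases p)
  obtain x1 x1' where x1: "p1 = (x1, x1')" by (cases p1)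
  note r = corr_reps[OF p[unfolded x]] corr_reps[OF p1[unfolded x1]]
  have C: "orbit (corr_group Q i v v') (corr_act Q i v v') p = orbit (corr_group Q i v v') (corr_act Q i v v') p1 \<longleftrightarrow>
    (\<exists>k\<in>carrier (corr_group Q i v v'). p1 = corr_act Q i v v' k p)"
    by (rule orbit_eq_iff_corr_act) (use r in \<open>auto simp: x x1\<close>)
  have act: "(\<exists>g\<in>carrier (GL_prod Q v). x1 = rep_act Q v g x) \<and> (\<exists>g\<in>carrier (GL_prod Q v'). x1' = rep_act Q v' g x')"
    if k: "k \<in> carrier (corr_group Q i v v')" "p1 = corr_act Q i v v' k p" for k
  proof -
    obtain a b g where abg: "k = (a, b, g)" by (cases k)
    have "a \<in> carrier (GL (v i))" "b \<in> carrier (GL (v' i))" "g \<in> (\<Pi>\<^sub>E j\<in>verts Q - {i}. carrier (GL (v j)))"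
      using k(1) unfolding abg corr_group_carrier by blast+
    then have "g(i := a) \<in> carrier (GL_prod Q v)" "g(i := b) \<in> carrier (GL_prod Q v')"
      using extend_GL_prod[OF adm_v] extend_GL_prod[OF adm_v'] by blast+
    moreover have "x1 = rep_act Q v (g(i := a)) x" "x1' = rep_act Q v' (g(i := b)) x'"
      using k(2) unfolding abg x x1 corr_act_def by auto
    ultimately show ?thesis by blast
  qed
  have "(\<exists>k\<in>carrier (corr_group Q i v v'). p1 = corr_act Q i v v' k p) \<longleftrightarrow> (\<exists>g\<in>carrier (GL_prod Q v). x1 = rep_act Q v g x)"
    using act corr_fibre_left[OF p[unfolded x] p1[unfolded x1], folded x x1] by metis
  then show "orbit (corr_group Q i v v') (corr_act Q i v v') p = orbit (corr_group Q i v v') (corr_act Q i v v') p1 \<longleftrightarrow>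
      orbit (GL_prod Q v) (rep_act Q v) (fst p) = orbit (GL_prod Q v) (rep_act Q v) (fst p1)"
    using C orbit_eq_iff_rep_act[OF r(1)[THEN conjunct1] r(2)[THEN conjunct1]] by (simp add: x x1)
  have "(\<exists>k\<in>carrier (corr_group Q i v v'). p1 = corr_act Q i v v' k p) \<longleftrightarrow> (\<exists>g\<in>carrier (GL_prod Q v'). x1' = rep_act Q v' g x')"
    using act corr_fibre_right[OF p[unfolded x] p1[unfolded x1], folded x x1] by metis
  then show "orbit (corr_group Q i v v') (corr_act Q i v v') p = orbit (corr_group Q i v v') (corr_act Q i v v') p1 \<longleftrightarrow>
      orbit (GL_prod Q v') (rep_act Q v') (snd p) = orbit (GL_prod Q v') (rep_act Q v') (snd p1)"
    using C orbit_eq_iff_rep_act[OF r(1)[THEN conjunct2] r(2)[THEN conjunct2]] by (simp add: x x1)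
qed

section \<open>Surjectivity of \<tau> and injectivity of \<sigma>' at stable points\<close>

lemma Z_reps: "x \<in> Z \<Longrightarrow> x \<in> reps Q v" and Z'_reps: "x' \<in> Z' \<Longrightarrow> x' \<in> reps Q v'"
  unfolding Z_iff by blast+

lemma tau_sigma_Z: "x \<in> Z \<Longrightarrow> tau_mat v x * sigma_mat v x = (s - 1) \<cdot>\<^sub>m 1\<^sub>m (v i)"
  using i unfolding Z_iff by (intro tau_sigma_of_moment_map[OF adm_v]) auto

lemma tau_sigma_Z': "x' \<in> Z' \<Longrightarrow> tau_mat v' x' * sigma_mat v' x' = (inverse s - 1) \<cdot>\<^sub>m 1\<^sub>m (v' i)"
  using i q'_i unfolding Z_iff by (intro tau_sigma_of_moment_map[OF adm_v']) auto

text \<open>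
  If \<open>q\<^sub>i \<noteq> 1\<close> then \<open>\<tau>\<sigma> = q\<^sub>i - 1\<close> is invertible. Otherwise \<open>\<theta>\<^sub>i < 0\<close>, and the image of \<open>\<tau>\<close> at \<open>i\<close>
  together with everything at the other vertices would violate stability if \<open>\<tau>\<close> were not onto.
\<close>

lemma tau_right_inverse:
  assumes x: "x \<in> Z"
  shows "\<exists>R\<in>carrier_mat N (v i). tau_mat v x * R = 1\<^sub>m (v i)"
proof (cases "s = 1")
  case False
  have "tau_mat v x * (inverse (s - 1) \<cdot>\<^sub>m sigma_mat v x) = inverse (s - 1) \<cdot>\<^sub>m (tau_mat v x * sigma_mat v x)"
    by (simp add: mat_ring)
  also have "\<dots> = 1\<^sub>m (v i)"
    unfolding tau_sigma_Z[OF x] using False by (simp add: smult_smult_mat one_smult_mat)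
  finally show ?thesis by (intro bexI[of _ "inverse (s - 1) \<cdot>\<^sub>m sigma_mat v x"]) auto
next
  case True
  then have \<theta>: "\<theta> i < 0" using theta_i theta_i_zero by linarith
  define W where "W = (\<lambda>u. tau_mat v x *\<^sub>v u) ` carrier_vec N"
  have sub: "lin_subspace (v i) W"
    unfolding W_def by (intro lin_subspace_image[OF _ lin_subspace_carrier]) auto
  have "W = carrier_vec (v i)"
  proof (rule ccontr)
    assume W: "W \<noteq> carrier_vec (v i)"
    define S where "S = (\<lambda>j. if j = i then W else carrier_vec (v j))"
    have "(\<Sum>j\<in>verts Q. \<theta> j * of_nat (subspace_dim (v j) (S j))) =
        \<theta> i * of_nat (subspace_dim (v i) W) + (\<Sum>j\<in>verts Q - {i}. \<theta> j * of_nat (v j))"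
      unfolding sum.remove[OF finite_verts i] by (auto simp: S_def subspace_dim_carrier intro!: sum.cong)
    also have "\<dots> = \<theta> i * (of_nat (subspace_dim (v i) W) - of_nat (v i))"
      using theta_dim unfolding sum.remove[OF finite_verts i] by (simp add: algebra_simps)
    also have "\<dots> > 0"
      using \<theta> subspace_dim_less[OF sub W] by (intro mult_neg_neg) auto
    finally have pos: "(\<Sum>j\<in>verts Q. \<theta> j * of_nat (subspace_dim (v j) (S j))) > 0" .
    have "invariant_subspace Q v x S"
      unfolding invariant_subspace_def
    proof (intro conjI ballI)
      fix j assume "j \<in> verts Q"
      then show "lin_subspace (v j) (S j)" using sub by (auto simp: S_def lin_subspace_carrier)
    next
      fix h u assume h: "h \<in> darrows Q" and u: "u \<in> S (out_v Q h)"
      have uc: "u \<in> carrier_vec (v (out_v Q h))"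
        using u sub unfolding S_def lin_subspace_iff by (auto split: if_splits)
      show "x h *\<^sub>v u \<in> S (in_v Q h)"
      proof (cases "in_v Q h = i")
        case True
        then have "h \<in> Hi" using h by (simp add: in_arrows_def)
        then show ?thesis
          using in_image_tau[OF adm_v Z_reps[OF x] _ uc] True by (simp add: S_def W_def)
      next
        case False
        then show ?thesis
          using mult_mat_vec_carrier[OF x_carrier[OF adm_v Z_reps[OF x] h] uc] by (simp add: S_def)
      qed
    qed
    moreover have "\<not> (\<forall>j\<in>verts Q. S j = {0\<^sub>v (v j)})"
    proof
      assume "\<forall>j\<in>verts Q. S j = {0\<^sub>v (v j)}"
      then have "(\<Sum>j\<in>verts Q. \<theta> j * of_nat (subspace_dim (v j) (S j))) = 0"
        by (simp add: subspace_dim_zero)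
      then show False using pos by simp
    qed
    moreover have "\<not> (\<forall>j\<in>verts Q. S j = carrier_vec (v j))" using W i unfolding S_def by auto
    ultimately have "(\<Sum>j\<in>verts Q. \<theta> j * of_nat (subspace_dim (v j) (S j))) < 0"
      using x unfolding Z_iff stable_def by blast
    then show False using pos by simp
  qed
  then have "\<exists>R\<in>carrier_mat N (v i). 1\<^sub>m (v i) = tau_mat v x * R"
    unfolding W_def by (intro range_subset_factor) auto
  then show ?thesis by metis
qed

text \<open>For \<open>q i \<noteq> 1\<close> a multiple of \<tau>' is a left inverse. Otherwise
  \<open>\<theta>' i > 0\<close>, and the kernel of \<sigma>', placed at \<open>i\<close> with zero
  elsewhere, would be an invariant subspace of positive weight if it were not zero.\<close>

lemma sigma_injective:
  assumes x: "x' \<in> Z'"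
  shows "inj_mat (sigma_mat v' x')"
proof (cases "s = 1")
  case False
  let ?c = "inverse (inverse s - 1)"
  have c: "inverse s - 1 \<noteq> 0" using False s_nonzero by (simp add: field_simps)
  show ?thesis
  proof (rule inj_mat_left_inverse)
    have "?c \<cdot>\<^sub>m tau_mat v' x' * sigma_mat v' x' = ?c \<cdot>\<^sub>m (tau_mat v' x' * sigma_mat v' x')"
      by (simp add: mat_ring)
    also have "\<dots> = 1\<^sub>m (v' i)"
      unfolding tau_sigma_Z'[OF x] using c by (simp add: smult_smult_mat one_smult_mat)
    finally show "?c \<cdot>\<^sub>m tau_mat v' x' * sigma_mat v' x' = 1\<^sub>m (v' i)" .
  qed auto
next
  case True
  then have \<theta>: "\<theta>' i > 0" using theta_i theta_i_zero \<theta>'_i by linarith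
  define W where "W = {u \<in> carrier_vec (v' i). sigma_mat v' x' *\<^sub>v u = 0\<^sub>v N}"
  have sub: "lin_subspace (v' i) W"
    using lin_subspace_preimage[OF vertex_mats_carrier(1) lin_subspace_zero] unfolding W_def by simp
  have zero_dim: "(\<Sum>j\<in>verts Q. \<theta>' j * of_nat (v' j)) = 0"
    using x unfolding Z_iff stable_def by blast
  have "W = {0\<^sub>v (v' i)}"
  proof (rule ccontr)
    assume W: "W \<noteq> {0\<^sub>v (v' i)}"
    define S where "S = (\<lambda>j. if j = i then W else {0\<^sub>v (v' j)})"
    have "(\<Sum>j\<in>verts Q. \<theta>' j * of_nat (subspace_dim (v' j) (S j))) = \<theta>' i * of_nat (subspace_dim (v' i) W)"
      unfolding sum.remove[OF finite_verts i] by (auto simp: S_def subspace_dim_zero)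
    also have "\<dots> > 0" using \<theta> subspace_dim_pos[OF sub W] by simp
    finally have pos: "(\<Sum>j\<in>verts Q. \<theta>' j * of_nat (subspace_dim (v' j) (S j))) > 0" .
    note xc = x_carrier[OF adm_v' Z'_reps[OF x]]
    have "invariant_subspace Q v' x' S"
      unfolding invariant_subspace_def
    proof (intro conjI ballI)
      fix j assume "j \<in> verts Q"
      then show "lin_subspace (v' j) (S j)" using sub by (auto simp: S_def lin_subspace_zero)
    next
      fix h u assume h: "h \<in> darrows Q" and u: "u \<in> S (out_v Q h)"
      show "x' h *\<^sub>v u \<in> S (in_v Q h)"
      proof (cases "out_v Q h = i")
        case False
        then have "x' h *\<^sub>v u = 0\<^sub>v (v' (in_v Q h))" using u xc[OF h] by (simp add: S_def mult_mat_zero_vec)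
        then show ?thesis using sub unfolding S_def lin_subspace_iff by simp
      next
        case True
        then have oh: "opp h \<in> Hi" using h by (simp add: in_arrows_def)
        have uW: "u \<in> carrier_vec (v' i)" "sigma_mat v' x' *\<^sub>v u = 0\<^sub>v N"
          using u True unfolding S_def W_def by auto
        note c = x_out_carrier[OF adm_v' Z'_reps[OF x]]
        have "blocks_vec Hi d (\<lambda>k. x' (opp k) *\<^sub>v u) = sigma_mat v' x' *\<^sub>v u"
          unfolding sigma_mat_def by (rule row_blocks_mult_vec[OF finite_Hi c uW(1), symmetric])
        also have "\<dots> = blocks_vec Hi d (\<lambda>k. 0\<^sub>v (d k))"
          unfolding uW(2) by (intro eq_vecI) (auto simp: blocks_vec_def blk_loc[OF finite_Hi, of _ d])
        finally have "x' (opp (opp h)) *\<^sub>v u = 0\<^sub>v (d (opp h))"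
          by (rule blocks_vec_eqD[OF finite_Hi _ oh]) (use c[OF oh] uW(1) in auto)
        then show ?thesis
          using out_v_Hi[OF oh] adm_d[OF adm_v' oh] by (simp add: S_def)
      qed
    qed
    moreover have "\<not> (\<forall>j\<in>verts Q. S j = {0\<^sub>v (v' j)})" using W i unfolding S_def by auto
    moreover have "\<not> (\<forall>j\<in>verts Q. S j = carrier_vec (v' j))"
    proof
      assume "\<forall>j\<in>verts Q. S j = carrier_vec (v' j)"
      then have "(\<Sum>j\<in>verts Q. \<theta>' j * of_nat (subspace_dim (v' j) (S j))) = 0"
        using zero_dim by (simp add: subspace_dim_carrier)
      then show False using pos by simp
    qed
    ultimately have "(\<Sum>j\<in>verts Q. \<theta>' j * of_nat (subspace_dim (v' j) (S j))) < 0"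
      using x unfolding Z_iff stable_def by blast
    then show False using pos by simp
  qed
  then show ?thesis unfolding W_def inj_mat_def by auto
qed

end

section \<open>Regular local sections\<close>

context quiver_vertex
begin

context
  fixes w Z
  assumes w: "adm w" and Z: "Z \<subseteq> reps Q w"
begin

abbreviation (input) regm where "regm \<equiv> reg_mat (rep_coords Q w) Z"

lemma reg_arrow: "h \<in> darrows Q \<Longrightarrow> regm (w (in_v Q h)) (w (out_v Q h)) (\<lambda>x. x h)"
  using Z x_carrier[OF w] by (intro reg_matI reg_on_coord) (auto simp: rep_coords_def)

lemma reg_arrow_in: "h \<in> Hi \<Longrightarrow> regm (w i) (d h) (\<lambda>x. x h)"
  using reg_arrow[of h] Hi_darrows in_v_Hi adm_d[OF w] by auto

lemma reg_arrow_out: "h \<in> Hi \<Longrightarrow> regm (d h) (w i) (\<lambda>x. x (opp h))"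
  using reg_arrow[of "opp h"] Hi_darrows in_v_Hi adm_d[OF w] by auto

lemma reg_one_plus:
  assumes h: "h \<in> Hi"
  shows "regm (w i) (w i) (\<lambda>x. one_plus Q w x h)"
  unfolding one_plus_def in_v_Hi[OF h]
  by (intro reg_mat_add reg_mat_const reg_mat_mult[OF reg_arrow_in[OF h] reg_arrow_out[OF h]]) auto

lemma reg_tau_block:
  assumes h: "h \<in> Hi"
  shows "regm (w i) (d h) (\<lambda>x. partial_prod Q ord i w x h * x h)"
proof (rule reg_mat_mult[OF _ reg_arrow_in[OF h]])
  show "regm (w i) (w i) (\<lambda>x. partial_prod Q ord i w x h)"
    unfolding partial_prod_def using finite_Hi Hi_darrows reg_one_plus
    by (intro reg_mat_ordered_prod[OF ord, where F = "\<lambda>h x. one_plus Q w x h"]) auto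
qed

lemma reg_col_blocks:
  assumes "\<And>h. h \<in> Hi \<Longrightarrow> regm n (d h) (\<lambda>x. X x h)"
  shows "regm n N (\<lambda>x. col_blocks Hi d n (X x))"
  unfolding col_blocks_def
  by (intro reg_mat_mat reg_mat_entry[OF assms]) (auto simp: blk_loc[OF finite_Hi, of _ d])

lemma reg_row_blocks:
  assumes "\<And>h. h \<in> Hi \<Longrightarrow> regm (d h) n (\<lambda>x. X x h)"
  shows "regm N n (\<lambda>x. row_blocks Hi d n (X x))"
  unfolding row_blocks_def
  by (intro reg_mat_mat reg_mat_entry[OF assms]) (auto simp: blk_loc[OF finite_Hi, of _ d])

lemma reg_upper:
  assumes "regm N N A"
  shows "regm N N (\<lambda>x. up (A x))"
  unfolding upper_blocks_def
proof (intro reg_mat_mat)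
  fix r c assume "r < N" "c < N"
  then show "reg_on (rep_coords Q w) Z (\<lambda>x. if (blk Hi d r, blk Hi d c) \<in> ord then A x $$ (r, c) else 0)"
    by (cases "(blk Hi d r, blk Hi d c) \<in> ord") (auto intro: reg_mat_entry[OF assms] reg_on_const)
qed

lemma reg_vertex_mats:
  "regm N (w i) (sigma_mat w)" "regm (w i) N (in_mat w)" "regm (w i) N (tau_mat w)"
  "regm N N (\<lambda>x. up (sigma_mat w x * in_mat w x))"
proof -
  show s: "regm N (w i) (sigma_mat w)" and x: "regm (w i) N (in_mat w)" and "regm (w i) N (tau_mat w)"
    unfolding sigma_mat_def in_mat_def tau_mat_def
    by (intro reg_row_blocks reg_col_blocks reg_arrow_in reg_arrow_out reg_tau_block; assumption)+
  show "regm N N (\<lambda>x. up (sigma_mat w x * in_mat w x))"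
    by (intro reg_upper reg_mat_mult[OF s x])
qed

lemma reg_rebuild:
  assumes w': "adm w'" and S: "regm N (w' i) S" and X: "regm (w' i) N X"
    and h: "h \<in> darrows Q"
  shows "regm (w' (in_v Q h)) (w' (out_v Q h)) (\<lambda>x. rebuild w' x (S x) (X x) h)"
  using h
proof (cases h rule: darrows_cases)
  case in_i
  show ?thesis
    unfolding rebuild_in[OF in_i] in_v_Hi[OF in_i] adm_d[OF w' in_i]
    using idx[OF finite_Hi in_i, of _ d] by (intro reg_mat_mat reg_mat_entry[OF X]) auto
next
  case (out_i k)
  show ?thesis
    unfolding out_i(2) rebuild_out[OF out_i(1)] in_v_opp out_v_opp in_v_Hi[OF out_i(1)] adm_d[OF w' out_i(1)]
    using idx[OF finite_Hi out_i(1), of _ d] by (intro reg_mat_mat reg_mat_entry[OF S]) auto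
next
  case other
  have "w' (in_v Q h) = w (in_v Q h)" "w' (out_v Q h) = w (out_v Q h)"
    using w w' other_not_i[OF other] in_v_verts[OF h] out_v_verts[OF h] unfolding adm_def by auto
  then show ?thesis unfolding rebuild_other[OF other] using reg_arrow[OF h] by simp
qed

end

end

context vertex_reflection
begin

text \<open>
  Near \<open>x0\<close> the columns of a fixed right inverse of \<open>\<tau>(x0)\<close> still map onto \<open>V\<^sub>i\<close> under \<open>\<tau>(x)\<close>;
  correcting it gives a right inverse \<open>\<rho>\<close> of \<open>\<tau>(x)\<close> depending regularly on \<open>x\<close>, and
  \<open>1 - \<rho>\<tau>\<close> carries a complement of its image onto the kernel of \<open>\<tau>(x)\<close>.
\<close>

lemma local_section_left:
  assumes x0: "x0 \<in> Z"
  shows "\<exists>M f. openin (zariski_topology (rep_coords Q v) Z) M \<and> x0 \<in> M \<and>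
    (\<forall>x\<in>M. f x \<in> P \<and> fst (f x) = x) \<and> (\<forall>c\<in>corr_coords Q v v'. reg_on (rep_coords Q v) M (\<lambda>x. c (f x)))"
proof -
  obtain \<rho>0 where \<rho>0: "\<rho>0 \<in> carrier_mat N (v i)" "tau_mat v x0 * \<rho>0 = 1\<^sub>m (v i)"
    using tau_right_inverse[OF x0] by blast
  obtain R L S where c: "R \<in> carrier_mat N (v i)" "L \<in> carrier_mat (v' i) N" "S \<in> carrier_mat N (v' i)"
    and e: "tau_mat v x0 * R = 1\<^sub>m (v i)" "L * S = 1\<^sub>m (v' i)" "L * R = 0\<^sub>m (v' i) (v i)" 
      "tau_mat v x0 * S = 0\<^sub>m (v i) (v' i)" "S * L + R * tau_mat v x0 = 1\<^sub>m N"
    using right_invertible_complement[OF vertex_mats_carrier(3) \<rho>0 v_add_v'[symmetric]] by metis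
  define M where "M = {x \<in> Z. det (tau_mat v x * R) \<noteq> 0}"
  have MZ: "M \<subseteq> reps Q v" using Z_reps unfolding M_def by blast
  define \<rho> where "\<rho> = (\<lambda>x. R * mat_inv (tau_mat v x * R))"
  define S' where "S' = (\<lambda>x. S - \<rho> x * (tau_mat v x * S))"
  define f where "f = (\<lambda>x. (x, rebuild v' x (S' x) (reflect_in s v L x)))"
  have "reg_on (rep_coords Q v) Z (\<lambda>x. det (tau_mat v x * R))"
    by (rule reg_on_det[OF reg_mat_mult[OF reg_vertex_mats(3)[OF adm_v subsetI[OF Z_reps]] reg_mat_const[OF c(1)]]])
  then have open_M: "openin (zariski_topology (rep_coords Q v) Z) M"
    unfolding M_def by (rule openin_reg_on_nonzero) (metis openin_topspace topspace_zariski)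
  have x0M: "x0 \<in> M" using x0 e(1) unfolding M_def by simp
  have mem: "f x \<in> P \<and> fst (f x) = x" if x: "x \<in> M" for x
  proof -
    have xZ: "x \<in> Z" and det: "det (tau_mat v x * R) \<noteq> 0" using x unfolding M_def by auto
    have tR: "tau_mat v x * R \<in> carrier_mat (v i) (v i)" using c by (auto intro!: carrier_matI)
    note I = mat_inv[OF tR det]
    have \<rho>: "\<rho> x \<in> carrier_mat N (v i)" using c I(1) by (auto simp: \<rho>_def)
    have t\<rho>: "tau_mat v x * \<rho> x = 1\<^sub>m (v i)"
    proof -
      have "tau_mat v x * \<rho> x = tau_mat v x * R * mat_inv (tau_mat v x * R)"
        unfolding \<rho>_def using c I(1) by (simp add: mult_mat_assoc)
      then show ?thesis unfolding I(2) .
    qed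
    \<comment> \<open>The values of \<rho> lie in the range of \<open>R\<close>, on which
      \<open>L\<close> vanishes. Hence the one matrix \<open>L\<close> chosen at \<open>x0\<close>
      is a retraction for all points of \<open>M\<close>.\<close>
    have L\<rho>: "L * \<rho> x = 0\<^sub>m (v' i) (v i)"
    proof -
      have "L * \<rho> x = L * R * mat_inv (tau_mat v x * R)"
        unfolding \<rho>_def using c I(1) by (simp add: mult_mat_assoc)
      then show ?thesis unfolding e(3) using I(1) by (simp add: mult_mat_zero_left)
    qed
    have S': "S' x \<in> carrier_mat N (v' i)" using c \<rho> by (auto simp: S'_def)
    have "split_exact (v' i) N (v i) (S' x) (tau_mat v x) L (\<rho> x)"
      unfolding split_exact_def
    proof (intro conjI)
      have "tau_mat v x * S' x = tau_mat v x * S - tau_mat v x * \<rho> x * (tau_mat v x * S)"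
        unfolding S'_def using c \<rho> by (simp add: mat_ring)
      also have "\<dots> = 0\<^sub>m (v i) (v' i)" unfolding t\<rho> using c by (intro eq_matI) (auto simp: mult_mat_one_left)
      finally show "tau_mat v x * S' x = 0\<^sub>m (v i) (v' i)" .
      have "L * S' x = L * S - L * \<rho> x * (tau_mat v x * S)"
        unfolding S'_def using c \<rho> by (simp add: mat_ring)
      also have "\<dots> = 1\<^sub>m (v' i)"
        unfolding e(2) L\<rho> using c by (intro eq_matI) (auto simp: mult_mat_zero_left)
      finally show "L * S' x = 1\<^sub>m (v' i)" .
      \<comment> \<open>Subtracting \<rho>\<tau> therefore annihilates \<open>R\<close>, so the
        contribution of \<open>R * tau_mat v x0\<close> to \<open>S' x * L\<close> cancels.\<close>
      have R: "R = \<rho> x * (tau_mat v x * R)"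
      proof -
        have "\<rho> x * (tau_mat v x * R) = R * (mat_inv (tau_mat v x * R) * (tau_mat v x * R))"
          unfolding \<rho>_def using c I(1) tR by (simp add: mult_mat_assoc)
        then show ?thesis unfolding I(3) using c by (simp add: mult_mat_one_right)
      qed
      have SL: "S * L = 1\<^sub>m N - R * tau_mat v x0"
        unfolding e(5)[symmetric] using c by (intro eq_matI) auto
      have "S' x * L = S * L - \<rho> x * (tau_mat v x * (S * L))"
        unfolding S'_def using c \<rho> by (simp add: mat_ring)
      also have "\<dots> = 1\<^sub>m N - R * tau_mat v x0 - (\<rho> x * tau_mat v x - \<rho> x * (tau_mat v x * R) * tau_mat v x0)"
        unfolding SL using c \<rho> by (simp add: mat_ring)
      also have "\<dots> = 1\<^sub>m N - \<rho> x * tau_mat v x"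
        unfolding R[symmetric] using c \<rho> by (intro eq_matI) (auto simp del: index_mult_mat(1))
      finally show "S' x * L + \<rho> x * tau_mat v x = 1\<^sub>m N"
        using \<rho> by (simp del: index_mult_mat(1)) (intro eq_matI, auto simp del: index_mult_mat(1))
    qed (use c \<rho> S' t\<rho> in auto)
    then have "linked s v v' x (rebuild v' x (S' x) (reflect_in s v L x))"
      by (intro linked_rebuild adm_v adm_v' Z_reps[OF xZ] s_nonzero tau_sigma_Z[OF xZ])
    then show ?thesis using linked_corr xZ unfolding f_def by auto
  qed
  have reg: "reg_on (rep_coords Q v) M (\<lambda>x. c' (f x))" if "c' \<in> corr_coords Q v v'" for c'
  proof -
    note V = reg_vertex_mats[OF adm_v MZ]
    have "reg_mat (rep_coords Q v) M N (v i) \<rho>"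
      unfolding \<rho>_def
      by (rule reg_mat_mult[OF reg_mat_const[OF c(1)] reg_mat_inv[OF reg_mat_mult[OF V(3) reg_mat_const[OF c(1)]]]])
        (auto simp: M_def)
    then have S': "reg_mat (rep_coords Q v) M N (v' i) S'"
      unfolding S'_def
      by (intro reg_mat_minus reg_mat_const[OF c(3)] reg_mat_mult[OF _ reg_mat_mult[OF V(3) reg_mat_const[OF c(3)]]])
    have X: "reg_mat (rep_coords Q v) M (v' i) N (reflect_in s v L)"
      unfolding reflect_in_def
      by (intro reg_mat_mult[where m = N] reg_mat_minus reg_mat_smult reg_mat_add reg_mat_mult[OF V(1,2)] V(4)
          reg_mat_const reg_on_const c one_carrier_mat)
    from that show ?thesis
      unfolding corr_coords_def
    proof (elim UnE CollectE exE conjE)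
      fix e assume "c' = e \<circ> fst" "e \<in> rep_coords Q v"
      then show ?thesis by (simp add: f_def reg_on_coord)
    next
      fix e assume c': "c' = e \<circ> snd" and "e \<in> rep_coords Q v'"
      then obtain h k l where h: "h \<in> darrows Q" "k < v' (in_v Q h)" "l < v' (out_v Q h)" "e = (\<lambda>x. x h $$ (k, l))"
        unfolding rep_coords_def by blast
      show ?thesis
        unfolding c' h(4) f_def comp_def snd_conv
        by (rule reg_mat_entry[OF reg_rebuild[OF adm_v MZ adm_v' S' X h(1)] h(2,3)])
    qed
  qed
  show ?thesis using open_M x0M mem reg by blast
qed

text \<open>A retraction \<open>L\<close> of \<sigma>'(x0) still restricts to an isomorphism on the
  range of \<sigma>'(x) near \<open>x0\<close>. Correcting it gives a regular retraction \<mu> of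
  \<sigma>'(x), and composing the cokernel map \<open>T\<close> at \<open>x0\<close> with 1 -
  \<sigma>'\<mu> gives a cokernel map at \<open>x\<close>, for which \<open>R\<close> remains a
  section.\<close>

lemma local_section_right:
  assumes x0: "x0 \<in> Z'"
  shows "\<exists>M f. openin (zariski_topology (rep_coords Q v') Z') M \<and> x0 \<in> M \<and>
    (\<forall>x\<in>M. f x \<in> P \<and> snd (f x) = x) \<and> (\<forall>c\<in>corr_coords Q v v'. reg_on (rep_coords Q v') M (\<lambda>x. c (f x)))"
proof -
  have "N = v' i + v i" using v_add_v' by simp
  from inj_mat_complement[OF vertex_mats_carrier(1) sigma_injective[OF x0] this]
  obtain R L T where c: "R \<in> carrier_mat N (v i)" "L \<in> carrier_mat (v' i) N" "T \<in> carrier_mat (v i) N"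
    and e: "L * sigma_mat v' x0 = 1\<^sub>m (v' i)" "T * R = 1\<^sub>m (v i)" "T * sigma_mat v' x0 = 0\<^sub>m (v i) (v' i)"
      "L * R = 0\<^sub>m (v' i) (v i)" "sigma_mat v' x0 * L + R * T = 1\<^sub>m N"
    by metis
  define M where "M = {x \<in> Z'. det (L * sigma_mat v' x) \<noteq> 0}"
  have MZ: "M \<subseteq> reps Q v'" using Z'_reps unfolding M_def by blast
  define \<mu> where "\<mu> = (\<lambda>x. mat_inv (L * sigma_mat v' x) * L)"
  define T' where "T' = (\<lambda>x. T - T * sigma_mat v' x * \<mu> x)"
  define f where "f = (\<lambda>x. (rebuild v x (coreflect_out s v' R x) (coreflect_in v' (T' x) x), x))"
  have "reg_on (rep_coords Q v') Z' (\<lambda>x. det (L * sigma_mat v' x))"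
    by (rule reg_on_det[OF reg_mat_mult[OF reg_mat_const[OF c(2)] reg_vertex_mats(1)[OF adm_v' subsetI[OF Z'_reps]]]])
  then have open_M: "openin (zariski_topology (rep_coords Q v') Z') M"
    unfolding M_def by (rule openin_reg_on_nonzero) (metis openin_topspace topspace_zariski)
  have x0M: "x0 \<in> M" using x0 e(1) unfolding M_def by simp
  have mem: "f x \<in> P \<and> snd (f x) = x" if x: "x \<in> M" for x
  proof -
    have xZ: "x \<in> Z'" and det: "det (L * sigma_mat v' x) \<noteq> 0" using x unfolding M_def by auto
    have Ls: "L * sigma_mat v' x \<in> carrier_mat (v' i) (v' i)" using c by (auto intro!: carrier_matI)
    note I = mat_inv[OF Ls det]
    have \<mu>: "\<mu> x \<in> carrier_mat (v' i) N" using c I(1) by (auto simp: \<mu>_def)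
    have \<mu>s: "\<mu> x * sigma_mat v' x = 1\<^sub>m (v' i)"
    proof -
      have "\<mu> x * sigma_mat v' x = mat_inv (L * sigma_mat v' x) * (L * sigma_mat v' x)"
        unfolding \<mu>_def using c I(1) by (simp add: mult_mat_assoc)
      then show ?thesis unfolding I(3) .
    qed
    have \<mu>R: "\<mu> x * R = 0\<^sub>m (v' i) (v i)"
    proof -
      have "\<mu> x * R = mat_inv (L * sigma_mat v' x) * (L * R)"
        unfolding \<mu>_def using c I(1) by (simp add: mult_mat_assoc)
      then show ?thesis unfolding e(4) using I(1) by (simp add: mult_mat_zero_right)
    qed
    have T': "T' x \<in> carrier_mat (v i) N" using c \<mu> by (auto simp: T'_def)
    have "split_exact (v' i) N (v i) (sigma_mat v' x) (T' x) (\<mu> x) R"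
      unfolding split_exact_def
    proof (intro conjI)
      have "T' x * sigma_mat v' x = T * sigma_mat v' x - T * sigma_mat v' x * (\<mu> x * sigma_mat v' x)"
        unfolding T'_def using c \<mu> by (simp add: mat_ring)
      also have "\<dots> = 0\<^sub>m (v i) (v' i)" unfolding \<mu>s using c by (intro eq_matI) (auto simp: mult_mat_one_right)
      finally show "T' x * sigma_mat v' x = 0\<^sub>m (v i) (v' i)" .
      have "T' x * R = T * R - T * sigma_mat v' x * (\<mu> x * R)"
        unfolding T'_def using c \<mu> by (simp add: mat_ring)
      also have "\<dots> = 1\<^sub>m (v i)"
        unfolding e(2) \<mu>R using c by (intro eq_matI) (auto simp: mult_mat_zero_right)
      finally show "T' x * R = 1\<^sub>m (v i)" .
      \<comment> \<open>\<open>L\<close> vanishes on the range of 1 - \<sigma>'\<mu>, so the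
        contribution of \<open>sigma_mat v' x0 * L\<close> to \<open>R * T' x\<close>
        cancels.\<close>
      have L: "L = L * sigma_mat v' x * \<mu> x"
      proof -
        have "L * sigma_mat v' x * \<mu> x = (L * sigma_mat v' x * mat_inv (L * sigma_mat v' x)) * L"
          unfolding \<mu>_def using c I(1) Ls by (simp add: mult_mat_assoc)
        then show ?thesis unfolding I(2) using c by (simp add: mult_mat_one_left)
      qed
      have RT: "R * T = 1\<^sub>m N - sigma_mat v' x0 * L"
        unfolding e(5)[symmetric] using c by (intro eq_matI) auto
      have "R * T' x = R * T - R * T * sigma_mat v' x * \<mu> x"
        unfolding T'_def using c \<mu> by (simp add: mat_ring)
      also have "\<dots> = 1\<^sub>m N - sigma_mat v' x0 * L -
          (sigma_mat v' x * \<mu> x - sigma_mat v' x0 * (L * sigma_mat v' x * \<mu> x))"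
        unfolding RT using c \<mu> by (simp add: mat_ring)
      also have "\<dots> = 1\<^sub>m N - sigma_mat v' x * \<mu> x"
        unfolding L[symmetric] using c \<mu> by (intro eq_matI) (auto simp del: index_mult_mat(1))
      finally show "sigma_mat v' x * \<mu> x + R * T' x = 1\<^sub>m N"
        using \<mu> by (simp del: index_mult_mat(1)) (intro eq_matI, auto simp del: index_mult_mat(1))
    qed (use c \<mu> T' \<mu>s in auto)
    then have "linked s v v' (rebuild v x (coreflect_out s v' R x) (coreflect_in v' (T' x) x)) x"
      by (intro linked_corebuild adm_v adm_v' Z'_reps[OF xZ] s_nonzero tau_sigma_Z'[OF xZ])
    then show ?thesis using linked_corr xZ unfolding f_def by auto
  qed
  have reg: "reg_on (rep_coords Q v') M (\<lambda>x. c' (f x))" if "c' \<in> corr_coords Q v v'" for c'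
  proof -
    note V = reg_vertex_mats[OF adm_v' MZ]
    have "reg_mat (rep_coords Q v') M (v' i) N \<mu>"
      unfolding \<mu>_def
      by (rule reg_mat_mult[OF reg_mat_inv[OF reg_mat_mult[OF reg_mat_const[OF c(2)] V(1)]] reg_mat_const[OF c(2)]])
        (auto simp: M_def)
    then have T': "reg_mat (rep_coords Q v') M (v i) N T'"
      unfolding T'_def
      by (intro reg_mat_minus reg_mat_const[OF c(3)] reg_mat_mult[OF reg_mat_mult[OF reg_mat_const[OF c(3)] V(1)]])
    have S: "reg_mat (rep_coords Q v') M N (v i) (coreflect_out s v' R)"
      unfolding coreflect_out_def
      by (intro reg_mat_mult[where m = N] reg_mat_minus reg_mat_smult reg_mat_add reg_mat_mult[OF V(1,3)]
          reg_mat_const reg_on_const c one_carrier_mat)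
    have X: "reg_mat (rep_coords Q v') M (v i) N (\<lambda>x. coreflect_in v' (T' x) x)"
      unfolding coreflect_in_def
      by (intro reg_mat_mult[OF T'] reg_mat_minus V(4) reg_mat_const one_carrier_mat)
    from that show ?thesis
      unfolding corr_coords_def
    proof (elim UnE CollectE exE conjE)
      fix e assume "c' = e \<circ> snd" "e \<in> rep_coords Q v'"
      then show ?thesis by (simp add: f_def reg_on_coord)
    next
      fix e assume c': "c' = e \<circ> fst" and "e \<in> rep_coords Q v"
      then obtain h k l where h: "h \<in> darrows Q" "k < v (in_v Q h)" "l < v (out_v Q h)" "e = (\<lambda>x. x h $$ (k, l))"
        unfolding rep_coords_def by blast
      show ?thesis
        unfolding c' h(4) f_def comp_def fst_conv
        by (rule reg_mat_entry[OF reg_rebuild[OF adm_v' MZ adm_v S X h(1)] h(2,3)])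
    qed
  qed
  show ?thesis using open_M x0M mem reg by blast
qed

end

theorem theorem5p2p2:
  fixes Q :: "('v, 'a) pre_digraph" and ord :: "('a + 'a) rel" and i :: 'v
    and v v' :: "'v \<Rightarrow> nat" and q q' :: "'v \<Rightarrow> complex" and \<theta> \<theta>' :: "'v \<Rightarrow> rat"
    and P :: "(('a + 'a \<Rightarrow> complex mat) \<times> ('a + 'a \<Rightarrow> complex mat)) set"
  assumes "fin_digraph Q"
    and "strict_linear_order_on (darrows Q) ord"
    and "i \<in> verts Q" and "loop_free Q i"
    and "in_arrows Q i \<subseteq> Inl ` arcs Q"
    and "\<forall>j\<in>verts Q. refl_dim Q i (\<lambda>k. int (v k)) j \<ge> 0"
    and "\<forall>j\<in>verts Q. q j \<noteq> 0"
    and "(\<Sum>j\<in>verts Q. \<theta> j * of_nat (v j)) = 0"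
    and "q' = refl_q Q i q"
    and "\<theta>' = refl_theta Q i \<theta>"
    and "\<forall>j\<in>verts Q. int (v' j) = refl_dim Q i (\<lambda>k. int (v k)) j"
    and "\<theta> i \<le> 0" and "\<theta> i = 0 \<longrightarrow> q i \<noteq> 1"
    and "P = corr Q ord i v v' q \<theta> q' \<theta>'"
  shows "fst ` P \<subseteq> stable_fibre Q ord v q \<theta> \<and>
    snd ` P \<subseteq> stable_fibre Q ord v' q' \<theta>' \<and>
    (\<exists>f. fs_iso (corr_quotient Q ord i v v' q \<theta> q' \<theta>') (moduli Q ord v q \<theta>) f \<and>
       (\<forall>p\<in>P. f (orbit (corr_group Q i v v') (corr_act Q i v v') p) =
              orbit (GL_prod Q v) (rep_act Q v) (fst p))) \<and>
    (\<exists>f'. fs_iso (corr_quotient Q ord i v v' q \<theta> q' \<theta>') (moduli Q ord v' q' \<theta>') f' \<and>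
       (\<forall>p\<in>P. f' (orbit (corr_group Q i v v') (corr_act Q i v v') p) =
              orbit (GL_prod Q v') (rep_act Q v') (snd p)))"
proof -
  interpret vertex_reflection Q ord i v v' q q' \<theta> \<theta>'
    by (intro vertex_reflection.intro quiver_vertex.intro vertex_reflection_axioms.intro assms)
  note P = \<open>P = corr Q ord i v v' q \<theta> q' \<theta>'\<close>
  have fst_mem: "fst p \<in> Z" and snd_mem: "snd p \<in> Z'" if "p \<in> P" for p
    using that corr_memD[of "fst p" "snd p"] unfolding P by auto
  have coords: "c \<circ> fst \<in> corr_coords Q v v'" if "c \<in> rep_coords Q v" for c
    using that unfolding corr_coords_def by blast
  have coords': "c \<circ> snd \<in> corr_coords Q v v'" if "c \<in> rep_coords Q v'" for c
    using that unfolding corr_coords_def by blast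
  have left: "\<exists>f. fs_iso (corr_quotient Q ord i v v' q \<theta> q' \<theta>') (moduli Q ord v q \<theta>) f \<and>
      (\<forall>p\<in>P. f (orbit (corr_group Q i v v') (corr_act Q i v v') p) =
             orbit (GL_prod Q v) (rep_act Q v) (fst p))"
    unfolding corr_quotient_def moduli_def P
    by (rule fs_iso_orbit_space_local_sections[OF fst_mem[unfolded P] coords local_section_left corr_orbit_eq_iff(1)])
  have right: "\<exists>f. fs_iso (corr_quotient Q ord i v v' q \<theta> q' \<theta>') (moduli Q ord v' q' \<theta>') f \<and>
      (\<forall>p\<in>P. f (orbit (corr_group Q i v v') (corr_act Q i v v') p) =
             orbit (GL_prod Q v') (rep_act Q v') (snd p))"
    unfolding corr_quotient_def moduli_def P
    by (rule fs_iso_orbit_space_local_sections[OF snd_mem[unfolded P] coords' local_section_right corr_orbit_eq_iff(2)])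
  show ?thesis using fst_mem snd_mem left right by blast
qed

end
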